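(* Let $d\ge2$, let $\mathfrak K:\mathbb R^d\to\mathbb R$ be a radially symmetric, compactly supported, smooth function with $\int_{\mathbb R^d}\mathfrak K(x)^2dx=1$, and let $$\mathsf K=\mathcal F^{-1}\Big(\zeta\mapsto\sqrt{\tfrac{2\pi^{d/2}}{\Gamma(d/2)}\int_{|\zeta|}^\infty t^{d-1}|\hat{\mathfrak K}(t)|^2\,dt}\Big).$$ Let $h$ be a whole-space LGF on $\mathbb R^d$. For any $\epsilon>0$ and $x\in\mathbb R^d$ let $\mathsf K_\epsilon(x)=\epsilon^{-d}\mathsf K(x/\epsilon)$. Then for every $\epsilon>0$ the white-noise field $\mathfrak h_\epsilon$ agrees in law with $h*\mathsf K_\epsilon$, both viewed as random continuous functions modulo a global additive constant.
   Context: A whole-space log-correlated Gaussian field (LGF) is a random generalized function $h$ on $\mathbb R^d$ which, viewed modulo an additive constant, is the centered Gaussian field with $\mathrm{Cov}[(h,f_1),(h,f_2)]=\iint f_1(x)f_2(y)\log\frac1{|x-y|}\,dx\,dy$ for Schwartz functions $f_1,f_2$ with zero integral. Fourier transform: $\mathcal F(f)(\zeta)=\hat f(\zeta)=\int_{\mathbb R^d}e^{-2\pi ix\cdot\zeta}f(x)\,dx$; since $\mathfrak K$ is radial, $\hat{\mathfrak K}$ is radial and $\hat{\mathfrak K}(t)$ denotes its value at $|\zeta|=t$. With $W(dy,dt)$ a space-time white noise on $\mathbb R^d\times(0,\infty)$, $$\mathfrak h_\epsilon(x)=\int_{\mathbb R^d}\int_\epsilon^\infty\mathfrak K\Big(\frac{x-y}t\Big)t^{-\frac{d+1}2}\,W(dy,dt),\qquad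 x\in\mathbb R^d,$$ which is well defined as a random continuous function modulo a global additive constant. *)

theory Defs
  imports "HOL-Probability.Probability"
begin

section \<open>Smooth functions, Schwartz functions, tempered distributions\<close>

primrec iter_deriv :: "'a list \<Rightarrow> ('a::euclidean_space \<Rightarrow> real) \<Rightarrow> 'a \<Rightarrow> real" where
  "iter_deriv [] f = f"
| "iter_deriv (v # vs) f = (\<lambda>x. frechet_derivative (iter_deriv vs f) (at x) v)"

definition smooth :: "('a::euclidean_space \<Rightarrow> real) \<Rightarrow> bool" where
  "smooth f \<longleftrightarrow> (\<forall>vs x. iter_deriv vs f differentiable (at x))"

definition schwartz :: "('a::euclidean_space \<Rightarrow> real) \<Rightarrow> bool" where
  "schwartz f \<longleftrightarrow> smooth f \<and>
     (\<forall>k vs. \<exists>C. \<forall>x. (1 + norm x) ^ k * \<bar>iter_deriv vs f x\<bar> \<le> C)"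

definition schwartz_seminorm :: "nat \<Rightarrow> 'a list \<Rightarrow> ('a::euclidean_space \<Rightarrow> real) \<Rightarrow> real" where
  "schwartz_seminorm k vs f = (SUP x. (1 + norm x) ^ k * \<bar>iter_deriv vs f x\<bar>)"

text \<open>The Schwartz space is metrizable, so continuity of a linear functional is sequential
  continuity at 0.\<close>

definition tempered_distribution :: "(('a::euclidean_space \<Rightarrow> real) \<Rightarrow> real) \<Rightarrow> bool" where
  "tempered_distribution T \<longleftrightarrow>
     (\<forall>f g a b. schwartz f \<longrightarrow> schwartz g \<longrightarrow>
        T (\<lambda>x. a * f x + b * g x) = a * T f + b * T g) \<and>
     (\<forall>\<phi> :: nat \<Rightarrow> 'a \<Rightarrow> real. (\<forall>n. schwartz (\<phi> n)) \<longrightarrow>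
        (\<forall>k vs. (\<lambda>n. schwartz_seminorm k vs (\<phi> n)) \<longlonglongrightarrow> 0) \<longrightarrow>
        (\<lambda>n. T (\<phi> n)) \<longlonglongrightarrow> 0)"

definition schwartz0 :: "('a::euclidean_space \<Rightarrow> real) set" where
  "schwartz0 = {f. schwartz f \<and> (LINT x|lborel. f x) = 0}"


section \<open>Fourier transform\<close>

definition fourier :: "('a::euclidean_space \<Rightarrow> complex) \<Rightarrow> 'a \<Rightarrow> complex" where
  "fourier f \<zeta> = (LINT x|lborel. cis (- 2 * pi * (x \<bullet> \<zeta>)) * f x)"

definition inv_fourier :: "('a::euclidean_space \<Rightarrow> complex) \<Rightarrow> 'a \<Rightarrow> complex" where
  "inv_fourier g x = (LINT \<zeta>|lborel. cis (2 * pi * (x \<bullet> \<zeta>)) * g \<zeta>)"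

definition radial :: "('a::real_normed_vector \<Rightarrow> 'b) \<Rightarrow> bool" where
  "radial f \<longleftrightarrow> (\<forall>x y. norm x = norm y \<longrightarrow> f x = f y)"

definition radial_value :: "('a::real_normed_vector \<Rightarrow> 'b) \<Rightarrow> real \<Rightarrow> 'b" where
  "radial_value f t = (THE v. \<forall>x. norm x = t \<longrightarrow> f x = v)"

text \<open>The real part only serves to obtain a real-valued function: the function being
  transformed is real and even, so its inverse Fourier transform is real.\<close>

definition mollifier :: "('a::euclidean_space \<Rightarrow> real) \<Rightarrow> 'a \<Rightarrow> real" where
  "mollifier K x = Re (inv_fourier (\<lambda>\<zeta>. complex_of_real (sqrt
     (2 * pi powr (real DIM('a) / 2) / Gamma (real DIM('a) / 2) *
       (LINT t:{norm \<zeta>..}|lborel.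
          t ^ (DIM('a) - 1) *
          (cmod (radial_value (fourier (\<lambda>z. complex_of_real (K z))) t))\<^sup>2)))) x)"

definition rescale :: "('a::euclidean_space \<Rightarrow> real) \<Rightarrow> real \<Rightarrow> 'a \<Rightarrow> real" where
  "rescale k \<epsilon> x = k (x /\<^sub>R \<epsilon>) / \<epsilon> ^ DIM('a)"


section \<open>Centered Gaussian families\<close>

definition centered_normal :: "'w measure \<Rightarrow> ('w \<Rightarrow> real) \<Rightarrow> real \<Rightarrow> bool" where
  "centered_normal M X v \<longleftrightarrow> X \<in> borel_measurable M \<and> 0 \<le> v \<and>
     distr M borel X =
       (if v = 0 then return borel 0 else density lborel (normal_density 0 (sqrt v)))"

text \<open>Joint Gaussianity: every finite linear combination is centered normal, with the
  variance dictated by the covariance \<open>C\<close>.\<close>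

definition centered_gaussian_family ::
    "'w measure \<Rightarrow> 'i set \<Rightarrow> ('i \<Rightarrow> 'w \<Rightarrow> real) \<Rightarrow> ('i \<Rightarrow> 'i \<Rightarrow> real) \<Rightarrow> bool" where
  "centered_gaussian_family M I X C \<longleftrightarrow> prob_space M \<and>
     (\<forall>F c. finite F \<longrightarrow> F \<subseteq> I \<longrightarrow>
        centered_normal M (\<lambda>\<omega>. \<Sum>i\<in>F. c i * X i \<omega>) (\<Sum>i\<in>F. \<Sum>j\<in>F. c i * c j * C i j))"


section \<open>Random continuous functions modulo a global additive constant\<close>

text \<open>Such a random function is given by a representative \<open>Y\<close>, of which only the increments
  matter (and have to be measurable).\<close>

definition random_continuous_mod_const ::
    "'w measure \<Rightarrow> ('w \<Rightarrow> 'a::euclidean_space \<Rightarrow> real) \<Rightarrow> bool" where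
  "random_continuous_mod_const M Y \<longleftrightarrow>
     (\<forall>\<omega>\<in>space M. continuous_on UNIV (Y \<omega>)) \<and>
     (\<forall>x y. (\<lambda>\<omega>. Y \<omega> x - Y \<omega> y) \<in> borel_measurable M)"

text \<open>A class of continuous functions modulo constants is encoded by the increments of any
  representative. On continuous functions modulo constants, the trace of the product
  sigma-algebra is the Borel sigma-algebra of locally uniform convergence, so two random
  continuous functions modulo constants agree in law iff these measures coincide.\<close>

definition law_mod_const ::
    "'w measure \<Rightarrow> ('w \<Rightarrow> 'a::euclidean_space \<Rightarrow> real) \<Rightarrow> ('a \<times> 'a \<Rightarrow> real) measure" where
  "law_mod_const M Y =
     distr M (PiM UNIV (\<lambda>_. borel)) (\<lambda>\<omega> p. Y \<omega> (fst p) - Y \<omega> (snd p))"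


section \<open>The whole-space log-correlated Gaussian field and its convolutions\<close>

definition log_cov :: "('a::euclidean_space \<Rightarrow> real) \<Rightarrow> ('a \<Rightarrow> real) \<Rightarrow> real" where
  "log_cov f g = (LINT p|lborel. f (fst p) * g (snd p) * ln (1 / norm (fst p - snd p)))"

definition whole_space_LGF ::
    "'w measure \<Rightarrow> ('w \<Rightarrow> ('a::euclidean_space \<Rightarrow> real) \<Rightarrow> real) \<Rightarrow> bool" where
  "whole_space_LGF M h \<longleftrightarrow> prob_space M \<and>
     (\<forall>\<omega>\<in>space M. tempered_distribution (h \<omega>)) \<and>
     (\<forall>f. schwartz f \<longrightarrow> (\<lambda>\<omega>. h \<omega> f) \<in> borel_measurable M) \<and>
     centered_gaussian_family M schwartz0 (\<lambda>f \<omega>. h \<omega> f) log_cov"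

text \<open>The kernel \<open>mollifier K\<close> need not be a Schwartz function, so \<open>(h, f)\<close> is needed for more
  general \<open>f\<close> in \<open>L\<^sup>2\<close>. As usual it is the extension by closure of \<open>f \<mapsto> (h, f)\<close>, viewed as
  a densely defined operator from \<open>L\<^sup>2\<close> to the square integrable random variables: \<open>X\<close> is a
  version of \<open>(h, f)\<close> if it is the limit in \<open>L\<^sup>2(M)\<close> of \<open>(h, \<phi> n)\<close> for zero-integral Schwartz
  functions \<open>\<phi> n\<close> converging to \<open>f\<close>. Almost surely \<open>X\<close> does not depend on the choice of
  \<open>\<phi>\<close>, since the operator is closable: the variance of \<open>(h, \<phi>)\<close> is a constant times the integral
  of the square of \<open>\<bar>\<phi>^(\<zeta>)\<bar> / \<bar>\<zeta>\<bar> powr (d/2)\<close>.\<close>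

definition LGF_pairing ::
    "'w measure \<Rightarrow> ('w \<Rightarrow> ('a::euclidean_space \<Rightarrow> real) \<Rightarrow> real) \<Rightarrow> ('a \<Rightarrow> real) \<Rightarrow>
      ('w \<Rightarrow> real) \<Rightarrow> bool" where
  "LGF_pairing M h f X \<longleftrightarrow>
     f \<in> borel_measurable borel \<and> X \<in> borel_measurable M \<and>
     (\<exists>\<phi> :: nat \<Rightarrow> 'a \<Rightarrow> real. (\<forall>n. \<phi> n \<in> schwartz0) \<and>
        (\<lambda>n. \<integral>\<^sup>+x. ennreal ((\<phi> n x - f x)\<^sup>2) \<partial>lborel) \<longlonglongrightarrow> 0 \<and>
        (\<lambda>n. \<integral>\<^sup>+\<omega>. ennreal ((h \<omega> (\<phi> n) - X \<omega>)\<^sup>2) \<partial>M) \<longlonglongrightarrow> 0)"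

text \<open>\<open>Y\<close> is (a continuous version of) \<open>h * k\<close>, modulo a global additive constant.\<close>

definition LGF_convolution ::
    "'w measure \<Rightarrow> ('w \<Rightarrow> ('a::euclidean_space \<Rightarrow> real) \<Rightarrow> real) \<Rightarrow> ('a \<Rightarrow> real) \<Rightarrow>
      ('w \<Rightarrow> 'a \<Rightarrow> real) \<Rightarrow> bool" where
  "LGF_convolution M h k Y \<longleftrightarrow> random_continuous_mod_const M Y \<and>
     (\<forall>x y. LGF_pairing M h (\<lambda>z. k (x - z) - k (y - z)) (\<lambda>\<omega>. Y \<omega> x - Y \<omega> y))"


section \<open>Space-time white noise and the white-noise field\<close>

definition spacetime_L2 :: "('a::euclidean_space \<times> real \<Rightarrow> real) set" where
  "spacetime_L2 = {\<phi>. \<phi> \<in> borel_measurable borel \<and>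
     set_integrable lborel (UNIV \<times> {0<..}) (\<lambda>p. (\<phi> p)\<^sup>2)}"

definition spacetime_inner ::
    "('a::euclidean_space \<times> real \<Rightarrow> real) \<Rightarrow> ('a \<times> real \<Rightarrow> real) \<Rightarrow> real" where
  "spacetime_inner \<phi> \<psi> = (LINT p:(UNIV \<times> {0<..})|lborel. \<phi> p * \<psi> p)"

text \<open>\<open>W \<phi>\<close> is the stochastic integral of \<open>\<phi>\<close> against the white noise \<open>W(dy, dt)\<close>.\<close>

definition spacetime_white_noise ::
    "'v measure \<Rightarrow> (('a::euclidean_space \<times> real \<Rightarrow> real) \<Rightarrow> 'v \<Rightarrow> real) \<Rightarrow> bool" where
  "spacetime_white_noise N W \<longleftrightarrow> centered_gaussian_family N spacetime_L2 W spacetime_inner"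

definition wn_kernel ::
    "('a::euclidean_space \<Rightarrow> real) \<Rightarrow> real \<Rightarrow> 'a \<Rightarrow> 'a \<times> real \<Rightarrow> real" where
  "wn_kernel K \<epsilon> x = (\<lambda>(y, t).
     if \<epsilon> < t then K ((x - y) /\<^sub>R t) * t powr (- (real DIM('a) + 1) / 2) else 0)"

text \<open>\<open>wn_kernel K \<epsilon> x\<close> itself is not square integrable (the integral diverges logarithmically
  as \<open>t\<close> tends to infinity), but differences of two such kernels are. Hence the stochastic
  integral defines the field modulo a global additive constant, through its increments.\<close>

definition white_noise_field ::
    "'v measure \<Rightarrow> (('a::euclidean_space \<times> real \<Rightarrow> real) \<Rightarrow> 'v \<Rightarrow> real) \<Rightarrow> ('a \<Rightarrow> real) \<Rightarrow>
      real \<Rightarrow> ('v \<Rightarrow> 'a \<Rightarrow> real) \<Rightarrow> bool" where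
  "white_noise_field N W K \<epsilon> Z \<longleftrightarrow> random_continuous_mod_const N Z \<and>
     (\<forall>x y. AE \<omega> in N. Z \<omega> x - Z \<omega> y = W (\<lambda>p. wn_kernel K \<epsilon> x p - wn_kernel K \<epsilon> y p) \<omega>)"

end

theory Submission
  imports Defs
begin

text \<open>
  Both fields are Gaussian, so it suffices to compare the variances of finite linear combinations of
  increments, and these are compared in Fourier space. Let \<open>A\<close> be the area of the unit sphere, let
  \<open>b\<close> be the symbol of the combination, and write \<open>F\<close> for the Fourier transform. Expressing
  \<open>- ln r\<close> as the integral of \<open>exp (- \<pi> r\<^sup>2 / t\<^sup>2) - exp (- \<pi> / t\<^sup>2)\<close> against \<open>dt / t\<close> turns the logarithmic
  covariance of a zero-integral Schwartz function \<open>\<phi>\<close> into \<open>1 / A\<close> times the integral of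
  \<open>\<bar>F \<phi>\<bar>\<^sup>2 / \<bar>\<zeta>\<bar> ^ d\<close>. Since \<open>\<phi> \<mapsto> (h, \<phi>)\<close> is closable, the same formula holds for the convolution with the
  mollifier and gives the integral of \<open>\<bar>b\<bar>\<^sup>2 g(\<epsilon> \<zeta>)\<^sup>2 / (A \<bar>\<zeta>\<bar> ^ d)\<close>, where \<open>g\<close> is the Fourier transform of the
  mollifier. For the white-noise field, Plancherel in space at every scale \<open>t\<close> followed by the
  substitution \<open>s = t \<bar>\<zeta>\<bar>\<close> gives the integral of \<open>\<bar>b\<bar>\<^sup>2 / \<bar>\<zeta>\<bar> ^ d\<close> times the integral of
  \<open>s ^ (d - 1) \<bar>F K s\<bar>\<^sup>2\<close> over \<open>s > \<epsilon> \<bar>\<zeta>\<bar>\<close>, which is the same number by the definition of \<open>g\<close>.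
\<close>

subsection \<open>Laws of families of random variables\<close>

text \<open>The mollifier is the inverse transform of a square root. Its symbol decays rapidly but
  need not be smooth: the tail integral contributes a multiple of \<open>norm \<zeta> ^ d\<close>
  near the origin, which is not smooth for odd \<open>d\<close> when the transform of
  \<open>K\<close> does not vanish at 0. Hence \<open>mollifier K\<close> need not be a Schwartz
  function, and increments of the convolution exist only as limits. Two tasks result: to construct
  such limits, by multiplying the kernel with wide Gaussians, and to show that every choice of
  approximating functions leads to the same variance, since \<open>LGF_pairing\<close> prescribes
  none. The singular weight \<open>1 / norm \<zeta> ^ d\<close> is harmless because symbols of
  increments vanish to first order at 0. The constant \<open>1 / A\<close> is the radial integral of
  the Gaussian of mass 1, and the factor \<open>A\<close> under the root in \<open>mollifier\<close>
  is there to cancel it. Finiteness is proved on the side of \<open>h\<close> and carried to the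
  white noise by the equality of the two energies, which holds in the extended reals.\<close>

lemma norm_cis_diff_le: "cmod (cis a - cis b) \<le> \<bar>a - b\<bar>"
proof -
  have "cmod (cis a - cis b) = cmod (cis b * (cis (a - b) - 1))"
    by (simp add: cis_mult algebra_simps)
  also have "\<dots> = cmod (iexp (a - b) - 1)"
    by (simp add: norm_mult cis_conv_exp)
  also have "\<dots> \<le> \<bar>a - b\<bar>"
    using iexp_approx1[of "a - b" 0] by simp
  finally show ?thesis .
qed

lemma cis_measurable [measurable]: "cis \<in> borel_measurable borel"
  by (intro borel_measurable_continuous_onI continuous_intros)

text \<open>Levy's uniqueness theorem concerns probability measures, so both measures are divided by
  their common mass, which is the value of the transform at \<open>t = 0\<close>. Mass zero admits
  no normalisation and is treated apart.\<close>

lemma finite_measure_eqI_cis: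
  fixes M1 M2 :: "real measure"
  assumes fin: "finite_measure M1" "finite_measure M2"
    and sets [measurable_cong]: "sets M1 = sets borel" "sets M2 = sets borel"
    and eq: "\<And>t. (LINT x|M1. cis (t * x)) = (LINT x|M2. cis (t * x))"
  shows "M1 = M2"
proof -
  interpret M1: finite_measure M1 by fact
  interpret M2: finite_measure M2 by fact
  define m where "m = measure M1 (space M1)"
  have m2: "measure M2 (space M2) = m"
    using eq[of 0] unfolding m_def by (simp add: scaleR_conv_of_real)
  show ?thesis
  proof (cases "m = 0")
    case True
    have e: "emeasure M1 (space M1) = 0" "emeasure M2 (space M2) = 0"
      using True m2 by (auto simp: m_def M1.emeasure_eq_measure M2.emeasure_eq_measure)
    show ?thesis
    proof (rule measure_eqI)
      fix A assume A: "A \<in> sets M1"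
      have "emeasure M1 A = 0" "emeasure M2 A = 0"
        using e emeasure_space[of M1 A] emeasure_space[of M2 A] by auto
      then show "emeasure M1 A = emeasure M2 A" by simp
    qed (simp add: sets)
  next
    case False
    then have m: "m > 0" by (simp add: m_def zero_less_measure_iff)
    define N where "N M = density M (\<lambda>_. ennreal (1 / m))" for M :: "real measure"
    have char: "char (N M) t = (1 / m) *\<^sub>R (LINT x|M. cis (t * x))"
      if "sets M = sets borel" for M t
    proof -
      have [measurable_cong]: "sets M = sets borel" by fact
      have "char (N M) t = (LINT x|M. (1 / m) *\<^sub>R cis (t * x))"
        unfolding char_def N_def using m
        by (subst integral_density) (auto simp: cis_conv_exp)
      then show ?thesis by simp
    qed
    have N: "real_distribution (N M)"
      if "sets M = sets borel" "finite_measure M" "measure M (space M) = m" for M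
    proof -
      interpret finite_measure M by fact
      have "prob_space (N M)"
        using m that
        by (intro prob_spaceI)
          (auto simp: N_def emeasure_density_const emeasure_eq_measure simp flip: ennreal_mult')
      then show ?thesis
        unfolding real_distribution_def real_distribution_axioms_def
        by (simp add: N_def that)
    qed
    have N_eq: "N M1 = N M2"
      by (intro Levy_uniqueness N ext) (auto simp: sets fin m_def[symmetric] m2 char eq)
    show ?thesis
    proof (rule measure_eqI)
      fix A assume A: "A \<in> sets M1"
      then have "A \<in> sets M2" by (simp add: sets)
      have *: "ennreal m * emeasure (N M) A = emeasure M A" if "A \<in> sets M" for M
        unfolding N_def using that m
        by (simp add: emeasure_density nn_integral_cmult_indicator mult.assoc[symmetric]
            flip: ennreal_mult)
      show "emeasure M1 A = emeasure M2 A"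
        using *[OF A] *[OF \<open>A \<in> sets M2\<close>] N_eq by simp
    qed (simp add: sets)
  qed
qed

lemma cos_eq_cis: "complex_of_real (cos x) = (cis x + cis (- x)) / 2"
  by (simp add: complex_eq_iff)

lemma integrable_cis_comp:
  assumes "finite_measure M" "f \<in> borel_measurable M"
  shows "integrable M (\<lambda>\<omega>. cis (f \<omega>))"
proof -
  interpret finite_measure M by fact
  note assms(2)[measurable]
  show ?thesis by (rule integrable_const_bound[where B=1]) auto
qed

text \<open>The density is nonnegative and a sum of exponentials: integrating
  \<open>cis (t * X \<omega>)\<close> against it only involves the transforms of \<open>X\<close>
  jointly with \<open>S\<close> and \<open>- S\<close>. Thus joint transforms determine those of a
  positive measure, to which one-dimensional uniqueness applies.\<close>

lemma cosine_density:
  fixes X S :: "'w \<Rightarrow> real" and a :: real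
  assumes fin: "finite_measure M" and [measurable]: "X \<in> borel_measurable M" "S \<in> borel_measurable M"
  defines "M' \<equiv> density M (\<lambda>\<omega>. ennreal (1 + cos (S \<omega> + a)))"
  shows "finite_measure M'"
    and "(LINT \<omega>|M'. cis (t * X \<omega>)) = (LINT \<omega>|M. cis (t * X \<omega>)) +
      cis a / 2 * (LINT \<omega>|M. cis (t * X \<omega> + S \<omega>)) + cis (- a) / 2 * (LINT \<omega>|M. cis (t * X \<omega> + - S \<omega>))"
    and "A \<in> sets borel \<Longrightarrow> (LINT x|distr M' borel X. indicator A x) = (LINT \<omega>|M. indicator A (X \<omega>) * (1 + cos (S \<omega> + a)))"
proof -
  interpret finite_measure M by fact
  have nn: "0 \<le> 1 + cos x" for x :: real
    using cos_ge_minus_one[of x] by linarith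
  have two: "\<bar>1 + cos x\<bar> \<le> 2" for x :: real
    using nn[of x] cos_le_one[of x] by linarith
  have i: "integrable M (\<lambda>\<omega>. 1 + cos (S \<omega> + a))"
    by (rule integrable_const_bound[where B=2]) (use two in simp_all)
  show "finite_measure M'"
  proof (rule finite_measureI)
    have "emeasure M' (space M') = (\<integral>\<^sup>+\<omega>. ennreal (1 + cos (S \<omega> + a)) \<partial>M)"
      unfolding M'_def by (simp add: emeasure_density cong: nn_integral_cong)
    then show "emeasure M' (space M') \<noteq> \<infinity>"
      by (simp add: nn_integral_eq_integral[OF i] nn)
  qed
  have [measurable_cong]: "sets M' = sets M"
    by (simp add: M'_def)
  have "(LINT \<omega>|M'. cis (t * X \<omega>)) = (LINT \<omega>|M. (1 + cos (S \<omega> + a)) *\<^sub>R cis (t * X \<omega>))"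
    unfolding M'_def by (subst integral_density) (use nn in auto)
  also have "\<dots> = (LINT \<omega>|M. cis (t * X \<omega>) + cis a / 2 * cis (t * X \<omega> + S \<omega>) + cis (- a) / 2 * cis (t * X \<omega> + - S \<omega>))"
    by (intro Bochner_Integration.integral_cong refl)
      (simp add: scaleR_conv_of_real cos_eq_cis cis_mult add_divide_distrib algebra_simps)
  also have "\<dots> = (LINT \<omega>|M. cis (t * X \<omega>)) +
      cis a / 2 * (LINT \<omega>|M. cis (t * X \<omega> + S \<omega>)) + cis (- a) / 2 * (LINT \<omega>|M. cis (t * X \<omega> + - S \<omega>))"
    by (simp add: integrable_cis_comp[OF fin] del: add_uminus_conv_diff)
  finally show "(LINT \<omega>|M'. cis (t * X \<omega>)) = (LINT \<omega>|M. cis (t * X \<omega>)) +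
      cis a / 2 * (LINT \<omega>|M. cis (t * X \<omega> + S \<omega>)) + cis (- a) / 2 * (LINT \<omega>|M. cis (t * X \<omega> + - S \<omega>))" .
  assume [measurable]: "A \<in> sets borel"
  have "(LINT x|distr M' borel X. indicator A x :: real) = (LINT \<omega>|M'. indicator A (X \<omega>))"
    by (subst integral_distr) simp_all
  then show "(LINT x|distr M' borel X. indicator A x) = (LINT \<omega>|M. indicator A (X \<omega>) * (1 + cos (S \<omega> + a)))"
    unfolding M'_def by (subst (asm) integral_density) (auto simp: nn mult.commute)
qed

text \<open>Restriction to the event that \<open>X\<close> lies in \<open>A\<close>. The phases 0
  and \<open>- pi / 2\<close> give the real and imaginary part of \<open>cis (S \<omega>)\<close>,
  which leads from cosine integrals back to the transform of the restricted measure.\<close>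

lemma indicator_density:
  fixes X S :: "'w \<Rightarrow> real"
  assumes fin: "finite_measure M" and [measurable]: "X \<in> borel_measurable M" "A \<in> sets borel"
  defines "M' \<equiv> density M (\<lambda>\<omega>. ennreal (indicator A (X \<omega>)))"
  shows "finite_measure M'"
    and "B \<in> sets M \<Longrightarrow> emeasure M' B = emeasure M (B \<inter> {\<omega>\<in>space M. X \<omega> \<in> A})"
    and "S \<in> borel_measurable M \<Longrightarrow> (LINT \<omega>|M'. cis (S \<omega>)) =
      Complex (LINT \<omega>|M. indicator A (X \<omega>) * cos (S \<omega> + 0)) (LINT \<omega>|M. indicator A (X \<omega>) * cos (S \<omega> + - pi / 2))"
proof -
  interpret finite_measure M by fact
  show em: "emeasure M' B = emeasure M (B \<inter> {\<omega>\<in>space M. X \<omega> \<in> A})" if "B \<in> sets M" for B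
  proof -
    have "emeasure M' B = (\<integral>\<^sup>+\<omega>. ennreal (indicator A (X \<omega>)) * indicator B \<omega> \<partial>M)"
      unfolding M'_def using that by (subst emeasure_density) auto
    also have "\<dots> = (\<integral>\<^sup>+\<omega>. indicator (B \<inter> {\<omega>\<in>space M. X \<omega> \<in> A}) \<omega> \<partial>M)"
      by (rule nn_integral_cong) (auto split: split_indicator)
    finally show ?thesis using that by simp
  qed
  show "finite_measure M'"
    using em[of "space M"] by (auto intro!: finite_measureI simp: M'_def)
  assume [measurable]: "S \<in> borel_measurable M"
  have i: "integrable M (\<lambda>\<omega>. indicator A (X \<omega>) * cis (S \<omega>))"
    by (rule integrable_const_bound[where B=1]; auto split: split_indicator simp: norm_mult)
  have "(LINT \<omega>|M'. cis (S \<omega>)) = (LINT \<omega>|M. indicator A (X \<omega>) * cis (S \<omega>))"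
    unfolding M'_def
    by (subst integral_density) (auto simp: scaleR_conv_of_real intro!: Bochner_Integration.integral_cong split: split_indicator)
  moreover have "Re (indicator A x * cis y) = indicator A x * cos (y + 0)"
    "Im (indicator A x * cis y) = indicator A x * cos (y + - pi / 2)" for x y
    by (auto split: split_indicator simp: cos_diff)
  ultimately show "(LINT \<omega>|M'. cis (S \<omega>)) =
      Complex (LINT \<omega>|M. indicator A (X \<omega>) * cos (S \<omega> + 0)) (LINT \<omega>|M. indicator A (X \<omega>) * cos (S \<omega> + - pi / 2))"
    by (simp only: complex_eq_iff complex.sel integral_Re[OF i, symmetric] integral_Im[OF i, symmetric])
qed

text \<open>Induction on the number of coordinates: a density of the form \<open>1 + cos\<close> keeps
  the measures positive, so that the one-dimensional uniqueness theorem applies.\<close>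

lemma rectangle_measure_eqI_cis:
  fixes M :: "'w measure" and N :: "'v measure" and X :: "'i \<Rightarrow> 'w \<Rightarrow> real"
  assumes "finite J" "finite_measure M" "finite_measure N"
    and "\<And>i. i \<in> J \<Longrightarrow> X i \<in> borel_measurable M"
    and "\<And>i. i \<in> J \<Longrightarrow> Y i \<in> borel_measurable N"
    and "\<And>c. (LINT \<omega>|M. cis (\<Sum>i\<in>J. c i * X i \<omega>)) = (LINT \<omega>|N. cis (\<Sum>i\<in>J. c i * Y i \<omega>))"
    and "\<And>i. i \<in> J \<Longrightarrow> A i \<in> sets borel"
  shows "measure M {\<omega>\<in>space M. \<forall>i\<in>J. X i \<omega> \<in> A i} = measure N {\<omega>\<in>space N. \<forall>i\<in>J. Y i \<omega> \<in> A i}"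
  using assms
proof (induction J arbitrary: M N rule: finite_induct)
  case empty
  then show ?case by (simp add: scaleR_conv_of_real)
next
  case (insert j J)
  interpret M: finite_measure M by fact
  interpret N: finite_measure N by fact
  note XJ = insert.prems(3) and YJ = insert.prems(4) and eq = insert.prems(5) and AJ = insert.prems(6)
  have Xj [measurable]: "X j \<in> borel_measurable M" and Yj [measurable]: "Y j \<in> borel_measurable N"
    and Aj [measurable]: "A j \<in> sets borel"
    using XJ YJ AJ by auto
  define S where "S c \<omega> = (\<Sum>i\<in>J. c i * X i \<omega>)" for c \<omega>
  define T where "T c \<omega> = (\<Sum>i\<in>J. c i * Y i \<omega>)" for c \<omega>
  have S [measurable]: "S c \<in> borel_measurable M" for c
    unfolding S_def using XJ by (intro borel_measurable_sum borel_measurable_times) auto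
  have T [measurable]: "T c \<in> borel_measurable N" for c
    unfolding T_def using YJ by (intro borel_measurable_sum borel_measurable_times) auto
  have eq': "(LINT \<omega>|M. cis (t * X j \<omega> + S c \<omega>)) = (LINT \<omega>|N. cis (t * Y j \<omega> + T c \<omega>))" for t c
  proof -
    define c' where "c' = c(j := t)"
    have 1: "(\<Sum>i\<in>J. c' i * X i \<omega>) = S c \<omega>" "(\<Sum>i\<in>J. c' i * Y i \<omega>') = T c \<omega>'" for \<omega> \<omega>'
      unfolding S_def T_def using insert.hyps by (intro sum.cong; auto simp: c'_def)+
    show ?thesis
      using eq[of c'] insert.hyps by (simp add: 1) (simp add: c'_def)
  qed
  have neg: "- S c \<omega> = S (\<lambda>i. - c i) \<omega>" "- T c \<omega>' = T (\<lambda>i. - c i) \<omega>'" for c \<omega> \<omega>'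
    by (simp_all add: S_def T_def sum_negf)
  have eq0: "(LINT \<omega>|M. cis (t * X j \<omega>)) = (LINT \<omega>|N. cis (t * Y j \<omega>))" for t
    using eq'[of t "\<lambda>_. 0"] by (simp add: S_def T_def)
  \<comment> \<open>Tilting by \<open>1 + cos\<close> produces finite measures under which
    \<open>X j\<close> and \<open>Y j\<close> have the same transform, hence the same law;
    evaluating both laws at \<open>A j\<close> gives the claim.\<close>
  have dens: "(LINT \<omega>|M. indicator (A j) (X j \<omega>) * (1 + cos (S c \<omega> + a))) =
        (LINT \<omega>|N. indicator (A j) (Y j \<omega>) * (1 + cos (T c \<omega> + a)))" for c a
  proof -
    note cM = cosine_density[OF M.finite_measure_axioms Xj S[of c], where a = a]
    note cN = cosine_density[OF N.finite_measure_axioms Yj T[of c], where a = a]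
    have "distr (density M (\<lambda>\<omega>. ennreal (1 + cos (S c \<omega> + a)))) borel (X j) =
        distr (density N (\<lambda>\<omega>. ennreal (1 + cos (T c \<omega> + a)))) borel (Y j)"
    proof (rule finite_measure_eqI_cis)
      fix t
      have "(LINT x|density M (\<lambda>\<omega>. ennreal (1 + cos (S c \<omega> + a))). cis (t * X j x)) =
          (LINT x|density N (\<lambda>\<omega>. ennreal (1 + cos (T c \<omega> + a))). cis (t * Y j x))"
        unfolding cM(2) cN(2) neg eq' eq0 ..
      then show "(LINT x|distr (density M (\<lambda>\<omega>. ennreal (1 + cos (S c \<omega> + a)))) borel (X j). cis (t * x)) =
          (LINT x|distr (density N (\<lambda>\<omega>. ennreal (1 + cos (T c \<omega> + a)))) borel (Y j). cis (t * x))"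
        by (subst (1 2) integral_distr) simp_all
    qed (auto intro!: finite_measure.finite_measure_distr cM(1) cN(1))
    with cM(3)[OF Aj] cN(3)[OF Aj] show ?thesis by simp
  qed
  have ind_eq: "(LINT \<omega>|M. indicator (A j) (X j \<omega>)) = (LINT \<omega>|N. indicator (A j) (Y j \<omega>) :: real)"
    using dens[of "\<lambda>_. 0" 0] by (simp add: S_def T_def)
  have indM: "integrable M (\<lambda>\<omega>. indicator (A j) (X j \<omega>) * cos (S c \<omega> + a))"
    "integrable M (\<lambda>\<omega>. indicator (A j) (X j \<omega>) :: real)" for c a
    by (rule M.integrable_const_bound[where B=1]; auto split: split_indicator)+
  have indN: "integrable N (\<lambda>\<omega>. indicator (A j) (Y j \<omega>) * cos (T c \<omega> + a))"
    "integrable N (\<lambda>\<omega>. indicator (A j) (Y j \<omega>) :: real)" for c a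
    by (rule N.integrable_const_bound[where B=1]; auto split: split_indicator)+
  \<comment> \<open>\<open>ind_eq\<close> removes the contribution of the summand 1, which leaves
    the cosine integrals alone.\<close>
  have cos_eq: "(LINT \<omega>|M. indicator (A j) (X j \<omega>) * cos (S c \<omega> + a)) =
     (LINT \<omega>|N. indicator (A j) (Y j \<omega>) * cos (T c \<omega> + a))" for c a
    using dens[of c a] indM(1)[of c a] indM(2) indN(1)[of c a] indN(2) ind_eq by (simp add: ring_distribs)
  \<comment> \<open>Conditioning on coordinate \<open>j\<close> without normalising: the restricted
    measures have equal transforms in the coordinates \<open>J\<close>. This is why the induction
    runs over finite measures and not over probability measures.\<close>
  define M' where "M' = density M (\<lambda>\<omega>. ennreal (indicator (A j) (X j \<omega>)))"
  define N' where "N' = density N (\<lambda>\<omega>. ennreal (indicator (A j) (Y j \<omega>)))"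
  note M' = indicator_density[OF M.finite_measure_axioms Xj Aj, folded M'_def]
    and N' = indicator_density[OF N.finite_measure_axioms Yj Aj, folded N'_def]
  have sp: "space M' = space M" "space N' = space N" "sets M' = sets M" "sets N' = sets N"
    by (simp_all add: M'_def N'_def)
  have "measure M' {\<omega>\<in>space M'. \<forall>i\<in>J. X i \<omega> \<in> A i} = measure N' {\<omega>\<in>space N'. \<forall>i\<in>J. Y i \<omega> \<in> A i}"
  proof (rule insert.IH)
    show "X i \<in> borel_measurable M'" "Y i \<in> borel_measurable N'" if "i \<in> J" for i
      using XJ YJ that by (auto cong: measurable_cong_sets simp: M'_def N'_def)
    show "(LINT \<omega>|M'. cis (\<Sum>i\<in>J. c i * X i \<omega>)) = (LINT \<omega>|N'. cis (\<Sum>i\<in>J. c i * Y i \<omega>))" for c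
      using M'(3)[OF S[of c]] N'(3)[OF T[of c]] unfolding cos_eq by (simp add: S_def T_def)
  qed (use AJ in \<open>auto intro: M'(1) N'(1)\<close>)
  moreover have "{\<omega>\<in>space M. \<forall>i\<in>J. X i \<omega> \<in> A i} \<in> sets M" "{\<omega>\<in>space N. \<forall>i\<in>J. Y i \<omega> \<in> A i} \<in> sets N"
    using XJ YJ AJ insert.hyps(1) by (auto intro!: sets.sets_Collect_finite_All predE pred_sets2)
  moreover have "{\<omega>\<in>space M. \<forall>i\<in>insert j J. X i \<omega> \<in> A i} =
      {\<omega>\<in>space M. \<forall>i\<in>J. X i \<omega> \<in> A i} \<inter> {\<omega>\<in>space M. X j \<omega> \<in> A j}"
    "{\<omega>\<in>space N. \<forall>i\<in>insert j J. Y i \<omega> \<in> A i} =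
      {\<omega>\<in>space N. \<forall>i\<in>J. Y i \<omega> \<in> A i} \<inter> {\<omega>\<in>space N. Y j \<omega> \<in> A j}" by auto
  ultimately show ?case
    by (simp add: measure_def M'(2) N'(2) sp)
qed

text \<open>The Cramer-Wold device. Linear combinations determine the joint transforms, these
  determine the measures of finite-dimensional rectangles, and such rectangles generate the product
  sigma-algebra over any index set.\<close>

lemma distr_PiM_eqI_linear_combinations:
  fixes X :: "'i \<Rightarrow> 'w \<Rightarrow> real" and Y :: "'i \<Rightarrow> 'v \<Rightarrow> real"
  assumes "prob_space M" "prob_space N"
    and X [measurable]: "\<And>i. X i \<in> borel_measurable M" and Y [measurable]: "\<And>i. Y i \<in> borel_measurable N"
    and eq: "\<And>J c. finite J \<Longrightarrow> distr M borel (\<lambda>\<omega>. \<Sum>i\<in>J. c i * X i \<omega>) = distr N borel (\<lambda>\<omega>. \<Sum>i\<in>J. c i * Y i \<omega>)"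
  shows "distr M (PiM UNIV (\<lambda>_. borel)) (\<lambda>\<omega> i. X i \<omega>) = distr N (PiM UNIV (\<lambda>_. borel)) (\<lambda>\<omega> i. Y i \<omega>)"
proof -
  interpret M: prob_space M by fact
  interpret N: prob_space N by fact
  have Xm [measurable]: "(\<lambda>\<omega> i. X i \<omega>) \<in> measurable M (PiM UNIV (\<lambda>_. borel))"
    by (rule measurable_PiM_single') auto
  have Ym [measurable]: "(\<lambda>\<omega> i. Y i \<omega>) \<in> measurable N (PiM UNIV (\<lambda>_. borel))"
    by (rule measurable_PiM_single') auto
  show ?thesis
  proof (rule measure_eqI_PiM_infinite)
    fix A :: "'i \<Rightarrow> real set" and J assume J: "finite J" "J \<subseteq> UNIV" and A: "\<And>i. i \<in> J \<Longrightarrow> A i \<in> sets borel"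
    let ?C = "prod_emb UNIV (\<lambda>_. borel) J (Pi\<^sub>E J A) :: ('i \<Rightarrow> real) set"
    have C: "?C \<in> sets (PiM UNIV (\<lambda>_. borel))"
      using J A by (intro sets_PiM_I) auto
    have "measure M {\<omega>\<in>space M. \<forall>i\<in>J. X i \<omega> \<in> A i} = measure N {\<omega>\<in>space N. \<forall>i\<in>J. Y i \<omega> \<in> A i}"
    proof (rule rectangle_measure_eqI_cis[OF J(1)])
      show "(LINT \<omega>|M. cis (\<Sum>i\<in>J. c i * X i \<omega>)) = (LINT \<omega>|N. cis (\<Sum>i\<in>J. c i * Y i \<omega>))" for c
      proof -
        have "(LINT x|distr M borel (\<lambda>\<omega>. \<Sum>i\<in>J. c i * X i \<omega>). cis x) = (LINT x|distr N borel (\<lambda>\<omega>. \<Sum>i\<in>J. c i * Y i \<omega>). cis x)"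
          using eq[OF J(1)] by simp
        then show ?thesis by (subst (asm) (1 2) integral_distr) simp_all
      qed
    qed (use A in \<open>auto intro: M.finite_measure_axioms N.finite_measure_axioms\<close>)
    moreover have "(\<lambda>\<omega> i. X i \<omega>) -` ?C \<inter> space M = {\<omega>\<in>space M. \<forall>i\<in>J. X i \<omega> \<in> A i}"
      "(\<lambda>\<omega> i. Y i \<omega>) -` ?C \<inter> space N = {\<omega>\<in>space N. \<forall>i\<in>J. Y i \<omega> \<in> A i}"
      by (auto simp: prod_emb_def PiE_iff)
    ultimately show "emeasure (distr M (PiM UNIV (\<lambda>_. borel)) (\<lambda>\<omega> i. X i \<omega>)) ?C =
        emeasure (distr N (PiM UNIV (\<lambda>_. borel)) (\<lambda>\<omega> i. Y i \<omega>)) ?C"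
      using C by (simp add: emeasure_distr M.emeasure_eq_measure N.emeasure_eq_measure)
  qed (auto intro!: M.finite_measure_distr)
qed


subsection \<open>Convergence in mean square\<close>

text \<open>Young's inequality with a free weight. The choice \<open>d = 1\<close> gives the usual
  factor 2; a small \<open>d\<close> keeps the coefficient of the first term close to 1, which is
  what convergence of norms requires.\<close>

lemma power2_norm_add_le:
  fixes a b :: "'a::real_normed_vector"
  assumes "d > 0"
  shows "(norm (a + b))\<^sup>2 \<le> (1 + d) * (norm a)\<^sup>2 + (1 + 1 / d) * (norm b)\<^sup>2"
proof -
  have "(norm (a + b))\<^sup>2 \<le> (norm a + norm b)\<^sup>2"
    by (intro power_mono norm_triangle_ineq) auto
  also have "\<dots> = (norm a)\<^sup>2 + (norm b)\<^sup>2 + 2 * norm a * norm b"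
    by (simp add: power2_sum)
  also have "2 * norm a * norm b \<le> d * (norm a)\<^sup>2 + (norm b)\<^sup>2 / d"
  proof -
    have "0 \<le> (d * norm a - norm b)\<^sup>2 / d" using assms by simp
    also have "\<dots> = d * (norm a)\<^sup>2 + (norm b)\<^sup>2 / d - 2 * norm a * norm b"
      using assms by (simp add: power2_eq_square field_simps)
    finally show ?thesis by simp
  qed
  finally show ?thesis by (simp add: algebra_simps)
qed

lemma nn_integral_power2_norm_add_le:
  fixes u v :: "'x \<Rightarrow> 'b::{real_normed_vector, second_countable_topology}"
  assumes [measurable]: "u \<in> borel_measurable M" "v \<in> borel_measurable M" and d: "d > 0"
  shows "(\<integral>\<^sup>+x. ennreal ((norm (u x + v x))\<^sup>2) \<partial>M) \<le>
    ennreal (1 + d) * (\<integral>\<^sup>+x. ennreal ((norm (u x))\<^sup>2) \<partial>M) +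
    ennreal (1 + 1 / d) * (\<integral>\<^sup>+x. ennreal ((norm (v x))\<^sup>2) \<partial>M)"
proof -
  have "(\<integral>\<^sup>+x. ennreal ((norm (u x + v x))\<^sup>2) \<partial>M) \<le>
    (\<integral>\<^sup>+x. ennreal (1 + d) * ennreal ((norm (u x))\<^sup>2) + ennreal (1 + 1 / d) * ennreal ((norm (v x))\<^sup>2) \<partial>M)"
    using d power2_norm_add_le[OF d]
    by (intro nn_integral_mono) (simp add: ennreal_leI flip: ennreal_mult ennreal_plus)
  also have "\<dots> = ennreal (1 + d) * (\<integral>\<^sup>+x. ennreal ((norm (u x))\<^sup>2) \<partial>M) +
    ennreal (1 + 1 / d) * (\<integral>\<^sup>+x. ennreal ((norm (v x))\<^sup>2) \<partial>M)"
    by (subst nn_integral_add) (auto simp: nn_integral_cmult)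
  finally show ?thesis .
qed

text \<open>The triangle inequality in both directions, written for extended nonnegative integrals
  because no \<open>u n\<close> is assumed to be square integrable.\<close>

lemma tendsto_L2_norm:
  fixes u :: "nat \<Rightarrow> 'x \<Rightarrow> 'b::{real_normed_vector, second_countable_topology}"
  assumes [measurable]: "\<And>n. u n \<in> borel_measurable M" "v \<in> borel_measurable M"
    and lim: "(\<lambda>n. \<integral>\<^sup>+x. ennreal ((norm (u n x - v x))\<^sup>2) \<partial>M) \<longlonglongrightarrow> 0"
    and fin: "(\<integral>\<^sup>+x. ennreal ((norm (v x))\<^sup>2) \<partial>M) < \<infinity>"
  shows "(\<lambda>n. \<integral>\<^sup>+x. ennreal ((norm (u n x))\<^sup>2) \<partial>M) \<longlonglongrightarrow> (\<integral>\<^sup>+x. ennreal ((norm (v x))\<^sup>2) \<partial>M)"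
proof -
  define E where "E n = (\<integral>\<^sup>+x. ennreal ((norm (u n x - v x))\<^sup>2) \<partial>M)" for n
  define A where "A n = (\<integral>\<^sup>+x. ennreal ((norm (u n x))\<^sup>2) \<partial>M)" for n
  define B where "B = (\<integral>\<^sup>+x. ennreal ((norm (v x))\<^sup>2) \<partial>M)"
  define e where "e n = enn2real (E n)" for n
  define a where "a n = enn2real (A n)" for n
  define b where "b = enn2real B"
  \<comment> \<open>The weight is about the square root of the squared distance \<open>e n\<close>,
    so that \<open>d n\<close> and \<open>e n / d n\<close> both vanish in the limit; the added
    \<open>1 / real (Suc n)\<close> keeps it positive when \<open>e n = 0\<close>.\<close>
  define d where "d n = sqrt (e n) + 1 / real (Suc n)" for n
  have d_pos: "d n > 0" for n by (simp add: d_def e_def add_nonneg_pos)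
  have E0: "E \<longlonglongrightarrow> 0" using lim by (simp add: E_def[abs_def])
  have ev: "eventually (\<lambda>n. E n < 1) sequentially"
    using order_tendstoD(2)[OF E0, of 1] by simp
  have e0: "e \<longlonglongrightarrow> 0"
    unfolding e_def using tendsto_enn2real[where u=E and l=0] E0 by simp
  have d0: "d \<longlonglongrightarrow> 0"
    unfolding d_def using tendsto_real_sqrt[OF e0] LIMSEQ_Suc[OF lim_1_over_n] tendsto_add by fastforce
  have B: "B = ennreal b" using fin by (simp add: B_def b_def less_top)
  have up: "A n \<le> ennreal (1 + d n) * B + ennreal (1 + 1 / d n) * E n" for n
    using nn_integral_power2_norm_add_le[of v M "\<lambda>x. u n x - v x" "d n"] d_pos
    by (simp add: A_def B_def E_def)
  have lo: "B \<le> ennreal (1 + d n) * A n + ennreal (1 + 1 / d n) * E n" for n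
    using nn_integral_power2_norm_add_le[of "u n" M "\<lambda>x. v x - u n x" "d n"] d_pos
    by (simp add: A_def B_def E_def norm_minus_commute)
  have small: "(1 + 1 / d n) * e n \<le> e n + sqrt (e n)" for n
  proof -
    have "e n / d n \<le> sqrt (e n)"
    proof (cases "e n = 0")
      case False
      then have "sqrt (e n) > 0" by (simp add: e_def less_le)
      have "e n / d n \<le> e n / sqrt (e n)"
        using \<open>sqrt (e n) > 0\<close> by (intro divide_left_mono mult_pos_pos d_pos) (auto simp: d_def e_def)
      then show ?thesis by (simp add: e_def real_div_sqrt)
    qed simp
    then show ?thesis by (simp add: algebra_simps)
  qed
  have ev2: "eventually (\<lambda>n. A n = ennreal (a n) \<and> a n \<le> (1 + d n) * b + (e n + sqrt (e n)) \<and>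
      (b - (e n + sqrt (e n))) / (1 + d n) \<le> a n) sequentially"
    using ev
  proof eventually_elim
    case (elim n)
    then have En: "E n = ennreal (e n)" by (simp add: e_def) (metis ennreal_enn2real ennreal_one_less_top order_less_trans)
    have nn: "e n \<ge> 0" "b \<ge> 0" "a n \<ge> 0" by (simp_all add: e_def b_def a_def)
    have An: "A n \<le> ennreal ((1 + d n) * b + (1 + 1 / d n) * e n)"
      using up[of n] d_pos[of n] nn by (simp add: En B ennreal_mult ennreal_plus less_imp_le)
    then have An': "A n = ennreal (a n)"
      by (simp add: a_def) (metis ennreal_enn2real ennreal_less_top order_le_less_trans)
    have "ennreal b \<le> ennreal ((1 + d n) * a n + (1 + 1 / d n) * e n)"
      using lo[of n] d_pos[of n] nn by (simp add: En B An' ennreal_mult ennreal_plus less_imp_le)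
    then have 1: "b \<le> (1 + d n) * a n + (1 + 1 / d n) * e n"
      using nn d_pos[of n] by (subst (asm) ennreal_le_iff) (auto intro!: add_nonneg_nonneg mult_nonneg_nonneg)
    have 2: "a n \<le> (1 + d n) * b + (1 + 1 / d n) * e n"
      using An nn d_pos[of n] unfolding An' by (subst (asm) ennreal_le_iff) (auto intro!: add_nonneg_nonneg mult_nonneg_nonneg)
    have 3: "a n \<le> (1 + d n) * b + (e n + sqrt (e n))"
      using 2 small[of n] by linarith
    have "b - (e n + sqrt (e n)) \<le> (1 + d n) * a n"
      using 1 small[of n] by linarith
    then have "(b - (e n + sqrt (e n))) / (1 + d n) \<le> a n"
      using d_pos[of n] by (simp add: divide_le_eq mult.commute)
    with 3 show ?case using An' by simp
  qed
  have "a \<longlonglongrightarrow> b"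
  proof (rule tendsto_sandwich)
    show "(\<lambda>n. (b - (e n + sqrt (e n))) / (1 + d n)) \<longlonglongrightarrow> b"
      by (rule tendsto_eq_intros e0 d0 refl | simp)+
    show "(\<lambda>n. (1 + d n) * b + (e n + sqrt (e n))) \<longlonglongrightarrow> b"
      by (rule tendsto_eq_intros e0 d0 refl | simp)+
  qed (use ev2 in \<open>auto elim: eventually_mono\<close>)
  then have "(\<lambda>n. ennreal (a n)) \<longlonglongrightarrow> ennreal b" by simp
  then have "A \<longlonglongrightarrow> B"
    using ev2 by (subst B, subst tendsto_cong[of A "\<lambda>n. ennreal (a n)"]) (auto elim: eventually_mono)
  then show ?thesis by (simp add: A_def[abs_def] B_def)
qed

subsection \<open>Centered normal variables\<close>

lemma centered_normal_char:
  assumes "prob_space M" "centered_normal M X v"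
  shows "(LINT \<omega>|M. cis (t * X \<omega>)) = complex_of_real (exp (- (t\<^sup>2 * v) / 2))"
proof -
  have [measurable]: "X \<in> borel_measurable M" and v: "0 \<le> v" and
    D: "distr M borel X = (if v = 0 then return borel 0 else density lborel (normal_density 0 (sqrt v)))"
    using assms by (auto simp: centered_normal_def)
  have "(LINT \<omega>|M. cis (t * X \<omega>)) = (LINT x|distr M borel X. cis (t * x))"
    by (subst integral_distr) auto
  also have "\<dots> = complex_of_real (exp (- (t\<^sup>2 * v) / 2))"
  proof (cases "v = 0")
    case True
    then show ?thesis by (simp add: D integral_return)
  next
    case False
    define s where "s = sqrt v"
    have s: "s > 0" using False v by (simp add: s_def)
    interpret S: prob_space std_normal_distribution by (rule prob_space_normal_density) simp
    have "distributed std_normal_distribution lborel (\<lambda>x. x) (normal_density 0 1)"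
      by (simp add: distributed_def distr_id2)
    from S.normal_density_affine[OF this, of s 0] s
    have "distr std_normal_distribution lborel (\<lambda>x. s * x) = density lborel (normal_density 0 s)"
      by (simp add: distributed_def)
    then have "(LINT x|distr M borel X. cis (t * x)) =
        (LINT x|distr std_normal_distribution lborel (\<lambda>x. s * x). cis (t * x))"
      using False by (simp add: D s_def)
    also have "\<dots> = (LINT x|std_normal_distribution. cis (t * (s * x)))"
      by (subst integral_distr) auto
    also have "\<dots> = char std_normal_distribution (t * s)"
      by (simp add: char_def cis_conv_exp mult_ac)
    also have "\<dots> = complex_of_real (exp (- ((t * s)\<^sup>2) / 2))"
      by (simp add: char_std_normal_distribution)
    finally show ?thesis using v by (simp add: s_def power_mult_distrib)
  qed
  finally show ?thesis .
qed

text \<open>\<open>centered_normal_char\<close> is applied to the model law \<open>D\<close> itself,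
  and uniqueness of transforms does the rest.\<close>

lemma centered_normalI_char:
  assumes "prob_space M" and [measurable]: "X \<in> borel_measurable M" and v: "0 \<le> v"
    and ch: "\<And>t. (LINT \<omega>|M. cis (t * X \<omega>)) = complex_of_real (exp (- (t\<^sup>2 * v) / 2))"
  shows "centered_normal M X v"
proof -
  interpret prob_space M by fact
  define D :: "real measure" where
    "D = (if v = 0 then return borel 0 else density lborel (normal_density 0 (sqrt v)))"
  have pD: "prob_space D" unfolding D_def using v
    by (auto intro!: prob_space_return prob_space_normal_density)
  have [measurable_cong, simp]: "sets D = sets borel" by (simp add: D_def)
  have "distr D borel (\<lambda>x. x) = distr D D (\<lambda>x. x)" by (rule distr_cong) auto
  then have "centered_normal D (\<lambda>x. x) v"
    using v unfolding centered_normal_def by (simp add: D_def[symmetric] distr_id2)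
  note cD = centered_normal_char[OF pD this]
  have "distr M borel X = D"
    by (rule finite_measure_eqI_cis)
      (auto intro!: finite_measure_distr prob_space.finite_measure[OF pD] simp: integral_distr ch cD)
  then show ?thesis using v by (simp add: centered_normal_def D_def)
qed

lemma centered_normal_second_moment:
  assumes "centered_normal M X v"
  shows "(\<integral>\<^sup>+\<omega>. ennreal ((X \<omega>)\<^sup>2) \<partial>M) = ennreal v"
proof -
  have [measurable]: "X \<in> borel_measurable M" and v: "0 \<le> v" and
    D: "distr M borel X = (if v = 0 then return borel 0 else density lborel (normal_density 0 (sqrt v)))"
    using assms by (auto simp: centered_normal_def)
  have "(\<integral>\<^sup>+\<omega>. ennreal ((X \<omega>)\<^sup>2) \<partial>M) = (\<integral>\<^sup>+x. ennreal (x\<^sup>2) \<partial>distr M borel X)"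
    by (subst nn_integral_distr) auto
  also have "\<dots> = ennreal v"
  proof (cases "v = 0")
    case True
    then show ?thesis by (simp add: D nn_integral_return)
  next
    case False
    define s where "s = sqrt v"
    have s: "s > 0" using False v by (simp add: s_def)
    have "has_bochner_integral lborel (\<lambda>x. normal_density 0 s x * x\<^sup>2) v"
      using normal_moment_even[OF s, of 0 1] s v
      by (simp add: s_def fact_2)
    then have "(\<integral>\<^sup>+x. ennreal (normal_density 0 s x * x\<^sup>2) \<partial>lborel) = ennreal v"
      by (subst nn_integral_eq_integral) (auto simp: has_bochner_integral_iff)
    then show ?thesis using False
      by (simp add: D s_def nn_integral_density flip: ennreal_mult)
  qed
  finally show ?thesis .
qed

text \<open>Since \<open>cis\<close> is 1-Lipschitz, mean square convergence of the variables forces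
  convergence of their characteristic functions; the limit is Gaussian because the variances
  converge.\<close>

lemma centered_normal_L2_limit:
  assumes M: "prob_space M" and X: "\<And>n. centered_normal M (X n) (v n)"
    and [measurable]: "Y \<in> borel_measurable M"
    and lim: "(\<lambda>n. \<integral>\<^sup>+\<omega>. ennreal ((X n \<omega> - Y \<omega>)\<^sup>2) \<partial>M) \<longlonglongrightarrow> 0"
    and v: "v \<longlonglongrightarrow> w"
  shows "centered_normal M Y w"
proof (rule centered_normalI_char[OF M])
  interpret prob_space M by fact
  have [measurable]: "X n \<in> borel_measurable M" and v0: "v n \<ge> 0" for n
    using X[of n] by (auto simp: centered_normal_def)
  show "0 \<le> w" using v v0 by (simp add: LIMSEQ_le_const)
  fix t :: real
  define E where "E n = (\<integral>\<^sup>+\<omega>. ennreal ((X n \<omega> - Y \<omega>)\<^sup>2) \<partial>M)" for n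
  have ic: "integrable M (\<lambda>\<omega>. cis (f \<omega>))" if "f \<in> borel_measurable M" for f
    by (rule integrable_cis_comp[OF finite_measure_axioms that])
  have bound: "cmod ((LINT \<omega>|M. cis (t * X n \<omega>)) - (LINT \<omega>|M. cis (t * Y \<omega>))) \<le> d + t\<^sup>2 / d * enn2real (E n)"
    if d: "d > 0" and fin: "E n < \<infinity>" for d n
  proof -
    have iq: "integrable M (\<lambda>\<omega>. (X n \<omega> - Y \<omega>)\<^sup>2)"
      using fin by (simp add: integrable_iff_bounded E_def)
    have "cmod ((LINT \<omega>|M. cis (t * X n \<omega>)) - (LINT \<omega>|M. cis (t * Y \<omega>))) =
        cmod (LINT \<omega>|M. cis (t * X n \<omega>) - cis (t * Y \<omega>))"
      by (simp add: ic)
    also have "\<dots> \<le> (LINT \<omega>|M. cmod (cis (t * X n \<omega>) - cis (t * Y \<omega>)))"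
      by (rule integral_norm_bound)
    also have "\<dots> \<le> (LINT \<omega>|M. d + t\<^sup>2 / d * (X n \<omega> - Y \<omega>)\<^sup>2)"
    proof (rule integral_mono)
      show "integrable M (\<lambda>\<omega>. cmod (cis (t * X n \<omega>) - cis (t * Y \<omega>)))"
        by (intro integrable_norm Bochner_Integration.integrable_diff ic) auto
      show "integrable M (\<lambda>\<omega>. d + t\<^sup>2 / d * (X n \<omega> - Y \<omega>)\<^sup>2)" using iq by simp
      fix \<omega>
      let ?x = "t * (X n \<omega> - Y \<omega>)"
      have "cmod (cis (t * X n \<omega>) - cis (t * Y \<omega>)) \<le> \<bar>?x\<bar>"
        using norm_cis_diff_le[of "t * X n \<omega>" "t * Y \<omega>"] by (simp add: right_diff_distrib)
      \<comment> \<open>The first power is traded for the square plus a small constant, so that only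
        the second moment \<open>E n\<close> enters.\<close>
      also have "\<bar>?x\<bar> \<le> d + ?x\<^sup>2 / d"
      proof -
        have "0 \<le> (d - \<bar>?x\<bar> / 2)\<^sup>2" by simp
        then have "\<bar>?x\<bar> * d \<le> d\<^sup>2 + \<bar>?x\<bar>\<^sup>2 / 4" by (simp add: power2_eq_square field_simps)
        also have "\<dots> \<le> d\<^sup>2 + ?x\<^sup>2" by simp
        finally show ?thesis using d by (simp add: divide_simps power2_eq_square)
      qed
      finally show "cmod (cis (t * X n \<omega>) - cis (t * Y \<omega>)) \<le> d + t\<^sup>2 / d * (X n \<omega> - Y \<omega>)\<^sup>2"
        by (simp add: power_mult_distrib)
    qed
    also have "\<dots> = d + t\<^sup>2 / d * (LINT \<omega>|M. (X n \<omega> - Y \<omega>)\<^sup>2)"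
      using iq by (simp add: prob_space)
    also have "(LINT \<omega>|M. (X n \<omega> - Y \<omega>)\<^sup>2) = enn2real (E n)"
      by (simp add: E_def integral_eq_nn_integral)
    finally show ?thesis .
  qed
  have E0: "E \<longlonglongrightarrow> 0" using lim by (simp add: E_def[abs_def])
  have e0: "(\<lambda>n. enn2real (E n)) \<longlonglongrightarrow> 0" using tendsto_enn2real[where u=E and l=0] E0 by simp
  have "(\<lambda>n. LINT \<omega>|M. cis (t * X n \<omega>)) \<longlonglongrightarrow> (LINT \<omega>|M. cis (t * Y \<omega>))"
  proof (rule metric_LIMSEQ_I, goal_cases)
    case (1 r)
    define d where "d = r / 2"
    have d: "d > 0" using 1 by (simp add: d_def)
    have "(\<lambda>n. t\<^sup>2 / d * enn2real (E n)) \<longlonglongrightarrow> t\<^sup>2 / d * 0" by (intro tendsto_intros e0)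
    then have "eventually (\<lambda>n. t\<^sup>2 / d * enn2real (E n) < d) sequentially"
      using d by (intro order_tendstoD(2)) auto
    moreover have "eventually (\<lambda>n. E n < 1) sequentially"
      using order_tendstoD(2)[OF E0, of 1] by simp
    ultimately have "eventually (\<lambda>n. dist (LINT \<omega>|M. cis (t * X n \<omega>)) (LINT \<omega>|M. cis (t * Y \<omega>)) < r) sequentially"
    proof eventually_elim
      case (elim n)
      have "E n < \<infinity>" using elim(2) by (simp add: order_less_trans)
      from bound[OF d this] elim(1) show ?case by (simp add: dist_norm d_def)
    qed
    then show ?case by (simp add: eventually_sequentially)
  qed
  moreover have "(\<lambda>n. LINT \<omega>|M. cis (t * X n \<omega>)) \<longlonglongrightarrow> complex_of_real (exp (- (t\<^sup>2 * w) / 2))"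
    unfolding centered_normal_char[OF M X] by (intro tendsto_intros v) simp_all
  ultimately show "(LINT \<omega>|M. cis (t * Y \<omega>)) = complex_of_real (exp (- (t\<^sup>2 * w) / 2))"
    by (rule LIMSEQ_unique)
qed fact

text \<open>The definition of a Gaussian family sums over sets of members, whereas here one member
  may belong to several indices. Coefficients are therefore collected over the fibres of
  \<open>u\<close>. Such repetitions do occur: all pairs \<open>(x, x)\<close> give the zero
  increment.\<close>

lemma centered_gaussian_family_combination:
  assumes G: "centered_gaussian_family M I X C" and J: "finite J" "u ` J \<subseteq> I"
  shows "centered_normal M (\<lambda>\<omega>. \<Sum>j\<in>J. c j * X (u j) \<omega>)
    (\<Sum>j\<in>J. \<Sum>k\<in>J. c j * c k * C (u j) (u k))"
proof -
  define c' where "c' i = (\<Sum>j\<in>{j\<in>J. u j = i}. c j)" for i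
  have collect: "(\<Sum>j\<in>J. c j * f (u j)) = (\<Sum>i\<in>u ` J. c' i * f i)" for f :: "_ \<Rightarrow> real"
  proof -
    have "(\<Sum>j\<in>J. c j * f (u j)) = (\<Sum>i\<in>u ` J. \<Sum>j\<in>{j\<in>J. u j = i}. c j * f (u j))"
      by (rule sum.image_gen[OF J(1)])
    also have "\<dots> = (\<Sum>i\<in>u ` J. c' i * f i)"
      by (intro sum.cong refl) (simp add: c'_def sum_distrib_right)
    finally show ?thesis .
  qed
  have 1: "(\<Sum>j\<in>J. \<Sum>k\<in>J. c j * c k * C (u j) (u k)) = (\<Sum>i\<in>u`J. \<Sum>l\<in>u`J. c' i * c' l * C i l)"
  proof -
    have "(\<Sum>j\<in>J. \<Sum>k\<in>J. c j * c k * C (u j) (u k)) = (\<Sum>j\<in>J. c j * (\<Sum>k\<in>J. c k * C (u j) (u k)))"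
      by (simp add: sum_distrib_left mult.assoc)
    also have "\<dots> = (\<Sum>i\<in>u`J. c' i * (\<Sum>l\<in>u`J. c' l * C i l))"
      by (simp only: collect[of "\<lambda>l. C i l" for i] collect[of "\<lambda>i. \<Sum>l\<in>u`J. c' l * C i l"])
    finally show ?thesis by (simp add: sum_distrib_left mult.assoc)
  qed
  show ?thesis
    unfolding collect[of "\<lambda>i. X i \<omega>" for \<omega>] 1 using G J
    by (auto simp: centered_gaussian_family_def)
qed

lemma cnj_measurable [measurable]: "cnj \<in> borel_measurable borel"
  by (intro borel_measurable_continuous_onI continuous_intros)

lemma uminus_euclidean_measurable [measurable]: "uminus \<in> borel_measurable (borel :: 'a::euclidean_space measure)"
  by (intro borel_measurable_continuous_onI continuous_intros)

subsection \<open>Changes of variables\<close>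

lemma nn_integral_affine:
  fixes f :: "'a::euclidean_space \<Rightarrow> ennreal"
  assumes [measurable]: "f \<in> borel_measurable borel" and c: "c \<noteq> 0"
  shows "(\<integral>\<^sup>+x. f x \<partial>lborel) = ennreal (\<bar>c\<bar> ^ DIM('a)) * (\<integral>\<^sup>+x. f (t + c *\<^sub>R x) \<partial>lborel)"
  by (subst lborel_affine[OF c, of t])
    (simp add: nn_integral_density nn_integral_distr nn_integral_cmult)

lemma integral_affine:
  fixes f :: "'a::euclidean_space \<Rightarrow> 'b::{banach, second_countable_topology}"
  assumes [measurable]: "f \<in> borel_measurable borel" and c: "c \<noteq> 0"
  shows "(LINT x|lborel. f x) = (\<bar>c\<bar> ^ DIM('a)) *\<^sub>R (LINT x|lborel. f (t + c *\<^sub>R x))"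
  by (subst lborel_affine[OF c, of t]) (simp add: integral_density integral_distr)

lemma integrable_affine:
  fixes f :: "'a::euclidean_space \<Rightarrow> 'b::{banach, second_countable_topology}"
  assumes int: "integrable lborel f" and c: "c \<noteq> 0"
  shows "integrable lborel (\<lambda>x. f (t + c *\<^sub>R x))"
proof -
  have [measurable]: "f \<in> borel_measurable borel" using borel_measurable_integrable[OF int] by simp
  have "(\<integral>\<^sup>+x. ennreal (norm (f x)) \<partial>lborel) < \<infinity>"
    using int by (simp add: integrable_iff_bounded)
  then have "(\<integral>\<^sup>+x. ennreal (norm (f (t + c *\<^sub>R x))) \<partial>lborel) < \<infinity>"
    using c by (subst (asm) nn_integral_affine[OF _ c, of _ t])
      (auto simp: ennreal_mult_less_top ennreal_zero_less_top)
  then show ?thesis by (simp add: integrable_iff_bounded)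
qed

section \<open>Integration in polar coordinates\<close>

text \<open>The half-lines \<open>{..a}\<close> reduce the claim to volumes of balls; the density is
  the derivative of \<open>unit_ball_vol d * r ^ d\<close>, with \<open>d\<close> the
  dimension.\<close>

lemma distr_lborel_norm:
  defines "\<sigma> \<equiv> real DIM('a::euclidean_space) * unit_ball_vol (real DIM('a))"
  shows "distr (lborel :: 'a measure) borel norm =
    density lborel (\<lambda>r. ennreal (\<sigma> * r ^ (DIM('a) - 1)) * indicator {0..} r)"
proof (rule measure_eqI_generator_eq)
  let ?E = "range (\<lambda>a::real. {..a})"
  show "Int_stable ?E" by (auto simp: Int_stable_def)
  show "?E \<subseteq> Pow UNIV" by simp
  show "range (\<lambda>n::nat. {..real n}) \<subseteq> ?E" by auto
  show "(\<Union>n::nat. {..real n}) = UNIV" using real_arch_simple by auto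
  have 1: "emeasure (distr (lborel :: 'a measure) borel norm) {..a} =
      (if a < 0 then 0 else ennreal (unit_ball_vol DIM('a) * a ^ DIM('a)))" for a
  proof -
    have "norm -` {..a} = (if a < 0 then {} else cball (0::'a) a)"
      by (auto simp: dist_norm) (smt (verit) norm_ge_zero)
    then show ?thesis by (auto simp: emeasure_distr emeasure_cball)
  qed
  then show "emeasure (distr (lborel :: 'a measure) borel norm) {..real n} \<noteq> \<infinity>" for n by simp
  fix X assume "X \<in> ?E"
  then obtain a where X: "X = {..a}" by auto
  have "emeasure (density lborel (\<lambda>r. ennreal (\<sigma> * r ^ (DIM('a) - 1)) * indicator {0..} r)) {..a} =
      (\<integral>\<^sup>+r. ennreal (\<sigma> * r ^ (DIM('a) - 1)) * indicator {0..a} r \<partial>lborel)"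
    by (subst emeasure_density) (auto intro!: nn_integral_cong split: split_indicator)
  also have "\<dots> = (if a < 0 then 0 else ennreal (unit_ball_vol DIM('a) * a ^ DIM('a)))"
  proof (cases "a < 0")
    case False
    have "(\<integral>\<^sup>+r. ennreal (\<sigma> * r ^ (DIM('a) - 1)) * indicator {0..a} r \<partial>lborel) =
        unit_ball_vol DIM('a) * a ^ DIM('a) - unit_ball_vol DIM('a) * 0 ^ DIM('a)"
      by (rule nn_integral_FTC_Icc)
        (use False in \<open>auto simp: \<sigma>_def intro!: derivative_eq_intros\<close>)
    then show ?thesis using False by simp
  qed simp
  finally show "emeasure (distr (lborel :: 'a measure) borel norm) X =
      emeasure (density lborel (\<lambda>r. ennreal (\<sigma> * r ^ (DIM('a) - 1)) * indicator {0..} r)) X"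
    by (simp add: X 1)
qed (simp_all add: borel_eq_atMost)

text \<open>Written in the form in which the constant occurs under the root in
  \<open>mollifier\<close>; \<open>sphere_area_eq\<close> relates it to the volume of the unit
  ball.\<close>

definition sphere_area :: "nat \<Rightarrow> real" where
  "sphere_area d = 2 * pi powr (real d / 2) / Gamma (real d / 2)"

lemma sphere_area_eq: "d > 0 \<Longrightarrow> real d * unit_ball_vol (real d) = sphere_area d"
  using Gamma_plus1[of "real d / 2"]
  by (simp add: unit_ball_vol_def sphere_area_def nonpos_Ints_def field_simps Gamma_eq_zero_iff)

lemma sphere_area_pos: "d > 0 \<Longrightarrow> sphere_area d > 0"
  by (simp add: sphere_area_def)

lemma nn_integral_radial:
  assumes [measurable]: "f \<in> borel_measurable borel"
  shows "(\<integral>\<^sup>+(x::'a::euclidean_space). f (norm x) \<partial>lborel) =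
    ennreal (sphere_area DIM('a)) * (\<integral>\<^sup>+r. ennreal (r ^ (DIM('a) - 1)) * f r * indicator {0..} r \<partial>lborel)"
proof -
  have pos: "sphere_area DIM('a) > 0" by (simp add: sphere_area_pos)
  have "(\<integral>\<^sup>+(x::'a). f (norm x) \<partial>lborel) = (\<integral>\<^sup>+r. f r \<partial>distr (lborel :: 'a measure) borel norm)"
    by (simp add: nn_integral_distr)
  also have "\<dots> = (\<integral>\<^sup>+r. ennreal (sphere_area DIM('a) * r ^ (DIM('a) - 1)) * indicator {0..} r * f r \<partial>lborel)"
    unfolding distr_lborel_norm by (simp add: nn_integral_density sphere_area_eq)
  also have "\<dots> = (\<integral>\<^sup>+r. ennreal (sphere_area DIM('a)) * (ennreal (r ^ (DIM('a) - 1)) * f r * indicator {0..} r) \<partial>lborel)"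
    using pos by (intro nn_integral_cong) (auto simp: ennreal_mult mult_ac split: split_indicator)
  also have "\<dots> = ennreal (sphere_area DIM('a)) * (\<integral>\<^sup>+r. ennreal (r ^ (DIM('a) - 1)) * f r * indicator {0..} r \<partial>lborel)"
    by (rule nn_integral_cmult) measurable
  finally show ?thesis .
qed

lemma nn_integral_inverse_square: "(\<integral>\<^sup>+r. ennreal (1 / (1 + r)\<^sup>2) * indicator {0..} r \<partial>lborel) = 1"
proof -
  have "(\<integral>\<^sup>+r. ennreal (1 / (1 + r)\<^sup>2) * indicator {0..} r \<partial>lborel) = ennreal (0 - (- 1 / (1 + 0)))"
  proof (rule nn_integral_FTC_atLeast)
    show "((\<lambda>r::real. - 1 / (1 + r)) \<longlongrightarrow> 0) at_top" by real_asymp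
  qed (auto intro!: derivative_eq_intros simp: power2_eq_square)
  then show ?thesis by simp
qed

lemma integrable_inverse_power_norm:
  assumes "m > DIM('a)"
  shows "integrable lborel (\<lambda>x::'a::euclidean_space. 1 / (1 + norm x) ^ m)"
proof -
  have eq: "(\<integral>\<^sup>+(x::'a). ennreal (1 / (1 + norm x) ^ m) \<partial>lborel) =
      ennreal (sphere_area DIM('a)) * (\<integral>\<^sup>+r. ennreal (r ^ (DIM('a) - 1)) * ennreal (1 / (1 + r) ^ m) * indicator {0..} r \<partial>lborel)"
    by (rule nn_integral_radial[where f="\<lambda>r. ennreal (1 / (1 + r) ^ m)"]) simp
  have "(\<integral>\<^sup>+r. ennreal (r ^ (DIM('a) - 1)) * ennreal (1 / (1 + r) ^ m) * indicator {0..} r \<partial>lborel) \<le>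
      (\<integral>\<^sup>+r. ennreal (1 / (1 + r)\<^sup>2) * indicator {0..} r \<partial>lborel)"
  proof (rule nn_integral_mono)
    fix r :: real
    have "r ^ (DIM('a) - 1) * (1 / (1 + r) ^ m) \<le> 1 / (1 + r)\<^sup>2" if "r \<ge> 0"
    proof -
      have "r ^ (DIM('a) - 1) * (1 + r)\<^sup>2 \<le> (1 + r) ^ (DIM('a) - 1) * (1 + r)\<^sup>2"
        using that by (intro mult_right_mono power_mono) auto
      also have "\<dots> = (1 + r) ^ (DIM('a) + 1)"
        by (simp flip: power_add)
      also have "\<dots> \<le> (1 + r) ^ m"
        using assms that by (intro power_increasing) auto
      finally show ?thesis using that by (simp add: divide_simps)
    qed
    then show "ennreal (r ^ (DIM('a) - 1)) * ennreal (1 / (1 + r) ^ m) * indicator {0..} r \<le>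
        ennreal (1 / (1 + r)\<^sup>2) * indicator {0..} r"
      by (auto split: split_indicator simp: ennreal_leI simp flip: ennreal_mult)
  qed
  also have "\<dots> = 1" by (rule nn_integral_inverse_square)
  finally have "(\<integral>\<^sup>+r. ennreal (r ^ (DIM('a) - 1)) * ennreal (1 / (1 + r) ^ m) * indicator {0..} r \<partial>lborel) < \<infinity>"
    by (rule order_le_less_trans) simp
  then have "(\<integral>\<^sup>+(x::'a). ennreal (1 / (1 + norm x) ^ m) \<partial>lborel) < \<infinity>"
    unfolding eq by (simp add: ennreal_mult_less_top)
  then show ?thesis by (simp add: integrable_iff_bounded)
qed

subsection \<open>The Gaussian\<close>

text \<open>The normalisation with \<open>pi\<close> goes with the factor \<open>2 * pi\<close> in
  \<open>fourier\<close>: this function has integral 1 and is its own Fourier transform.\<close>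

definition gauss :: "'a::euclidean_space \<Rightarrow> real" where
  "gauss x = exp (- pi * (norm x)\<^sup>2)"

lemma gauss_nonneg [simp]: "0 \<le> gauss x" and gauss_pos: "0 < gauss x" and gauss_le_1: "gauss x \<le> 1"
  and gauss_minus [simp]: "gauss (- x) = gauss x" and gauss_0 [simp]: "gauss 0 = 1"
  by (simp_all add: gauss_def)

lemma continuous_on_gauss [continuous_intros]:
  "continuous_on A f \<Longrightarrow> continuous_on A (\<lambda>x. gauss (f x))"
  unfolding gauss_def by (intro continuous_intros)

lemma gauss_measurable [measurable]: "gauss \<in> borel_measurable borel"
  by (intro borel_measurable_continuous_onI continuous_intros)

text \<open>The characteristic function of the standard normal law after a dilation by the factor
  \<open>sqrt (2 * pi)\<close>.\<close>

lemma integral_cis_gauss_real: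
  "integrable lborel (\<lambda>x::real. cis (b * x) * complex_of_real (exp (- pi * x\<^sup>2)))" (is ?I)
  "(LINT (x::real)|lborel. cis (b * x) * complex_of_real (exp (- pi * x\<^sup>2))) =
    complex_of_real (exp (- b\<^sup>2 / (4 * pi)))" (is ?V)
proof -
  define c where "c = b / sqrt (2 * pi)"
  have s: "sqrt (2 * pi) > 0" by simp
  have "integrable lborel std_normal_density" by (rule integrable_normal_density) simp
  then have "integrable lborel (\<lambda>x. std_normal_density (0 + sqrt (2 * pi) * x))"
    by (rule lborel_integrable_real_affine) simp
  then have "integrable lborel (\<lambda>x. sqrt (2 * pi) * std_normal_density (0 + sqrt (2 * pi) * x))"
    by (rule integrable_mult_right)
  then have "integrable lborel (\<lambda>x::real. exp (- pi * x\<^sup>2))"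
    by (simp add: std_normal_density_def power_mult_distrib)
  then show ?I
    by (rule Bochner_Integration.integrable_bound) (auto simp: norm_mult)
  have "complex_of_real (exp (- (b / sqrt (2 * pi))\<^sup>2 / 2)) = char std_normal_distribution c"
    by (simp add: char_std_normal_distribution c_def)
  also have "\<dots> = (LINT x|lborel. std_normal_density x *\<^sub>R cis (c * x))"
    by (simp add: char_def integral_density cis_conv_exp)
  also have "\<dots> = sqrt (2 * pi) *\<^sub>R (LINT x|lborel. std_normal_density (0 + sqrt (2 * pi) * x) *\<^sub>R cis (c * (0 + sqrt (2 * pi) * x)))"
    using s by (subst lborel_integral_real_affine[of "sqrt (2 * pi)" _ 0]) auto
  also have "\<dots> = (LINT x|lborel. sqrt (2 * pi) *\<^sub>R (std_normal_density (0 + sqrt (2 * pi) * x) *\<^sub>R cis (c * (0 + sqrt (2 * pi) * x))))"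
    by (rule integral_scaleR_right[symmetric])
  also have "\<dots> = (LINT x|lborel. cis (b * x) * complex_of_real (exp (- pi * x\<^sup>2)))"
    by (intro Bochner_Integration.integral_cong refl)
      (simp add: std_normal_density_def power_mult_distrib c_def scaleR_conv_of_real real_sqrt_mult)
  finally show ?V by (simp add: power_divide)
qed

lemma gauss_times_cis_eq_prod:
  fixes b x :: "'a::euclidean_space"
  shows "cis (b \<bullet> x) * complex_of_real (gauss x) =
    (\<Prod>i\<in>Basis. cis ((b \<bullet> i) * (x \<bullet> i)) * complex_of_real (exp (- pi * (x \<bullet> i)\<^sup>2)))"
proof -
  have "cis (b \<bullet> x) = (\<Prod>i\<in>Basis. cis ((b \<bullet> i) * (x \<bullet> i)))"
    unfolding euclidean_inner[of b x] cis_conv_exp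
    by (simp add: sum_distrib_left exp_sum)
  moreover have "gauss x = (\<Prod>i\<in>Basis. exp (- pi * (x \<bullet> i)\<^sup>2))"
    unfolding gauss_def power2_norm_eq_inner euclidean_inner[of x x]
    by (simp add: sum_distrib_left exp_sum flip: sum_negf power2_eq_square)
  ultimately show ?thesis by (simp add: prod.distrib)
qed

lemma integral_cis_gauss:
  fixes b :: "'a::euclidean_space"
  shows "(LINT x|lborel. cis (b \<bullet> x) * complex_of_real (gauss x)) =
    complex_of_real (exp (- (norm b)\<^sup>2 / (4 * pi)))"
proof -
  let ?f = "\<lambda>i x::real. cis ((b \<bullet> i) * x) * complex_of_real (exp (- pi * x\<^sup>2))"
  interpret product_sigma_finite "\<lambda>_::'a. lborel :: real measure" by standard
  have "(LINT x|lborel. cis (b \<bullet> x) * complex_of_real (gauss x)) = (LINT (x::'a)|lborel. (\<Prod>i\<in>Basis. ?f i (x \<bullet> i)))"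
    by (simp add: gauss_times_cis_eq_prod)
  also have "\<dots> = (LINT x|(Pi\<^sub>M (Basis :: 'a set) (\<lambda>_. lborel)). (\<Prod>i\<in>Basis. ?f i (x i)))"
    by (subst lborel_eq, subst integral_distr) (auto simp: intro!: Bochner_Integration.integral_cong)
  also have "\<dots> = (\<Prod>i\<in>Basis. LINT x|lborel. ?f i x)"
    by (rule product_integral_prod) (rule finite_Basis integral_cis_gauss_real(1))+
  also have "\<dots> = complex_of_real (\<Prod>i\<in>Basis. exp (- (b \<bullet> i)\<^sup>2 / (4 * pi)))"
    unfolding integral_cis_gauss_real by simp
  also have "(\<Prod>i\<in>Basis. exp (- (b \<bullet> i)\<^sup>2 / (4 * pi))) = exp (- (norm b)\<^sup>2 / (4 * pi))"
    unfolding power2_norm_eq_inner euclidean_inner[of b b]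
    by (simp add: sum_divide_distrib exp_sum flip: sum_negf power2_eq_square)
  finally show ?thesis .
qed

text \<open>A non-integrable function has Bochner integral 0 by convention, while
  \<open>integral_cis_gauss\<close> at \<open>b = 0\<close> gives the value 1.\<close>

lemma integrable_gauss: "integrable lborel (gauss :: 'a::euclidean_space \<Rightarrow> real)"
proof (rule ccontr)
  assume "\<not> integrable lborel (gauss :: 'a \<Rightarrow> real)"
  then have "\<not> integrable lborel (\<lambda>x::'a. complex_of_real (gauss x))"
    by (metis complex_of_real_integrable_eq)
  then have "(LINT (x::'a)|lborel. complex_of_real (gauss x)) = 0"
    by (rule not_integrable_integral_eq)
  then show False using integral_cis_gauss[of "0::'a"] by simp
qed

lemma integral_gauss: "(LINT (x::'a::euclidean_space)|lborel. gauss x) = 1"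
  using integral_cis_gauss[of "0::'a"] by simp

text \<open>Polar coordinates applied to the total mass 1 of \<open>gauss\<close>. This is the
  origin of the factor \<open>1 / sphere_area\<close> in \<open>log_energy\<close>.\<close>

lemma nn_integral_radial_gauss:
  shows "(\<integral>\<^sup>+r. ennreal (r ^ (DIM('a::euclidean_space) - 1)) * ennreal (exp (- pi * r\<^sup>2)) * indicator {0..} r \<partial>lborel) =
    ennreal (1 / sphere_area DIM('a))"
proof -
  let ?I = "\<integral>\<^sup>+r. ennreal (r ^ (DIM('a::euclidean_space) - 1)) * ennreal (exp (- pi * r\<^sup>2)) * indicator {0..} r \<partial>lborel"
  have "1 = (\<integral>\<^sup>+(x::'a). ennreal (gauss x) \<partial>lborel)"
    by (subst nn_integral_eq_integral) (auto simp: integrable_gauss integral_gauss)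
  also have "\<dots> = ennreal (sphere_area DIM('a)) * ?I"
    unfolding gauss_def by (rule nn_integral_radial[where f="\<lambda>r. ennreal (exp (- pi * r\<^sup>2))"]) simp
  finally have *: "ennreal (sphere_area DIM('a)) * ?I = 1" by simp
  have pos: "sphere_area DIM('a) > 0" by (simp add: sphere_area_pos)
  have "?I = ennreal (1 / sphere_area DIM('a)) * (ennreal (sphere_area DIM('a)) * ?I)"
    using pos by (simp add: mult.assoc[symmetric] flip: ennreal_mult)
  also have "\<dots> = ennreal (1 / sphere_area DIM('a))" unfolding * by simp
  finally show ?thesis .
qed

lemma integral_cis_gauss_scaled:
  fixes z :: "'a::euclidean_space"
  assumes t: "t > 0"
  shows "(LINT \<zeta>|lborel. cis (2 * pi * (z \<bullet> \<zeta>)) * complex_of_real (gauss (t *\<^sub>R \<zeta>))) =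
    complex_of_real (gauss (z /\<^sub>R t) / t ^ DIM('a))"
proof -
  have "(LINT x|lborel. cis ((2 * pi / t) *\<^sub>R z \<bullet> x) * complex_of_real (gauss x)) =
      (\<bar>t\<bar> ^ DIM('a)) *\<^sub>R (LINT x|lborel. cis ((2 * pi / t) *\<^sub>R z \<bullet> (0 + t *\<^sub>R x)) * complex_of_real (gauss (0 + t *\<^sub>R x)))"
    using t by (intro integral_affine) auto
  also have "\<dots> = (t ^ DIM('a)) *\<^sub>R (LINT \<zeta>|lborel. cis (2 * pi * (z \<bullet> \<zeta>)) * complex_of_real (gauss (t *\<^sub>R \<zeta>)))"
    using t by simp
  finally have "complex_of_real (exp (- (norm ((2 * pi / t) *\<^sub>R z))\<^sup>2 / (4 * pi))) =
      (t ^ DIM('a)) *\<^sub>R (LINT \<zeta>|lborel. cis (2 * pi * (z \<bullet> \<zeta>)) * complex_of_real (gauss (t *\<^sub>R \<zeta>)))"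
    by (simp only: integral_cis_gauss)
  moreover have "exp (- (norm ((2 * pi / t) *\<^sub>R z))\<^sup>2 / (4 * pi)) = gauss (z /\<^sub>R t)"
    using t by (simp add: gauss_def power_mult_distrib power2_eq_square field_simps)
  ultimately show ?thesis using t by (simp add: scaleR_conv_of_real field_simps)
qed

lemma integrable_gauss_scaled:
  assumes "t \<noteq> 0"
  shows "integrable lborel (\<lambda>x::'a::euclidean_space. gauss (t *\<^sub>R x))"
  using integrable_affine[OF integrable_gauss assms, of 0] by simp


subsection \<open>The Fourier transform of integrable functions\<close>

lemma fourier_measurable [measurable]:
  assumes [measurable]: "f \<in> borel_measurable borel"
  shows "fourier f \<in> borel_measurable borel"
  unfolding fourier_def[abs_def] by measurable

lemma inv_fourier_eq: "inv_fourier f \<zeta> = fourier f (- \<zeta>)"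
  by (simp add: inv_fourier_def fourier_def inner_commute)

lemma inv_fourier_measurable [measurable]:
  assumes [measurable]: "f \<in> borel_measurable borel"
  shows "inv_fourier f \<in> borel_measurable borel"
  unfolding inv_fourier_eq[abs_def] by measurable

lemma integrable_cis_mult:
  assumes "integrable M f" "g \<in> borel_measurable M"
  shows "integrable M (\<lambda>x. cis (g x) * f x)"
proof -
  have [measurable]: "g \<in> borel_measurable M" "f \<in> borel_measurable M" using assms by auto
  show ?thesis
    by (rule Bochner_Integration.integrable_bound[OF assms(1)]) (auto simp: norm_mult)
qed

lemma norm_fourier_le:
  assumes "integrable lborel f"
  shows "cmod (fourier f \<zeta>) \<le> (LINT x|lborel. cmod (f x))"
proof -
  have "cmod (fourier f \<zeta>) \<le> (LINT x|lborel. cmod (cis (- 2 * pi * (x \<bullet> \<zeta>)) * f x))"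
    unfolding fourier_def by (rule integral_norm_bound)
  then show ?thesis by (simp add: norm_mult)
qed

lemma integrable_prod_mult:
  fixes f :: "'a::euclidean_space \<Rightarrow> complex" and g :: "'b::euclidean_space \<Rightarrow> complex"
  assumes "integrable lborel f" "integrable lborel g"
  shows "integrable (lborel \<Otimes>\<^sub>M lborel) (\<lambda>(x, y). f x * g y)"
proof (rule lborel_pair.Fubini_integrable)
  have [measurable]: "f \<in> borel_measurable borel" "g \<in> borel_measurable borel"
    using assms borel_measurable_integrable by fastforce+
  show "(\<lambda>(x, y). f x * g y) \<in> borel_measurable (lborel \<Otimes>\<^sub>M lborel)" by measurable
  have "(\<lambda>x. LINT y|lborel. cmod (case (x, y) of (x, y) \<Rightarrow> f x * g y)) = (\<lambda>x. cmod (f x) * (LINT y|lborel. cmod (g y)))"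
    by (simp add: norm_mult)
  then show "integrable lborel (\<lambda>x. LINT y|lborel. cmod (case (x, y) of (x, y) \<Rightarrow> f x * g y))"
    using assms by simp
qed (use assms in auto)

text \<open>Fubini's theorem. Moving the transform from one factor to the other takes the place of
  an inversion theorem in what follows.\<close>

lemma fourier_multiplication:
  assumes u: "integrable lborel u" and v: "integrable lborel v"
  shows "(LINT x|lborel. u x * fourier v x) = (LINT \<zeta>|lborel. fourier u \<zeta> * v \<zeta>)"
proof -
  have [measurable]: "u \<in> borel_measurable borel" "v \<in> borel_measurable borel"
    using assms borel_measurable_integrable by fastforce+
  have int: "integrable (lborel \<Otimes>\<^sub>M lborel) (\<lambda>(x, \<zeta>). cis (- 2 * pi * (\<zeta> \<bullet> x)) * (u x * v \<zeta>))"
    using integrable_cis_mult[OF integrable_prod_mult[OF u v], of "\<lambda>(x, \<zeta>). - 2 * pi * (\<zeta> \<bullet> x)"]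
    by (simp add: split_beta')
  have "(LINT x|lborel. u x * fourier v x) = (LINT x|lborel. LINT \<zeta>|lborel. cis (- 2 * pi * (\<zeta> \<bullet> x)) * (u x * v \<zeta>))"
    unfolding fourier_def by (simp flip: integral_mult_right_zero add: mult_ac)
  also have "\<dots> = (LINT \<zeta>|lborel. LINT x|lborel. cis (- 2 * pi * (\<zeta> \<bullet> x)) * (u x * v \<zeta>))"
    by (rule lborel_pair.Fubini_integral[symmetric]) (use int in simp)
  also have "\<dots> = (LINT \<zeta>|lborel. fourier u \<zeta> * v \<zeta>)"
    unfolding fourier_def by (simp flip: integral_mult_left_zero add: mult.assoc inner_commute)
  finally show ?thesis .
qed

lemma integral_reflect:
  fixes f :: "'a::euclidean_space \<Rightarrow> 'b::{banach, second_countable_topology}"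
  assumes "f \<in> borel_measurable borel"
  shows "(LINT x|lborel. f (- x)) = (LINT x|lborel. f x)"
  using integral_affine[OF assms, of "- 1" 0] by simp

lemma nn_integral_reflect:
  fixes f :: "'a::euclidean_space \<Rightarrow> ennreal"
  assumes "f \<in> borel_measurable borel"
  shows "(\<integral>\<^sup>+x. f (- x) \<partial>lborel) = (\<integral>\<^sup>+x. f x \<partial>lborel)"
  using nn_integral_affine[OF assms, of "- 1" 0] by simp

lemma integrable_reflect:
  fixes f :: "'a::euclidean_space \<Rightarrow> 'b::{banach, second_countable_topology}"
  assumes "integrable lborel f"
  shows "integrable lborel (\<lambda>x. f (- x))"
  using integrable_affine[OF assms, of "- 1" 0] by simp

lemma cnj_fourier: "cnj (fourier f \<zeta>) = fourier (\<lambda>x. cnj (f x)) (- \<zeta>)"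
  unfolding fourier_def by (simp add: cis_cnj flip: Bochner_Integration.integral_cnj)

section \<open>Plancherel's theorem by Gaussian regularisation\<close>

text \<open>The multiplication formula for \<open>f\<close> and the damped conjugate
  \<open>v\<close> of its transform. The Gaussian makes \<open>v\<close> integrable, and the
  transform of \<open>v\<close> is the average of \<open>cnj (f y)\<close> over a Gaussian of width
  \<open>t\<close>. Small \<open>t\<close> yields Plancherel's theorem; integration over all
  \<open>t\<close> yields the logarithmic covariance.\<close>

lemma gauss_plancherel:
  fixes f :: "'a::euclidean_space \<Rightarrow> complex"
  assumes f: "integrable lborel f" and t: "t > 0"
  shows "complex_of_real (LINT \<zeta>|lborel. gauss (t *\<^sub>R \<zeta>) * (cmod (fourier f \<zeta>))\<^sup>2) =
    (LINT x|lborel. f x * (LINT y|lborel. cnj (f y) * complex_of_real (gauss ((x - y) /\<^sub>R t) / t ^ DIM('a))))"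
proof -
  have [measurable]: "f \<in> borel_measurable borel"
    using f borel_measurable_integrable by fastforce
  have cf: "integrable lborel (\<lambda>x. cnj (f x))" using f by simp
  define \<gamma> where "\<gamma> \<zeta> = complex_of_real (gauss (t *\<^sub>R \<zeta>))" for \<zeta> :: 'a
  have \<gamma>: "integrable lborel \<gamma>"
    unfolding \<gamma>_def using integrable_gauss_scaled[of t, where ?'a='a] t by simp
  have [measurable]: "\<gamma> \<in> borel_measurable borel" unfolding \<gamma>_def by measurable
  define v where "v \<zeta> = \<gamma> \<zeta> * cnj (fourier f \<zeta>)" for \<zeta>
  have v: "integrable lborel v"
  proof (rule Bochner_Integration.integrable_bound)
    show "integrable lborel (\<lambda>\<zeta>. \<gamma> \<zeta> * complex_of_real (LINT x|lborel. cmod (f x)))"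
      using \<gamma> by simp
    show "AE \<zeta> in lborel. norm (v \<zeta>) \<le> norm (\<gamma> \<zeta> * complex_of_real (LINT x|lborel. cmod (f x)))"
      unfolding v_def norm_mult complex_mod_cnj using norm_fourier_le[OF f]
      by (intro AE_I2 mult_left_mono order_trans[OF norm_fourier_le[OF f]]) auto
    show "v \<in> borel_measurable lborel" unfolding v_def by measurable
  qed
  have kernel: "fourier v x = (LINT y|lborel. cnj (f y) * complex_of_real (gauss ((x - y) /\<^sub>R t) / t ^ DIM('a)))" for x
  proof -
    have i: "integrable lborel (\<lambda>\<zeta>. cis (2 * pi * (x \<bullet> \<zeta>)) * \<gamma> \<zeta>)"
      by (intro integrable_cis_mult \<gamma>) auto
    have "fourier v x = (LINT \<zeta>|lborel. cis (- 2 * pi * (\<zeta> \<bullet> x)) * (\<gamma> \<zeta> * fourier (\<lambda>y. cnj (f y)) (- \<zeta>)))"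
      unfolding fourier_def[of v] v_def cnj_fourier ..
    also have "\<dots> = (LINT \<zeta>|lborel. cis (- 2 * pi * (- \<zeta> \<bullet> x)) * (\<gamma> (- \<zeta>) * fourier (\<lambda>y. cnj (f y)) (- (- \<zeta>))))"
      by (rule integral_reflect[symmetric]) measurable
    also have "\<dots> = (LINT \<zeta>|lborel. fourier (\<lambda>y. cnj (f y)) \<zeta> * (cis (2 * pi * (x \<bullet> \<zeta>)) * \<gamma> \<zeta>))"
      by (simp add: \<gamma>_def inner_commute mult_ac)
    also have "\<dots> = (LINT y|lborel. cnj (f y) * fourier (\<lambda>\<zeta>. cis (2 * pi * (x \<bullet> \<zeta>)) * \<gamma> \<zeta>) y)"
      by (rule fourier_multiplication[symmetric]) fact+
    also have "\<dots> = (LINT y|lborel. cnj (f y) * complex_of_real (gauss ((x - y) /\<^sub>R t) / t ^ DIM('a)))"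
    proof -
      have "fourier (\<lambda>\<zeta>. cis (2 * pi * (x \<bullet> \<zeta>)) * \<gamma> \<zeta>) y = complex_of_real (gauss ((x - y) /\<^sub>R t) / t ^ DIM('a))" for y
      proof -
        have shift: "cis (- 2 * pi * (\<zeta> \<bullet> y)) * (cis (2 * pi * (x \<bullet> \<zeta>)) * \<gamma> \<zeta>) = cis (2 * pi * ((x - y) \<bullet> \<zeta>)) * \<gamma> \<zeta>" for \<zeta>
          unfolding mult.assoc[symmetric] cis_mult
          by (rule arg_cong[where f="\<lambda>a. cis a * \<gamma> \<zeta>"]) (simp add: inner_diff_left inner_commute[of \<zeta>] right_diff_distrib)
        show ?thesis
          unfolding fourier_def integral_cis_gauss_scaled[OF t, symmetric]
          by (intro Bochner_Integration.integral_cong refl) (simp only: shift, simp only: \<gamma>_def)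
      qed
      then show ?thesis by (simp only:)
    qed
    finally show ?thesis .
  qed
  have "complex_of_real (LINT \<zeta>|lborel. gauss (t *\<^sub>R \<zeta>) * (cmod (fourier f \<zeta>))\<^sup>2) = (LINT \<zeta>|lborel. fourier f \<zeta> * v \<zeta>)"
    unfolding v_def \<gamma>_def
    by (subst integral_complex_of_real[symmetric])
      (auto intro!: Bochner_Integration.integral_cong simp: complex_norm_square simp flip: of_real_power)
  also have "\<dots> = (LINT x|lborel. f x * fourier v x)"
    by (rule fourier_multiplication[symmetric]) fact+
  also have "\<dots> = (LINT x|lborel. f x * (LINT y|lborel. cnj (f y) * complex_of_real (gauss ((x - y) /\<^sub>R t) / t ^ DIM('a))))"
    by (simp only: kernel)
  finally show ?thesis .
qed

lemma integral_gauss_kernel: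
  fixes f :: "'a::euclidean_space \<Rightarrow> complex"
  assumes [measurable]: "f \<in> borel_measurable borel" and t: "t > 0"
  shows "(LINT y|lborel. f y * complex_of_real (gauss ((x - y) /\<^sub>R t) / t ^ DIM('a))) =
    (LINT z|lborel. f (x + t *\<^sub>R z) * complex_of_real (gauss z))"
proof -
  have "(LINT y|lborel. f y * complex_of_real (gauss ((x - y) /\<^sub>R t) / t ^ DIM('a))) =
    (\<bar>t\<bar> ^ DIM('a)) *\<^sub>R (LINT z|lborel. f (x + t *\<^sub>R z) * complex_of_real (gauss ((x - (x + t *\<^sub>R z)) /\<^sub>R t) / t ^ DIM('a)))"
    using t by (intro integral_affine) auto
  also have "\<dots> = (LINT z|lborel. (\<bar>t\<bar> ^ DIM('a)) *\<^sub>R (f (x + t *\<^sub>R z) * complex_of_real (gauss ((x - (x + t *\<^sub>R z)) /\<^sub>R t) / t ^ DIM('a))))"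
    by (rule integral_scaleR_right[symmetric])
  also have "\<dots> = (LINT z|lborel. f (x + t *\<^sub>R z) * complex_of_real (gauss z))"
    using t by (intro Bochner_Integration.integral_cong refl) (simp add: scaleR_conv_of_real)
  finally show ?thesis .
qed

text \<open>Gaussians of vanishing width are an approximate identity. With the width placed in the
  argument of \<open>f\<close>, dominated convergence applies with the fixed majorant
  \<open>B * gauss z\<close>.\<close>

lemma gauss_average_tendsto:
  fixes f :: "'a::euclidean_space \<Rightarrow> complex"
  assumes cont: "continuous_on UNIV f" and bdd: "\<And>x. cmod (f x) \<le> B" and t: "t \<longlonglongrightarrow> 0"
  shows "(\<lambda>n. LINT z|lborel. f (x + t n *\<^sub>R z) * complex_of_real (gauss z)) \<longlonglongrightarrow> f x"
proof -
  have [measurable]: "f \<in> borel_measurable borel" by (rule borel_measurable_continuous_onI[OF cont])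
  have "(\<lambda>n. LINT z|lborel. f (x + t n *\<^sub>R z) * complex_of_real (gauss z)) \<longlonglongrightarrow> (LINT (z::'a)|lborel. f x * complex_of_real (gauss z))"
  proof (rule integral_dominated_convergence)
    show "integrable lborel (\<lambda>z::'a. B * gauss z)" using integrable_gauss[where ?'a='a] by simp
    show "AE z in lborel. (\<lambda>n. f (x + t n *\<^sub>R z) * complex_of_real (gauss z)) \<longlonglongrightarrow> f x * complex_of_real (gauss z)"
    proof (intro AE_I2 tendsto_intros)
      fix z
      have "(\<lambda>n. x + t n *\<^sub>R z) \<longlonglongrightarrow> x + 0 *\<^sub>R z" by (intro tendsto_intros t)
      then show "(\<lambda>n. f (x + t n *\<^sub>R z)) \<longlonglongrightarrow> f x"
        using cont by (intro continuous_on_tendsto_compose[OF cont]) auto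
    qed
    show "AE z in lborel. norm (f (x + t n *\<^sub>R z) * complex_of_real (gauss z)) \<le> B * gauss z" for n
      using bdd by (auto simp: norm_mult mult_right_mono)
  qed auto
  then show ?thesis by (simp add: integral_gauss)
qed

text \<open>The Gaussian identity at widths \<open>1 / real (Suc n)\<close>: in space the averages
  converge to \<open>cnj (f x)\<close> and are dominated through \<open>B\<close>; in frequency the
  damping factors increase to 1.\<close>

theorem plancherel:
  fixes f :: "'a::euclidean_space \<Rightarrow> complex"
  assumes f: "integrable lborel f" and cont: "continuous_on UNIV f" and bdd: "\<And>x. cmod (f x) \<le> B"
  shows "(\<integral>\<^sup>+\<zeta>. ennreal ((cmod (fourier f \<zeta>))\<^sup>2) \<partial>lborel) = (\<integral>\<^sup>+x. ennreal ((cmod (f x))\<^sup>2) \<partial>lborel)"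
    and "(\<integral>\<^sup>+x. ennreal ((cmod (f x))\<^sup>2) \<partial>lborel) < \<infinity>"
proof -
  have [measurable]: "f \<in> borel_measurable borel" by (rule borel_measurable_continuous_onI[OF cont])
  have B: "0 \<le> B" using bdd[of 0] norm_ge_zero order_trans by blast
  have f2: "integrable lborel (\<lambda>x. (cmod (f x))\<^sup>2)"
  proof (rule Bochner_Integration.integrable_bound)
    show "integrable lborel (\<lambda>x. B * cmod (f x))" using f by simp
    show "AE x in lborel. norm ((cmod (f x))\<^sup>2) \<le> norm (B * cmod (f x))"
      using bdd B by (auto simp: power2_eq_square intro!: mult_right_mono)
  qed simp
  then show "(\<integral>\<^sup>+x. ennreal ((cmod (f x))\<^sup>2) \<partial>lborel) < \<infinity>"
    by (simp add: integrable_iff_bounded)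
  define t where "t n = 1 / real (Suc n)" for n
  have t: "t n > 0" for n by (simp add: t_def)
  have t0: "t \<longlonglongrightarrow> 0" unfolding t_def using LIMSEQ_Suc[OF lim_1_over_n] by simp
  define R where "R n = (LINT \<zeta>|lborel. gauss (t n *\<^sub>R \<zeta>) * (cmod (fourier f \<zeta>))\<^sup>2)" for n
  have iR: "integrable lborel (\<lambda>\<zeta>. gauss (t n *\<^sub>R \<zeta>) * (cmod (fourier f \<zeta>))\<^sup>2)" for n
  proof (rule Bochner_Integration.integrable_bound)
    show "integrable lborel (\<lambda>\<zeta>::'a. gauss (t n *\<^sub>R \<zeta>) * (LINT x|lborel. cmod (f x))\<^sup>2)"
      using integrable_gauss_scaled[of "t n", where ?'a='a] t[of n] by simp
    show "AE \<zeta> in lborel. norm (gauss (t n *\<^sub>R \<zeta>) * (cmod (fourier f \<zeta>))\<^sup>2) \<le>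
        norm (gauss (t n *\<^sub>R \<zeta>) * (LINT x|lborel. cmod (f x))\<^sup>2)"
      using norm_fourier_le[OF f] by (auto intro!: mult_left_mono power_mono)
  qed simp
  have cR: "complex_of_real (R n) = (LINT x|lborel. f x * (LINT z|lborel. cnj (f (x + t n *\<^sub>R z)) * complex_of_real (gauss z)))" for n
    unfolding R_def gauss_plancherel[OF f t]
    by (intro Bochner_Integration.integral_cong refl arg_cong2[of _ _ _ _ times] integral_gauss_kernel t) simp
  have "(\<lambda>n. complex_of_real (R n)) \<longlonglongrightarrow> (LINT x|lborel. f x * cnj (f x))"
    unfolding cR
  proof (rule integral_dominated_convergence)
    show "integrable lborel (\<lambda>x. B * cmod (f x))" using f by simp
    have "(\<lambda>n. LINT z|lborel. cnj (f (x + t n *\<^sub>R z)) * complex_of_real (gauss z)) \<longlonglongrightarrow> cnj (f x)" for x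
      by (rule gauss_average_tendsto[where B=B]) (use bdd t0 cont in \<open>auto intro: continuous_intros\<close>)
    then show "AE x in lborel. (\<lambda>n. f x * (LINT z|lborel. cnj (f (x + t n *\<^sub>R z)) * complex_of_real (gauss z))) \<longlonglongrightarrow> f x * cnj (f x)"
      by (intro AE_I2 tendsto_intros)
    have "cmod (LINT z|lborel. cnj (f (x + t n *\<^sub>R z)) * complex_of_real (gauss z)) \<le> B" for x n
    proof -
      have "cmod (LINT z|lborel. cnj (f (x + t n *\<^sub>R z)) * complex_of_real (gauss z)) \<le>
          (LINT (z::'a)|lborel. B * gauss z)"
      proof (rule Bochner_Integration.integral_norm_bound_integral)
        show i: "integrable lborel (\<lambda>z::'a. B * gauss z)" using integrable_gauss[where ?'a='a] by simp
        show le: "cmod (cnj (f (x + t n *\<^sub>R z)) * complex_of_real (gauss z)) \<le> B * gauss z" for z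
          using bdd by (simp add: norm_mult mult_right_mono)
        show "integrable lborel (\<lambda>z. cnj (f (x + t n *\<^sub>R z)) * complex_of_real (gauss z))"
          by (rule Bochner_Integration.integrable_bound[OF i]) (use le B in \<open>auto simp: abs_mult\<close>)
      qed
      then show ?thesis by (simp add: integral_gauss)
    qed
    then show "AE x in lborel. norm (f x * (LINT z|lborel. cnj (f (x + t n *\<^sub>R z)) * complex_of_real (gauss z))) \<le> B * cmod (f x)" for n
      unfolding norm_mult mult.commute[of B] by (intro AE_I2 mult_left_mono) auto
    have "(\<lambda>x. LINT z|lborel. cnj (f (x + t n *\<^sub>R z)) * complex_of_real (gauss z)) \<in> borel_measurable borel" for n
      by measurable
    then show "(\<lambda>x. f x * (LINT z|lborel. cnj (f (x + t n *\<^sub>R z)) * complex_of_real (gauss z))) \<in> borel_measurable lborel" for n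
      by simp
    show "(\<lambda>x. f x * cnj (f x)) \<in> borel_measurable lborel" by simp
  qed
  also have "(LINT x|lborel. f x * cnj (f x)) = complex_of_real (LINT x|lborel. (cmod (f x))\<^sup>2)"
    by (subst integral_complex_of_real[symmetric]) (simp add: complex_norm_square flip: of_real_power)
  finally have "R \<longlonglongrightarrow> (LINT x|lborel. (cmod (f x))\<^sup>2)"
    by (simp only: tendsto_of_real_iff)
  then have "(\<lambda>n. ennreal (R n)) \<longlonglongrightarrow> ennreal (LINT x|lborel. (cmod (f x))\<^sup>2)" by simp
  also have "ennreal (LINT x|lborel. (cmod (f x))\<^sup>2) = (\<integral>\<^sup>+x. ennreal ((cmod (f x))\<^sup>2) \<partial>lborel)"
    by (rule nn_integral_eq_integral[symmetric]) (auto simp: f2)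
  finally have lim1: "(\<lambda>n. ennreal (R n)) \<longlonglongrightarrow> (\<integral>\<^sup>+x. ennreal ((cmod (f x))\<^sup>2) \<partial>lborel)" .
  have RE: "ennreal (R n) = (\<integral>\<^sup>+\<zeta>. ennreal (gauss (t n *\<^sub>R \<zeta>) * (cmod (fourier f \<zeta>))\<^sup>2) \<partial>lborel)" for n
    unfolding R_def by (rule nn_integral_eq_integral[symmetric]) (auto simp: iR)
  have "(\<lambda>n. ennreal (R n)) \<longlonglongrightarrow> (\<integral>\<^sup>+\<zeta>. ennreal ((cmod (fourier f \<zeta>))\<^sup>2) \<partial>lborel)"
    unfolding RE
  \<comment> \<open>Monotone convergence, so that square integrability of the transform is a result
    and not a prerequisite.\<close>
  proof (rule nn_integral_LIMSEQ)
    have "gauss (t m *\<^sub>R \<zeta>) \<le> gauss (t n *\<^sub>R \<zeta>)" if "m \<le> n" for m n and \<zeta> :: 'a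
    proof -
      have "t n \<le> t m" using that by (simp add: t_def frac_le)
      then have "(norm (t n *\<^sub>R \<zeta>))\<^sup>2 \<le> (norm (t m *\<^sub>R \<zeta>))\<^sup>2"
        using t[of n] t[of m] by (intro power_mono) (auto intro!: mult_right_mono)
      then show ?thesis unfolding gauss_def by simp
    qed
    then show "incseq (\<lambda>n \<zeta>. ennreal (gauss (t n *\<^sub>R \<zeta>) * (cmod (fourier f \<zeta>))\<^sup>2))"
      by (auto simp: incseq_def le_fun_def intro!: ennreal_leI mult_right_mono)
    fix \<zeta> :: 'a
    have "(\<lambda>n. gauss (t n *\<^sub>R \<zeta>)) \<longlonglongrightarrow> exp (- pi * (norm (0 *\<^sub>R \<zeta>))\<^sup>2)"
      unfolding gauss_def by (intro tendsto_intros t0)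
    then have "(\<lambda>n. gauss (t n *\<^sub>R \<zeta>) * (cmod (fourier f \<zeta>))\<^sup>2) \<longlonglongrightarrow> 1 * (cmod (fourier f \<zeta>))\<^sup>2"
      by (intro tendsto_intros) simp
    then show "(\<lambda>n. ennreal (gauss (t n *\<^sub>R \<zeta>) * (cmod (fourier f \<zeta>))\<^sup>2)) \<longlonglongrightarrow> ennreal ((cmod (fourier f \<zeta>))\<^sup>2)"
      by simp
  qed measurable
  with lim1 show "(\<integral>\<^sup>+\<zeta>. ennreal ((cmod (fourier f \<zeta>))\<^sup>2) \<partial>lborel) = (\<integral>\<^sup>+x. ennreal ((cmod (f x))\<^sup>2) \<partial>lborel)"
    using LIMSEQ_unique by blast
qed

lemma nn_integral_norm_diff_square:
  fixes f g :: "'x \<Rightarrow> complex"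
  assumes [measurable]: "f \<in> borel_measurable M" "g \<in> borel_measurable M"
    and f: "(\<integral>\<^sup>+x. ennreal ((cmod (f x))\<^sup>2) \<partial>M) < \<infinity>" and g: "(\<integral>\<^sup>+x. ennreal ((cmod (g x))\<^sup>2) \<partial>M) < \<infinity>"
  shows "(\<integral>\<^sup>+x. ennreal ((cmod (f x - g x))\<^sup>2) \<partial>M) = ennreal (enn2real (\<integral>\<^sup>+x. ennreal ((cmod (f x))\<^sup>2) \<partial>M) +
    enn2real (\<integral>\<^sup>+x. ennreal ((cmod (g x))\<^sup>2) \<partial>M) - 2 * Re (LINT x|M. f x * cnj (g x)))"
proof -
  have i: "integrable M (\<lambda>x. (cmod (f x))\<^sup>2)" "integrable M (\<lambda>x. (cmod (g x))\<^sup>2)"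
    using f g by (auto simp: integrable_iff_bounded)
  have ifg: "integrable M (\<lambda>x. f x * cnj (g x))"
  proof (rule Bochner_Integration.integrable_bound)
    show "integrable M (\<lambda>x. (cmod (f x))\<^sup>2 + (cmod (g x))\<^sup>2)" using i by simp
    have "a * b \<le> a\<^sup>2 + b\<^sup>2" if "a \<ge> 0" "b \<ge> 0" for a b :: real
      using that sum_squares_bound[of a b] mult_nonneg_nonneg[OF that] by linarith
    then show "AE x in M. norm (f x * cnj (g x)) \<le> norm ((cmod (f x))\<^sup>2 + (cmod (g x))\<^sup>2)"
      by (auto simp: norm_mult)
    show "(\<lambda>x. f x * cnj (g x)) \<in> borel_measurable M" by measurable
  qed
  have eq: "(cmod (a - b))\<^sup>2 = (cmod a)\<^sup>2 + (cmod b)\<^sup>2 - 2 * Re (a * cnj b)" for a b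
    by (simp add: cmod_power2) (simp add: power2_eq_square algebra_simps)
  have iR: "integrable M (\<lambda>x. Re (f x * cnj (g x)))" using ifg by (rule integrable_Re)
  have int: "integrable M (\<lambda>x. (cmod (f x - g x))\<^sup>2)"
    unfolding eq using i iR by (intro Bochner_Integration.integrable_diff Bochner_Integration.integrable_add integrable_mult_right)
  have "(\<integral>\<^sup>+x. ennreal ((cmod (f x - g x))\<^sup>2) \<partial>M) = ennreal (LINT x|M. (cmod (f x - g x))\<^sup>2)"
    by (rule nn_integral_eq_integral) (auto simp: int)
  also have "(LINT x|M. (cmod (f x - g x))\<^sup>2) = (LINT x|M. (cmod (f x))\<^sup>2) + (LINT x|M. (cmod (g x))\<^sup>2) - 2 * Re (LINT x|M. f x * cnj (g x))"
    unfolding eq using i iR integral_Re[OF ifg] by (simp del: times_complex.simps Re_complex_div_eq_0)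
  finally show ?thesis by (simp add: integral_eq_nn_integral)
qed

text \<open>Here \<open>G\<close> lives in frequency and \<open>fourier G\<close> need not be
  integrable, so Plancherel's theorem does not apply to the difference. The square is expanded
  instead: the two squares are handled by Plancherel and the mixed term by the multiplication
  formula.\<close>

theorem plancherel_diff:
  fixes \<phi> G :: "'a::euclidean_space \<Rightarrow> complex"
  assumes \<phi>: "integrable lborel \<phi>" "continuous_on UNIV \<phi>" "\<And>x. cmod (\<phi> x) \<le> B"
    and G: "integrable lborel G" "continuous_on UNIV G" "\<And>x. cmod (G x) \<le> C"
  shows "(\<integral>\<^sup>+z. ennreal ((cmod (\<phi> z - fourier G z))\<^sup>2) \<partial>lborel) =
    (\<integral>\<^sup>+\<zeta>. ennreal ((cmod (inv_fourier \<phi> \<zeta> - G \<zeta>))\<^sup>2) \<partial>lborel)"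
proof -
  have [measurable]: "\<phi> \<in> borel_measurable borel" "G \<in> borel_measurable borel"
    using \<phi> G by (auto intro: borel_measurable_continuous_onI)
  have inv: "(\<integral>\<^sup>+\<zeta>. ennreal ((cmod (inv_fourier \<phi> \<zeta>))\<^sup>2) \<partial>lborel) = (\<integral>\<^sup>+\<zeta>. ennreal ((cmod (fourier \<phi> \<zeta>))\<^sup>2) \<partial>lborel)"
    unfolding inv_fourier_eq by (rule nn_integral_reflect) measurable
  note P = plancherel[OF \<phi>] plancherel[OF G]
  have cG: "integrable lborel (\<lambda>x. cnj (G x))" using G by simp
  have refl_inv: "fourier (\<lambda>z. \<phi> (- z)) \<zeta> = inv_fourier \<phi> \<zeta>" for \<zeta>
  proof -
    have "fourier (\<lambda>z. \<phi> (- z)) \<zeta> = (LINT x|lborel. cis (- 2 * pi * (- (- x) \<bullet> \<zeta>)) * \<phi> (- x))"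
      by (simp add: fourier_def)
    also have "\<dots> = (LINT x|lborel. cis (- 2 * pi * (- x \<bullet> \<zeta>)) * \<phi> x)"
      by (rule integral_reflect[of "\<lambda>x. cis (- 2 * pi * (- x \<bullet> \<zeta>)) * \<phi> x"]) measurable
    finally show ?thesis by (simp add: inv_fourier_def inner_commute)
  qed
  have "(LINT z|lborel. \<phi> z * cnj (fourier G z)) = (LINT z|lborel. \<phi> z * fourier (\<lambda>x. cnj (G x)) (- z))"
    by (simp add: cnj_fourier)
  also have "\<dots> = (LINT z|lborel. \<phi> (- z) * fourier (\<lambda>x. cnj (G x)) (- (- z)))"
    by (rule integral_reflect[symmetric]) measurable
  also have "\<dots> = (LINT \<zeta>|lborel. fourier (\<lambda>z. \<phi> (- z)) \<zeta> * cnj (G \<zeta>))"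
    using fourier_multiplication[OF integrable_reflect[OF \<phi>(1)] cG] by simp
  also have "\<dots> = (LINT \<zeta>|lborel. inv_fourier \<phi> \<zeta> * cnj (G \<zeta>))"
    by (simp only: refl_inv)
  finally have cross: "(LINT z|lborel. \<phi> z * cnj (fourier G z)) = (LINT \<zeta>|lborel. inv_fourier \<phi> \<zeta> * cnj (G \<zeta>))" .
  have "(\<integral>\<^sup>+z. ennreal ((cmod (\<phi> z - fourier G z))\<^sup>2) \<partial>lborel) =
     ennreal (enn2real (\<integral>\<^sup>+x. ennreal ((cmod (\<phi> x))\<^sup>2) \<partial>lborel) +
       enn2real (\<integral>\<^sup>+x. ennreal ((cmod (fourier G x))\<^sup>2) \<partial>lborel) - 2 * Re (LINT z|lborel. \<phi> z * cnj (fourier G z)))"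
    by (rule nn_integral_norm_diff_square) (use P in auto)
  moreover have "(\<integral>\<^sup>+\<zeta>. ennreal ((cmod (inv_fourier \<phi> \<zeta> - G \<zeta>))\<^sup>2) \<partial>lborel) =
     ennreal (enn2real (\<integral>\<^sup>+x. ennreal ((cmod (inv_fourier \<phi> x))\<^sup>2) \<partial>lborel) +
       enn2real (\<integral>\<^sup>+x. ennreal ((cmod (G x))\<^sup>2) \<partial>lborel) - 2 * Re (LINT \<zeta>|lborel. inv_fourier \<phi> \<zeta> * cnj (G \<zeta>)))"
    by (rule nn_integral_norm_diff_square) (use P inv in auto)
  ultimately show ?thesis by (simp only: cross inv P(1) P(3))
qed

subsection \<open>Schwartz functions\<close>

lemma smooth_iter_deriv_differentiable: "smooth f \<Longrightarrow> iter_deriv vs f differentiable (at x)"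
  by (auto simp: smooth_def)

lemma smooth_continuous: "smooth f \<Longrightarrow> continuous_on A (iter_deriv vs f)"
  by (meson continuous_at_imp_continuous_on differentiable_imp_continuous_within smooth_def)

lemma schwartz_continuous: "schwartz f \<Longrightarrow> continuous_on A f"
  using smooth_continuous[of f A "[]"] by (simp add: schwartz_def)

lemma schwartz_measurable: "schwartz f \<Longrightarrow> f \<in> borel_measurable borel"
  by (rule borel_measurable_continuous_onI) (rule schwartz_continuous)

lemma schwartz_decay:
  assumes "schwartz f"
  obtains C where "C \<ge> 0" "\<And>x. \<bar>f x\<bar> \<le> C / (1 + norm x) ^ k"
proof -
  obtain C where C: "\<And>x. (1 + norm x) ^ k * \<bar>iter_deriv [] f x\<bar> \<le> C"
    using assms unfolding schwartz_def by metis
  show ?thesis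
  proof
    have "0 \<le> (1 + norm (0::'a)) ^ k * \<bar>iter_deriv [] f 0\<bar>" by simp
    also have "\<dots> \<le> C" by (rule C)
    finally show "0 \<le> C" .
    show "\<bar>f x\<bar> \<le> C / (1 + norm x) ^ k" for x
    proof -
      have "1 + norm x > 0" by (simp add: add_pos_nonneg)
      then show ?thesis using C[of x] by (simp add: pos_le_divide_eq mult.commute)
    qed
  qed
qed

lemma schwartz_weighted_integrable:
  fixes f :: "'a::euclidean_space \<Rightarrow> real"
  assumes "schwartz f"
  shows "integrable lborel (\<lambda>x. (1 + norm x) ^ k * f x)"
proof -
  obtain C where C: "C \<ge> 0" "\<And>x. \<bar>f x\<bar> \<le> C / (1 + norm x) ^ (k + (DIM('a) + 1))"
    using schwartz_decay[OF assms] by metis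
  have [measurable]: "f \<in> borel_measurable borel" by (rule schwartz_measurable) fact
  show ?thesis
  proof (rule Bochner_Integration.integrable_bound)
    show "integrable lborel (\<lambda>x::'a. C * (1 / (1 + norm x) ^ (DIM('a) + 1)))"
      by (intro integrable_mult_right integrable_inverse_power_norm) simp
    have "(1 + norm x) ^ k * \<bar>f x\<bar> \<le> C * (1 / (1 + norm x) ^ (DIM('a) + 1))" for x
    proof -
      have p: "1 + norm x > 0" by (simp add: add_pos_nonneg)
      have "(1 + norm x) ^ k * \<bar>f x\<bar> \<le> (1 + norm x) ^ k * (C / (1 + norm x) ^ (k + (DIM('a) + 1)))"
        using p by (intro mult_left_mono C) auto
      also have "\<dots> = C * (1 / (1 + norm x) ^ (DIM('a) + 1))"
        using p by (simp add: power_add)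
      finally show ?thesis .
    qed
    then show "AE x in lborel. norm ((1 + norm x) ^ k * f x) \<le> norm (C * (1 / (1 + norm x) ^ (DIM('a) + 1)))"
      using C(1) by (auto simp: abs_mult)
  qed simp
qed

lemma schwartz_integrable: "schwartz f \<Longrightarrow> integrable lborel f"
  using schwartz_weighted_integrable[of f 0] by simp

lemma schwartz_bounded:
  assumes "schwartz f"
  obtains B where "B \<ge> 0" "\<And>x. \<bar>f x\<bar> \<le> B"
  using schwartz_decay[OF assms, of 0] by auto

subsection \<open>The logarithm as a superposition of Gaussians\<close>

text \<open>The integrand is the derivative in \<open>t\<close> of
  \<open>exp (- pi * u\<^sup>2 / t\<^sup>2) / u\<close>, which rises from 0 to
  \<open>1 / u\<close>.\<close>

lemma nn_integral_gauss_scale_derivative: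
  assumes u: "u > (0::real)"
  shows "(\<integral>\<^sup>+t. ennreal (2 * pi * u / t ^ 3 * exp (- pi * u\<^sup>2 / t\<^sup>2)) * indicator {0<..} t \<partial>lborel) = ennreal (1 / u)"
proof -
  let ?F = "\<lambda>t. exp (- pi * u\<^sup>2 / t\<^sup>2) / u" and ?f = "\<lambda>t. 2 * pi * u / t ^ 3 * exp (- pi * u\<^sup>2 / t\<^sup>2)"
  have nn: "0 \<le> ?f t" if "t > 0" for t using that u by simp
  have ein: "einterval 0 \<infinity> = {0::real<..}" by (auto simp: einterval_def)
  have D: "DERIV ?F t :> ?f t" if "t > 0" for t
    using that u by (auto intro!: derivative_eq_intros simp: power2_eq_square power3_eq_cube field_simps)
  have lim: "((?F \<circ> real_of_ereal) \<longlongrightarrow> 0) (at_right 0)" "((?F \<circ> real_of_ereal) \<longlongrightarrow> inverse u) (at_left \<infinity>)"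
    unfolding zero_ereal_def ereal_tendsto_simps using u by real_asymp+
  have "set_integrable lborel (einterval 0 \<infinity>) ?f"
    by (rule interval_integral_FTC_nonneg(1)[where F="?F", OF _ _ _ _ lim])
      (use D nn in \<open>auto intro!: continuous_intros\<close>)
  moreover have "(LBINT t=0..\<infinity>. ?f t) = inverse u - 0"
    by (rule interval_integral_FTC_nonneg(2)[where F="?F", OF _ _ _ _ lim])
      (use D nn in \<open>auto intro!: continuous_intros\<close>)
  ultimately have int: "set_integrable lborel {0<..} ?f" "(LINT t:{0<..}|lborel. ?f t) = 1 / u"
    by (simp_all add: interval_lebesgue_integral_def ein inverse_eq_divide)
  have "(\<integral>\<^sup>+t. ennreal (?f t) * indicator {0<..} t \<partial>lborel) = (\<integral>\<^sup>+t. ennreal (indicator {0<..} t *\<^sub>R ?f t) \<partial>lborel)"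
    by (intro nn_integral_cong) (auto split: split_indicator)
  also have "\<dots> = ennreal (LINT t:{0<..}|lborel. ?f t)"
    using int(1) nn unfolding set_lebesgue_integral_def set_integrable_def
    by (intro nn_integral_eq_integral) (auto split: split_indicator)
  finally show ?thesis using int(2) by simp
qed

text \<open>A Frullani integral: the difference of exponentials is an integral over \<open>u\<close>
  in \<open>{a..b}\<close>, and exchanging the integrals leaves the integral of
  \<open>1 / u\<close>.\<close>

lemma nn_integral_frullani:
  assumes a: "0 < a" "a \<le> (b::real)"
  shows "(\<integral>\<^sup>+t. ennreal ((exp (- pi * a\<^sup>2 / t\<^sup>2) - exp (- pi * b\<^sup>2 / t\<^sup>2)) / t) * indicator {0<..} t \<partial>lborel) = ennreal (ln b - ln a)"
proof -
  have inner: "ennreal ((exp (- pi * a\<^sup>2 / t\<^sup>2) - exp (- pi * b\<^sup>2 / t\<^sup>2)) / t) =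
      (\<integral>\<^sup>+u. ennreal (2 * pi * u / t ^ 3 * exp (- pi * u\<^sup>2 / t\<^sup>2)) * indicator {a..b} u \<partial>lborel)" if t: "t > 0" for t
  proof -
    have "(\<integral>\<^sup>+u. ennreal (2 * pi * u / t ^ 3 * exp (- pi * u\<^sup>2 / t\<^sup>2)) * indicator {a..b} u \<partial>lborel) =
        ennreal (- exp (- pi * b\<^sup>2 / t\<^sup>2) / t - (- exp (- pi * a\<^sup>2 / t\<^sup>2) / t))"
    proof (rule nn_integral_FTC_Icc)
      show "DERIV (\<lambda>u. - exp (- pi * u\<^sup>2 / t\<^sup>2) / t) u :> 2 * pi * u / t ^ 3 * exp (- pi * u\<^sup>2 / t\<^sup>2)" for u
        using t by (auto intro!: derivative_eq_intros simp: power2_eq_square power3_eq_cube field_simps)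
    qed (use a t in auto)
    then show ?thesis by (simp add: diff_divide_distrib)
  qed
  have "(\<integral>\<^sup>+t. ennreal ((exp (- pi * a\<^sup>2 / t\<^sup>2) - exp (- pi * b\<^sup>2 / t\<^sup>2)) / t) * indicator {0<..} t \<partial>lborel) =
    (\<integral>\<^sup>+t. (\<integral>\<^sup>+u. ennreal (2 * pi * u / t ^ 3 * exp (- pi * u\<^sup>2 / t\<^sup>2)) * indicator {a..b} u * indicator {0<..} t \<partial>lborel) \<partial>lborel)"
  proof (rule nn_integral_cong)
    fix t :: real
    show "ennreal ((exp (- pi * a\<^sup>2 / t\<^sup>2) - exp (- pi * b\<^sup>2 / t\<^sup>2)) / t) * indicator {0<..} t =
      (\<integral>\<^sup>+u. ennreal (2 * pi * u / t ^ 3 * exp (- pi * u\<^sup>2 / t\<^sup>2)) * indicator {a..b} u * indicator {0<..} t \<partial>lborel)"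
      using inner[of t] by (cases "t > 0") simp_all
  qed
  also have "\<dots> = (\<integral>\<^sup>+u. (\<integral>\<^sup>+t. ennreal (2 * pi * u / t ^ 3 * exp (- pi * u\<^sup>2 / t\<^sup>2)) * indicator {a..b} u * indicator {0<..} t \<partial>lborel) \<partial>lborel)"
    by (rule lborel_pair.Fubini') measurable
  also have "\<dots> = (\<integral>\<^sup>+u. ennreal (1 / u) * indicator {a..b} u \<partial>lborel)"
  proof (rule nn_integral_cong)
    fix u :: real
    show "(\<integral>\<^sup>+t. ennreal (2 * pi * u / t ^ 3 * exp (- pi * u\<^sup>2 / t\<^sup>2)) * indicator {a..b} u * indicator {0<..} t \<partial>lborel) =
        ennreal (1 / u) * indicator {a..b} u"
      using nn_integral_gauss_scale_derivative[of u] a by (cases "u \<in> {a..b}") simp_all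
  qed
  also have "\<dots> = ennreal (ln b - ln a)"
    by (rule nn_integral_FTC_Icc) (use a in \<open>auto intro!: derivative_eq_intros\<close>)
  finally show ?thesis .
qed

text \<open>The subtracted term makes the integral over \<open>t\<close> converge at infinity and
  fixes the additive constant so that \<open>r = 1\<close> gives 0. It does not depend on
  \<open>r\<close>, hence it disappears against functions of integral zero.\<close>

definition log_scale_kernel :: "real \<Rightarrow> real \<Rightarrow> real" where
  "log_scale_kernel r t = (if t > 0 then (exp (- pi * r\<^sup>2 / t\<^sup>2) - exp (- pi / t\<^sup>2)) / t else 0)"

lemma log_scale_kernel_measurable [measurable]:
  assumes [measurable]: "f \<in> borel_measurable M" "g \<in> borel_measurable M"
  shows "(\<lambda>x. log_scale_kernel (f x) (g x)) \<in> borel_measurable M"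
  unfolding log_scale_kernel_def by measurable

text \<open>For fixed \<open>r\<close> the kernel has one sign, nonnegative for
  \<open>r \<le> 1\<close> and nonpositive otherwise, so the Frullani integral also computes its
  absolute integral; that is what Fubini's theorem will ask for.\<close>

lemma log_scale_kernel_integral:
  assumes r: "r > 0"
  shows "integrable lborel (log_scale_kernel r)"
    and "(LINT t|lborel. \<bar>log_scale_kernel r t\<bar>) = \<bar>ln r\<bar>"
    and "(LINT t|lborel. log_scale_kernel r t) = ln (1 / r)"
proof -
  define s where "s = (if r \<le> 1 then 1 else - 1 :: real)"
  have pos: "0 \<le> s * log_scale_kernel r t" for t
  proof -
    have "r\<^sup>2 \<le> 1" if "r \<le> 1" using r that by (simp add: power_le_one)
    moreover have "1 \<le> r\<^sup>2" if "\<not> r \<le> 1" using that by (simp add: one_le_power)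
    ultimately show ?thesis
      by (auto simp: s_def log_scale_kernel_def divide_simps)
  qed
  have nn: "(\<integral>\<^sup>+t. ennreal (s * log_scale_kernel r t) \<partial>lborel) = ennreal (s * ln (1 / r))"
  proof (cases "r \<le> 1")
    case True
    have "(\<integral>\<^sup>+t. ennreal (s * log_scale_kernel r t) \<partial>lborel) =
        (\<integral>\<^sup>+t. ennreal ((exp (- pi * r\<^sup>2 / t\<^sup>2) - exp (- pi * 1\<^sup>2 / t\<^sup>2)) / t) * indicator {0<..} t \<partial>lborel)"
      using True by (intro nn_integral_cong) (simp add: s_def log_scale_kernel_def split: split_indicator)
    also have "\<dots> = ennreal (ln 1 - ln r)"
      by (rule nn_integral_frullani) (use r True in auto)
    also have "ln 1 - ln r = s * ln (1 / r)" using r True by (simp add: s_def ln_div)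
    finally show ?thesis .
  next
    case False
    have "(\<integral>\<^sup>+t. ennreal (s * log_scale_kernel r t) \<partial>lborel) =
        (\<integral>\<^sup>+t. ennreal ((exp (- pi * 1\<^sup>2 / t\<^sup>2) - exp (- pi * r\<^sup>2 / t\<^sup>2)) / t) * indicator {0<..} t \<partial>lborel)"
      using False by (intro nn_integral_cong) (simp add: s_def log_scale_kernel_def diff_divide_distrib split: split_indicator)
    also have "\<dots> = ennreal (ln r - ln 1)"
      by (rule nn_integral_frullani) (use r False in auto)
    also have "ln r - ln 1 = s * ln (1 / r)" using r False by (simp add: s_def ln_div)
    finally show ?thesis .
  qed
  have s_ln: "0 \<le> s * ln (1 / r)" "s * ln (1 / r) = \<bar>ln r\<bar>" using r by (auto simp: s_def ln_div)
  have hb: "has_bochner_integral lborel (\<lambda>t. s * log_scale_kernel r t) (s * ln (1 / r))"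
    by (rule has_bochner_integral_nn_integral) (use pos s_ln nn in auto)
  have s: "s * s = 1" "s \<noteq> 0" by (auto simp: s_def)
  show int: "integrable lborel (log_scale_kernel r)"
    using hb s by (simp add: has_bochner_integral_iff)
  have "(LINT t|lborel. s * log_scale_kernel r t) = s * ln (1 / r)"
    using hb by (rule has_bochner_integral_integral_eq)
  then show "(LINT t|lborel. log_scale_kernel r t) = ln (1 / r)" using s by simp
  have "\<bar>log_scale_kernel r t\<bar> = s * log_scale_kernel r t" for t
    using pos[of t] by (auto simp: s_def split: if_splits)
  then show "(LINT t|lborel. \<bar>log_scale_kernel r t\<bar>) = \<bar>ln r\<bar>"
    using has_bochner_integral_integral_eq[OF hb] s_ln by simp
qed

text \<open>Substituting \<open>r = t * norm \<zeta>\<close> in the radial Gaussian integral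
  extracts the power of \<open>norm \<zeta>\<close>; this is where the spectral weight comes
  from.\<close>

lemma nn_integral_gauss_dilation:
  fixes \<zeta> :: "'a::euclidean_space"
  assumes "\<zeta> \<noteq> 0"
  shows "(\<integral>\<^sup>+t. ennreal (t ^ (DIM('a) - 1) * gauss (t *\<^sub>R \<zeta>)) * indicator {0<..} t \<partial>lborel) =
    ennreal (1 / sphere_area DIM('a)) * ennreal (1 / norm \<zeta> ^ DIM('a))"
proof -
  define d where "d = DIM('a)"
  have d: "d > 0" "Suc (d - 1) = d" by (simp_all add: d_def)
  define n where "n = norm \<zeta>"
  have n: "n > 0" using assms by (simp add: n_def)
  define f where "f r = ennreal (r ^ (d - 1)) * ennreal (exp (- pi * r\<^sup>2)) * indicator {0..} r" for r :: real
  have [measurable]: "f \<in> borel_measurable borel" unfolding f_def by measurable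
  have "ennreal (1 / sphere_area d) = (\<integral>\<^sup>+r. f r \<partial>lborel)"
    unfolding f_def d_def by (rule nn_integral_radial_gauss[symmetric])
  also have "\<dots> = ennreal \<bar>n\<bar> * (\<integral>\<^sup>+t. f (0 + n * t) \<partial>lborel)"
    using n by (intro nn_integral_real_affine) auto
  also have "(\<integral>\<^sup>+t. f (0 + n * t) \<partial>lborel) = (\<integral>\<^sup>+t. ennreal (n ^ (d - 1)) * (ennreal (t ^ (d - 1) * gauss (t *\<^sub>R \<zeta>)) * indicator {0<..} t) \<partial>lborel)"
  proof (rule nn_integral_cong_AE)
    have "AE t in lborel. t \<noteq> (0::real)" by (rule AE_lborel_singleton)
    then show "AE t in lborel. f (0 + n * t) = ennreal (n ^ (d - 1)) * (ennreal (t ^ (d - 1) * gauss (t *\<^sub>R \<zeta>)) * indicator {0<..} t)"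
    proof eventually_elim
      case (elim t)
      show ?case
        using n elim by (auto simp: f_def gauss_def n_def[symmetric] power_mult_distrib zero_le_mult_iff mult_ac
            split: split_indicator simp flip: ennreal_mult)
    qed
  qed
  also have "\<dots> = ennreal (n ^ (d - 1)) * (\<integral>\<^sup>+t. ennreal (t ^ (d - 1) * gauss (t *\<^sub>R \<zeta>)) * indicator {0<..} t \<partial>lborel)"
    by (rule nn_integral_cmult) measurable
  also have "ennreal \<bar>n\<bar> * (ennreal (n ^ (d - 1)) * (\<integral>\<^sup>+t. ennreal (t ^ (d - 1) * gauss (t *\<^sub>R \<zeta>)) * indicator {0<..} t \<partial>lborel)) =
      ennreal (n ^ d) * (\<integral>\<^sup>+t. ennreal (t ^ (d - 1) * gauss (t *\<^sub>R \<zeta>)) * indicator {0<..} t \<partial>lborel)"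
    using n d by (simp add: mult.assoc[symmetric] power_Suc[symmetric] del: power_Suc flip: ennreal_mult)
  finally have "ennreal (1 / sphere_area d) * ennreal (1 / n ^ d) =
      ennreal (1 / n ^ d) * ennreal (n ^ d) * (\<integral>\<^sup>+t. ennreal (t ^ (d - 1) * gauss (t *\<^sub>R \<zeta>)) * indicator {0<..} t \<partial>lborel)"
    by (simp add: mult_ac)
  also have "ennreal (1 / n ^ d) * ennreal (n ^ d) = 1"
    using n by (simp flip: ennreal_mult)
  finally show ?thesis by (simp add: d_def n_def)
qed

subsection \<open>The covariance of the log-correlated field in Fourier space\<close>

text \<open>In polar coordinates the integrand is \<open>r ^ (d - 1) / r\<close>, bounded by 1 on
  the unit interval as soon as \<open>d \<ge> 2\<close>.\<close>

lemma nn_integral_inverse_norm_ball: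
  assumes "DIM('a::euclidean_space) \<ge> 2"
  shows "(\<integral>\<^sup>+(z::'a). ennreal (1 / norm z) * indicator (ball 0 1) z \<partial>lborel) < \<infinity>"
proof -
  have "(\<integral>\<^sup>+(z::'a). ennreal (1 / norm z) * indicator (ball 0 1) z \<partial>lborel) =
      (\<integral>\<^sup>+(z::'a). ennreal (1 / norm z) * indicator {..<1} (norm z) \<partial>lborel)"
    by (intro nn_integral_cong) (auto split: split_indicator)
  also have "\<dots> = ennreal (sphere_area DIM('a)) *
      (\<integral>\<^sup>+r. ennreal (r ^ (DIM('a) - 1)) * (ennreal (1 / r) * indicator {..<1} r) * indicator {0..} r \<partial>lborel)"
    by (rule nn_integral_radial[where f="\<lambda>r. ennreal (1 / r) * indicator {..<1} r"]) simp
  also have "\<dots> < \<infinity>"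
  proof -
    have "(\<integral>\<^sup>+r. ennreal (r ^ (DIM('a) - 1)) * (ennreal (1 / r) * indicator {..<1} r) * indicator {0..} r \<partial>lborel) \<le>
        (\<integral>\<^sup>+r. indicator {0..1} r \<partial>(lborel :: real measure))"
    proof (rule nn_integral_mono)
      fix r :: real
      have "r ^ (DIM('a) - 1) * (1 / r) \<le> 1" if "0 \<le> r" "r < 1"
      proof (cases "r = 0")
        case False
        have "r ^ (DIM('a) - 1) \<le> r ^ 1"
          using assms that by (intro power_decreasing) auto
        then show ?thesis using that False by (simp add: divide_simps)
      qed simp
      then show "ennreal (r ^ (DIM('a) - 1)) * (ennreal (1 / r) * indicator {..<1} r) * indicator {0..} r \<le> indicator {0..1} r"
        by (auto split: split_indicator simp: ennreal_le_1 simp flip: ennreal_mult)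
    qed
    also have "\<dots> < \<infinity>" by simp
    finally show ?thesis by (simp add: ennreal_mult_less_top)
  qed
  finally show ?thesis .
qed

lemma abs_ln_le:
  assumes "r > 0"
  shows "\<bar>ln r\<bar> \<le> r + 1 / (r::real)"
proof -
  have "1 / r > 0" using assms by simp
  moreover have "ln r \<le> r - 1" "- ln r \<le> 1 / r - 1"
    using ln_le_minus_one[of r] ln_le_minus_one[of "1 / r"] assms by (simp_all add: ln_div)
  ultimately show ?thesis using assms by linarith
qed

lemma AE_lborel_pair_distinct: "AE p in (lborel :: ('a::euclidean_space \<times> 'a) measure). fst p \<noteq> snd p"
proof -
  have "AE p in (lborel :: 'a measure) \<Otimes>\<^sub>M (lborel :: 'a measure). fst p \<noteq> snd p"
  proof (rule lborel_pair.AE_pair_measure[where P="\<lambda>p. fst p \<noteq> snd p"])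
    show "AE x in (lborel :: 'a measure). AE y in (lborel :: 'a measure). fst (x, y) \<noteq> snd (x, y)"
    proof (rule AE_I2)
      fix x :: 'a
      show "AE y in lborel. fst (x, y) \<noteq> snd (x, y)"
        using AE_lborel_singleton[of x] by eventually_elim auto
    qed
  qed measurable
  then show ?thesis unfolding lborel_prod .
qed

text \<open>By \<open>abs_ln_le\<close> the logarithm is at most \<open>r + 1 / r\<close>. The part
  \<open>r\<close> is absorbed by the weights \<open>(1 + norm x) * (1 + norm y)\<close>, which a
  Schwartz function tolerates; for the part \<open>1 / r\<close> the integral over \<open>y\<close>
  is bounded uniformly in \<open>x\<close>, by boundedness of \<open>f\<close> near the pole and by
  its integrability away from it.\<close>

lemma integrable_log_kernel:
  fixes f :: "'a::euclidean_space \<Rightarrow> real"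
  assumes d: "DIM('a) \<ge> 2" and f: "schwartz f"
  shows "integrable lborel (\<lambda>p. f (fst p) * f (snd p) * ln (norm (fst p - snd p)))"
proof -
  have [measurable]: "f \<in> borel_measurable borel" by (rule schwartz_measurable[OF f])
  obtain B where B: "B \<ge> 0" "\<And>x. \<bar>f x\<bar> \<le> B" using schwartz_bounded[OF f] by metis
  have [measurable]: "ball (0::'a) 1 \<in> sets borel" by simp
  define q where "q z = ennreal (1 / norm z) * indicator (ball 0 1) z" for z :: 'a
  have [measurable]: "q \<in> borel_measurable borel" unfolding q_def by measurable
  define I where "I = (\<integral>\<^sup>+z. q z \<partial>lborel)"
  have I: "I < \<infinity>" unfolding I_def q_def by (rule nn_integral_inverse_norm_ball[OF d])
  define L where "L = (\<integral>\<^sup>+x. ennreal \<bar>f x\<bar> \<partial>lborel)"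
  have L: "L < \<infinity>" unfolding L_def using schwartz_integrable[OF f] by (simp add: integrable_iff_bounded)
  define L1 where "L1 = (\<integral>\<^sup>+x. ennreal \<bar>(1 + norm x) ^ 1 * f x\<bar> \<partial>lborel)"
  have L1: "L1 < \<infinity>" unfolding L1_def using schwartz_weighted_integrable[OF f, of 1] by (simp only: integrable_iff_bounded real_norm_def)
  have conv: "(\<integral>\<^sup>+y. ennreal (\<bar>f y\<bar> / norm (x - y)) \<partial>lborel) \<le> ennreal B * I + L" for x
  proof -
    have "(\<integral>\<^sup>+y. ennreal (\<bar>f y\<bar> / norm (x - y)) \<partial>lborel) \<le>
        (\<integral>\<^sup>+y. ennreal B * q (x - y) + ennreal \<bar>f y\<bar> \<partial>lborel)"
    proof (rule nn_integral_mono)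
      fix y
      have 1: "\<bar>f y\<bar> / norm (x - y) \<le> B * (1 / norm (x - y))"
        using B by (auto intro!: divide_right_mono)
      have 2: "\<bar>f y\<bar> / norm (x - y) \<le> \<bar>f y\<bar>" if "norm (x - y) \<ge> 1"
        using that mult_left_mono[of 1 "norm (x - y)" "\<bar>f y\<bar>"] by (auto simp: divide_le_eq)
      show "ennreal (\<bar>f y\<bar> / norm (x - y)) \<le> ennreal B * q (x - y) + ennreal \<bar>f y\<bar>"
      proof (cases "norm (x - y) < 1")
        case True
        have "ennreal (\<bar>f y\<bar> / norm (x - y)) \<le> ennreal (B * (1 / norm (x - y)))"
          using 1 by (rule ennreal_leI)
        also have "\<dots> = ennreal B * q (x - y)"
          using True B(1) unfolding q_def by (subst ennreal_mult) auto
        finally show ?thesis by (simp add: add_increasing2)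
      next
        case False
        then show ?thesis using 2 by (simp add: ennreal_leI add_increasing q_def)
      qed
    qed
    also have "\<dots> = ennreal B * (\<integral>\<^sup>+y. q (x - y) \<partial>lborel) + L"
      unfolding L_def by (subst nn_integral_add) (auto simp: nn_integral_cmult)
    also have "(\<integral>\<^sup>+y. q (x - y) \<partial>lborel) = I"
      unfolding I_def using nn_integral_affine[of q "- 1" x] by simp
    finally show ?thesis .
  qed
  have "(\<integral>\<^sup>+p. ennreal (norm (f (fst p) * f (snd p) * ln (norm (fst p - snd p)))) \<partial>lborel) \<le>
      (\<integral>\<^sup>+p. ennreal \<bar>(1 + norm (fst p)) ^ 1 * f (fst p)\<bar> * ennreal \<bar>(1 + norm (snd p)) ^ 1 * f (snd p)\<bar> +
        ennreal \<bar>f (fst p)\<bar> * ennreal (\<bar>f (snd p)\<bar> / norm (fst p - snd p)) \<partial>lborel)"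
  proof (rule nn_integral_mono_AE)
    show "AE p in (lborel :: ('a \<times> 'a) measure). ennreal (norm (f (fst p) * f (snd p) * ln (norm (fst p - snd p)))) \<le>
       ennreal \<bar>(1 + norm (fst p)) ^ 1 * f (fst p)\<bar> * ennreal \<bar>(1 + norm (snd p)) ^ 1 * f (snd p)\<bar> +
        ennreal \<bar>f (fst p)\<bar> * ennreal (\<bar>f (snd p)\<bar> / norm (fst p - snd p))"
      using AE_lborel_pair_distinct
    proof eventually_elim
      case (elim p)
      define x y where "x = fst p" and "y = snd p"
      have r: "norm (x - y) > 0" using elim by (simp add: x_def y_def)
      have "norm (x - y) \<le> norm x + norm y" by (rule norm_triangle_ineq4)
      also have "\<dots> \<le> (1 + norm x) * (1 + norm y)" by (simp add: algebra_simps)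
      finally have "\<bar>ln (norm (x - y))\<bar> \<le> (1 + norm x) * (1 + norm y) + 1 / norm (x - y)"
        using abs_ln_le[OF r] by linarith
      then have "\<bar>f x * f y\<bar> * \<bar>ln (norm (x - y))\<bar> \<le> \<bar>f x * f y\<bar> * ((1 + norm x) * (1 + norm y) + 1 / norm (x - y))"
        by (intro mult_left_mono) auto
      also have "\<dots> = \<bar>(1 + norm x) ^ 1 * f x\<bar> * \<bar>(1 + norm y) ^ 1 * f y\<bar> + \<bar>f x\<bar> * (\<bar>f y\<bar> / norm (x - y))"
      proof -
        have "\<bar>(1 + norm z) ^ 1 * f z\<bar> = (1 + norm z) * \<bar>f z\<bar>" for z by (simp add: abs_mult)
        then show ?thesis by (simp only:) (simp add: abs_mult algebra_simps)
      qed
      finally have "norm (f x * f y * ln (norm (x - y))) \<le> \<bar>(1 + norm x) ^ 1 * f x\<bar> * \<bar>(1 + norm y) ^ 1 * f y\<bar> + \<bar>f x\<bar> * (\<bar>f y\<bar> / norm (x - y))"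
        by (simp add: abs_mult)
      then show ?case
        unfolding x_def[symmetric] y_def[symmetric]
        by (subst ennreal_mult[symmetric] ennreal_plus[symmetric]; simp add: ennreal_leI flip: ennreal_mult ennreal_plus)+
    qed
  qed
  also have "\<dots> = (\<integral>\<^sup>+x. \<integral>\<^sup>+y. ennreal \<bar>(1 + norm x) ^ 1 * f x\<bar> * ennreal \<bar>(1 + norm y) ^ 1 * f y\<bar> +
        ennreal \<bar>f x\<bar> * ennreal (\<bar>f y\<bar> / norm (x - y)) \<partial>lborel \<partial>lborel)"
    unfolding lborel_prod[symmetric] by (subst lborel.nn_integral_fst[symmetric]) (simp_all add: split_beta')
  also have "\<dots> = (\<integral>\<^sup>+x. ennreal \<bar>(1 + norm x) ^ 1 * f x\<bar> * L1 + ennreal \<bar>f x\<bar> * (\<integral>\<^sup>+y. ennreal (\<bar>f y\<bar> / norm (x - y)) \<partial>lborel) \<partial>lborel)"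
    by (intro nn_integral_cong, subst nn_integral_add) (auto simp: nn_integral_cmult L1_def)
  also have "\<dots> \<le> (\<integral>\<^sup>+x. ennreal \<bar>(1 + norm x) ^ 1 * f x\<bar> * L1 + ennreal \<bar>f x\<bar> * (ennreal B * I + L) \<partial>lborel)"
    by (intro nn_integral_mono add_mono mult_left_mono conv) auto
  also have "\<dots> = L1 * L1 + L * (ennreal B * I + L)"
    unfolding L1_def L_def by (subst nn_integral_add) (auto simp: nn_integral_multc)
  also have "\<dots> < \<infinity>"
    using I L L1 by (simp add: ennreal_mult_less_top ennreal_add_less_top)
  finally have "(\<integral>\<^sup>+p. ennreal (norm (f (fst p) * f (snd p) * ln (norm (fst p - snd p)))) \<partial>lborel) < \<infinity>" .
  moreover have "(\<lambda>p. f (fst p) * f (snd p) * ln (norm (fst p - snd p))) \<in> borel_measurable lborel"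
    unfolding lborel_prod[symmetric] by measurable
  ultimately show ?thesis
    by (simp add: integrable_iff_bounded)
qed

text \<open>Up to its constant, the squared homogeneous Sobolev norm of order minus
  \<open>d / 2\<close>. It takes extended values so that it can be formed before finiteness is
  known.\<close>

definition log_energy :: "('a::euclidean_space \<Rightarrow> complex) \<Rightarrow> ennreal" where
  "log_energy g = ennreal (1 / sphere_area DIM('a)) * (\<integral>\<^sup>+\<zeta>. ennreal ((cmod (g \<zeta>))\<^sup>2 / norm \<zeta> ^ DIM('a)) \<partial>lborel)"

text \<open>The exchange of \<open>p\<close> and \<open>t\<close> rests on absolute integrability,
  the exchange of \<open>t\<close> and \<open>\<zeta>\<close> on positivity. Nonnegativity is
  recorded as well because \<open>ennreal\<close> would hide a negative covariance.\<close>

theorem log_cov_fourier: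
  fixes f :: "'a::euclidean_space \<Rightarrow> real"
  assumes d: "DIM('a) \<ge> 2" and f: "f \<in> schwartz0"
  shows "ennreal (log_cov f f) = log_energy (fourier (\<lambda>x. complex_of_real (f x)))"
    and "0 \<le> log_cov f f"
proof -
  have fs: "schwartz f" and f0: "(LINT x|lborel. f x) = 0" using f by (auto simp: schwartz0_def)
  have [measurable]: "f \<in> borel_measurable borel" by (rule schwartz_measurable[OF fs])
  have fi: "integrable lborel f" by (rule schwartz_integrable[OF fs])
  define F where "F = fourier (\<lambda>x. complex_of_real (f x))"
  have [measurable]: "F \<in> borel_measurable borel" unfolding F_def by measurable
  let ?P = "(lborel :: ('a \<times> 'a) measure)"
  define u where "u p = f (fst p) * f (snd p)" for p
  have [measurable]: "u \<in> borel_measurable borel"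
    unfolding u_def borel_prod[symmetric] by measurable
  have u_int: "integrable ?P u"
  proof -
    have "integrable (lborel \<Otimes>\<^sub>M lborel) (\<lambda>p. complex_of_real (f (fst p) * f (snd p)))"
      using integrable_prod_mult[of "\<lambda>x. complex_of_real (f x)" "\<lambda>x. complex_of_real (f x)"] fi
      by (simp add: split_beta')
    then show ?thesis
      unfolding lborel_prod[symmetric] u_def complex_of_real_integrable_eq .
  qed
  \<comment> \<open>The zero integral of \<open>f\<close> enters here: it removes the compensating
    term \<open>exp (- pi / t\<^sup>2)\<close> at every scale.\<close>
  have u0: "(LINT p|?P. u p) = 0"
  proof -
    have "(LINT p|?P. u p) = (LINT x|lborel. LINT y|lborel. u (x, y))"
      using u_int unfolding lborel_prod[symmetric] by (subst lborel_pair.integral_fst'[symmetric]) auto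
    then show ?thesis by (simp add: u_def f0)
  qed
  define h where "h p t = u p * log_scale_kernel (norm (fst p - snd p)) t" for p t
  have h_meas [measurable]: "(\<lambda>(p, t). h p t) \<in> borel_measurable (?P \<Otimes>\<^sub>M lborel)"
  proof -
    have [measurable]: "(\<lambda>p :: 'a \<times> 'a. norm (fst p - snd p)) \<in> borel_measurable borel"
      by (intro borel_measurable_continuous_onI continuous_intros)
    show ?thesis unfolding h_def by measurable
  qed
  have h_int: "integrable (?P \<Otimes>\<^sub>M lborel) (\<lambda>(p, t). h p t)"
  proof (rule lborel_pair.Fubini_integrable)
    have *: "AE p in ?P. (LINT t|lborel. norm (h p t)) = \<bar>u p * ln (norm (fst p - snd p))\<bar>"
      using AE_lborel_pair_distinct
      by eventually_elim (simp add: h_def abs_mult log_scale_kernel_integral)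
    have "integrable ?P (\<lambda>p. \<bar>u p * ln (norm (fst p - snd p))\<bar>)"
      unfolding u_def by (intro integrable_abs integrable_log_kernel d fs)
    then show "integrable ?P (\<lambda>p. LINT t|lborel. norm (case (p, t) of (p, t) \<Rightarrow> h p t))"
      using * by (subst integrable_cong_AE[where g="\<lambda>p. \<bar>u p * ln (norm (fst p - snd p))\<bar>"]) auto
    show "AE p in ?P. integrable lborel (\<lambda>t. case (p, t) of (p, t) \<Rightarrow> h p t)"
      using AE_lborel_pair_distinct
      by eventually_elim (simp add: h_def log_scale_kernel_integral)
  qed fact
  have "log_cov f f = (LINT p|?P. LINT t|lborel. h p t)"
    unfolding log_cov_def
  proof (rule integral_cong_AE)
    show "AE p in ?P. f (fst p) * f (snd p) * ln (1 / norm (fst p - snd p)) = (LINT t|lborel. h p t)"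
      using AE_lborel_pair_distinct
      by eventually_elim (simp add: h_def log_scale_kernel_integral u_def)
    have [measurable]: "(\<lambda>p :: 'a \<times> 'a. norm (fst p - snd p)) \<in> borel_measurable borel"
      by (intro borel_measurable_continuous_onI continuous_intros)
    show "(\<lambda>p. f (fst p) * f (snd p) * ln (1 / norm (fst p - snd p))) \<in> borel_measurable ?P"
      unfolding u_def[symmetric] by measurable
  qed measurable
  also have "\<dots> = (LINT t|lborel. LINT p|?P. h p t)"
    by (rule lborel_pair.Fubini_integral[symmetric]) (rule h_int)
  finally have lc: "log_cov f f = (LINT t|lborel. LINT p|?P. h p t)" .
  define J where "J t = (LINT \<zeta>|lborel. gauss (t *\<^sub>R \<zeta>) * (cmod (F \<zeta>))\<^sup>2)" for t
  have iJ: "integrable lborel (\<lambda>\<zeta>. gauss (t *\<^sub>R \<zeta>) * (cmod (F \<zeta>))\<^sup>2)" if "t > 0" for t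
  proof (rule Bochner_Integration.integrable_bound)
    show "integrable lborel (\<lambda>\<zeta>::'a. gauss (t *\<^sub>R \<zeta>) * (LINT x|lborel. \<bar>f x\<bar>)\<^sup>2)"
      using integrable_gauss_scaled[of t, where ?'a='a] that by simp
    have "cmod (F \<zeta>) \<le> (LINT x|lborel. \<bar>f x\<bar>)" for \<zeta>
      unfolding F_def using norm_fourier_le[of "\<lambda>x. complex_of_real (f x)"] fi by simp
    then show "AE \<zeta> in lborel. norm (gauss (t *\<^sub>R \<zeta>) * (cmod (F \<zeta>))\<^sup>2) \<le>
        norm (gauss (t *\<^sub>R \<zeta>) * (LINT x|lborel. \<bar>f x\<bar>)\<^sup>2)"
      by (auto intro!: mult_left_mono power_mono)
  qed simp
  \<comment> \<open>At a fixed scale the kernel is a Gaussian of width \<open>t\<close>, and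
    \<open>gauss_plancherel\<close> gives \<open>t ^ d * J t\<close>; the measure
    \<open>dt / t\<close> lowers the exponent by one.\<close>
  have inner: "(LINT p|?P. h p t) = t ^ (DIM('a) - 1) * J t" if t: "t > 0" for t
  proof -
    define k where "k p = gauss ((fst p - snd p) /\<^sub>R t)" for p :: "'a \<times> 'a"
    have [measurable]: "k \<in> borel_measurable borel"
      unfolding k_def by (intro borel_measurable_continuous_onI continuous_intros)
    have ui: "integrable ?P (\<lambda>p. u p * k p)"
    proof (rule Bochner_Integration.integrable_bound[OF u_int])
      have "\<bar>u p\<bar> * \<bar>k p\<bar> \<le> \<bar>u p\<bar>" for p
        by (intro mult_left_le) (auto simp: k_def gauss_le_1)
      then show "AE p in ?P. norm (u p * k p) \<le> norm (u p)" by (simp add: abs_mult)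
    qed measurable
    have "h p t = (u p * k p - u p * exp (- pi / t\<^sup>2)) / t" for p
      using t by (simp add: h_def log_scale_kernel_def k_def gauss_def power_mult_distrib right_diff_distrib divide_inverse power_inverse)
    then have "(LINT p|?P. h p t) = (LINT p|?P. u p * k p) / t"
      using ui u_int by (simp add: u0)
    also have "(LINT p|?P. u p * k p) = (LINT x|lborel. f x * (LINT y|lborel. f y * gauss ((x - y) /\<^sub>R t)))"
    proof -
      have "(LINT p|?P. u p * k p) = (LINT x|lborel. LINT y|lborel. u (x, y) * k (x, y))"
        using ui unfolding lborel_prod[symmetric] by (subst lborel_pair.integral_fst'[symmetric]) auto
      then show ?thesis by (simp add: u_def k_def mult.assoc)
    qed
    also have "\<dots> = t ^ DIM('a) * J t"
    proof -
      have "complex_of_real (J t) = complex_of_real (LINT x|lborel. f x * (LINT y|lborel. f y * (gauss ((x - y) /\<^sub>R t) / t ^ DIM('a))))"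
        unfolding J_def F_def using gauss_plancherel[of "\<lambda>x. complex_of_real (f x)" t] fi t
        by (simp flip: of_real_mult of_real_divide of_real_power)
      then have "J t = (LINT x|lborel. f x * (LINT y|lborel. f y * (gauss ((x - y) /\<^sub>R t) / t ^ DIM('a))))"
        by (simp only: of_real_eq_iff)
      also have "\<dots> = (LINT x|lborel. f x * (LINT y|lborel. f y * gauss ((x - y) /\<^sub>R t))) / t ^ DIM('a)"
        by simp
      finally show ?thesis using t by simp
    qed
    also have "t ^ DIM('a) * J t / t = t ^ (DIM('a) - 1) * J t"
      using t by (simp add: power_diff)
    finally show ?thesis .
  qed
  have inner': "(LINT p|?P. h p t) = indicator {0<..} t * (t ^ (DIM('a) - 1) * J t)" for t
    using inner[of t] by (cases "t > 0") (auto simp: h_def log_scale_kernel_def)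
  have J0: "J t \<ge> 0" for t unfolding J_def by (rule integral_nonneg_AE) auto
  have "integrable lborel (\<lambda>t. LINT p|?P. h p t)"
    using lborel_pair.integrable_snd[OF h_int] by simp
  then have int: "integrable lborel (\<lambda>t. indicator {0<..} t * (t ^ (DIM('a) - 1) * J t))"
    unfolding inner' .
  show "0 \<le> log_cov f f"
    unfolding lc inner' by (rule integral_nonneg_AE) (auto simp: J0 split: split_indicator)
  have "ennreal (log_cov f f) = (\<integral>\<^sup>+t. ennreal (indicator {0<..} t * (t ^ (DIM('a) - 1) * J t)) \<partial>lborel)"
    unfolding lc inner' using int
    by (intro nn_integral_eq_integral[symmetric]) (auto simp: J0 split: split_indicator)
  also have "\<dots> = (\<integral>\<^sup>+t. (\<integral>\<^sup>+\<zeta>. ennreal ((cmod (F \<zeta>))\<^sup>2) * (ennreal (t ^ (DIM('a) - 1) * gauss (t *\<^sub>R \<zeta>)) * indicator {0<..} t) \<partial>lborel) \<partial>lborel)"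
  proof (intro nn_integral_cong)
    fix t :: real
    show "ennreal (indicator {0<..} t * (t ^ (DIM('a) - 1) * J t)) =
       (\<integral>\<^sup>+\<zeta>. ennreal ((cmod (F \<zeta>))\<^sup>2) * (ennreal (t ^ (DIM('a) - 1) * gauss (t *\<^sub>R \<zeta>)) * indicator {0<..} t) \<partial>lborel)"
    proof (cases "t > 0")
      case True
      have "ennreal (J t) = (\<integral>\<^sup>+\<zeta>. ennreal (gauss (t *\<^sub>R \<zeta>) * (cmod (F \<zeta>))\<^sup>2) \<partial>lborel)"
        unfolding J_def by (rule nn_integral_eq_integral[symmetric]) (auto simp: iJ True)
      then have "ennreal (t ^ (DIM('a) - 1) * J t) = (\<integral>\<^sup>+\<zeta>. ennreal (t ^ (DIM('a) - 1)) * ennreal (gauss (t *\<^sub>R \<zeta>) * (cmod (F \<zeta>))\<^sup>2) \<partial>lborel)"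
        using True by (simp add: ennreal_mult J0 nn_integral_cmult)
      then show ?thesis using True by (simp add: ennreal_mult mult_ac)
    qed simp
  qed
  also have "\<dots> = (\<integral>\<^sup>+\<zeta>. (\<integral>\<^sup>+t. ennreal ((cmod (F \<zeta>))\<^sup>2) * (ennreal (t ^ (DIM('a) - 1) * gauss (t *\<^sub>R \<zeta>)) * indicator {0<..} t) \<partial>lborel) \<partial>lborel)"
    by (rule lborel_pair.Fubini') measurable
  also have "\<dots> = (\<integral>\<^sup>+\<zeta>. ennreal (1 / sphere_area DIM('a)) * ennreal ((cmod (F \<zeta>))\<^sup>2 / norm \<zeta> ^ DIM('a)) \<partial>lborel)"
  proof (rule nn_integral_cong_AE)
    have "AE \<zeta> in lborel. \<zeta> \<noteq> (0::'a)" by (rule AE_lborel_singleton)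
    then show "AE \<zeta> in lborel. (\<integral>\<^sup>+t. ennreal ((cmod (F \<zeta>))\<^sup>2) * (ennreal (t ^ (DIM('a) - 1) * gauss (t *\<^sub>R \<zeta>)) * indicator {0<..} t) \<partial>lborel) =
        ennreal (1 / sphere_area DIM('a)) * ennreal ((cmod (F \<zeta>))\<^sup>2 / norm \<zeta> ^ DIM('a))"
    proof eventually_elim
      case (elim \<zeta>)
      have "(\<integral>\<^sup>+t. ennreal ((cmod (F \<zeta>))\<^sup>2) * (ennreal (t ^ (DIM('a) - 1) * gauss (t *\<^sub>R \<zeta>)) * indicator {0<..} t) \<partial>lborel) =
          ennreal ((cmod (F \<zeta>))\<^sup>2) * (ennreal (1 / sphere_area DIM('a)) * ennreal (1 / norm \<zeta> ^ DIM('a)))"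
        unfolding nn_integral_gauss_dilation[OF elim, symmetric] by (rule nn_integral_cmult) measurable
      also have "\<dots> = ennreal (1 / sphere_area DIM('a)) * (ennreal ((cmod (F \<zeta>))\<^sup>2) * ennreal (1 / norm \<zeta> ^ DIM('a)))"
        by (simp only: mult_ac)
      also have "ennreal ((cmod (F \<zeta>))\<^sup>2) * ennreal (1 / norm \<zeta> ^ DIM('a)) = ennreal ((cmod (F \<zeta>))\<^sup>2 / norm \<zeta> ^ DIM('a))"
        by (simp flip: ennreal_mult)
      finally show ?case .
    qed
  qed
  also have "\<dots> = log_energy F"
    unfolding log_energy_def by (rule nn_integral_cmult) measurable
  finally show "ennreal (log_cov f f) = log_energy (fourier (\<lambda>x. complex_of_real (f x)))"
    by (simp add: F_def)
qed

subsection \<open>Rotation invariance\<close>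

lemma nn_integral_translate:
  fixes f :: "'a::euclidean_space \<Rightarrow> ennreal"
  assumes "f \<in> borel_measurable borel"
  shows "(\<integral>\<^sup>+x. f (x + a) \<partial>lborel) = (\<integral>\<^sup>+x. f x \<partial>lborel)"
  using nn_integral_affine[OF assms, of 1 a] by (simp add: add.commute)

text \<open>Uniqueness of Haar measure by the usual double integral, normalised on the unit ball,
  which an orthogonal map preserves.\<close>

lemma distr_lborel_orthogonal:
  fixes T :: "'a::euclidean_space \<Rightarrow> 'a"
  assumes T: "orthogonal_transformation T"
  shows "distr lborel borel T = lborel"
proof (rule measure_eqI)
  have lin: "linear T" and nT: "norm (T x) = norm x" for x
    using T by (auto simp: orthogonal_transformation)
  have Tm [measurable]: "T \<in> borel_measurable borel"
    using lin by (intro borel_measurable_continuous_onI linear_continuous_on) (simp add: linear_conv_bounded_linear)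
  have surj: "surj T" using T by (rule orthogonal_transformation_surj)
  define S where "S = inv T"
  have TS: "T (S y) = y" for y unfolding S_def by (rule surj_f_inv_f[OF surj])
  have add: "T (x + y) = T x + T y" "T (x - y) = T x - T y" for x y
    using lin by (simp_all add: linear_add linear_diff)
  fix A assume "A \<in> sets (distr lborel borel T)"
  then have A [measurable]: "A \<in> sets borel" by simp
  define B where "B = ball (0::'a) 1"
  have [measurable]: "B \<in> sets borel" by (simp add: B_def)
  define v where "v = emeasure lborel B"
  have v: "v \<noteq> 0" "v \<noteq> \<infinity>"
    using less_imp_neq[OF unit_ball_vol_pos[of "real DIM('a)"]] by (auto simp: v_def B_def emeasure_ball)
  have B_eq: "(\<integral>\<^sup>+x. indicator B (y - T x) \<partial>lborel) = v" for y
  proof -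
    have "indicator B (y - T x) = (indicator B (S y + (- 1) *\<^sub>R x) :: ennreal)" for x
      using nT[of "S y - x"] by (simp add: B_def add TS indicator_def)
    then have "(\<integral>\<^sup>+x. indicator B (y - T x) \<partial>lborel) = (\<integral>\<^sup>+x. indicator B (S y + (- 1) *\<^sub>R x) \<partial>lborel)"
      by simp
    also have "\<dots> = (\<integral>\<^sup>+x. indicator B x \<partial>lborel)"
      using nn_integral_affine[of "indicator B :: 'a \<Rightarrow> ennreal" "- 1" "S y"] by simp
    finally show ?thesis by (simp add: v_def)
  qed
  have "emeasure (distr lborel borel T) A * v = (\<integral>\<^sup>+x. indicator A (T x) \<partial>lborel) * (\<integral>\<^sup>+y. indicator B y \<partial>lborel)"
    by (simp add: v_def nn_integral_distr flip: nn_integral_indicator)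
  also have "\<dots> = (\<integral>\<^sup>+y. (\<integral>\<^sup>+x. indicator A (T x) \<partial>lborel) * indicator B y \<partial>lborel)"
    by (rule nn_integral_cmult[symmetric]) simp
  also have "\<dots> = (\<integral>\<^sup>+y. (\<integral>\<^sup>+x. indicator A (T x + y) * indicator B y \<partial>lborel) \<partial>lborel)"
  proof (rule nn_integral_cong)
    fix y
    have "(\<integral>\<^sup>+x. indicator A (T x) \<partial>lborel) = (\<integral>\<^sup>+x. indicator A (T (x + S y)) \<partial>(lborel :: 'a measure))"
      by (rule nn_integral_translate[symmetric]) measurable
    then show "(\<integral>\<^sup>+x. indicator A (T x) \<partial>lborel) * indicator B y = (\<integral>\<^sup>+x. indicator A (T x + y) * indicator B y \<partial>lborel)"
      by (simp add: add TS nn_integral_multc)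
  qed
  also have "\<dots> = (\<integral>\<^sup>+x. (\<integral>\<^sup>+y. indicator A (T x + y) * indicator B y \<partial>lborel) \<partial>lborel)"
    by (rule lborel_pair.Fubini') measurable
  also have "\<dots> = (\<integral>\<^sup>+x. (\<integral>\<^sup>+y. indicator A y * indicator B (y - T x) \<partial>lborel) \<partial>lborel)"
  proof (rule nn_integral_cong)
    fix x
    show "(\<integral>\<^sup>+y. indicator A (T x + y) * indicator B y \<partial>lborel) = (\<integral>\<^sup>+y. indicator A y * indicator B (y - T x) \<partial>lborel)"
      using nn_integral_translate[of "\<lambda>y. indicator A y * indicator B (y - T x)" "T x"] by (simp add: add.commute)
  qed
  also have "\<dots> = (\<integral>\<^sup>+y. (\<integral>\<^sup>+x. indicator A y * indicator B (y - T x) \<partial>lborel) \<partial>lborel)"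
    by (rule lborel_pair.Fubini') measurable
  also have "\<dots> = (\<integral>\<^sup>+y. indicator A y * v \<partial>lborel)"
    by (simp add: nn_integral_cmult B_eq)
  also have "\<dots> = emeasure lborel A * v"
    by (simp add: nn_integral_multc)
  finally show "emeasure (distr lborel borel T) A = emeasure lborel A"
    using v by (metis ennreal_mult_divide_eq infinity_ennreal_def)
qed simp

text \<open>An orthogonal map takes \<open>x\<close> to \<open>y\<close> when the norms agree; it
  preserves Lebesgue measure, the inner product and \<open>f\<close>.\<close>

lemma fourier_radial:
  fixes f :: "real ^ 'n \<Rightarrow> complex"
  assumes f: "radial f" and [measurable]: "f \<in> borel_measurable borel"
  shows "radial (fourier f)"
  unfolding radial_def
proof (intro allI impI)
  fix x y :: "real ^ 'n" assume "norm x = norm y"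
  then obtain T where T: "orthogonal_transformation T" "T x = y"
    using orthogonal_transformation_exists by metis
  have [measurable]: "T \<in> borel_measurable borel"
    using T by (intro borel_measurable_continuous_onI linear_continuous_on)
      (simp add: orthogonal_transformation linear_conv_bounded_linear)
  have fT: "f (T z) = f z" for z
    using f T unfolding radial_def by (metis orthogonal_transformation)
  have "fourier f y = (LINT z|distr lborel borel T. cis (- 2 * pi * (z \<bullet> y)) * f z)"
    by (simp add: fourier_def distr_lborel_orthogonal[OF T(1)])
  also have "\<dots> = (LINT z|lborel. cis (- 2 * pi * (T z \<bullet> T x)) * f (T z))"
    by (subst integral_distr) (auto simp: T(2))
  also have "\<dots> = fourier f x"
    using T(1) by (simp add: fourier_def fT orthogonal_transformation_def)
  finally show "fourier f x = fourier f y" ..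
qed

lemma radial_value_norm:
  assumes "radial f"
  shows "radial_value f (norm x) = f x"
  unfolding radial_value_def
proof (rule the_equality)
  show "\<forall>y. norm y = norm x \<longrightarrow> f y = f x" using assms unfolding radial_def by blast
  show "v = f x" if "\<forall>y. norm y = norm x \<longrightarrow> f y = v" for v using that by simp
qed

subsection \<open>The Fourier transform of a derivative\<close>

lemma real_derivative_along_line:
  fixes f :: "'a::real_normed_vector \<Rightarrow> real"
  assumes "f differentiable (at (x + s *\<^sub>R v))"
  shows "((\<lambda>s. f (x + s *\<^sub>R v)) has_real_derivative frechet_derivative f (at (x + s *\<^sub>R v)) v) (at s)"
proof -
  have 1: "(f has_derivative frechet_derivative f (at (x + s *\<^sub>R v))) (at (x + s *\<^sub>R v))"
    using assms by (simp add: frechet_derivative_works)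
  have 2: "((\<lambda>s. x + s *\<^sub>R v) has_derivative (\<lambda>h. h *\<^sub>R v)) (at s)"
    by (auto intro!: derivative_eq_intros)
  have "((\<lambda>s. f (x + s *\<^sub>R v)) has_derivative (\<lambda>h. frechet_derivative f (at (x + s *\<^sub>R v)) (h *\<^sub>R v))) (at s)"
    using has_derivative_compose[OF 2 1] .
  moreover have "frechet_derivative f (at (x + s *\<^sub>R v)) (h *\<^sub>R v) = h * frechet_derivative f (at (x + s *\<^sub>R v)) v" for h
    using has_derivative_linear[OF 1] by (simp add: linear_scale)
  ultimately show ?thesis by (simp add: has_field_derivative_def mult.commute[of _ "frechet_derivative f (at (x + s *\<^sub>R v)) v"])
qed

lemma compact_support_bounded_integrable:
  fixes f :: "'a::euclidean_space \<Rightarrow> real"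
  assumes cont: "continuous_on UNIV f" and supp: "\<And>x. norm x > R \<Longrightarrow> f x = 0"
  shows "integrable lborel f" "\<exists>B\<ge>0. \<forall>x. \<bar>f x\<bar> \<le> B"
proof -
  have eq: "(\<lambda>x. indicator (cball 0 R) x *\<^sub>R f x) = f"
    using supp by (auto simp: fun_eq_iff indicator_def dist_norm not_le)
  have cont': "continuous_on (cball 0 R) f" using cont continuous_on_subset by blast
  show "integrable lborel f"
    using borel_integrable_compact[OF compact_cball cont'] unfolding eq .
  obtain B where B: "\<forall>y\<in>f ` cball 0 R. norm y \<le> B"
    using compact_imp_bounded[OF compact_continuous_image[OF cont' compact_cball]] unfolding bounded_iff by blast
  have "\<bar>f x\<bar> \<le> max B 0" for x
  proof (cases "norm x \<le> R")
    case True
    then show ?thesis using B by (force simp: dist_norm le_max_iff_disj)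
  next
    case False
    then show ?thesis using supp[of x] by simp
  qed
  then show "\<exists>B\<ge>0. \<forall>x. \<bar>f x\<bar> \<le> B" by (intro exI[of _ "max B 0"]) auto
qed

lemma fourier_translate:
  fixes f :: "'a::euclidean_space \<Rightarrow> complex"
  assumes [measurable]: "f \<in> borel_measurable borel"
  shows "fourier (\<lambda>x. f (x + a)) \<zeta> = cis (2 * pi * (a \<bullet> \<zeta>)) * fourier f \<zeta>"
proof -
  have "fourier f \<zeta> = (LINT x|lborel. cis (- 2 * pi * ((a + 1 *\<^sub>R x) \<bullet> \<zeta>)) * f (a + 1 *\<^sub>R x))"
    unfolding fourier_def by (subst integral_affine[of _ 1 a]) auto
  also have "cis (2 * pi * (a \<bullet> \<zeta>)) * \<dots> = (LINT x|lborel. cis (2 * pi * (a \<bullet> \<zeta>)) * (cis (- 2 * pi * ((a + 1 *\<^sub>R x) \<bullet> \<zeta>)) * f (a + 1 *\<^sub>R x)))"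
    by simp
  also have "\<dots> = fourier (\<lambda>x. f (x + a)) \<zeta>"
    unfolding fourier_def
  proof (intro Bochner_Integration.integral_cong refl)
    fix x
    have "cis (2 * pi * (a \<bullet> \<zeta>)) * cis (- 2 * pi * ((a + 1 *\<^sub>R x) \<bullet> \<zeta>)) = cis (- 2 * pi * (x \<bullet> \<zeta>))"
      unfolding cis_mult by (rule arg_cong[where f=cis]) (simp add: inner_add_left distrib_left)
    then show "cis (2 * pi * (a \<bullet> \<zeta>)) * (cis (- 2 * pi * ((a + 1 *\<^sub>R x) \<bullet> \<zeta>)) * f (a + 1 *\<^sub>R x)) = cis (- 2 * pi * (x \<bullet> \<zeta>)) * f (x + a)"
      by (simp only: mult.assoc[symmetric] scaleR_one add.commute[of a])
  qed
  finally show ?thesis by simp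
qed

lemma cis_difference_quotient:
  assumes "t \<longlonglongrightarrow> 0" "\<And>n. t n \<noteq> (0::real)"
  shows "(\<lambda>n. (cis (a * t n) - 1) / complex_of_real (t n)) \<longlonglongrightarrow> \<i> * complex_of_real a"
proof -
  have "((\<lambda>z. exp (\<i> * complex_of_real a * z)) has_field_derivative \<i> * complex_of_real a) (at 0)"
    by (auto intro!: derivative_eq_intros)
  then have "((\<lambda>h. (exp (\<i> * complex_of_real a * h) - 1) / h) \<longlongrightarrow> \<i> * complex_of_real a) (at 0)"
    by (simp add: DERIV_def)
  moreover have "filterlim (\<lambda>n. complex_of_real (t n)) (at 0) sequentially"
    using assms tendsto_of_real[OF assms(1), where ?'a=complex] by (auto simp: filterlim_at)
  ultimately have "(\<lambda>n. (exp (\<i> * complex_of_real a * complex_of_real (t n)) - 1) / complex_of_real (t n)) \<longlonglongrightarrow> \<i> * complex_of_real a"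
    by (rule filterlim_compose)
  then show ?thesis by (simp add: cis_conv_exp mult.assoc)
qed

text \<open>The transform of a difference quotient is explicit by translation, and compact support
  provides a majorant for the quotients; dominated convergence replaces integration by
  parts.\<close>

lemma fourier_directional_derivative:
  fixes f :: "'a::euclidean_space \<Rightarrow> real"
  defines "D \<equiv> \<lambda>v x. frechet_derivative f (at x) v"
  assumes diff: "\<And>x. f differentiable (at x)" and cont: "continuous_on UNIV f"
    and contD: "continuous_on UNIV (D v)" and supp: "\<And>x. norm x > R \<Longrightarrow> f x = 0"
    and suppD: "\<And>x. norm x > R \<Longrightarrow> D v x = 0"
  shows "fourier (\<lambda>x. complex_of_real (D v x)) \<zeta> = \<i> * complex_of_real (2 * pi * (v \<bullet> \<zeta>)) * fourier (\<lambda>x. complex_of_real (f x)) \<zeta>"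
proof -
  have [measurable]: "f \<in> borel_measurable borel" "D v \<in> borel_measurable borel"
    using cont contD by (auto intro: borel_measurable_continuous_onI)
  have fi: "integrable lborel f" by (rule compact_support_bounded_integrable(1)[OF cont supp])
  obtain B where B: "B \<ge> 0" "\<And>x. \<bar>D v x\<bar> \<le> B"
    using compact_support_bounded_integrable(2)[OF contD suppD] by metis
  define t where "t n = 1 / real (Suc n)" for n
  have t: "0 < t n" "t n \<le> 1" for n by (simp_all add: t_def)
  have t0: "t \<longlonglongrightarrow> 0" unfolding t_def using LIMSEQ_Suc[OF lim_1_over_n] by simp
  define q where "q n x = (f (x + t n *\<^sub>R v) - f x) / t n" for n x
  have [measurable]: "q n \<in> borel_measurable borel" for n unfolding q_def by measurable
  have line: "((\<lambda>s. f (x + s *\<^sub>R v)) has_real_derivative D v (x + s *\<^sub>R v)) (at s)" for x s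
    unfolding D_def by (rule real_derivative_along_line[OF diff])
  have q_lim: "(\<lambda>n. q n x) \<longlonglongrightarrow> D v x" for x
  proof -
    have "((\<lambda>h. (f (x + h *\<^sub>R v) - f x) / h) \<longlongrightarrow> D v x) (at 0)"
      using line[of x 0] by (simp add: DERIV_def)
    moreover have "filterlim t (at 0) sequentially"
      using t0 t(1) by (simp add: filterlim_at less_imp_neq[symmetric])
    ultimately show ?thesis unfolding q_def by (rule filterlim_compose)
  qed
  \<comment> \<open>The mean value theorem bounds the quotient by \<open>B\<close>. Since
    \<open>t n \<le> 1\<close>, it vanishes outside the ball of radius \<open>R + norm v\<close>,
    which gives one dominating function for all \<open>n\<close>.\<close>
  have q_bound: "\<bar>q n x\<bar> \<le> B * indicator (cball 0 (R + norm v)) x" for n x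
  proof (cases "norm x \<le> R + norm v")
    case True
    obtain z where "f (x + t n *\<^sub>R v) - f (x + 0 *\<^sub>R v) = (t n - 0) * D v (x + z *\<^sub>R v)"
      using MVT2[of 0 "t n" "\<lambda>s. f (x + s *\<^sub>R v)" "\<lambda>s. D v (x + s *\<^sub>R v)"] line t by blast
    then have "q n x = D v (x + z *\<^sub>R v)"
      using t(1)[of n] by (simp add: q_def)
    then show ?thesis using B True by (simp add: dist_norm)
  next
    case False
    have "norm x \<le> norm (x + t n *\<^sub>R v) + norm (t n *\<^sub>R v)"
      by (metis add_diff_cancel_right' norm_triangle_ineq4)
    moreover have "norm (t n *\<^sub>R v) \<le> norm v"
      using t[of n] by (simp add: mult_left_le_one_le)
    ultimately have "norm (x + t n *\<^sub>R v) > R" "norm x > R"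
      using False norm_ge_zero[of v] by linarith+
    then show ?thesis using supp B by (simp add: q_def)
  qed
  have "(\<lambda>n. fourier (\<lambda>x. complex_of_real (q n x)) \<zeta>) \<longlonglongrightarrow> fourier (\<lambda>x. complex_of_real (D v x)) \<zeta>"
    unfolding fourier_def
  proof (rule integral_dominated_convergence)
    show "integrable lborel (\<lambda>x::'a. B * indicator (cball 0 (R + norm v)) x)"
      using emeasure_lborel_cball_finite[of "0::'a" "R + norm v"] by simp
    show "AE x in lborel. (\<lambda>n. cis (- 2 * pi * (x \<bullet> \<zeta>)) * complex_of_real (q n x)) \<longlonglongrightarrow> cis (- 2 * pi * (x \<bullet> \<zeta>)) * complex_of_real (D v x)"
      by (intro AE_I2 tendsto_intros q_lim)
    show "AE x in lborel. norm (cis (- 2 * pi * (x \<bullet> \<zeta>)) * complex_of_real (q n x)) \<le> B * indicator (cball 0 (R + norm v)) x" for n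
      using q_bound by (simp add: norm_mult)
  qed simp_all
  moreover have "fourier (\<lambda>x. complex_of_real (q n x)) \<zeta> =
      (cis (2 * pi * (v \<bullet> \<zeta>) * t n) - 1) / complex_of_real (t n) * fourier (\<lambda>x. complex_of_real (f x)) \<zeta>" for n
  proof -
    have i1: "integrable lborel (\<lambda>x. cis (- 2 * pi * (x \<bullet> \<zeta>)) * complex_of_real (f (x + t n *\<^sub>R v)))"
      using integrable_affine[OF fi, of 1 "t n *\<^sub>R v"] by (intro integrable_cis_mult) (simp_all add: add.commute)
    have i2: "integrable lborel (\<lambda>x. cis (- 2 * pi * (x \<bullet> \<zeta>)) * complex_of_real (f x))"
      using fi by (intro integrable_cis_mult) simp_all
    have "fourier (\<lambda>x. complex_of_real (q n x)) \<zeta> =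
        (LINT x|lborel. (cis (- 2 * pi * (x \<bullet> \<zeta>)) * complex_of_real (f (x + t n *\<^sub>R v)) - cis (- 2 * pi * (x \<bullet> \<zeta>)) * complex_of_real (f x)) / complex_of_real (t n))"
      unfolding fourier_def q_def by (intro Bochner_Integration.integral_cong refl) (simp add: right_diff_distrib)
    also have "\<dots> = (fourier (\<lambda>x. complex_of_real (f (x + t n *\<^sub>R v))) \<zeta> - fourier (\<lambda>x. complex_of_real (f x)) \<zeta>) / complex_of_real (t n)"
      unfolding fourier_def using i1 i2 by simp
    also have "fourier (\<lambda>x. complex_of_real (f (x + t n *\<^sub>R v))) \<zeta> = cis (2 * pi * ((t n *\<^sub>R v) \<bullet> \<zeta>)) * fourier (\<lambda>x. complex_of_real (f x)) \<zeta>"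
      by (rule fourier_translate) measurable
    finally show ?thesis by (simp add: field_simps)
  qed
  ultimately have 1: "(\<lambda>n. (cis (2 * pi * (v \<bullet> \<zeta>) * t n) - 1) / complex_of_real (t n) * fourier (\<lambda>x. complex_of_real (f x)) \<zeta>) \<longlonglongrightarrow> fourier (\<lambda>x. complex_of_real (D v x)) \<zeta>"
    by simp
  have t_ne: "t n \<noteq> 0" for n using t(1)[of n] by simp
  have 2: "(\<lambda>n. (cis (2 * pi * (v \<bullet> \<zeta>) * t n) - 1) / complex_of_real (t n) * fourier (\<lambda>x. complex_of_real (f x)) \<zeta>) \<longlonglongrightarrow>
      \<i> * complex_of_real (2 * pi * (v \<bullet> \<zeta>)) * fourier (\<lambda>x. complex_of_real (f x)) \<zeta>"
    by (intro tendsto_mult tendsto_const cis_difference_quotient t0 t_ne)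
  show ?thesis using LIMSEQ_unique[OF 1 2] .
qed

lemma iter_deriv_outside_support:
  fixes f :: "'a::euclidean_space \<Rightarrow> real"
  assumes "\<And>x. norm x > R \<Longrightarrow> f x = 0" "norm x > R"
  shows "iter_deriv vs f x = 0"
  using assms(2)
proof (induction vs arbitrary: x)
  case Nil
  then show ?case using assms(1) by simp
next
  case (Cons v vs)
  have op: "open {y::'a. norm y > R}" by (intro open_Collect_less continuous_intros)
  have "((\<lambda>y. 0) has_derivative (\<lambda>h. 0)) (at x)" by simp
  then have "(iter_deriv vs f has_derivative (\<lambda>h. 0)) (at x)"
    by (rule has_derivative_transform_within_open[OF _ op]) (use Cons in auto)
  then show ?case using frechet_derivative_at by (metis iter_deriv.simps(2))
qed

text \<open>Taking moduli discards the powers of the imaginary unit.\<close>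

lemma fourier_iter_deriv:
  fixes f :: "'a::euclidean_space \<Rightarrow> real"
  assumes f: "smooth f" and supp: "\<And>x. norm x > R \<Longrightarrow> f x = 0"
  shows "cmod (fourier (\<lambda>x. complex_of_real (iter_deriv (replicate m v) f x)) \<zeta>) =
    \<bar>2 * pi * (v \<bullet> \<zeta>)\<bar> ^ m * cmod (fourier (\<lambda>x. complex_of_real (f x)) \<zeta>)"
proof (induction m)
  case (Suc m)
  let ?g = "iter_deriv (replicate m v) f"
  have cD: "continuous_on UNIV (\<lambda>x. frechet_derivative ?g (at x) v)"
    using smooth_continuous[OF f, of UNIV "v # replicate m v"] by simp
  have sD: "frechet_derivative ?g (at x) v = 0" if "norm x > R" for x
    using iter_deriv_outside_support[of R f x "v # replicate m v", OF supp that] by simp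
  have "fourier (\<lambda>x. complex_of_real (frechet_derivative ?g (at x) v)) \<zeta> =
      \<i> * complex_of_real (2 * pi * (v \<bullet> \<zeta>)) * fourier (\<lambda>x. complex_of_real (?g x)) \<zeta>"
    by (rule fourier_directional_derivative[where R=R])
      (use f supp cD sD in \<open>auto intro: smooth_iter_deriv_differentiable smooth_continuous iter_deriv_outside_support\<close>)
  then show ?case
    using Suc by (simp add: norm_mult abs_mult)
qed simp

text \<open>Powers of \<open>t\<close> become derivatives in the direction \<open>e\<close>, whose
  transforms are bounded by their absolute integrals. One ray suffices for the later use, where the
  transform is radial.\<close>

lemma smooth_compact_support_fourier_decay:
  fixes f :: "'a::euclidean_space \<Rightarrow> real"
  assumes f: "smooth f" and supp: "\<And>x. norm x > R \<Longrightarrow> f x = 0" and e: "norm e = 1"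
  shows "\<exists>C\<ge>0. \<forall>t\<ge>0. cmod (fourier (\<lambda>x. complex_of_real (f x)) (t *\<^sub>R e)) \<le> C / (1 + t) ^ m"
proof -
  let ?F = "fourier (\<lambda>x. complex_of_real (f x))"
  have bound: "\<exists>C. \<forall>t\<ge>0. t ^ k * cmod (?F (t *\<^sub>R e)) \<le> C" for k
  proof -
    let ?g = "iter_deriv (replicate k e) f"
    have gi: "integrable lborel (\<lambda>x. complex_of_real (?g x))"
      using compact_support_bounded_integrable(1)[OF smooth_continuous[OF f] iter_deriv_outside_support[OF supp]]
      by simp
    show ?thesis
    proof (intro exI allI impI)
      fix t :: real assume t: "t \<ge> 0"
      have "t ^ k * cmod (?F (t *\<^sub>R e)) \<le> (2 * pi * t) ^ k * cmod (?F (t *\<^sub>R e))"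
        using t pi_ge_two by (intro mult_right_mono power_mono) (auto simp: mult_le_cancel_right1)
      also have "\<dots> = cmod (fourier (\<lambda>x. complex_of_real (?g x)) (t *\<^sub>R e))"
        using t e by (subst fourier_iter_deriv[OF f supp]) (auto simp: abs_mult dot_square_norm)
      also have "\<dots> \<le> (LINT x|lborel. cmod (complex_of_real (?g x)))"
        by (rule norm_fourier_le[OF gi])
      finally show "t ^ k * cmod (?F (t *\<^sub>R e)) \<le> (LINT x|lborel. cmod (complex_of_real (?g x)))" .
    qed
  qed
  obtain C0 where C0: "\<And>t. t \<ge> 0 \<Longrightarrow> cmod (?F (t *\<^sub>R e)) \<le> C0" using bound[of 0] by auto
  obtain C1 where C1: "\<And>t. t \<ge> 0 \<Longrightarrow> t ^ m * cmod (?F (t *\<^sub>R e)) \<le> C1" using bound[of m] by auto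
  \<comment> \<open>Since \<open>1 + t\<close> is at most 2 for \<open>t \<le> 1\<close> and at most
    \<open>2 * t\<close> afterwards, the bounds for the powers 0 and \<open>m\<close> combine at the
    cost of \<open>2 ^ m\<close>.\<close>
  define C where "C = 2 ^ m * max C0 C1"
  have m0: "0 \<le> max C0 C1" using order_trans[OF norm_ge_zero C0[of 0]] by (simp add: le_max_iff_disj)
  show ?thesis
  proof (intro exI conjI allI impI)
    show "C \<ge> 0" using m0 by (simp add: C_def)
    fix t :: real assume t: "t \<ge> 0"
    have "(1 + t) ^ m * cmod (?F (t *\<^sub>R e)) \<le> C"
    proof (cases "t \<le> 1")
      case True
      have "(1 + t) ^ m * cmod (?F (t *\<^sub>R e)) \<le> 2 ^ m * max C0 C1"
        using True t C0[OF t] by (intro mult_mono power_mono) auto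
      then show ?thesis by (simp add: C_def)
    next
      case False
      have "(1 + t) ^ m * cmod (?F (t *\<^sub>R e)) \<le> (2 * t) ^ m * cmod (?F (t *\<^sub>R e))"
        using False by (intro mult_right_mono power_mono) auto
      also have "\<dots> = 2 ^ m * (t ^ m * cmod (?F (t *\<^sub>R e)))"
        by (simp add: power_mult_distrib)
      also have "\<dots> \<le> C"
        unfolding C_def using C1[OF t] by (intro mult_left_mono) auto
      finally show ?thesis .
    qed
    then show "cmod (?F (t *\<^sub>R e)) \<le> C / (1 + t) ^ m"
      using t by (simp add: pos_le_divide_eq mult.commute)
  qed
qed


subsection \<open>The mollifier in Fourier space\<close>

definition mollifier_hat :: "('a::euclidean_space \<Rightarrow> real) \<Rightarrow> 'a \<Rightarrow> real" where
  "mollifier_hat K \<zeta> = sqrt (sphere_area DIM('a) *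
       (LINT t:{norm \<zeta>..}|lborel. t ^ (DIM('a) - 1) *
          (cmod (radial_value (fourier (\<lambda>z. complex_of_real (K z))) t))\<^sup>2))"

lemma mollifier_eq: "mollifier K x = Re (inv_fourier (\<lambda>\<zeta>. complex_of_real (mollifier_hat K \<zeta>)) x)"
  by (simp add: mollifier_def mollifier_hat_def sphere_area_def)

text \<open>Only decay is required, without derivatives, as \<open>mollifier_hat K\<close> need not
  be smooth. Decay of a symbol is smoothness of its inverse transform.\<close>

definition rapidly_decaying :: "('a::real_normed_vector \<Rightarrow> real) \<Rightarrow> bool" where
  "rapidly_decaying g \<longleftrightarrow> (\<forall>m. \<exists>C\<ge>0. \<forall>x. \<bar>g x\<bar> \<le> C / (1 + norm x) ^ m)"

locale radial_bump =
  fixes K :: "real ^ 'n \<Rightarrow> real"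
  assumes K_radial: "radial K" and K_smooth: "smooth K"
    and K_support: "compact (closure {x. K x \<noteq> 0})"
begin

definition K_hat :: "real ^ 'n \<Rightarrow> complex" where
  "K_hat = fourier (\<lambda>z. complex_of_real (K z))"

definition profile :: "real \<Rightarrow> real" where
  "profile t = t ^ (CARD('n) - 1) * (cmod (radial_value K_hat t))\<^sup>2"

definition tail :: "real \<Rightarrow> real" where
  "tail r = (LINT t:{r..}|lborel. profile t)"

lemma K_continuous: "continuous_on A K"
  using smooth_continuous[OF K_smooth, of A "[]"] by simp

lemma K_measurable [measurable]: "K \<in> borel_measurable borel"
  by (rule borel_measurable_continuous_onI[OF K_continuous])

lemma support_radius: "\<exists>R. \<forall>x. norm x > R \<longrightarrow> K x = 0"
proof -
  have "bounded {x. K x \<noteq> 0}"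
    using compact_imp_bounded[OF K_support] closure_subset bounded_subset by blast
  then obtain R where "R > 0" "\<And>x. K x \<noteq> 0 \<Longrightarrow> norm x \<le> R"
    unfolding bounded_pos by auto
  then show ?thesis by (meson not_le)
qed

lemma K_integrable: "integrable lborel K" and K_bounded: "\<exists>B\<ge>0. \<forall>x. \<bar>K x\<bar> \<le> B"
proof -
  obtain R where R: "\<And>x. norm x > R \<Longrightarrow> K x = 0" using support_radius by auto
  from compact_support_bounded_integrable[OF K_continuous R]
  show "integrable lborel K" "\<exists>B\<ge>0. \<forall>x. \<bar>K x\<bar> \<le> B" by auto
qed

lemma K_hat_measurable [measurable]: "K_hat \<in> borel_measurable borel"
  unfolding K_hat_def by measurable

lemma K_hat_radial: "radial K_hat"
proof -
  have "radial (\<lambda>z. complex_of_real (K z))"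
    using K_radial unfolding radial_def by metis
  then show ?thesis unfolding K_hat_def by (rule fourier_radial) measurable
qed

lemma radial_value_K_hat: "radial_value K_hat (norm \<zeta>) = K_hat \<zeta>"
  by (rule radial_value_norm[OF K_hat_radial])

lemma radial_value_eq:
  assumes "norm e = 1" "t \<ge> 0"
  shows "radial_value K_hat t = K_hat (t *\<^sub>R e)"
  using radial_value_K_hat[of "t *\<^sub>R e"] assms by simp

lemma profile_measurable [measurable]: "profile \<in> borel_measurable borel"
proof -
  define e :: "real ^ 'n" where "e = axis undefined 1"
  have e: "norm e = 1" by (simp add: e_def)
  \<comment> \<open>No vector has negative norm, so for \<open>t < 0\<close> the definite
    description ranges over a vacuous condition and is one fixed value; measurability on the whole
    line is not disturbed.\<close>
  have "radial_value K_hat t = (if t \<ge> 0 then K_hat (t *\<^sub>R e) else (THE v. True))" for t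
  proof (cases "t \<ge> 0")
    case False
    then have "norm x \<noteq> t" for x :: "real ^ 'n" using norm_ge_zero[of x] by linarith
    then show ?thesis using False by (simp add: radial_value_def)
  qed (simp add: radial_value_eq[OF e])
  then show ?thesis unfolding profile_def by simp
qed

lemma profile_nonneg: "t \<ge> 0 \<Longrightarrow> profile t \<ge> 0"
  by (simp add: profile_def)

section \<open>Decay and continuity of the radial tail\<close>

text \<open>The two spare powers become the integrable factor \<open>1 / (1 + t)\<^sup>2\<close>
  when the tail is estimated.\<close>

lemma profile_decay: "\<exists>C\<ge>0. \<forall>t\<ge>0. profile t \<le> C / (1 + t) ^ (m + 2)"
proof -
  define d where "d = CARD('n)"
  define e :: "real ^ 'n" where "e = axis undefined 1"
  have e: "norm e = 1" by (simp add: e_def)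
  obtain R where R: "\<And>x. norm x > R \<Longrightarrow> K x = 0" using support_radius by auto
  obtain C where C: "C \<ge> 0" "\<And>t. t \<ge> 0 \<Longrightarrow> cmod (K_hat (t *\<^sub>R e)) \<le> C / (1 + t) ^ (d + m + 2)"
    using smooth_compact_support_fourier_decay[where m="d + m + 2", OF K_smooth R e, folded K_hat_def] by auto
  have "profile t \<le> C\<^sup>2 / (1 + t) ^ (m + 2)" if t: "t \<ge> 0" for t
  proof -
    have "profile t \<le> (1 + t) ^ (d - 1) * (C / (1 + t) ^ (d + m + 2))\<^sup>2"
      unfolding profile_def radial_value_eq[OF e t] d_def[symmetric]
      using t C by (intro mult_mono power_mono) auto
    also have "\<dots> = C\<^sup>2 * ((1 + t) ^ (d - 1) / (1 + t) ^ (2 * (d + m + 2)))"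
      unfolding power_even_eq power_divide by simp
    also have "\<dots> \<le> C\<^sup>2 * (1 / (1 + t) ^ (m + 2))"
    proof (rule mult_left_mono)
      have "(1 + t) ^ (d - 1) * (1 + t) ^ (m + 2) = (1 + t) ^ (d - 1 + (m + 2))"
        by (simp only: power_add)
      also have "\<dots> \<le> (1 + t) ^ (2 * (d + m + 2))"
        using t by (intro power_increasing) auto
      finally show "(1 + t) ^ (d - 1) / (1 + t) ^ (2 * (d + m + 2)) \<le> 1 / (1 + t) ^ (m + 2)"
        using t by (simp add: divide_simps)
    qed simp
    finally show ?thesis by simp
  qed
  then show ?thesis by (intro exI[of _ "C\<^sup>2"]) auto
qed

lemma profile_integrable:
  assumes "r \<ge> 0"
  shows "integrable lborel (\<lambda>t. indicator {r..} t * profile t)"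
proof -
  obtain C where C: "C \<ge> 0" "\<And>t. t \<ge> 0 \<Longrightarrow> profile t \<le> C / (1 + t) ^ 2"
    using profile_decay[of 0] unfolding add_0 by blast
  have "integrable lborel (\<lambda>t. C * (1 / (1 + t)\<^sup>2 * indicator {0..} t))"
  proof (intro integrable_mult_right)
    show "integrable lborel (\<lambda>t::real. 1 / (1 + t)\<^sup>2 * indicator {0..} t)"
    proof (rule integrableI_nonneg)
      have "(\<integral>\<^sup>+t. ennreal (1 / (1 + t)\<^sup>2 * indicator {0..} t) \<partial>lborel) = (\<integral>\<^sup>+t. ennreal (1 / (1 + t)\<^sup>2) * indicator {0..} t \<partial>lborel)"
        by (intro nn_integral_cong) (auto split: split_indicator)
      then show "(\<integral>\<^sup>+t. ennreal (1 / (1 + t)\<^sup>2 * indicator {0..} t) \<partial>lborel) < \<infinity>"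
        by (simp add: nn_integral_inverse_square)
    qed (auto split: split_indicator)
  qed
  then show ?thesis
  proof (rule Bochner_Integration.integrable_bound)
    show "AE t in lborel. norm (indicator {r..} t * profile t) \<le> norm (C * (1 / (1 + t)\<^sup>2 * indicator {0..} t))"
    proof (rule AE_I2)
      fix t :: real
      show "norm (indicator {r..} t * profile t) \<le> norm (C * (1 / (1 + t)\<^sup>2 * indicator {0..} t))"
      proof (cases "r \<le> t")
        case True
        then have "t \<ge> 0" using assms by simp
        then show ?thesis using True C(1) C(2)[of t] profile_nonneg[of t] by (simp add: abs_mult)
      qed simp
    qed
  qed measurable
qed

lemma tail_eq: "tail r = (LINT t|lborel. indicator {r..} t * profile t)"
  by (simp add: tail_def set_lebesgue_integral_def)

lemma tail_nonneg: "r \<ge> 0 \<Longrightarrow> tail r \<ge> 0"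
  unfolding tail_eq by (intro integral_nonneg_AE AE_I2) (auto split: split_indicator intro: profile_nonneg)

lemma ennreal_tail:
  assumes "r \<ge> 0"
  shows "ennreal (tail r) = (\<integral>\<^sup>+t. ennreal (profile t) * indicator {r..} t \<partial>lborel)"
proof -
  have "ennreal (tail r) = (\<integral>\<^sup>+t. ennreal (indicator {r..} t * profile t) \<partial>lborel)"
    unfolding tail_eq using assms
    by (intro nn_integral_eq_integral[symmetric] profile_integrable AE_I2)
      (auto split: split_indicator intro!: profile_nonneg)
  then show ?thesis by (auto intro!: nn_integral_cong split: split_indicator)
qed

lemma mollifier_hat_eq: "mollifier_hat K \<zeta> = sqrt (sphere_area CARD('n) * tail (norm \<zeta>))"
  by (simp add: mollifier_hat_def tail_def profile_def K_hat_def)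

lemma mollifier_hat_nonneg: "mollifier_hat K \<zeta> \<ge> 0"
  unfolding mollifier_hat_eq using sphere_area_pos[of "CARD('n)"] by (simp add: tail_nonneg)

lemma mollifier_hat_square: "(mollifier_hat K \<zeta>)\<^sup>2 = sphere_area CARD('n) * tail (norm \<zeta>)"
  unfolding mollifier_hat_eq using sphere_area_pos[of "CARD('n)"] by (simp add: tail_nonneg)

lemma mollifier_hat_minus: "mollifier_hat K (- \<zeta>) = mollifier_hat K \<zeta>"
  by (simp add: mollifier_hat_def)

text \<open>When the endpoint moves to \<open>a\<close>, the indicators of the half-lines converge
  at every point other than \<open>a\<close>, so dominated convergence applies.\<close>

lemma tail_continuous: "continuous_on {0..} tail"
proof (rule continuous_on_sequentiallyI)
  fix u :: "nat \<Rightarrow> real" and a assume u: "\<forall>n. u n \<in> {0..}" and a: "a \<in> {0..}" and ua: "u \<longlonglongrightarrow> a"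
  show "(\<lambda>n. tail (u n)) \<longlonglongrightarrow> tail a"
    unfolding tail_eq
  proof (rule integral_dominated_convergence)
    show "integrable lborel (\<lambda>t. indicator {0..} t * profile t)" by (rule profile_integrable) simp
    have "AE t in lborel. t \<noteq> a" by (rule AE_lborel_singleton)
    then show "AE t in lborel. (\<lambda>n. indicator {u n..} t * profile t) \<longlonglongrightarrow> indicator {a..} t * profile t"
    proof eventually_elim
      case (elim t)
      have "eventually (\<lambda>n. indicator {u n..} t * profile t = indicator {a..} t * profile t) sequentially"
      proof (cases "t < a")
        case True
        show ?thesis
          using order_tendstoD(1)[OF ua True] by (rule eventually_mono) (use True in simp)
      next
        case False
        then have "t > a" using elim by simp
        show ?thesis
          using order_tendstoD(2)[OF ua \<open>t > a\<close>] by (rule eventually_mono) (use \<open>t > a\<close> in simp)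
      qed
      then show ?case by (rule tendsto_eventually)
    qed
    show "AE t in lborel. norm (indicator {u n..} t * profile t) \<le> indicator {0..} t * profile t" for n
    proof (rule AE_I2)
      fix t
      have "u n \<ge> 0" using u by simp
      then show "norm (indicator {u n..} t * profile t) \<le> indicator {0..} t * profile t"
        using profile_nonneg[of t] by (auto split: split_indicator)
    qed
  qed measurable
qed

lemma mollifier_hat_continuous: "continuous_on A (mollifier_hat K)"
proof -
  have "continuous_on A (\<lambda>\<zeta>. tail (norm (\<zeta> :: real ^ 'n)))"
    by (rule continuous_on_compose2[OF tail_continuous]) (auto intro: continuous_intros)
  then show ?thesis unfolding mollifier_hat_eq[abs_def] by (intro continuous_intros)
qed

lemma tail_decay: "\<exists>C\<ge>0. \<forall>r\<ge>0. tail r \<le> C / (1 + r) ^ m"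
proof -
  obtain C where C: "C \<ge> 0" "\<And>t. t \<ge> 0 \<Longrightarrow> profile t \<le> C / (1 + t) ^ (m + 2)" using profile_decay[of m] by auto
  have "tail r \<le> C / (1 + r) ^ m" if r: "r \<ge> 0" for r
  proof -
    have "ennreal (tail r) \<le> (\<integral>\<^sup>+t. ennreal (C / (1 + r) ^ m) * (ennreal (1 / (1 + t)\<^sup>2) * indicator {0..} t) \<partial>lborel)"
      unfolding ennreal_tail[OF r]
    proof (rule nn_integral_mono)
      fix t :: real
      show "ennreal (profile t) * indicator {r..} t \<le> ennreal (C / (1 + r) ^ m) * (ennreal (1 / (1 + t)\<^sup>2) * indicator {0..} t)"
      proof (cases "r \<le> t")
        case True
        have "profile t \<le> C / (1 + t) ^ (m + 2)" using C(2) r True by simp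
        also have "\<dots> = C * (1 / (1 + t) ^ m) * (1 / (1 + t)\<^sup>2)" by (simp add: power_add power2_eq_square)
        also have "\<dots> \<le> C * (1 / (1 + r) ^ m) * (1 / (1 + t)\<^sup>2)"
          using C(1) r True by (intro mult_right_mono mult_left_mono divide_left_mono power_mono) auto
        finally have "ennreal (profile t) \<le> ennreal (C / (1 + r) ^ m * (1 / (1 + t)\<^sup>2))"
          by (intro ennreal_leI) simp
        also have "\<dots> = ennreal (C / (1 + r) ^ m) * ennreal (1 / (1 + t)\<^sup>2)"
          using C(1) r by (intro ennreal_mult) auto
        finally show ?thesis using r True by simp
      qed simp
    qed
    also have "\<dots> = ennreal (C / (1 + r) ^ m)"
      by (subst nn_integral_cmult) (auto simp: nn_integral_inverse_square)
    finally show ?thesis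
      using C(1) r by (subst (asm) ennreal_le_iff) auto
  qed
  then show ?thesis using C(1) by (intro exI[of _ C]) auto
qed

lemma mollifier_hat_rapidly_decaying: "rapidly_decaying (mollifier_hat K)"
  unfolding rapidly_decaying_def
proof
  fix m
  let ?A = "sphere_area CARD('n)"
  have A: "?A > 0" by (rule sphere_area_pos) simp
  \<comment> \<open>The square root halves the exponent, hence the tail is used with
    \<open>2 * m\<close>.\<close>
  obtain C where C: "C \<ge> 0" "\<And>r. r \<ge> 0 \<Longrightarrow> tail r \<le> C / (1 + r) ^ (2 * m)" using tail_decay[of "2 * m"] by auto
  have "\<bar>mollifier_hat K \<zeta>\<bar> \<le> sqrt (?A * C) / (1 + norm \<zeta>) ^ m" for \<zeta>
  proof -
    have "\<bar>mollifier_hat K \<zeta>\<bar> = sqrt (?A * tail (norm \<zeta>))"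
      using mollifier_hat_nonneg[of \<zeta>] unfolding mollifier_hat_eq by simp
    also have "\<dots> \<le> sqrt (?A * (C / (1 + norm \<zeta>) ^ (2 * m)))"
      using A C(2)[of "norm \<zeta>"] by (intro real_sqrt_le_mono mult_left_mono) auto
    also have "\<dots> = sqrt (?A * C) / (1 + norm \<zeta>) ^ m"
      by (simp add: real_sqrt_divide power_mult power2_eq_square[symmetric] mult.commute[of 2] real_sqrt_power[symmetric])
    finally show ?thesis .
  qed
  then show "\<exists>C\<ge>0. \<forall>\<zeta>. \<bar>mollifier_hat K \<zeta>\<bar> \<le> C / (1 + norm \<zeta>) ^ m"
    using A C(1) by (intro exI[of _ "sqrt (?A * C)"]) auto
qed

subsection \<open>Variances of white-noise increments\<close>

definition wn_combination :: "real \<Rightarrow> ('i \<Rightarrow> real) \<Rightarrow> 'i set \<Rightarrow> ('i \<Rightarrow> (real ^ 'n) \<times> (real ^ 'n)) \<Rightarrow> (real ^ 'n) \<times> real \<Rightarrow> real" where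
  "wn_combination \<epsilon> c J w q = (\<Sum>j\<in>J. c j * (wn_kernel K \<epsilon> (fst (w j)) q - wn_kernel K \<epsilon> (snd (w j)) q))"

end

text \<open>The inverse transform of the combination, with coefficients \<open>c j\<close>, of
  differences of point masses at the two points of \<open>w j\<close>. The total mass is zero, so
  the symbol vanishes at the origin.\<close>

definition increment_symbol :: "('i \<Rightarrow> real) \<Rightarrow> 'i set \<Rightarrow> ('i \<Rightarrow> 'a \<times> 'a) \<Rightarrow> 'a::euclidean_space \<Rightarrow> complex" where
  "increment_symbol c J w \<zeta> = (\<Sum>j\<in>J. complex_of_real (c j) * (cis (2 * pi * (fst (w j) \<bullet> \<zeta>)) - cis (2 * pi * (snd (w j) \<bullet> \<zeta>))))"

lemma increment_symbol_continuous: "continuous_on A (increment_symbol c J w)"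
  unfolding increment_symbol_def by (intro continuous_intros)

lemma increment_symbol_measurable [measurable]: "increment_symbol c J w \<in> borel_measurable borel"
  by (rule borel_measurable_continuous_onI[OF increment_symbol_continuous])

context radial_bump
begin

text \<open>The substitution \<open>y = x - t *\<^sub>R u\<close> reflects the argument, which turns
  the inverse transform of the slice into the transform of \<open>K\<close>.\<close>

lemma inv_fourier_K_reflected:
  assumes t: "t > 0"
  shows "inv_fourier (\<lambda>y. complex_of_real (K ((x - y) /\<^sub>R t))) \<zeta> = complex_of_real (t ^ CARD('n)) * cis (2 * pi * (x \<bullet> \<zeta>)) * K_hat (t *\<^sub>R \<zeta>)"
proof -
  have "inv_fourier (\<lambda>y. complex_of_real (K ((x - y) /\<^sub>R t))) \<zeta> =
      (\<bar>- t\<bar> ^ DIM(real ^ 'n)) *\<^sub>R (LINT u|lborel. cis (2 * pi * (\<zeta> \<bullet> (x + (- t) *\<^sub>R u))) * complex_of_real (K ((x - (x + (- t) *\<^sub>R u)) /\<^sub>R t)))"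
    unfolding inv_fourier_def using t by (intro integral_affine) auto
  also have "(LINT u|lborel. cis (2 * pi * (\<zeta> \<bullet> (x + (- t) *\<^sub>R u))) * complex_of_real (K ((x - (x + (- t) *\<^sub>R u)) /\<^sub>R t))) =
      (LINT u|lborel. cis (2 * pi * (x \<bullet> \<zeta>)) * (cis (- 2 * pi * (u \<bullet> (t *\<^sub>R \<zeta>))) * complex_of_real (K u)))"
  proof (intro Bochner_Integration.integral_cong refl)
    fix u :: "real ^ 'n"
    have "cis (2 * pi * (\<zeta> \<bullet> (x + (- t) *\<^sub>R u))) = cis (2 * pi * (x \<bullet> \<zeta>)) * cis (- 2 * pi * (u \<bullet> (t *\<^sub>R \<zeta>)))"
      unfolding cis_mult by (rule arg_cong[where f=cis]) (simp add: inner_diff_right inner_commute[of \<zeta>] right_diff_distrib)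
    moreover have "(x - (x + (- t) *\<^sub>R u)) /\<^sub>R t = u" using t by simp
    ultimately show "cis (2 * pi * (\<zeta> \<bullet> (x + (- t) *\<^sub>R u))) * complex_of_real (K ((x - (x + (- t) *\<^sub>R u)) /\<^sub>R t)) =
        cis (2 * pi * (x \<bullet> \<zeta>)) * (cis (- 2 * pi * (u \<bullet> (t *\<^sub>R \<zeta>))) * complex_of_real (K u))"
      by (simp only: mult.assoc)
  qed
  also have "\<dots> = cis (2 * pi * (x \<bullet> \<zeta>)) * K_hat (t *\<^sub>R \<zeta>)"
    unfolding K_hat_def fourier_def by simp
  finally show ?thesis using t by (simp add: scaleR_conv_of_real)
qed

lemma nn_integral_wn_slice:
  assumes J: "finite J" and t: "t > 0" "\<epsilon> < t"
  shows "(\<integral>\<^sup>+y. ennreal ((wn_combination \<epsilon> c J w (y, t))\<^sup>2) \<partial>lborel) =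
    (\<integral>\<^sup>+\<zeta>. ennreal ((cmod (increment_symbol c J w \<zeta>))\<^sup>2) * ennreal (t ^ (CARD('n) - 1) * (cmod (K_hat (t *\<^sub>R \<zeta>)))\<^sup>2) \<partial>lborel)"
proof -
  define d where "d = CARD('n)"
  have d: "d > 0" by (simp add: d_def)
  \<comment> \<open>The kernel contributes \<open>t powr (- (d + 1))\<close> to the square and the
    spatial transform contributes \<open>t ^ (2 * d)\<close>; their product is the radial weight
    \<open>t ^ (d - 1)\<close> of \<open>profile\<close>.\<close>
  define s where "s = t powr (- (real d + 1) / 2)"
  have s: "s\<^sup>2 * (t ^ d)\<^sup>2 = t ^ (d - 1)"
  proof -
    have "s\<^sup>2 = t powr (- (real d + 1))" using t by (simp add: s_def powr_add[symmetric] power2_eq_square)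
    also have "\<dots> = 1 / t ^ (d + 1)"
      using t powr_realpow[of t "d + 1"] unfolding powr_minus_divide by (simp add: add.commute)
    finally show ?thesis using t d by (simp add: power2_eq_square power_diff divide_simps) (simp add: mult_ac)
  qed
  define k where "k x y = complex_of_real (K ((x - y) /\<^sub>R t))" for x y
  obtain B where B: "B \<ge> 0" "\<And>x. \<bar>K x\<bar> \<le> B" using K_bounded by auto
  have kc: "continuous_on UNIV (k x)" for x
    unfolding k_def by (intro continuous_intros continuous_on_compose2[OF K_continuous[of UNIV]]) auto
  have ki: "integrable lborel (k x)" for x
  proof -
    have "integrable lborel (\<lambda>y. K (x /\<^sub>R t + (- 1 / t) *\<^sub>R y))"
      using t by (intro integrable_affine K_integrable) auto
    moreover have "x /\<^sub>R t + (- 1 / t) *\<^sub>R y = (x - y) /\<^sub>R t" for y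
      by (simp add: scaleR_diff_right divide_inverse)
    ultimately show ?thesis unfolding k_def by simp
  qed
  define \<psi> where "\<psi> y = (\<Sum>j\<in>J. complex_of_real (c j) * (k (fst (w j)) y - k (snd (w j)) y)) * complex_of_real s" for y
  have \<psi>c: "continuous_on UNIV \<psi>" unfolding \<psi>_def by (intro continuous_intros kc)
  have \<psi>i: "integrable lborel \<psi>" unfolding \<psi>_def
    by (intro integrable_mult_left Bochner_Integration.integrable_sum integrable_mult_right Bochner_Integration.integrable_diff ki)
  have \<psi>b: "cmod (\<psi> y) \<le> (\<Sum>j\<in>J. \<bar>c j\<bar> * (2 * B)) * s" for y
  proof -
    have "cmod (k x y) \<le> B" for x using B by (simp add: k_def)
    then have "cmod (k x y - k x' y) \<le> 2 * B" for x x'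
      using norm_triangle_ineq4[of "k x y" "k x' y"] by (smt (verit))
    then have "cmod (\<Sum>j\<in>J. complex_of_real (c j) * (k (fst (w j)) y - k (snd (w j)) y)) \<le> (\<Sum>j\<in>J. \<bar>c j\<bar> * (2 * B))"
      by (intro sum_norm_le) (auto simp: norm_mult intro!: mult_left_mono)
    then show ?thesis
      unfolding \<psi>_def norm_mult using t by (intro mult_mono) (auto simp: s_def sum_nonneg B)
  qed
  have inv\<psi>: "inv_fourier \<psi> \<zeta> = increment_symbol c J w \<zeta> * (complex_of_real (t ^ d * s) * K_hat (t *\<^sub>R \<zeta>))" for \<zeta>
  proof -
    have ik: "integrable lborel (\<lambda>y. cis (2 * pi * (\<zeta> \<bullet> y)) * k x y)" for x
      by (intro integrable_cis_mult ki) simp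
    have "inv_fourier \<psi> \<zeta> = (LINT y|lborel. (\<Sum>j\<in>J. complex_of_real (c j) * (cis (2 * pi * (\<zeta> \<bullet> y)) * k (fst (w j)) y - cis (2 * pi * (\<zeta> \<bullet> y)) * k (snd (w j)) y)) * complex_of_real s)"
      unfolding inv_fourier_def \<psi>_def
      by (intro Bochner_Integration.integral_cong refl) (simp add: sum_distrib_left algebra_simps)
    also have "\<dots> = (\<Sum>j\<in>J. complex_of_real (c j) * (inv_fourier (k (fst (w j))) \<zeta> - inv_fourier (k (snd (w j))) \<zeta>)) * complex_of_real s"
      unfolding inv_fourier_def using ik by simp
    also have "\<dots> = increment_symbol c J w \<zeta> * (complex_of_real (t ^ d * s) * K_hat (t *\<^sub>R \<zeta>))"
      unfolding k_def inv_fourier_K_reflected[OF t(1)] increment_symbol_def d_def sum_distrib_right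
      by (intro sum.cong refl) (simp add: algebra_simps)
    finally show ?thesis .
  qed
  have "(\<integral>\<^sup>+y. ennreal ((wn_combination \<epsilon> c J w (y, t))\<^sup>2) \<partial>lborel) = (\<integral>\<^sup>+y. ennreal ((cmod (\<psi> y))\<^sup>2) \<partial>lborel)"
  proof (rule nn_integral_cong)
    fix y
    have "wn_combination \<epsilon> c J w (y, t) = (\<Sum>j\<in>J. c j * (K ((fst (w j) - y) /\<^sub>R t) - K ((snd (w j) - y) /\<^sub>R t))) * s"
      unfolding wn_combination_def wn_kernel_def sum_distrib_right using t
      by (intro sum.cong refl) (simp add: s_def d_def left_diff_distrib mult.assoc)
    then have "\<psi> y = complex_of_real (wn_combination \<epsilon> c J w (y, t))"
      by (simp add: \<psi>_def k_def)
    then show "ennreal ((wn_combination \<epsilon> c J w (y, t))\<^sup>2) = ennreal ((cmod (\<psi> y))\<^sup>2)" by simp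
  qed
  also have "\<dots> = (\<integral>\<^sup>+\<zeta>. ennreal ((cmod (fourier \<psi> \<zeta>))\<^sup>2) \<partial>lborel)"
    by (rule plancherel(1)[symmetric, OF \<psi>i \<psi>c \<psi>b])
  also have "\<dots> = (\<integral>\<^sup>+\<zeta>. ennreal ((cmod (inv_fourier \<psi> \<zeta>))\<^sup>2) \<partial>lborel)"
    unfolding inv_fourier_eq
    using borel_measurable_integrable[OF \<psi>i] by (intro nn_integral_reflect[symmetric]) simp
  also have "\<dots> = (\<integral>\<^sup>+\<zeta>. ennreal ((cmod (increment_symbol c J w \<zeta>))\<^sup>2) * ennreal (t ^ (d - 1) * (cmod (K_hat (t *\<^sub>R \<zeta>)))\<^sup>2) \<partial>lborel)"
  proof (rule nn_integral_cong)
    fix \<zeta>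
    have "(cmod (inv_fourier \<psi> \<zeta>))\<^sup>2 = (cmod (increment_symbol c J w \<zeta>))\<^sup>2 * ((s\<^sup>2 * (t ^ d)\<^sup>2) * (cmod (K_hat (t *\<^sub>R \<zeta>)))\<^sup>2)"
      unfolding inv\<psi> norm_mult norm_of_real power_mult_distrib power2_abs by (simp only: mult_ac)
    then show "ennreal ((cmod (inv_fourier \<psi> \<zeta>))\<^sup>2) = ennreal ((cmod (increment_symbol c J w \<zeta>))\<^sup>2) * ennreal (t ^ (d - 1) * (cmod (K_hat (t *\<^sub>R \<zeta>)))\<^sup>2)"
      unfolding s using t by (simp add: ennreal_mult)
  qed
  finally show ?thesis by (simp only: d_def)
qed

lemma nn_integral_K_hat_dilation:
  assumes \<zeta>: "\<zeta> \<noteq> 0" and \<epsilon>: "\<epsilon> > 0"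
  shows "(\<integral>\<^sup>+t. ennreal (t ^ (CARD('n) - 1) * (cmod (K_hat (t *\<^sub>R \<zeta>)))\<^sup>2) * indicator {\<epsilon><..} t \<partial>lborel) =
    ennreal (tail (\<epsilon> * norm \<zeta>) / norm \<zeta> ^ CARD('n))"
proof -
  define d where "d = CARD('n)"
  have d: "Suc (d - 1) = d" by (simp add: d_def)
  define n where "n = norm \<zeta>"
  have n: "n > 0" using \<zeta> by (simp add: n_def)
  let ?I = "\<integral>\<^sup>+t. ennreal (t ^ (d - 1) * (cmod (K_hat (t *\<^sub>R \<zeta>)))\<^sup>2) * indicator {\<epsilon><..} t \<partial>lborel"
  have "ennreal (tail (\<epsilon> * n)) = (\<integral>\<^sup>+s. ennreal (profile s) * indicator {\<epsilon> * n..} s \<partial>lborel)"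
    using \<epsilon> n by (intro ennreal_tail) simp
  also have "\<dots> = ennreal \<bar>n\<bar> * (\<integral>\<^sup>+t. ennreal (profile (0 + n * t)) * indicator {\<epsilon> * n..} (0 + n * t) \<partial>lborel)"
    using n by (intro nn_integral_real_affine) auto
  also have "(\<integral>\<^sup>+t. ennreal (profile (0 + n * t)) * indicator {\<epsilon> * n..} (0 + n * t) \<partial>lborel) =
      (\<integral>\<^sup>+t. ennreal (n ^ (d - 1)) * (ennreal (t ^ (d - 1) * (cmod (K_hat (t *\<^sub>R \<zeta>)))\<^sup>2) * indicator {\<epsilon><..} t) \<partial>lborel)"
  proof (rule nn_integral_cong_AE)
    \<comment> \<open>The open half-line from the white-noise cutoff and the closed one in
      \<open>tail\<close> differ only at \<open>t = \<epsilon>\<close>.\<close>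
    have "AE t in lborel. t \<noteq> \<epsilon>" by (rule AE_lborel_singleton)
    then show "AE t in lborel. ennreal (profile (0 + n * t)) * indicator {\<epsilon> * n..} (0 + n * t) =
        ennreal (n ^ (d - 1)) * (ennreal (t ^ (d - 1) * (cmod (K_hat (t *\<^sub>R \<zeta>)))\<^sup>2) * indicator {\<epsilon><..} t)"
    proof eventually_elim
      case (elim t)
      show ?case
      proof (cases "\<epsilon> < t")
        case True
        have "radial_value K_hat (n * t) = K_hat (t *\<^sub>R \<zeta>)"
          using radial_value_K_hat[of "t *\<^sub>R \<zeta>"] True \<epsilon> by (simp add: n_def mult.commute)
        then have "profile (0 + n * t) = n ^ (d - 1) * (t ^ (d - 1) * (cmod (K_hat (t *\<^sub>R \<zeta>)))\<^sup>2)"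
          by (simp add: profile_def d_def power_mult_distrib)
        then show ?thesis using True n \<epsilon> by (simp add: ennreal_mult mult.commute[of n])
      next
        case False
        then have "t < \<epsilon>" using elim by simp
        then have "\<not> \<epsilon> * n \<le> n * t" using n by (simp add: mult.commute[of \<epsilon>])
        then show ?thesis using False by simp
      qed
    qed
  qed
  also have "\<dots> = ennreal (n ^ (d - 1)) * ?I"
    by (rule nn_integral_cmult) measurable
  also have "ennreal \<bar>n\<bar> * (ennreal (n ^ (d - 1)) * ?I) = ennreal (n ^ d) * ?I"
    using n d by (simp add: mult.assoc[symmetric] power_Suc[symmetric] del: power_Suc flip: ennreal_mult)
  finally have "ennreal (1 / n ^ d) * ennreal (tail (\<epsilon> * n)) = ennreal (1 / n ^ d) * ennreal (n ^ d) * ?I"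
    by (simp add: mult_ac)
  also have "ennreal (1 / n ^ d) * ennreal (n ^ d) = 1"
    using n by (simp flip: ennreal_mult)
  finally show ?thesis
    using n tail_nonneg[of "\<epsilon> * n"] \<epsilon> by (simp add: d_def n_def flip: ennreal_mult)
qed

lemma wn_kernel_measurable [measurable]: "wn_kernel K \<epsilon> x \<in> borel_measurable borel"
  unfolding wn_kernel_def borel_prod[symmetric] by measurable

lemma wn_combination_measurable [measurable]: "wn_combination \<epsilon> c J w \<in> borel_measurable borel"
  unfolding wn_combination_def by measurable

text \<open>Every exchange is Tonelli's theorem, so the identity holds before either side is known
  to be finite. Finiteness is supplied later by the existence of the pairings with
  \<open>h\<close>.\<close>

theorem nn_integral_wn_combination:
  assumes J: "finite J" and \<epsilon>: "\<epsilon> > 0"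
  shows "(\<integral>\<^sup>+q. ennreal ((wn_combination \<epsilon> c J w q)\<^sup>2) \<partial>lborel) =
    log_energy (\<lambda>\<zeta>. increment_symbol c J w \<zeta> * complex_of_real (mollifier_hat K (\<epsilon> *\<^sub>R \<zeta>)))"
proof -
  define b where "b \<zeta> = (cmod (increment_symbol c J w \<zeta>))\<^sup>2" for \<zeta>
  have [measurable]: "b \<in> borel_measurable borel" unfolding b_def by measurable
  have [measurable]: "(\<lambda>q. wn_combination \<epsilon> c J w q) \<in> borel_measurable (lborel \<Otimes>\<^sub>M lborel)"
    using wn_combination_measurable[of \<epsilon> c J w] by (simp add: lborel_prod)
  have "(\<integral>\<^sup>+q. ennreal ((wn_combination \<epsilon> c J w q)\<^sup>2) \<partial>lborel) =
      (\<integral>\<^sup>+t. (\<integral>\<^sup>+y. ennreal ((wn_combination \<epsilon> c J w (y, t))\<^sup>2) \<partial>lborel) \<partial>lborel)"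
    unfolding lborel_prod[symmetric] by (rule lborel_pair.nn_integral_snd[symmetric]) measurable
  also have "\<dots> = (\<integral>\<^sup>+t. (\<integral>\<^sup>+\<zeta>. ennreal (b \<zeta>) * (ennreal (t ^ (CARD('n) - 1) * (cmod (K_hat (t *\<^sub>R \<zeta>)))\<^sup>2) * indicator {\<epsilon><..} t) \<partial>lborel) \<partial>lborel)"
  proof (rule nn_integral_cong)
    fix t :: real
    show "(\<integral>\<^sup>+y. ennreal ((wn_combination \<epsilon> c J w (y, t))\<^sup>2) \<partial>lborel) =
      (\<integral>\<^sup>+\<zeta>. ennreal (b \<zeta>) * (ennreal (t ^ (CARD('n) - 1) * (cmod (K_hat (t *\<^sub>R \<zeta>)))\<^sup>2) * indicator {\<epsilon><..} t) \<partial>lborel)"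
    proof (cases "\<epsilon> < t")
      case True
      then show ?thesis using nn_integral_wn_slice[OF J, of t \<epsilon> c w] \<epsilon> by (simp add: b_def)
    next
      case False
      then show ?thesis by (simp add: wn_combination_def wn_kernel_def)
    qed
  qed
  also have "\<dots> = (\<integral>\<^sup>+\<zeta>. (\<integral>\<^sup>+t. ennreal (b \<zeta>) * (ennreal (t ^ (CARD('n) - 1) * (cmod (K_hat (t *\<^sub>R \<zeta>)))\<^sup>2) * indicator {\<epsilon><..} t) \<partial>lborel) \<partial>lborel)"
    by (rule lborel_pair.Fubini') measurable
  also have "\<dots> = (\<integral>\<^sup>+\<zeta>. ennreal (1 / sphere_area CARD('n)) *
      ennreal ((cmod (increment_symbol c J w \<zeta> * complex_of_real (mollifier_hat K (\<epsilon> *\<^sub>R \<zeta>))))\<^sup>2 / norm \<zeta> ^ CARD('n)) \<partial>lborel)"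
  proof (rule nn_integral_cong_AE)
    have "AE \<zeta> in lborel. \<zeta> \<noteq> (0 :: real ^ 'n)" by (rule AE_lborel_singleton)
    then show "AE \<zeta> in lborel. (\<integral>\<^sup>+t. ennreal (b \<zeta>) * (ennreal (t ^ (CARD('n) - 1) * (cmod (K_hat (t *\<^sub>R \<zeta>)))\<^sup>2) * indicator {\<epsilon><..} t) \<partial>lborel) =
      ennreal (1 / sphere_area CARD('n)) * ennreal ((cmod (increment_symbol c J w \<zeta> * complex_of_real (mollifier_hat K (\<epsilon> *\<^sub>R \<zeta>))))\<^sup>2 / norm \<zeta> ^ CARD('n))"
    proof eventually_elim
      case (elim \<zeta>)
      let ?A = "sphere_area CARD('n)"
      have A: "?A > 0" by (rule sphere_area_pos) simp
      have "(\<integral>\<^sup>+t. ennreal (b \<zeta>) * (ennreal (t ^ (CARD('n) - 1) * (cmod (K_hat (t *\<^sub>R \<zeta>)))\<^sup>2) * indicator {\<epsilon><..} t) \<partial>lborel) =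
          ennreal (b \<zeta>) * ennreal (tail (\<epsilon> * norm \<zeta>) / norm \<zeta> ^ CARD('n))"
        unfolding nn_integral_K_hat_dilation[OF elim \<epsilon>, symmetric] by (rule nn_integral_cmult) measurable
      also have "\<dots> = ennreal (b \<zeta> * (tail (\<epsilon> * norm \<zeta>) / norm \<zeta> ^ CARD('n)))"
        by (rule ennreal_mult[symmetric]) (use \<epsilon> in \<open>auto simp: b_def tail_nonneg\<close>)
      \<comment> \<open>\<open>mollifier_hat_square\<close> brings in \<open>sphere_area\<close>,
        which cancels the factor \<open>1 / ?A\<close> of the energy; this explains the constant in
        the definition of the mollifier.\<close>
      also have "b \<zeta> * (tail (\<epsilon> * norm \<zeta>) / norm \<zeta> ^ CARD('n)) =
          1 / ?A * ((cmod (increment_symbol c J w \<zeta> * complex_of_real (mollifier_hat K (\<epsilon> *\<^sub>R \<zeta>))))\<^sup>2 / norm \<zeta> ^ CARD('n))"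
        unfolding norm_mult power_mult_distrib norm_of_real power2_abs mollifier_hat_square b_def
        using A \<epsilon> by simp
      also have "ennreal \<dots> = ennreal (1 / ?A) * ennreal ((cmod (increment_symbol c J w \<zeta> * complex_of_real (mollifier_hat K (\<epsilon> *\<^sub>R \<zeta>))))\<^sup>2 / norm \<zeta> ^ CARD('n))"
        using A by (intro ennreal_mult) auto
      finally show ?case .
    qed
  qed
  also have "\<dots> = log_energy (\<lambda>\<zeta>. increment_symbol c J w \<zeta> * complex_of_real (mollifier_hat K (\<epsilon> *\<^sub>R \<zeta>)))"
  proof -
    have [measurable]: "mollifier_hat K \<in> borel_measurable borel"
      by (rule borel_measurable_continuous_onI[OF mollifier_hat_continuous])
    show ?thesis unfolding log_energy_def by (subst nn_integral_cmult) auto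
  qed
  finally show ?thesis .
qed

end

subsection \<open>Inverse Fourier transforms of rapidly decaying functions\<close>

lemma norm_inv_fourier_le:
  assumes "integrable lborel f"
  shows "cmod (inv_fourier f x) \<le> (LINT \<zeta>|lborel. cmod (f \<zeta>))"
  unfolding inv_fourier_eq by (rule norm_fourier_le[OF assms])

lemma norm_weight_mult: "cmod (complex_of_real ((1 + norm x) ^ m) * z) = (1 + norm x) ^ m * cmod z"
  unfolding norm_mult norm_of_real by simp

lemma norm_cis_taylor_le: "cmod (cis (a + b) - cis a - \<i> * complex_of_real b * cis a) \<le> b\<^sup>2"
proof -
  have "cis (a + b) - cis a - \<i> * complex_of_real b * cis a = cis a * (iexp b - (1 + \<i> * complex_of_real b))"
    by (simp add: cis_conv_exp exp_add algebra_simps)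
  then have "cmod (cis (a + b) - cis a - \<i> * complex_of_real b * cis a) = cmod (iexp b - (1 + \<i> * complex_of_real b))"
    by (simp add: norm_mult)
  also have "\<dots> \<le> b\<^sup>2 / 2"
    using iexp_approx1[of b 1] by (simp add: power2_eq_square)
  also have "\<dots> \<le> b\<^sup>2" by simp
  finally show ?thesis .
qed

text \<open>The second-order Taylor estimate for \<open>cis\<close>, integrated against
  \<open>f\<close>, bounds the remainder by a multiple of \<open>(norm (y - x))\<^sup>2\<close>;
  this is why the weight is quadratic.\<close>

lemma inv_fourier_has_derivative:
  fixes f :: "'a::euclidean_space \<Rightarrow> complex"
  assumes [measurable]: "f \<in> borel_measurable borel"
    and int: "integrable lborel (\<lambda>\<zeta>. complex_of_real ((1 + norm \<zeta>) ^ 2) * f \<zeta>)"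
  shows "(inv_fourier f has_derivative (\<lambda>v. inv_fourier (\<lambda>\<zeta>. \<i> * complex_of_real (2 * pi * (v \<bullet> \<zeta>)) * f \<zeta>) x)) (at x)"
proof -
  let ?L = "\<lambda>v. inv_fourier (\<lambda>\<zeta>. \<i> * complex_of_real (2 * pi * (v \<bullet> \<zeta>)) * f \<zeta>) x"
  define M where "M = (LINT \<zeta>|lborel. cmod (complex_of_real ((1 + norm \<zeta>) ^ 2) * f \<zeta>))"
  have le: "1 \<le> (1 + norm \<zeta>) ^ 2" "norm \<zeta> \<le> (1 + norm \<zeta>) ^ 2" "(norm \<zeta>)\<^sup>2 \<le> (1 + norm \<zeta>) ^ 2" for \<zeta> :: 'a
    by (simp_all add: power2_eq_square algebra_simps)
  have fi: "integrable lborel f"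
  proof (rule Bochner_Integration.integrable_bound[OF int])
    show "AE \<zeta> in lborel. norm (f \<zeta>) \<le> norm (complex_of_real ((1 + norm \<zeta>) ^ 2) * f \<zeta>)"
    proof (rule AE_I2)
      fix \<zeta>
      show "norm (f \<zeta>) \<le> norm (complex_of_real ((1 + norm \<zeta>) ^ 2) * f \<zeta>)"
        unfolding norm_weight_mult using mult_right_mono[OF le(1)[of \<zeta>] norm_ge_zero[of "f \<zeta>"]] by simp
    qed
  qed simp
  have vb: "\<bar>2 * pi * (v \<bullet> \<zeta>)\<bar> \<le> 2 * pi * norm v * norm \<zeta>" for v \<zeta> :: 'a
    using Cauchy_Schwarz_ineq2[of v \<zeta>] by (simp add: abs_mult)
  have Lb: "cmod (\<i> * complex_of_real (2 * pi * (v \<bullet> \<zeta>)) * f \<zeta>) \<le> 2 * pi * norm v * cmod (complex_of_real ((1 + norm \<zeta>) ^ 2) * f \<zeta>)" for v \<zeta>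
  proof -
    have "cmod (\<i> * complex_of_real (2 * pi * (v \<bullet> \<zeta>)) * f \<zeta>) = \<bar>2 * pi * (v \<bullet> \<zeta>)\<bar> * cmod (f \<zeta>)"
      by (simp add: norm_mult abs_mult)
    also have "\<dots> \<le> (2 * pi * norm v * norm \<zeta>) * cmod (f \<zeta>)"
      by (intro mult_right_mono vb) simp
    also have "\<dots> \<le> (2 * pi * norm v * (1 + norm \<zeta>) ^ 2) * cmod (f \<zeta>)"
      by (intro mult_right_mono mult_left_mono le) auto
    finally show ?thesis unfolding norm_weight_mult mult.assoc .
  qed
  have Li: "integrable lborel (\<lambda>\<zeta>. \<i> * complex_of_real (2 * pi * (v \<bullet> \<zeta>)) * f \<zeta>)" for v
  proof (rule Bochner_Integration.integrable_bound)
    show "integrable lborel (\<lambda>\<zeta>. complex_of_real (2 * pi * norm v) * (complex_of_real ((1 + norm \<zeta>) ^ 2) * f \<zeta>))"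
      by (rule integrable_mult_right[OF int])
    show "AE \<zeta> in lborel. norm (\<i> * complex_of_real (2 * pi * (v \<bullet> \<zeta>)) * f \<zeta>) \<le>
        norm (complex_of_real (2 * pi * norm v) * (complex_of_real ((1 + norm \<zeta>) ^ 2) * f \<zeta>))"
      using Lb[of v] by (simp add: norm_mult abs_mult)
  qed measurable
  have ci: "integrable lborel (\<lambda>\<zeta>. cis (2 * pi * (y \<bullet> \<zeta>)) * g \<zeta>)" if "integrable lborel g" for y :: 'a and g
    by (rule integrable_cis_mult[OF that]) simp
  have blin: "bounded_linear ?L"
  proof (rule bounded_linear_intro)
    show "?L (v + w) = ?L v + ?L w" for v w
      unfolding inv_fourier_def Bochner_Integration.integral_add[OF ci[OF Li] ci[OF Li], symmetric]
      by (simp add: inner_add_left algebra_simps)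
    show "?L (r *\<^sub>R v) = r *\<^sub>R ?L v" for r v
      unfolding inv_fourier_def integral_scaleR_right[symmetric]
      by (simp add: scaleR_conv_of_real mult_ac)
    show "cmod (?L v) \<le> norm v * (2 * pi * M)" for v
    proof -
      have "cmod (?L v) \<le> (LINT \<zeta>|lborel. cmod (\<i> * complex_of_real (2 * pi * (v \<bullet> \<zeta>)) * f \<zeta>))"
        by (rule norm_inv_fourier_le[OF Li])
      also have "\<dots> \<le> (LINT \<zeta>|lborel. 2 * pi * norm v * cmod (complex_of_real ((1 + norm \<zeta>) ^ 2) * f \<zeta>))"
        by (intro integral_mono integrable_norm Li integrable_mult_right int Lb)
      also have "\<dots> = norm v * (2 * pi * M)"
        unfolding M_def by simp
      finally show ?thesis .
    qed
  qed
  define N where "N = (2 * pi)\<^sup>2 * M"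
  have rem: "cmod (inv_fourier f y - inv_fourier f x - ?L (y - x)) \<le> N * (norm (y - x))\<^sup>2" for y
  proof -
    let ?r = "\<lambda>\<zeta>. cis (2 * pi * (y \<bullet> \<zeta>)) * f \<zeta> - cis (2 * pi * (x \<bullet> \<zeta>)) * f \<zeta> - cis (2 * pi * (x \<bullet> \<zeta>)) * (\<i> * complex_of_real (2 * pi * ((y - x) \<bullet> \<zeta>)) * f \<zeta>)"
    have ri: "integrable lborel ?r"
      by (intro Bochner_Integration.integrable_diff ci fi Li)
    have "inv_fourier f y - inv_fourier f x - ?L (y - x) = (LINT \<zeta>|lborel. ?r \<zeta>)"
      unfolding inv_fourier_def using ci[OF fi] ci[OF Li] by simp
    also have "cmod \<dots> \<le> (LINT \<zeta>|lborel. N / M * (norm (y - x))\<^sup>2 * cmod (complex_of_real ((1 + norm \<zeta>) ^ 2) * f \<zeta>))"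
    \<comment> \<open>For \<open>M = 0\<close> the quotient \<open>N / M\<close> is 0 by convention
      and the pointwise bound of the other case may fail on a null set; but then \<open>f\<close>
      vanishes almost everywhere and both sides are 0.\<close>
    proof (cases "M = 0")
      case True
      have "AE \<zeta> in lborel. cmod (complex_of_real ((1 + norm \<zeta>) ^ 2) * f \<zeta>) = 0"
        using True integral_nonneg_eq_0_iff_AE[OF integrable_norm[OF int]] unfolding M_def by simp
      then have "AE \<zeta> in lborel. ?r \<zeta> = 0"
      proof eventually_elim
        case (elim \<zeta>)
        have "(1 + norm \<zeta>) ^ 2 \<noteq> 0" using le(1)[of \<zeta>] by linarith
        then have "f \<zeta> = 0" using elim by (simp del: of_real_power of_real_add)
        then show ?case by simp
      qed
      then have "(LINT \<zeta>|lborel. ?r \<zeta>) = (LINT \<zeta>|(lborel :: 'a measure). 0)"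
        by (intro integral_cong_AE) auto
      then show ?thesis by (simp add: True)
    next
      case False
      show ?thesis
      proof (rule Bochner_Integration.integral_norm_bound_integral[OF ri])
        show "integrable lborel (\<lambda>\<zeta>. N / M * (norm (y - x))\<^sup>2 * cmod (complex_of_real ((1 + norm \<zeta>) ^ 2) * f \<zeta>))"
          by (intro integrable_mult_right integrable_norm int)
        fix \<zeta> :: 'a
        have ab: "2 * pi * (y \<bullet> \<zeta>) = 2 * pi * (x \<bullet> \<zeta>) + 2 * pi * ((y - x) \<bullet> \<zeta>)"
          by (simp add: inner_diff_left algebra_simps)
        have "?r \<zeta> = (cis (2 * pi * (x \<bullet> \<zeta>) + 2 * pi * ((y - x) \<bullet> \<zeta>)) - cis (2 * pi * (x \<bullet> \<zeta>)) -
            \<i> * complex_of_real (2 * pi * ((y - x) \<bullet> \<zeta>)) * cis (2 * pi * (x \<bullet> \<zeta>))) * f \<zeta>"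
        proof -
          have "a * z - b * z - b * (\<i> * u * z) = (a - b - \<i> * u * b) * z" for a b u z :: complex
            by (simp add: algebra_simps)
          then show ?thesis unfolding ab .
        qed
        then have "cmod (?r \<zeta>) \<le> (2 * pi * ((y - x) \<bullet> \<zeta>))\<^sup>2 * cmod (f \<zeta>)"
          unfolding norm_mult by (simp only: norm_mult) (intro mult_right_mono norm_cis_taylor_le norm_ge_zero)
        also have "\<dots> \<le> (2 * pi * norm (y - x) * norm \<zeta>)\<^sup>2 * cmod (f \<zeta>)"
          using power_mono[OF vb[of "y - x" \<zeta>], of 2] by (intro mult_right_mono) auto
        also have "\<dots> = (2 * pi)\<^sup>2 * (norm (y - x))\<^sup>2 * ((norm \<zeta>)\<^sup>2 * cmod (f \<zeta>))"
          by (simp only: power_mult_distrib mult.assoc)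
        also have "\<dots> \<le> (2 * pi)\<^sup>2 * (norm (y - x))\<^sup>2 * ((1 + norm \<zeta>) ^ 2 * cmod (f \<zeta>))"
          by (intro mult_left_mono mult_right_mono le) auto
        also have "\<dots> = N / M * (norm (y - x))\<^sup>2 * cmod (complex_of_real ((1 + norm \<zeta>) ^ 2) * f \<zeta>)"
          unfolding norm_weight_mult using False by (simp add: N_def)
        finally show "norm (?r \<zeta>) \<le> N / M * (norm (y - x))\<^sup>2 * cmod (complex_of_real ((1 + norm \<zeta>) ^ 2) * f \<zeta>)" .
      qed
    qed
    also have "\<dots> = N / M * (norm (y - x))\<^sup>2 * M"
      unfolding M_def by (rule integral_mult_right_zero)
    also have "\<dots> = N * (norm (y - x))\<^sup>2" by (simp add: N_def)
    finally show ?thesis .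
  qed
  show ?thesis
  proof (rule has_derivativeI_sandwich[of 1])
    show "((\<lambda>y. N * norm (y - x)) \<longlongrightarrow> 0) (at x)"
      by (auto intro!: tendsto_eq_intros)
    show "norm (inv_fourier f y - inv_fourier f x - ?L (y - x)) / norm (y - x) \<le> N * norm (y - x)"
      if "y \<noteq> x" for y
      using rem[of y] that by (simp add: divide_le_eq power2_eq_square mult.assoc)
  qed (use blin in auto)
qed

section \<open>Iterated derivatives of inverse transforms\<close>

definition derivative_multiplier :: "'a::euclidean_space list \<Rightarrow> 'a \<Rightarrow> complex" where
  "derivative_multiplier vs \<zeta> = (\<Prod>v\<leftarrow>vs. \<i> * complex_of_real (2 * pi * (v \<bullet> \<zeta>)))"

lemma derivative_multiplier_measurable [measurable]: "derivative_multiplier vs \<in> borel_measurable borel"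
  unfolding derivative_multiplier_def by (induction vs) simp_all

lemma derivative_multiplier_bound: "\<exists>C\<ge>0. \<forall>\<zeta>. cmod (derivative_multiplier vs \<zeta>) \<le> C * (1 + norm \<zeta>) ^ length vs"
proof (induction vs)
  case Nil
  show ?case by (intro exI[of _ 1]) (simp add: derivative_multiplier_def)
next
  case (Cons v vs)
  then obtain C where C: "C \<ge> 0" "\<And>\<zeta>. cmod (derivative_multiplier vs \<zeta>) \<le> C * (1 + norm \<zeta>) ^ length vs" by auto
  have "cmod (derivative_multiplier (v # vs) \<zeta>) \<le> (2 * pi * norm v * C) * (1 + norm \<zeta>) ^ length (v # vs)" for \<zeta>
  proof -
    have "cmod (derivative_multiplier (v # vs) \<zeta>) = \<bar>2 * pi * (v \<bullet> \<zeta>)\<bar> * cmod (derivative_multiplier vs \<zeta>)"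
      by (simp add: derivative_multiplier_def norm_mult abs_mult)
    also have "\<dots> \<le> (2 * pi * norm v * (1 + norm \<zeta>)) * (C * (1 + norm \<zeta>) ^ length vs)"
    proof (intro mult_mono C)
      have "\<bar>v \<bullet> \<zeta>\<bar> \<le> norm v * (1 + norm \<zeta>)"
        using Cauchy_Schwarz_ineq2[of v \<zeta>] by (simp add: algebra_simps add_increasing)
      then show "\<bar>2 * pi * (v \<bullet> \<zeta>)\<bar> \<le> 2 * pi * norm v * (1 + norm \<zeta>)"
        by (simp add: abs_mult mult.assoc)
    qed auto
    also have "\<dots> = (2 * pi * norm v * C) * (1 + norm \<zeta>) ^ length (v # vs)"
      by (simp only: length_Cons power_Suc mult_ac)
    finally show ?thesis .
  qed
  then show ?case using C(1) by (intro exI[of _ "2 * pi * norm v * C"]) auto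
qed

lemma rapidly_decaying_integrable:
  fixes g :: "'a::euclidean_space \<Rightarrow> real"
  assumes g: "rapidly_decaying g" and [measurable]: "g \<in> borel_measurable borel"
    and [measurable]: "p \<in> borel_measurable borel" and p: "\<And>x. cmod (p x) \<le> C * (1 + norm x) ^ m"
  shows "integrable lborel (\<lambda>x. p x * complex_of_real (g x))"
proof -
  obtain D where D: "D \<ge> 0" "\<And>x. \<bar>g x\<bar> \<le> D / (1 + norm x) ^ (m + (DIM('a) + 1))"
    using g unfolding rapidly_decaying_def by metis
  have C: "C \<ge> 0" using order_trans[OF norm_ge_zero p[of 0]] by simp
  show ?thesis
  proof (rule Bochner_Integration.integrable_bound)
    show "integrable lborel (\<lambda>x::'a. C * D * (1 / (1 + norm x) ^ (DIM('a) + 1)))"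
      by (intro integrable_mult_right integrable_inverse_power_norm) simp
    show "AE x in lborel. norm (p x * complex_of_real (g x)) \<le> norm (C * D * (1 / (1 + norm x) ^ (DIM('a) + 1)))"
    proof (rule AE_I2)
      fix x :: 'a
      have pos: "1 + norm x > 0" by (simp add: add_pos_nonneg)
      have "norm (p x * complex_of_real (g x)) \<le> C * (1 + norm x) ^ m * (D / (1 + norm x) ^ (m + (DIM('a) + 1)))"
        unfolding norm_mult using D p C by (intro mult_mono) auto
      also have "\<dots> = C * D * (1 / (1 + norm x) ^ (DIM('a) + 1))"
        using pos by (simp add: power_add)
      also have "\<dots> \<le> norm \<dots>" by (simp only: real_norm_def abs_ge_self)
      finally show "norm (p x * complex_of_real (g x)) \<le> norm (C * D * (1 / (1 + norm x) ^ (DIM('a) + 1)))" .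
    qed
  qed measurable
qed

definition real_inv_fourier :: "('a::euclidean_space \<Rightarrow> real) \<Rightarrow> 'a \<Rightarrow> real" where
  "real_inv_fourier g x = Re (inv_fourier (\<lambda>\<zeta>. complex_of_real (g \<zeta>)) x)"

context
  fixes g :: "'a::euclidean_space \<Rightarrow> real"
  assumes g: "rapidly_decaying g" and g_meas [measurable]: "g \<in> borel_measurable borel"
begin

lemma real_inv_fourier_derivative:
  "((\<lambda>x. Re (inv_fourier (\<lambda>\<zeta>. derivative_multiplier vs \<zeta> * complex_of_real (g \<zeta>)) x)) has_derivative
    (\<lambda>v. Re (inv_fourier (\<lambda>\<zeta>. derivative_multiplier (v # vs) \<zeta> * complex_of_real (g \<zeta>)) x))) (at x)"
proof -
  obtain C where C: "C \<ge> 0" "\<And>\<zeta>. cmod (derivative_multiplier vs \<zeta>) \<le> C * (1 + norm \<zeta>) ^ length vs"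
    using derivative_multiplier_bound[of vs] by auto
  have "integrable lborel (\<lambda>\<zeta>. (complex_of_real ((1 + norm \<zeta>) ^ 2) * derivative_multiplier vs \<zeta>) * complex_of_real (g \<zeta>))"
  proof (rule rapidly_decaying_integrable[OF g g_meas])
    fix \<zeta>
    have "cmod (complex_of_real ((1 + norm \<zeta>) ^ 2) * derivative_multiplier vs \<zeta>) = (1 + norm \<zeta>) ^ 2 * cmod (derivative_multiplier vs \<zeta>)"
      by (rule norm_weight_mult)
    also have "\<dots> \<le> (1 + norm \<zeta>) ^ 2 * (C * (1 + norm \<zeta>) ^ length vs)"
      by (intro mult_left_mono C) simp
    also have "\<dots> = C * (1 + norm \<zeta>) ^ (2 + length vs)" unfolding power_add by (simp only: mult_ac)
    finally show "cmod (complex_of_real ((1 + norm \<zeta>) ^ 2) * derivative_multiplier vs \<zeta>) \<le> C * (1 + norm \<zeta>) ^ (2 + length vs)" .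
  qed measurable
  then have "(inv_fourier (\<lambda>\<zeta>. derivative_multiplier vs \<zeta> * complex_of_real (g \<zeta>)) has_derivative
      (\<lambda>v. inv_fourier (\<lambda>\<zeta>. \<i> * complex_of_real (2 * pi * (v \<bullet> \<zeta>)) * (derivative_multiplier vs \<zeta> * complex_of_real (g \<zeta>))) x)) (at x)"
    by (intro inv_fourier_has_derivative) (simp_all only: mult.assoc, measurable)
  from has_derivative_Re[OF this] show ?thesis
    by (simp add: derivative_multiplier_def mult.assoc)
qed

text \<open>Each derivative is again an inverse transform, with one more linear factor in the
  multiplier, so the induction never leaves this form.\<close>

lemma iter_deriv_real_inv_fourier:
  "iter_deriv vs (real_inv_fourier g) = (\<lambda>x. Re (inv_fourier (\<lambda>\<zeta>. derivative_multiplier vs \<zeta> * complex_of_real (g \<zeta>)) x))"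
proof (induction vs)
  case Nil
  show ?case by (simp add: real_inv_fourier_def[abs_def] derivative_multiplier_def)
next
  case (Cons v vs)
  show ?case
    unfolding iter_deriv.simps Cons frechet_derivative_at[OF real_inv_fourier_derivative, symmetric] ..
qed

lemma smooth_real_inv_fourier: "smooth (real_inv_fourier g)"
  unfolding smooth_def iter_deriv_real_inv_fourier
  using real_inv_fourier_derivative by (auto simp: differentiable_def)

text \<open>The derivatives are bounded by integrals of rapidly decaying symbols. Decay in
  \<open>x\<close> would call for smoothness of \<open>g\<close> and is left to the Gaussian
  cutoff.\<close>

lemma iter_deriv_real_inv_fourier_bounded: "\<exists>B\<ge>0. \<forall>x. \<bar>iter_deriv vs (real_inv_fourier g) x\<bar> \<le> B"
proof -
  obtain C where C: "C \<ge> 0" "\<And>\<zeta>. cmod (derivative_multiplier vs \<zeta>) \<le> C * (1 + norm \<zeta>) ^ length vs"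
    using derivative_multiplier_bound[of vs] by auto
  have i: "integrable lborel (\<lambda>\<zeta>. derivative_multiplier vs \<zeta> * complex_of_real (g \<zeta>))"
    by (rule rapidly_decaying_integrable[OF g g_meas _ C(2)]) measurable
  have "\<bar>iter_deriv vs (real_inv_fourier g) x\<bar> \<le> (LINT \<zeta>|lborel. cmod (derivative_multiplier vs \<zeta> * complex_of_real (g \<zeta>)))" for x
    unfolding iter_deriv_real_inv_fourier
    using order_trans[OF abs_Re_le_cmod norm_inv_fourier_le[OF i]] by blast
  moreover have "0 \<le> (LINT \<zeta>|lborel. cmod (derivative_multiplier vs \<zeta> * complex_of_real (g \<zeta>)))"
    by (rule integral_nonneg_AE) simp
  ultimately show ?thesis by blast
qed

end

subsection \<open>Gaussian cutoffs are Schwartz functions\<close>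

lemma power_div_fact_le_exp:
  assumes "x \<ge> (0::real)"
  shows "x ^ n / fact n \<le> exp x"
proof -
  have "sum (\<lambda>k. x ^ k /\<^sub>R fact k) {n} \<le> (\<Sum>k. x ^ k /\<^sub>R fact k)"
    using assms sums_summable[OF exp_converges[of x]] by (intro sum_le_suminf) auto
  then show ?thesis using sums_unique[OF exp_converges[of x]] by (simp add: divide_inverse mult.commute)
qed

lemma gauss_scaled_has_derivative:
  fixes x :: "'a::euclidean_space"
  shows "((\<lambda>x. gauss (c *\<^sub>R x)) has_derivative (\<lambda>v. (- 2 * pi * c\<^sup>2) * (x \<bullet> v) * gauss (c *\<^sub>R x))) (at x)"
proof -
  have eq: "gauss (c *\<^sub>R x) = exp (- pi * c\<^sup>2 * (x \<bullet> x))" for x :: 'a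
    by (simp add: gauss_def power_mult_distrib power2_norm_eq_inner)
  show ?thesis unfolding eq
    by (auto intro!: derivative_eq_intros simp: inner_commute fun_eq_iff)
qed

lemma polynomial_times_gauss_bounded:
  assumes c: "c \<noteq> 0"
  shows "\<exists>D\<ge>0. \<forall>x::'a::euclidean_space. (1 + norm x) ^ m * gauss (c *\<^sub>R x) \<le> D"
proof -
  define A where "A = pi * c\<^sup>2"
  have A: "A > 0" using c by (simp add: A_def)
  have "(1 + norm x) ^ m * gauss (c *\<^sub>R x) \<le> fact m * exp (1 + 1 / A)" for x :: 'a
  proof -
    let ?r = "norm x"
    have "(1 + ?r) ^ m / fact m \<le> exp (1 + ?r)"
      by (rule power_div_fact_le_exp) simp
    then have "(1 + ?r) ^ m \<le> fact m * exp (1 + ?r)" by (simp add: divide_le_eq mult.commute)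
    then have "(1 + ?r) ^ m * gauss (c *\<^sub>R x) \<le> fact m * exp (1 + ?r) * exp (- A * ?r\<^sup>2)"
    proof -
      have "gauss (c *\<^sub>R x) = exp (- A * ?r\<^sup>2)" by (simp add: gauss_def A_def power_mult_distrib mult.assoc)
      with \<open>(1 + ?r) ^ m \<le> fact m * exp (1 + ?r)\<close> show ?thesis by (simp add: mult_right_mono)
    qed
    also have "\<dots> = fact m * exp (1 + ?r - A * ?r\<^sup>2)"
      by (simp add: exp_add[symmetric] mult.assoc)
    also have "\<dots> \<le> fact m * exp (1 + 1 / A)"
    proof -
      \<comment> \<open>Completing the square: with \<open>r\<close> the norm of \<open>x\<close>,
        the exponent \<open>r - A * r\<^sup>2\<close> is at most \<open>1 / A\<close>.\<close>
      have "0 \<le> (A * ?r - 1)\<^sup>2 / A + ?r" using A by simp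
      also have "\<dots> = A * ?r\<^sup>2 - ?r + 1 / A" using A by (simp add: power2_eq_square field_simps)
      finally show ?thesis by simp
    qed
    finally show ?thesis .
  qed
  then show ?thesis by (intro exI[of _ "fact m * exp (1 + 1 / A)"]) auto
qed

text \<open>Multiplied by a Gaussian, this algebra is closed under differentiation.\<close>

inductive_set derivative_algebra :: "('a::euclidean_space \<Rightarrow> real) \<Rightarrow> ('a \<Rightarrow> real) set" for f where
  base: "iter_deriv vs f \<in> derivative_algebra f"
| const: "(\<lambda>x. c) \<in> derivative_algebra f"
| coordinate: "(\<lambda>x. x \<bullet> v) \<in> derivative_algebra f"
| add: "a \<in> derivative_algebra f \<Longrightarrow> b \<in> derivative_algebra f \<Longrightarrow> (\<lambda>x. a x + b x) \<in> derivative_algebra f"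
| mult: "a \<in> derivative_algebra f \<Longrightarrow> b \<in> derivative_algebra f \<Longrightarrow> (\<lambda>x. a x * b x) \<in> derivative_algebra f"

context
  fixes f :: "'a::euclidean_space \<Rightarrow> real"
  assumes f_smooth: "smooth f" and f_bounded: "\<And>vs. \<exists>B\<ge>0. \<forall>x. \<bar>iter_deriv vs f x\<bar> \<le> B"
begin

lemma derivative_algebra_derivative:
  assumes "a \<in> derivative_algebra f"
  shows "\<exists>a'. (\<forall>x. (a has_derivative a' x) (at x)) \<and> (\<forall>v. (\<lambda>x. a' x v) \<in> derivative_algebra f)"
  using assms
proof induction
  case (base vs)
  have "(iter_deriv vs f has_derivative frechet_derivative (iter_deriv vs f) (at x)) (at x)" for x
    using smooth_iter_deriv_differentiable[OF f_smooth] by (simp add: frechet_derivative_works)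
  moreover have "(\<lambda>x. frechet_derivative (iter_deriv vs f) (at x) v) \<in> derivative_algebra f" for v
    using derivative_algebra.base[of "v # vs" f] by simp
  ultimately show ?case by (intro exI[of _ "\<lambda>x. frechet_derivative (iter_deriv vs f) (at x)"] conjI allI)
next
  case (const c)
  show ?case by (intro exI[of _ "\<lambda>x v. 0"]) (auto intro: derivative_algebra.const)
next
  case (coordinate w)
  show ?case by (intro exI[of _ "\<lambda>x v. v \<bullet> w"]) (auto intro!: derivative_algebra.const derivative_eq_intros)
next
  case (add a b)
  then obtain a' b' where "\<And>x. (a has_derivative a' x) (at x)" "\<And>v. (\<lambda>x. a' x v) \<in> derivative_algebra f"
    "\<And>x. (b has_derivative b' x) (at x)" "\<And>v. (\<lambda>x. b' x v) \<in> derivative_algebra f" by blast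
  then show ?case
    by (intro exI[of _ "\<lambda>x v. a' x v + b' x v"]) (auto intro!: derivative_algebra.add has_derivative_add)
next
  case (mult a b)
  then obtain a' b' where *: "\<And>x. (a has_derivative a' x) (at x)" "\<And>v. (\<lambda>x. a' x v) \<in> derivative_algebra f"
    "\<And>x. (b has_derivative b' x) (at x)" "\<And>v. (\<lambda>x. b' x v) \<in> derivative_algebra f" by blast
  show ?case
    by (intro exI[of _ "\<lambda>x v. a x * b' x v + a' x v * b x"] conjI allI has_derivative_mult
        derivative_algebra.add derivative_algebra.mult * mult.hyps)
qed

lemma derivative_algebra_growth:
  assumes "a \<in> derivative_algebra f"
  shows "\<exists>C\<ge>0. \<exists>m. \<forall>x. \<bar>a x\<bar> \<le> C * (1 + norm x) ^ m"
  using assms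
proof induction
  case (base vs)
  obtain B where "B \<ge> 0" "\<And>x. \<bar>iter_deriv vs f x\<bar> \<le> B" using f_bounded by blast
  then show ?case by (intro exI[of _ B] conjI exI[of _ 0]) auto
next
  case (const c)
  show ?case by (intro exI[of _ "\<bar>c\<bar>"] conjI exI[of _ 0]) auto
next
  case (coordinate v)
  have "\<bar>x \<bullet> v\<bar> \<le> norm v * (1 + norm x)" for x :: 'a
    using Cauchy_Schwarz_ineq2[of x v] by (simp add: algebra_simps add_increasing)
  then show ?case by (intro exI[of _ "norm v"] conjI exI[of _ 1]) auto
next
  case (add a b)
  then obtain C m D n where C: "C \<ge> 0" "\<And>x. \<bar>a x\<bar> \<le> C * (1 + norm x) ^ m"
    and D: "D \<ge> 0" "\<And>x. \<bar>b x\<bar> \<le> D * (1 + norm x) ^ n" by blast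
  have "\<bar>a x + b x\<bar> \<le> (C + D) * (1 + norm x) ^ (m + n)" for x
  proof -
    have "\<bar>a x + b x\<bar> \<le> C * (1 + norm x) ^ m + D * (1 + norm x) ^ n"
      using C(2)[of x] D(2)[of x] by linarith
    also have "\<dots> \<le> C * (1 + norm x) ^ (m + n) + D * (1 + norm x) ^ (m + n)"
      using C(1) D(1) by (intro add_mono mult_left_mono power_increasing) auto
    finally show ?thesis by (simp add: distrib_right)
  qed
  then show ?case using C(1) D(1) by (intro exI[of _ "C + D"] conjI exI[of _ "m + n"]) auto
next
  case (mult a b)
  then obtain C m D n where C: "C \<ge> 0" "\<And>x. \<bar>a x\<bar> \<le> C * (1 + norm x) ^ m"
    and D: "D \<ge> 0" "\<And>x. \<bar>b x\<bar> \<le> D * (1 + norm x) ^ n" by blast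
  have "\<bar>a x * b x\<bar> \<le> (C * D) * (1 + norm x) ^ (m + n)" for x
  proof -
    have "\<bar>a x * b x\<bar> \<le> (C * (1 + norm x) ^ m) * (D * (1 + norm x) ^ n)"
      unfolding abs_mult using C D by (intro mult_mono) auto
    then show ?thesis by (simp add: power_add mult_ac)
  qed
  then show ?case using C(1) D(1) by (intro exI[of _ "C * D"] conjI exI[of _ "m + n"]) auto
qed

text \<open>Differentiating the Gaussian only brings down a coordinate times a constant, so the
  cofactor \<open>b\<close> remains in the algebra at every order.\<close>

lemma iter_deriv_times_gauss:
  assumes "a \<in> derivative_algebra f"
  shows "\<exists>b\<in>derivative_algebra f. iter_deriv vs (\<lambda>x. a x * gauss (c *\<^sub>R x)) = (\<lambda>x. b x * gauss (c *\<^sub>R x))"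
proof (induction vs)
  case Nil
  then show ?case using assms by auto
next
  case (Cons v vs)
  then obtain b where b: "b \<in> derivative_algebra f" "iter_deriv vs (\<lambda>x. a x * gauss (c *\<^sub>R x)) = (\<lambda>x. b x * gauss (c *\<^sub>R x))" by blast
  obtain b' where b': "\<And>x. (b has_derivative b' x) (at x)" "\<And>v. (\<lambda>x. b' x v) \<in> derivative_algebra f"
    using derivative_algebra_derivative[OF b(1)] by blast
  have "frechet_derivative (\<lambda>x. b x * gauss (c *\<^sub>R x)) (at x) v =
      (b x * ((- 2 * pi * c\<^sup>2) * (x \<bullet> v)) + b' x v) * gauss (c *\<^sub>R x)" for x
  proof -
    have "((\<lambda>x. b x * gauss (c *\<^sub>R x)) has_derivative
        (\<lambda>v. b x * ((- 2 * pi * c\<^sup>2) * (x \<bullet> v) * gauss (c *\<^sub>R x)) + b' x v * gauss (c *\<^sub>R x))) (at x)"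
      by (intro has_derivative_mult b' gauss_scaled_has_derivative)
    from frechet_derivative_at[OF this, symmetric] show ?thesis by (simp add: algebra_simps)
  qed
  then have "iter_deriv (v # vs) (\<lambda>x. a x * gauss (c *\<^sub>R x)) =
      (\<lambda>x. (b x * ((- 2 * pi * c\<^sup>2) * (x \<bullet> v)) + b' x v) * gauss (c *\<^sub>R x))"
    by (simp add: b(2))
  moreover have "(\<lambda>x. b x * ((- 2 * pi * c\<^sup>2) * (x \<bullet> v)) + b' x v) \<in> derivative_algebra f"
    by (intro derivative_algebra.intros b b')
  ultimately show ?case by (rule rev_bexI[rotated])
qed

text \<open>The cofactors of the derivatives grow at most polynomially, because all derivatives of
  \<open>f\<close> are bounded, and the Gaussian beats every polynomial.\<close>

theorem schwartz_times_gauss: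
  assumes c: "c \<noteq> 0"
  shows "schwartz (\<lambda>x. f x * gauss (c *\<^sub>R x))"
  unfolding schwartz_def smooth_def
proof (intro conjI allI)
  have fa: "f \<in> derivative_algebra f" using derivative_algebra.base[of "[]" f] by simp
  fix vs
  obtain b where b: "b \<in> derivative_algebra f" "iter_deriv vs (\<lambda>x. f x * gauss (c *\<^sub>R x)) = (\<lambda>x. b x * gauss (c *\<^sub>R x))"
    using iter_deriv_times_gauss[OF fa] by blast
  show "iter_deriv vs (\<lambda>x. f x * gauss (c *\<^sub>R x)) differentiable (at x)" for x
  proof -
    obtain b' where "(b has_derivative b') (at x)" using derivative_algebra_derivative[OF b(1)] by blast
    from has_derivative_mult[OF this gauss_scaled_has_derivative]
    show ?thesis unfolding b(2) differentiable_def by blast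
  qed
  fix k
  obtain C m where C: "C \<ge> 0" "\<And>x. \<bar>b x\<bar> \<le> C * (1 + norm x) ^ m" using derivative_algebra_growth[OF b(1)] by blast
  obtain D where D: "\<And>x::'a. (1 + norm x) ^ (k + m) * gauss (c *\<^sub>R x) \<le> D"
    using polynomial_times_gauss_bounded[OF c] by blast
  show "\<exists>C. \<forall>x. (1 + norm x) ^ k * \<bar>iter_deriv vs (\<lambda>x. f x * gauss (c *\<^sub>R x)) x\<bar> \<le> C"
  proof (intro exI allI)
    fix x
    have "(1 + norm x) ^ k * \<bar>b x * gauss (c *\<^sub>R x)\<bar> \<le> (1 + norm x) ^ k * (C * (1 + norm x) ^ m * gauss (c *\<^sub>R x))"
      unfolding abs_mult using C by (intro mult_left_mono mult_mono) auto
    also have "\<dots> = C * ((1 + norm x) ^ (k + m) * gauss (c *\<^sub>R x))" by (simp add: power_add mult_ac)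
    also have "\<dots> \<le> C * D" by (intro mult_left_mono D C)
    finally show "(1 + norm x) ^ k * \<bar>iter_deriv vs (\<lambda>x. f x * gauss (c *\<^sub>R x)) x\<bar> \<le> C * D"
      unfolding b(2) .
  qed
qed

end

subsection \<open>Operations on Schwartz functions\<close>

lemma iter_deriv_reflect:
  fixes f :: "'a::euclidean_space \<Rightarrow> real"
  assumes f: "smooth f"
  shows "iter_deriv vs (\<lambda>z. f (x - z)) = (\<lambda>z. (- 1) ^ length vs * iter_deriv vs f (x - z))"
    and "(\<lambda>z. (- 1) ^ length vs * iter_deriv vs f (x - z)) differentiable (at z)"
proof -
  have D: "((\<lambda>z. (- 1) ^ length vs * iter_deriv vs f (x - z)) has_derivative
      (\<lambda>v. (- 1) ^ length vs * (frechet_derivative (iter_deriv vs f) (at (x - z)) (- v)))) (at z)" for vs z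
  proof -
    have 1: "(iter_deriv vs f has_derivative frechet_derivative (iter_deriv vs f) (at (x - z))) (at (x - z))"
      using smooth_iter_deriv_differentiable[OF f] by (simp add: frechet_derivative_works)
    have 2: "((\<lambda>z. x - z) has_derivative (\<lambda>v. - v)) (at z)" by (auto intro!: derivative_eq_intros)
    show ?thesis by (rule has_derivative_mult_right[OF has_derivative_compose[OF 2 1]])
  qed
  have lin: "frechet_derivative (iter_deriv vs f) (at y) (- v) = - frechet_derivative (iter_deriv vs f) (at y) v" for vs y v
    using linear_frechet_derivative[OF smooth_iter_deriv_differentiable[OF f]] by (rule linear_neg)
  show "(\<lambda>z. (- 1) ^ length vs * iter_deriv vs f (x - z)) differentiable (at z)"
    using D unfolding differentiable_def by blast
  show "iter_deriv vs (\<lambda>z. f (x - z)) = (\<lambda>z. (- 1) ^ length vs * iter_deriv vs f (x - z))"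
  proof (induction vs)
    case (Cons v vs)
    show ?case
      unfolding iter_deriv.simps Cons frechet_derivative_at[OF D, symmetric] lin by simp
  qed simp
qed

lemma schwartz_reflect:
  fixes f :: "'a::euclidean_space \<Rightarrow> real"
  assumes f: "schwartz f"
  shows "schwartz (\<lambda>z. f (x - z))"
proof -
  have fs: "smooth f" using f by (simp add: schwartz_def)
  show ?thesis
    unfolding schwartz_def smooth_def iter_deriv_reflect(1)[OF fs]
  proof (intro conjI allI iter_deriv_reflect(2)[OF fs])
    fix k vs
    obtain C where C: "\<And>y. (1 + norm y) ^ k * \<bar>iter_deriv vs f y\<bar> \<le> C"
      using f unfolding schwartz_def by metis
    have "(1 + norm z) ^ k * \<bar>(- 1) ^ length vs * iter_deriv vs f (x - z)\<bar> \<le> (1 + norm x) ^ k * C" for z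
    proof -
      have "norm z \<le> norm x + norm (x - z)"
        by (metis add.commute diff_add_cancel norm_minus_commute norm_triangle_ineq)
      then have "1 + norm z \<le> (1 + norm x) * (1 + norm (x - z))"
      proof -
        have "(1 + norm x) * (1 + norm (x - z)) = 1 + norm x + norm (x - z) + norm x * norm (x - z)"
          by (simp add: algebra_simps)
        moreover have "0 \<le> norm x * norm (x - z)" by simp
        ultimately show ?thesis using \<open>norm z \<le> norm x + norm (x - z)\<close> by linarith
      qed
      then have "(1 + norm z) ^ k \<le> (1 + norm x) ^ k * (1 + norm (x - z)) ^ k"
        unfolding power_mult_distrib[symmetric] by (intro power_mono) auto
      then have "(1 + norm z) ^ k * \<bar>iter_deriv vs f (x - z)\<bar> \<le> (1 + norm x) ^ k * (1 + norm (x - z)) ^ k * \<bar>iter_deriv vs f (x - z)\<bar>"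
        by (intro mult_right_mono) auto
      also have "\<dots> \<le> (1 + norm x) ^ k * C"
        unfolding mult.assoc by (intro mult_left_mono C) auto
      finally show ?thesis by (simp add: abs_mult power_abs)
    qed
    then show "\<exists>C. \<forall>z. (1 + norm z) ^ k * \<bar>(- 1) ^ length vs * iter_deriv vs f (x - z)\<bar> \<le> C" by blast
  qed
qed

lemma iter_deriv_linear:
  fixes f g :: "'a::euclidean_space \<Rightarrow> real"
  assumes f: "smooth f" and g: "smooth g"
  shows "iter_deriv vs (\<lambda>x. a * f x + b * g x) = (\<lambda>x. a * iter_deriv vs f x + b * iter_deriv vs g x)"
    and "(\<lambda>x. a * iter_deriv vs f x + b * iter_deriv vs g x) differentiable (at x)"
proof -
  have D: "((\<lambda>x. a * iter_deriv vs f x + b * iter_deriv vs g x) has_derivative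
      (\<lambda>v. a * frechet_derivative (iter_deriv vs f) (at x) v + b * frechet_derivative (iter_deriv vs g) (at x) v)) (at x)" for vs x
    using smooth_iter_deriv_differentiable[OF f, of vs x] smooth_iter_deriv_differentiable[OF g, of vs x]
    by (intro has_derivative_add has_derivative_mult_right) (simp_all add: frechet_derivative_works)
  show "(\<lambda>x. a * iter_deriv vs f x + b * iter_deriv vs g x) differentiable (at x)"
    using D unfolding differentiable_def by blast
  show "iter_deriv vs (\<lambda>x. a * f x + b * g x) = (\<lambda>x. a * iter_deriv vs f x + b * iter_deriv vs g x)"
  proof (induction vs)
    case (Cons v vs)
    show ?case
      unfolding iter_deriv.simps Cons frechet_derivative_at[OF D, symmetric] ..
  qed simp
qed

lemma schwartz_linear:
  fixes f g :: "'a::euclidean_space \<Rightarrow> real"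
  assumes f: "schwartz f" and g: "schwartz g"
  shows "schwartz (\<lambda>x. a * f x + b * g x)"
proof -
  have s: "smooth f" "smooth g" using f g by (simp_all add: schwartz_def)
  show ?thesis
    unfolding schwartz_def smooth_def iter_deriv_linear(1)[OF s]
  proof (intro conjI allI iter_deriv_linear(2)[OF s])
    fix k vs
    obtain C D where C: "\<And>x. (1 + norm x) ^ k * \<bar>iter_deriv vs f x\<bar> \<le> C"
      and D: "\<And>x. (1 + norm x) ^ k * \<bar>iter_deriv vs g x\<bar> \<le> D"
      using f g unfolding schwartz_def by metis
    have "(1 + norm x) ^ k * \<bar>a * iter_deriv vs f x + b * iter_deriv vs g x\<bar> \<le> \<bar>a\<bar> * C + \<bar>b\<bar> * D" for x
    proof -
      have "(1 + norm x) ^ k * \<bar>a * iter_deriv vs f x + b * iter_deriv vs g x\<bar> \<le>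
          (1 + norm x) ^ k * (\<bar>a\<bar> * \<bar>iter_deriv vs f x\<bar> + \<bar>b\<bar> * \<bar>iter_deriv vs g x\<bar>)"
        by (intro mult_left_mono order_trans[OF abs_triangle_ineq]) (auto simp: abs_mult)
      also have "\<dots> = \<bar>a\<bar> * ((1 + norm x) ^ k * \<bar>iter_deriv vs f x\<bar>) + \<bar>b\<bar> * ((1 + norm x) ^ k * \<bar>iter_deriv vs g x\<bar>)"
        by (simp only: distrib_left mult_ac)
      also have "\<dots> \<le> \<bar>a\<bar> * C + \<bar>b\<bar> * D"
        by (intro add_mono mult_left_mono C D) auto
      finally show ?thesis .
    qed
    then show "\<exists>C. \<forall>x. (1 + norm x) ^ k * \<bar>a * iter_deriv vs f x + b * iter_deriv vs g x\<bar> \<le> C" by blast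
  qed
qed

lemma schwartz0_linear:
  assumes "f \<in> schwartz0" "g \<in> schwartz0"
  shows "(\<lambda>x. a * f x + b * g x) \<in> schwartz0"
  using assms schwartz_integrable[of f] schwartz_integrable[of g]
  by (auto simp: schwartz0_def intro: schwartz_linear)

lemma schwartz0_increment:
  fixes f :: "'a::euclidean_space \<Rightarrow> real"
  assumes f: "schwartz f"
  shows "(\<lambda>z. f (x - z) - f (y - z)) \<in> schwartz0"
proof -
  have "schwartz (\<lambda>z. 1 * f (x - z) + (- 1) * f (y - z))"
    by (intro schwartz_linear schwartz_reflect f)
  moreover have "(LINT z|lborel. f (x - z)) = (LINT z|lborel. f z)" for x
    using integral_affine[of f "- 1" x] schwartz_measurable[OF f] by simp
  moreover have "integrable lborel (\<lambda>z. f (x - z))" for x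
    using schwartz_integrable[OF schwartz_reflect[OF f]] .
  ultimately show ?thesis by (simp add: schwartz0_def)
qed

subsection \<open>The logarithmic energy\<close>

lemma ennreal_tendsto_0_le:
  fixes f g :: "nat \<Rightarrow> ennreal"
  assumes "\<And>n. f n \<le> g n" "g \<longlonglongrightarrow> 0"
  shows "f \<longlonglongrightarrow> 0"
  by (rule tendsto_sandwich[OF _ _ tendsto_const assms(2)]) (auto simp: assms(1))

text \<open>Fatou's lemma prepared for Cauchy estimates: one index is fixed and gives
  \<open>a\<close>, the other runs off and its share \<open>b\<close> vanishes. It passes from a
  Cauchy bound to a bound on the distance to the limit, both in frequency and on the probability
  space.\<close>

lemma nn_integral_le_of_AE_limit:
  assumes [measurable]: "\<And>m. u m \<in> borel_measurable M"
    and lim: "AE x in M. (\<lambda>m. u m x) \<longlonglongrightarrow> (v x :: ennreal)"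
    and le: "\<And>m. (\<integral>\<^sup>+x. u m x \<partial>M) \<le> a + b m" and b: "b \<longlonglongrightarrow> 0"
  shows "(\<integral>\<^sup>+x. v x \<partial>M) \<le> a"
proof -
  have "(\<integral>\<^sup>+x. v x \<partial>M) = (\<integral>\<^sup>+x. liminf (\<lambda>m. u m x) \<partial>M)"
  proof (rule nn_integral_cong_AE)
    show "AE x in M. v x = liminf (\<lambda>m. u m x)"
      using lim by eventually_elim (simp add: lim_imp_Liminf)
  qed
  also have "\<dots> \<le> liminf (\<lambda>m. \<integral>\<^sup>+x. u m x \<partial>M)"
    by (rule nn_integral_liminf) measurable
  also have "\<dots> \<le> liminf (\<lambda>m. a + b m)"
    by (intro Liminf_mono always_eventually allI le)
  also have "(\<lambda>m. a + b m) \<longlonglongrightarrow> a + 0" by (intro tendsto_add tendsto_const b)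
  then have "liminf (\<lambda>m. a + b m) = a" by (simp add: lim_imp_Liminf)
  finally show ?thesis .
qed

text \<open>Makes \<open>log_energy\<close> a squared norm in an L2 space, so that the lemmas on
  convergence in mean square apply to it.\<close>

definition energy_measure :: "'a::euclidean_space measure" where
  "energy_measure = density lborel (\<lambda>\<zeta>. ennreal (1 / (sphere_area DIM('a) * norm \<zeta> ^ DIM('a))))"

lemma sets_energy_measure [measurable_cong, simp]: "sets energy_measure = sets borel"
  by (simp add: energy_measure_def)

lemma log_energy_eq:
  assumes [measurable]: "(f :: 'a::euclidean_space \<Rightarrow> complex) \<in> borel_measurable borel"
  shows "log_energy f = (\<integral>\<^sup>+\<zeta>. ennreal ((cmod (f \<zeta>))\<^sup>2) \<partial>energy_measure)"
proof -
  let ?A = "sphere_area DIM('a)"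
  have A: "?A > 0" by (simp add: sphere_area_pos)
  have "(\<integral>\<^sup>+\<zeta>. ennreal ((cmod (f \<zeta>))\<^sup>2) \<partial>energy_measure) = (\<integral>\<^sup>+\<zeta>. ennreal (1 / ?A) * ennreal ((cmod (f \<zeta>))\<^sup>2 / norm \<zeta> ^ DIM('a)) \<partial>lborel)"
    unfolding energy_measure_def using A
    by (subst nn_integral_density) (auto intro!: nn_integral_cong simp flip: ennreal_mult)
  also have "\<dots> = log_energy f"
    unfolding log_energy_def by (rule nn_integral_cmult) measurable
  finally show ?thesis ..
qed

lemma log_energy_reflect:
  fixes f :: "'a::euclidean_space \<Rightarrow> complex"
  assumes [measurable]: "f \<in> borel_measurable borel"
  shows "log_energy (\<lambda>\<zeta>. f (- \<zeta>)) = log_energy f"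
  unfolding log_energy_def
  using nn_integral_reflect[of "\<lambda>\<zeta>. ennreal ((cmod (f \<zeta>))\<^sup>2 / norm \<zeta> ^ DIM('a))"] by simp

lemma log_energy_add_le:
  fixes f g :: "'a::euclidean_space \<Rightarrow> complex"
  assumes [measurable]: "f \<in> borel_measurable borel" "g \<in> borel_measurable borel"
  shows "log_energy (\<lambda>\<zeta>. f \<zeta> + g \<zeta>) \<le> 2 * log_energy f + 2 * log_energy g"
proof -
  have "log_energy (\<lambda>\<zeta>. f \<zeta> + g \<zeta>) = (\<integral>\<^sup>+\<zeta>. ennreal ((cmod (f \<zeta> + g \<zeta>))\<^sup>2) \<partial>energy_measure)"
    by (rule log_energy_eq) measurable
  also have "\<dots> \<le> 2 * log_energy f + 2 * log_energy g"
    using nn_integral_power2_norm_add_le[of f energy_measure g 1] by (simp add: log_energy_eq)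
  finally show ?thesis .
qed

text \<open>In polar coordinates the integrand is just \<open>r\<close>, in every dimension: the
  first-order zero of an increment symbol compensates the weight near the origin.\<close>

lemma nn_integral_low_frequency:
  "(\<integral>\<^sup>+(\<zeta>::'a::euclidean_space). ennreal ((norm \<zeta>)\<^sup>2 / norm \<zeta> ^ DIM('a)) * indicator (ball 0 1) \<zeta> \<partial>lborel) < \<infinity>"
proof -
  have "(\<integral>\<^sup>+(\<zeta>::'a). ennreal ((norm \<zeta>)\<^sup>2 / norm \<zeta> ^ DIM('a)) * indicator (ball 0 1) \<zeta> \<partial>lborel) =
      (\<integral>\<^sup>+(\<zeta>::'a). ennreal ((norm \<zeta>)\<^sup>2 / norm \<zeta> ^ DIM('a)) * indicator {..<1} (norm \<zeta>) \<partial>lborel)"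
    by (intro nn_integral_cong) (auto split: split_indicator)
  also have "\<dots> = ennreal (sphere_area DIM('a)) *
      (\<integral>\<^sup>+r. ennreal (r ^ (DIM('a) - 1)) * (ennreal (r\<^sup>2 / r ^ DIM('a)) * indicator {..<1} r) * indicator {0..} r \<partial>lborel)"
    by (rule nn_integral_radial[where f="\<lambda>r. ennreal (r\<^sup>2 / r ^ DIM('a)) * indicator {..<1} r"]) simp
  also have "\<dots> < \<infinity>"
  proof -
    have "(\<integral>\<^sup>+r. ennreal (r ^ (DIM('a) - 1)) * (ennreal (r\<^sup>2 / r ^ DIM('a)) * indicator {..<1} r) * indicator {0..} r \<partial>lborel) \<le>
        (\<integral>\<^sup>+r. indicator {0..1} r \<partial>(lborel :: real measure))"
    proof (rule nn_integral_mono)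
      fix r :: real
      have "r ^ (DIM('a) - 1) * (r\<^sup>2 / r ^ DIM('a)) \<le> 1" if "0 \<le> r" "r < 1"
      proof (cases "r = 0")
        case False
        then have "r ^ (DIM('a) - 1) * (r\<^sup>2 / r ^ DIM('a)) = r"
          by (simp add: power_diff power2_eq_square)
        then show ?thesis using that by simp
      qed simp
      then show "ennreal (r ^ (DIM('a) - 1)) * (ennreal (r\<^sup>2 / r ^ DIM('a)) * indicator {..<1} r) * indicator {0..} r \<le> indicator {0..1} r"
        by (auto split: split_indicator simp: ennreal_le_1 simp flip: ennreal_mult)
    qed
    also have "\<dots> < \<infinity>" by simp
    finally show ?thesis by (simp add: ennreal_mult_less_top)
  qed
  finally show ?thesis .
qed

subsection \<open>Gaussian cutoffs of the kernel in Fourier space\<close>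

definition plane_wave_diff :: "'a::euclidean_space \<Rightarrow> 'a \<Rightarrow> 'a \<Rightarrow> complex" where
  "plane_wave_diff x y \<zeta> = cis (2 * pi * (x \<bullet> \<zeta>)) - cis (2 * pi * (y \<bullet> \<zeta>))"

lemma plane_wave_diff_measurable [measurable]: "plane_wave_diff x y \<in> borel_measurable borel"
  unfolding plane_wave_diff_def by measurable

text \<open>The constant bound serves high frequencies, the linear one low frequencies.\<close>

lemma plane_wave_diff_bounds:
  "cmod (plane_wave_diff x y \<zeta>) \<le> 2" "cmod (plane_wave_diff x y \<zeta>) \<le> 2 * pi * norm (x - y) * norm \<zeta>"
proof -
  show "cmod (plane_wave_diff x y \<zeta>) \<le> 2"
    using norm_triangle_ineq4[of "cis (2 * pi * (x \<bullet> \<zeta>))" "cis (2 * pi * (y \<bullet> \<zeta>))"] by (simp add: plane_wave_diff_def)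
  have "cmod (plane_wave_diff x y \<zeta>) \<le> \<bar>2 * pi * (x \<bullet> \<zeta>) - 2 * pi * (y \<bullet> \<zeta>)\<bar>"
    unfolding plane_wave_diff_def by (rule norm_cis_diff_le)
  also have "\<dots> = 2 * pi * \<bar>(x - y) \<bullet> \<zeta>\<bar>" by (simp add: inner_diff_left abs_mult flip: right_diff_distrib)
  also have "\<dots> \<le> 2 * pi * (norm (x - y) * norm \<zeta>)"
    by (intro mult_left_mono Cauchy_Schwarz_ineq2) simp
  finally show "cmod (plane_wave_diff x y \<zeta>) \<le> 2 * pi * norm (x - y) * norm \<zeta>" by (simp add: mult.assoc)
qed

text \<open>The properties of \<open>mollifier_hat K (\<epsilon> *\<^sub>R \<zeta>)\<close> that the
  approximation uses. Evenness makes the kernel real and lets \<open>fourier\<close> and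
  \<open>inv_fourier\<close> agree on the symbol.\<close>

locale even_rapid =
  fixes g :: "'a::euclidean_space \<Rightarrow> real"
  assumes g_cont: "continuous_on UNIV g" and g_even: "g (- \<zeta>) = g \<zeta>" and g_rapid: "rapidly_decaying g"
begin

lemma g_measurable [measurable]: "g \<in> borel_measurable borel"
  by (rule borel_measurable_continuous_onI[OF g_cont])

abbreviation cg :: "'a \<Rightarrow> complex" where "cg \<zeta> \<equiv> complex_of_real (g \<zeta>)"

lemma cg_integrable: "integrable lborel cg"
  using rapidly_decaying_integrable[OF g_rapid g_measurable, of "\<lambda>_. 1" 1 0] by simp

lemma cg_cont: "continuous_on UNIV cg"
  by (intro continuous_intros g_cont)

lemma g_bounded: "\<exists>B\<ge>0. \<forall>\<zeta>. \<bar>g \<zeta>\<bar> \<le> B"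
  using g_rapid[unfolded rapidly_decaying_def, rule_format, of 0] by simp

lemma fourier_cg_minus: "fourier cg (- x) = fourier cg x"
proof -
  have "fourier cg (- x) = (LINT \<zeta>|lborel. cis (- 2 * pi * (- \<zeta> \<bullet> x)) * cg (- \<zeta>))"
    by (simp add: fourier_def g_even)
  also have "\<dots> = fourier cg x"
    unfolding fourier_def by (rule integral_reflect) measurable
  finally show ?thesis .
qed

lemma of_real_kernel: "complex_of_real (real_inv_fourier g x) = fourier cg x"
proof -
  have "cnj (fourier cg x) = fourier cg x" by (simp add: cnj_fourier fourier_cg_minus)
  then have "Im (fourier cg x) = 0" by (metis complex_cnj complex.sel(2) equal_neg_zero cnj.simps(2))
  then show ?thesis
    unfolding real_inv_fourier_def inv_fourier_eq fourier_cg_minus by (simp add: complex_eq_iff)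
qed

text \<open>A Gaussian window in space, which is Gaussian averaging of \<open>g\<close> at width
  \<open>s\<close> in frequency. For \<open>s\<close> tending to 0 the window opens and the kernel
  is recovered.\<close>

definition cutoff :: "real \<Rightarrow> 'a \<Rightarrow> real" where
  "cutoff s x = real_inv_fourier g x * gauss (s *\<^sub>R x)"

lemma kernel_continuous: "continuous_on A (real_inv_fourier g)"
  using smooth_continuous[OF smooth_real_inv_fourier[OF g_rapid g_measurable], of A "[]"] by simp

lemma kernel_measurable [measurable]: "real_inv_fourier g \<in> borel_measurable borel"
  by (rule borel_measurable_continuous_onI[OF kernel_continuous])

lemma schwartz_cutoff: "s \<noteq> 0 \<Longrightarrow> schwartz (cutoff s)"
  unfolding cutoff_def[abs_def]
  using schwartz_times_gauss[OF smooth_real_inv_fourier[OF g_rapid g_measurable] iter_deriv_real_inv_fourier_bounded[OF g_rapid g_measurable]] .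

lemma cutoff_measurable [measurable]: "cutoff s \<in> borel_measurable borel"
  unfolding cutoff_def[abs_def] by measurable

text \<open>The multiplication formula with a modulated Gaussian: its transform is a Gaussian bump
  of width \<open>s\<close> centred at \<open>- \<zeta>\<close>.\<close>

lemma fourier_cutoff:
  assumes s: "s > 0"
  shows "fourier (\<lambda>x. complex_of_real (cutoff s x)) \<zeta> = (LINT z|lborel. cg (- \<zeta> + s *\<^sub>R z) * complex_of_real (gauss z))"
proof -
  define u where "u x = cis (- 2 * pi * (x \<bullet> \<zeta>)) * complex_of_real (gauss (s *\<^sub>R x))" for x
  have ui: "integrable lborel u"
    unfolding u_def using integrable_gauss_scaled[of s, where ?'a='a] s by (intro integrable_cis_mult) simp_all
  have "fourier (\<lambda>x. complex_of_real (cutoff s x)) \<zeta> = (LINT x|lborel. u x * fourier cg x)"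
    unfolding fourier_def[of "\<lambda>x. complex_of_real (cutoff s x)"]
    by (intro Bochner_Integration.integral_cong refl) (simp add: cutoff_def of_real_kernel u_def mult_ac)
  also have "\<dots> = (LINT \<eta>|lborel. fourier u \<eta> * cg \<eta>)"
    by (rule fourier_multiplication[OF ui cg_integrable])
  also have "\<dots> = (LINT \<eta>|lborel. cg \<eta> * complex_of_real (gauss ((- \<zeta> - \<eta>) /\<^sub>R s) / s ^ DIM('a)))"
  proof -
    have "fourier u \<eta> = complex_of_real (gauss ((- \<zeta> - \<eta>) /\<^sub>R s) / s ^ DIM('a))" for \<eta>
    proof -
      have shift: "cis (- 2 * pi * (x \<bullet> \<eta>)) * (cis (- 2 * pi * (x \<bullet> \<zeta>)) * z) = cis (2 * pi * ((- \<zeta> - \<eta>) \<bullet> x)) * z" for x z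
        unfolding mult.assoc[symmetric] cis_mult
        by (rule arg_cong[where f="\<lambda>a. cis a * z"]) (simp add: inner_diff_left inner_commute[of x] algebra_simps)
      show ?thesis
        unfolding integral_cis_gauss_scaled[OF s, symmetric] fourier_def u_def shift ..
    qed
    then show ?thesis by (simp only: mult.commute)
  qed
  also have "\<dots> = (LINT z|lborel. cg (- \<zeta> + s *\<^sub>R z) * complex_of_real (gauss z))"
    by (rule integral_gauss_kernel[OF _ s]) measurable
  finally show ?thesis .
qed

lemma fourier_cutoff_bound:
  assumes s: "s > 0" and B: "\<And>\<zeta>. \<bar>g \<zeta>\<bar> \<le> B"
  shows "cmod (fourier (\<lambda>x. complex_of_real (cutoff s x)) \<zeta>) \<le> B"
proof -
  have "cmod (fourier (\<lambda>x. complex_of_real (cutoff s x)) \<zeta>) \<le> (LINT (z::'a)|lborel. B * gauss z)"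
    unfolding fourier_cutoff[OF s]
  proof (rule Bochner_Integration.integral_norm_bound_integral)
    show i: "integrable lborel (\<lambda>z::'a. B * gauss z)" using integrable_gauss[where ?'a='a] by simp
    have B0: "B \<ge> 0" using order_trans[OF abs_ge_zero B[of 0]] .
    show le: "cmod (cg (- \<zeta> + s *\<^sub>R z) * complex_of_real (gauss z)) \<le> B * gauss z" for z
      using B by (simp add: norm_mult mult_right_mono)
    show "integrable lborel (\<lambda>z. cg (- \<zeta> + s *\<^sub>R z) * complex_of_real (gauss z))"
      by (rule Bochner_Integration.integrable_bound[OF i]) (use le B0 in \<open>auto simp: abs_mult\<close>)
  qed
  then show ?thesis by (simp add: integral_gauss)
qed

lemma fourier_cutoff_tendsto:
  assumes "s \<longlonglongrightarrow> 0" "\<And>n. s n > 0"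
  shows "(\<lambda>n. fourier (\<lambda>x. complex_of_real (cutoff (s n) x)) \<zeta>) \<longlonglongrightarrow> cg \<zeta>"
proof -
  obtain B where B: "\<And>\<zeta>. \<bar>g \<zeta>\<bar> \<le> B" using g_bounded by auto
  have "(\<lambda>n. LINT z|lborel. cg (- \<zeta> + s n *\<^sub>R z) * complex_of_real (gauss z)) \<longlonglongrightarrow> cg (- \<zeta>)"
    by (rule gauss_average_tendsto[OF cg_cont _ assms(1), of B]) (simp add: B)
  then show ?thesis by (simp add: fourier_cutoff assms(2) g_even)
qed

lemma kernel_L2: "(\<integral>\<^sup>+x. ennreal ((real_inv_fourier g x)\<^sup>2) \<partial>lborel) < \<infinity>"
proof -
  obtain B where B: "\<And>\<zeta>. \<bar>g \<zeta>\<bar> \<le> B" using g_bounded by auto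
  have "cmod (cg \<zeta>) \<le> B" for \<zeta> using B by simp
  note P = plancherel[OF cg_integrable cg_cont this]
  have "(\<integral>\<^sup>+x. ennreal ((real_inv_fourier g x)\<^sup>2) \<partial>lborel) = (\<integral>\<^sup>+x. ennreal ((cmod (fourier cg x))\<^sup>2) \<partial>lborel)"
    unfolding of_real_kernel[symmetric] by simp
  then show ?thesis using P by simp
qed

lemma cutoff_L2_tendsto:
  assumes "s \<longlonglongrightarrow> 0" "\<And>n. s n > 0"
  shows "(\<lambda>n. \<integral>\<^sup>+x. ennreal ((cutoff (s n) x - real_inv_fourier g x)\<^sup>2) \<partial>lborel) \<longlonglongrightarrow> 0"
proof -
  have "(\<lambda>n. \<integral>\<^sup>+x. ennreal ((cutoff (s n) x - real_inv_fourier g x)\<^sup>2) \<partial>lborel) \<longlonglongrightarrow> (\<integral>\<^sup>+(x::'a). 0 \<partial>lborel)"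
  proof (rule nn_integral_dominated_convergence)
    show "(\<integral>\<^sup>+x. ennreal ((real_inv_fourier g x)\<^sup>2) \<partial>lborel) < \<infinity>" by (rule kernel_L2)
    show "AE x in lborel. ennreal ((cutoff (s n) x - real_inv_fourier g x)\<^sup>2) \<le> ennreal ((real_inv_fourier g x)\<^sup>2)" for n
    proof (intro AE_I2 ennreal_leI)
      fix x
      have "cutoff (s n) x - real_inv_fourier g x = real_inv_fourier g x * (gauss (s n *\<^sub>R x) - 1)"
        by (simp add: cutoff_def algebra_simps)
      moreover have "\<bar>gauss (s n *\<^sub>R x) - 1\<bar> \<le> 1"
        using gauss_le_1[of "s n *\<^sub>R x"] gauss_nonneg[of "s n *\<^sub>R x"] by (simp add: abs_le_iff del: gauss_nonneg)
      ultimately have "\<bar>cutoff (s n) x - real_inv_fourier g x\<bar> \<le> \<bar>real_inv_fourier g x\<bar>"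
        by (simp add: abs_mult mult_left_le)
      then show "(cutoff (s n) x - real_inv_fourier g x)\<^sup>2 \<le> (real_inv_fourier g x)\<^sup>2"
        by (simp add: abs_le_square_iff)
    qed
    show "AE x in lborel. (\<lambda>n. ennreal ((cutoff (s n) x - real_inv_fourier g x)\<^sup>2)) \<longlonglongrightarrow> 0"
    proof (rule AE_I2)
      fix x :: 'a
      have "(\<lambda>n. (cutoff (s n) x - real_inv_fourier g x)\<^sup>2) \<longlonglongrightarrow>
          (real_inv_fourier g x * exp (- pi * (norm (0 *\<^sub>R x))\<^sup>2) - real_inv_fourier g x)\<^sup>2"
        unfolding cutoff_def gauss_def by (intro tendsto_intros assms)
      then have "(\<lambda>n. (cutoff (s n) x - real_inv_fourier g x)\<^sup>2) \<longlonglongrightarrow> 0" by simp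
      from tendsto_ennrealI[OF this] show "(\<lambda>n. ennreal ((cutoff (s n) x - real_inv_fourier g x)\<^sup>2)) \<longlonglongrightarrow> 0" by simp
    qed
  qed measurable
  then show ?thesis by simp
qed

text \<open>\<open>plancherel_diff\<close> compares with the inverse transform; evenness of
  \<open>g\<close> undoes the reflection.\<close>

lemma fourier_cutoff_L2:
  assumes s: "s > 0"
  shows "(\<integral>\<^sup>+\<zeta>. ennreal ((cmod (fourier (\<lambda>x. complex_of_real (cutoff s x)) \<zeta> - cg \<zeta>))\<^sup>2) \<partial>lborel) =
    (\<integral>\<^sup>+x. ennreal ((cutoff s x - real_inv_fourier g x)\<^sup>2) \<partial>lborel)"
proof -
  let ?k = "\<lambda>x. complex_of_real (cutoff s x)"
  have sw: "schwartz (cutoff s)" using s by (intro schwartz_cutoff) simp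
  obtain B where B: "\<And>\<zeta>. \<bar>g \<zeta>\<bar> \<le> B" using g_bounded by auto
  obtain C where C: "\<And>x. \<bar>cutoff s x\<bar> \<le> C" using schwartz_bounded[OF sw] by metis
  have "(\<integral>\<^sup>+x. ennreal ((cutoff s x - real_inv_fourier g x)\<^sup>2) \<partial>lborel) = (\<integral>\<^sup>+z. ennreal ((cmod (?k z - fourier cg z))\<^sup>2) \<partial>lborel)"
    unfolding of_real_kernel[symmetric] of_real_diff[symmetric] norm_of_real power2_abs ..
  also have "\<dots> = (\<integral>\<^sup>+\<zeta>. ennreal ((cmod (inv_fourier ?k \<zeta> - cg \<zeta>))\<^sup>2) \<partial>lborel)"
  proof (rule plancherel_diff)
    show "integrable lborel ?k" using schwartz_integrable[OF sw] by simp
    show "continuous_on UNIV ?k" by (intro continuous_intros schwartz_continuous sw)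
    show "cmod (?k x) \<le> C" for x using C by simp
    show "cmod (cg x) \<le> B" for x using B by simp
  qed (rule cg_integrable cg_cont)+
  also have "\<dots> = (\<integral>\<^sup>+\<zeta>. ennreal ((cmod (fourier ?k (- \<zeta>) - cg (- \<zeta>)))\<^sup>2) \<partial>lborel)"
    unfolding inv_fourier_eq g_even ..
  also have "\<dots> = (\<integral>\<^sup>+\<zeta>. ennreal ((cmod (fourier ?k \<zeta> - cg \<zeta>))\<^sup>2) \<partial>lborel)"
    by (rule nn_integral_reflect) measurable
  finally show ?thesis ..
qed

text \<open>Frequencies are split at norm 1. Below, the linear bound on the plane waves leaves an
  integrable weight, and the error tends to 0 pointwise within a fixed bound; above, the singular
  weight is at most 1 and Plancherel's theorem reduces the error to that of the cutoffs in
  space.\<close>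

lemma log_energy_cutoff_tendsto:
  assumes s: "s \<longlonglongrightarrow> 0" "\<And>n. s n > 0"
  shows "(\<lambda>n. log_energy (\<lambda>\<zeta>. plane_wave_diff x y \<zeta> * (fourier (\<lambda>x. complex_of_real (cutoff (s n) x)) \<zeta> - cg \<zeta>))) \<longlonglongrightarrow> 0"
proof -
  define u where "u n \<zeta> = fourier (\<lambda>x. complex_of_real (cutoff (s n) x)) \<zeta> - cg \<zeta>" for n \<zeta>
  have [measurable]: "u n \<in> borel_measurable borel" for n unfolding u_def[abs_def] by measurable
  obtain B where B: "B \<ge> 0" "\<And>\<zeta>. \<bar>g \<zeta>\<bar> \<le> B" using g_bounded by auto
  have u_bound: "cmod (u n \<zeta>) \<le> 2 * B" for n \<zeta>
    using norm_triangle_ineq4[of "fourier (\<lambda>x. complex_of_real (cutoff (s n) x)) \<zeta>" "cg \<zeta>"]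
      fourier_cutoff_bound[OF s(2)[of n] B(2), of \<zeta>] B(2)[of \<zeta>] by (simp add: u_def)
  have u_lim: "(\<lambda>n. u n \<zeta>) \<longlonglongrightarrow> 0" for \<zeta>
    unfolding u_def using tendsto_diff[OF fourier_cutoff_tendsto[OF s] tendsto_const, of \<zeta> "cg \<zeta>"] by simp
  define L where "L = (2 * pi * norm (x - y))\<^sup>2"
  have L: "L \<ge> 0" by (simp add: L_def)
  define w where "w \<zeta> = ennreal ((norm \<zeta>)\<^sup>2 / norm \<zeta> ^ DIM('a)) * indicator (ball 0 1) \<zeta>" for \<zeta> :: 'a
  have [measurable]: "ball (0::'a) 1 \<in> sets borel" by simp
  have [measurable]: "w \<in> borel_measurable borel" unfolding w_def by measurable
  have w_fin: "(\<integral>\<^sup>+\<zeta>. w \<zeta> \<partial>lborel) < \<infinity>" unfolding w_def by (rule nn_integral_low_frequency)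
  define I1 where "I1 n = (\<integral>\<^sup>+\<zeta>. w \<zeta> * ennreal ((cmod (u n \<zeta>))\<^sup>2) \<partial>lborel)" for n
  define I2 where "I2 n = (\<integral>\<^sup>+\<zeta>. ennreal ((cmod (u n \<zeta>))\<^sup>2) \<partial>lborel)" for n
  have I1: "I1 \<longlonglongrightarrow> 0"
  proof -
    have "I1 \<longlonglongrightarrow> (\<integral>\<^sup>+(\<zeta>::'a). 0 \<partial>lborel)"
      unfolding I1_def
    proof (rule nn_integral_dominated_convergence)
      show "(\<integral>\<^sup>+\<zeta>. w \<zeta> * ennreal ((2 * B)\<^sup>2) \<partial>lborel) < \<infinity>"
        using w_fin by (simp add: nn_integral_multc ennreal_mult_less_top)
      show "AE \<zeta> in lborel. w \<zeta> * ennreal ((cmod (u n \<zeta>))\<^sup>2) \<le> w \<zeta> * ennreal ((2 * B)\<^sup>2)" for n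
        by (intro AE_I2 mult_left_mono ennreal_leI power_mono u_bound) auto
      show "AE \<zeta> in lborel. (\<lambda>n. w \<zeta> * ennreal ((cmod (u n \<zeta>))\<^sup>2)) \<longlonglongrightarrow> 0"
      proof (rule AE_I2)
        fix \<zeta> :: 'a
        have "w \<zeta> \<noteq> \<top>" by (simp add: w_def ennreal_mult_eq_top_iff indicator_def)
        moreover have "(\<lambda>n. (cmod (u n \<zeta>))\<^sup>2) \<longlonglongrightarrow> (cmod 0)\<^sup>2" by (intro tendsto_intros u_lim)
        then have "(\<lambda>n. ennreal ((cmod (u n \<zeta>))\<^sup>2)) \<longlonglongrightarrow> ennreal ((cmod 0)\<^sup>2)" by (rule tendsto_ennrealI)
        ultimately have "(\<lambda>n. w \<zeta> * ennreal ((cmod (u n \<zeta>))\<^sup>2)) \<longlonglongrightarrow> w \<zeta> * ennreal ((cmod 0)\<^sup>2)"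
          by (intro ennreal_tendsto_cmult) (simp_all add: less_top)
        then show "(\<lambda>n. w \<zeta> * ennreal ((cmod (u n \<zeta>))\<^sup>2)) \<longlonglongrightarrow> 0" by simp
      qed
    qed measurable
    then show ?thesis by simp
  qed
  have I2: "I2 \<longlonglongrightarrow> 0"
    unfolding I2_def u_def fourier_cutoff_L2[OF s(2)] by (rule cutoff_L2_tendsto[OF s])
  have bound: "log_energy (\<lambda>\<zeta>. plane_wave_diff x y \<zeta> * u n \<zeta>) \<le> ennreal (1 / sphere_area DIM('a)) * (ennreal L * I1 n + ennreal 4 * I2 n)" for n
    unfolding log_energy_def
  proof (rule mult_left_mono)
    have "(\<integral>\<^sup>+\<zeta>. ennreal ((cmod (plane_wave_diff x y \<zeta> * u n \<zeta>))\<^sup>2 / norm \<zeta> ^ DIM('a)) \<partial>lborel) \<le>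
        (\<integral>\<^sup>+\<zeta>. ennreal L * (w \<zeta> * ennreal ((cmod (u n \<zeta>))\<^sup>2)) + ennreal 4 * ennreal ((cmod (u n \<zeta>))\<^sup>2) \<partial>lborel)"
    proof (rule nn_integral_mono)
      fix \<zeta> :: 'a
      let ?p = "cmod (plane_wave_diff x y \<zeta>)" and ?u = "(cmod (u n \<zeta>))\<^sup>2" and ?d = "norm \<zeta> ^ DIM('a)"
      have eq: "(cmod (plane_wave_diff x y \<zeta> * u n \<zeta>))\<^sup>2 / ?d = ?p\<^sup>2 * ?u / ?d"
        by (simp add: norm_mult power_mult_distrib)
      show "ennreal ((cmod (plane_wave_diff x y \<zeta> * u n \<zeta>))\<^sup>2 / ?d) \<le>
          ennreal L * (w \<zeta> * ennreal ?u) + ennreal 4 * ennreal ?u"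
      proof (cases "norm \<zeta> < 1")
        case True
        have "?p\<^sup>2 \<le> L * (norm \<zeta>)\<^sup>2"
          unfolding L_def power_mult_distrib[symmetric] by (intro power_mono plane_wave_diff_bounds) simp
        then have "?p\<^sup>2 * ?u / ?d \<le> L * (norm \<zeta>)\<^sup>2 * ?u / ?d"
          by (intro divide_right_mono mult_right_mono) auto
        also have "\<dots> = L * ((norm \<zeta>)\<^sup>2 / ?d * ?u)" by simp
        finally have "ennreal (?p\<^sup>2 * ?u / ?d) \<le> ennreal (L * ((norm \<zeta>)\<^sup>2 / ?d * ?u))" by (rule ennreal_leI)
        also have "\<dots> = ennreal L * (w \<zeta> * ennreal ?u)"
        proof -
          have "ennreal (L * ((norm \<zeta>)\<^sup>2 / ?d * ?u)) = ennreal L * (ennreal ((norm \<zeta>)\<^sup>2 / ?d) * ennreal ?u)"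
            by (subst ennreal_mult, rule L, simp, subst ennreal_mult, simp_all)
          then show ?thesis using True by (simp add: w_def)
        qed
        finally show ?thesis unfolding eq by (simp add: add_increasing2)
      next
        case False
        have "?p\<^sup>2 \<le> 2\<^sup>2" by (intro power_mono plane_wave_diff_bounds) simp
        then have "?p\<^sup>2 * ?u / ?d \<le> 4 * ?u / ?d" by (intro divide_right_mono mult_right_mono) auto
        also have "\<dots> \<le> 4 * ?u"
          using one_le_power[of "norm \<zeta>" "DIM('a)"] False mult_left_mono[of 1 ?d "4 * ?u"] by (simp add: divide_le_eq)
        finally have "ennreal (?p\<^sup>2 * ?u / ?d) \<le> ennreal 4 * ennreal ?u"
          unfolding ennreal_mult[OF zero_le_numeral zero_le_power2, symmetric] by (rule ennreal_leI)
        then show ?thesis unfolding eq by (simp add: add_increasing)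
      qed
    qed
    also have "\<dots> = ennreal L * I1 n + ennreal 4 * I2 n"
      unfolding I1_def I2_def by (subst nn_integral_add) (auto simp: nn_integral_cmult simp del: ennreal_numeral)
    finally show "(\<integral>\<^sup>+\<zeta>. ennreal ((cmod (plane_wave_diff x y \<zeta> * u n \<zeta>))\<^sup>2 / norm \<zeta> ^ DIM('a)) \<partial>lborel) \<le> ennreal L * I1 n + ennreal 4 * I2 n" .
  qed simp
  have "(\<lambda>n. ennreal (1 / sphere_area DIM('a)) * (ennreal L * I1 n + ennreal 4 * I2 n)) \<longlonglongrightarrow>
      ennreal (1 / sphere_area DIM('a)) * (ennreal L * 0 + ennreal 4 * 0)"
    by (intro ennreal_tendsto_cmult tendsto_add I1 I2) simp_all
  then have "(\<lambda>n. ennreal (1 / sphere_area DIM('a)) * (ennreal L * I1 n + ennreal 4 * I2 n)) \<longlonglongrightarrow> 0" by simp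
  from ennreal_tendsto_0_le[OF bound this] show ?thesis unfolding u_def .
qed

section \<open>Cutoffs of increments\<close>

definition increment_cutoff :: "real \<Rightarrow> 'a \<Rightarrow> 'a \<Rightarrow> 'a \<Rightarrow> real" where
  "increment_cutoff s x y z = cutoff s (x - z) - cutoff s (y - z)"

lemma increment_cutoff_schwartz0: "s \<noteq> 0 \<Longrightarrow> increment_cutoff s x y \<in> schwartz0"
  unfolding increment_cutoff_def[abs_def] by (intro schwartz0_increment schwartz_cutoff)

lemma inv_fourier_increment_cutoff:
  assumes s: "s \<noteq> 0"
  shows "inv_fourier (\<lambda>z. complex_of_real (increment_cutoff s x y z)) \<zeta> =
    plane_wave_diff x y \<zeta> * fourier (\<lambda>x. complex_of_real (cutoff s x)) \<zeta>"
proof -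
  have sw: "schwartz (cutoff s)" using s by (rule schwartz_cutoff)
  have i: "integrable lborel (\<lambda>z. cis (2 * pi * (\<zeta> \<bullet> z)) * complex_of_real (cutoff s (x - z)))" for x
    using schwartz_integrable[OF schwartz_reflect[OF sw]] by (intro integrable_cis_mult) simp_all
  have 1: "(LINT z|lborel. cis (2 * pi * (\<zeta> \<bullet> z)) * complex_of_real (cutoff s (x - z))) =
      cis (2 * pi * (x \<bullet> \<zeta>)) * fourier (\<lambda>x. complex_of_real (cutoff s x)) \<zeta>" for x
  proof -
    have "(LINT z|lborel. cis (2 * pi * (\<zeta> \<bullet> z)) * complex_of_real (cutoff s (x - z))) =
        (\<bar>- 1\<bar> ^ DIM('a)) *\<^sub>R (LINT u|lborel. cis (2 * pi * (\<zeta> \<bullet> (x + (- 1) *\<^sub>R u))) * complex_of_real (cutoff s (x - (x + (- 1) *\<^sub>R u))))"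
      by (rule integral_affine) simp_all
    also have "\<dots> = (LINT u|lborel. cis (2 * pi * (x \<bullet> \<zeta>)) * (cis (- 2 * pi * (u \<bullet> \<zeta>)) * complex_of_real (cutoff s u)))"
    proof -
      have "cis (2 * pi * (\<zeta> \<bullet> (x + (- 1) *\<^sub>R u))) * z = cis (2 * pi * (x \<bullet> \<zeta>)) * (cis (- 2 * pi * (u \<bullet> \<zeta>)) * z)" for u z
        unfolding mult.assoc[symmetric] cis_mult
        by (rule arg_cong[where f="\<lambda>a. cis a * z"]) (simp add: inner_diff_right inner_commute[of \<zeta>] algebra_simps)
      moreover have "cutoff s (x - (x + (- 1) *\<^sub>R u)) = cutoff s u" for u by simp
      ultimately show ?thesis by (simp only:) simp
    qed
    finally show ?thesis unfolding fourier_def by simp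
  qed
  show ?thesis
    unfolding inv_fourier_def increment_cutoff_def plane_wave_diff_def left_diff_distrib 1[symmetric]
    using i[of x] i[of y] by (simp add: right_diff_distrib)
qed

lemma increment_cutoff_L2_tendsto:
  assumes s: "s \<longlonglongrightarrow> 0" "\<And>n. s n > 0"
  shows "(\<lambda>n. \<integral>\<^sup>+z. ennreal ((increment_cutoff (s n) x y z - (real_inv_fourier g (x - z) - real_inv_fourier g (y - z)))\<^sup>2) \<partial>lborel) \<longlonglongrightarrow> 0"
proof -
  define e where "e n = (\<integral>\<^sup>+x. ennreal ((cutoff (s n) x - real_inv_fourier g x)\<^sup>2) \<partial>lborel)" for n
  have e: "e \<longlonglongrightarrow> 0" unfolding e_def by (rule cutoff_L2_tendsto[OF s])
  have shift: "(\<integral>\<^sup>+z. ennreal ((cutoff (s n) (x - z) - real_inv_fourier g (x - z))\<^sup>2) \<partial>lborel) = e n" for n x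
    unfolding e_def using nn_integral_affine[of "\<lambda>x. ennreal ((cutoff (s n) x - real_inv_fourier g x)\<^sup>2)" "- 1" x] by simp
  have "(\<integral>\<^sup>+z. ennreal ((increment_cutoff (s n) x y z - (real_inv_fourier g (x - z) - real_inv_fourier g (y - z)))\<^sup>2) \<partial>lborel) \<le> 4 * e n" for n
  proof -
    let ?D = "\<lambda>x z. cutoff (s n) (x - z) - real_inv_fourier g (x - z)"
    have "(\<integral>\<^sup>+z. ennreal ((increment_cutoff (s n) x y z - (real_inv_fourier g (x - z) - real_inv_fourier g (y - z)))\<^sup>2) \<partial>lborel) =
        (\<integral>\<^sup>+z. ennreal ((norm (?D x z + - ?D y z))\<^sup>2) \<partial>lborel)"
      by (simp add: increment_cutoff_def algebra_simps)
    also have "\<dots> \<le> ennreal (1 + 1) * (\<integral>\<^sup>+z. ennreal ((norm (?D x z))\<^sup>2) \<partial>lborel) + ennreal (1 + 1 / 1) * (\<integral>\<^sup>+z. ennreal ((norm (- ?D y z))\<^sup>2) \<partial>lborel)"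
      by (rule nn_integral_power2_norm_add_le) simp_all
    also have "\<dots> = 2 * e n + 2 * e n"
      unfolding real_norm_def power2_abs power2_minus shift by simp
    also have "\<dots> = 4 * e n" by (simp flip: distrib_right)
    finally show ?thesis .
  qed
  moreover have "(\<lambda>n. 4 * e n) \<longlonglongrightarrow> 0"
    using ennreal_tendsto_cmult[OF _ e, of 4] by simp
  ultimately show ?thesis by (rule ennreal_tendsto_0_le)
qed

end

subsection \<open>Pairings of the field with non-smooth functions\<close>

lemma schwartz_zero: "schwartz (\<lambda>x::'a::euclidean_space. 0)"
proof -
  have z: "iter_deriv vs (\<lambda>x::'a. 0) = (\<lambda>x. 0)" for vs
  proof (induction vs)
    case (Cons v vs)
    have "((\<lambda>x::'a. 0::real) has_derivative (\<lambda>v. 0)) (at x)" for x by simp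
    from frechet_derivative_at[OF this, symmetric] show ?case unfolding iter_deriv.simps Cons by simp
  qed simp
  show ?thesis unfolding schwartz_def smooth_def z by auto
qed

lemma schwartz0_zero: "(\<lambda>x. 0) \<in> schwartz0"
  by (simp add: schwartz0_def schwartz_zero)

text \<open>The inverse transform is chosen because increments involve the kernel at
  \<open>x - z\<close>, and the reflection then yields plane waves times the transform of the
  kernel. The energy does not see the difference, by \<open>log_energy_reflect\<close>.\<close>

definition spectrum :: "('a::euclidean_space \<Rightarrow> real) \<Rightarrow> 'a \<Rightarrow> complex" where
  "spectrum \<phi> = inv_fourier (\<lambda>x. complex_of_real (\<phi> x))"

lemma spectrum_measurable [measurable]: "\<phi> \<in> schwartz0 \<Longrightarrow> spectrum \<phi> \<in> borel_measurable borel"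
  unfolding spectrum_def using schwartz_measurable[of \<phi>] by (auto simp: schwartz0_def)

lemma spectrum_diff:
  assumes "\<phi> \<in> schwartz0" "\<psi> \<in> schwartz0"
  shows "spectrum (\<lambda>x. 1 * \<phi> x + (- 1) * \<psi> x) \<zeta> = spectrum \<phi> \<zeta> - spectrum \<psi> \<zeta>"
proof -
  have "integrable lborel (\<lambda>x. cis (2 * pi * (\<zeta> \<bullet> x)) * complex_of_real (f x))" if "f \<in> schwartz0" for f
    using that schwartz_integrable[of f] by (intro integrable_cis_mult) (auto simp: schwartz0_def)
  from this[OF assms(1)] this[OF assms(2)] show ?thesis
    by (simp add: spectrum_def inv_fourier_def right_diff_distrib)
qed

locale log_field =
  fixes M :: "'w measure" and h :: "'w \<Rightarrow> ('a::euclidean_space \<Rightarrow> real) \<Rightarrow> real"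
  assumes LGF: "whole_space_LGF M h" and dim: "DIM('a) \<ge> 2"
begin

sublocale prob_space M
  using LGF by (simp add: whole_space_LGF_def)

lemma h_measurable: "\<phi> \<in> schwartz0 \<Longrightarrow> (\<lambda>\<omega>. h \<omega> \<phi>) \<in> borel_measurable M"
  using LGF by (simp add: whole_space_LGF_def schwartz0_def)

lemma h_linear:
  assumes "\<omega> \<in> space M" "\<phi> \<in> schwartz0" "\<psi> \<in> schwartz0"
  shows "h \<omega> (\<lambda>x. a * \<phi> x + b * \<psi> x) = a * h \<omega> \<phi> + b * h \<omega> \<psi>"
  using LGF assms by (simp add: whole_space_LGF_def tempered_distribution_def schwartz0_def)

lemma h_zero: "\<omega> \<in> space M \<Longrightarrow> h \<omega> (\<lambda>x. 0) = 0"
  using h_linear[OF _ schwartz0_zero schwartz0_zero, of \<omega> 0 0] by simp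

lemma h_normal:
  assumes "\<phi> \<in> schwartz0"
  shows "centered_normal M (\<lambda>\<omega>. h \<omega> \<phi>) (log_cov \<phi> \<phi>)"
  using centered_gaussian_family_combination[of M schwartz0 "\<lambda>f \<omega>. h \<omega> f" log_cov "{\<phi>}" "\<lambda>i. i" "\<lambda>_. 1"]
    LGF assms by (simp add: whole_space_LGF_def)

lemma ennreal_log_cov:
  fixes \<phi> :: "'a \<Rightarrow> real"
  assumes "\<phi> \<in> schwartz0"
  shows "ennreal (log_cov \<phi> \<phi>) = log_energy (spectrum \<phi>)"
proof -
  have [measurable]: "\<phi> \<in> borel_measurable borel" using schwartz_measurable assms by (auto simp: schwartz0_def)
  show ?thesis
    unfolding log_cov_fourier(1)[OF dim assms] spectrum_def inv_fourier_eq[abs_def]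
    by (rule log_energy_reflect[symmetric]) measurable
qed

text \<open>An isometry between spectra in the energy norm and pairings in mean square. Convergence
  questions for \<open>h\<close> become questions in frequency, and conversely.\<close>

lemma h_second_moment:
  assumes "\<phi> \<in> schwartz0"
  shows "(\<integral>\<^sup>+\<omega>. ennreal ((h \<omega> \<phi>)\<^sup>2) \<partial>M) = log_energy (spectrum \<phi>)"
  unfolding centered_normal_second_moment[OF h_normal[OF assms]] by (rule ennreal_log_cov[OF assms])

lemma h_diff_second_moment:
  assumes "\<phi> \<in> schwartz0" "\<psi> \<in> schwartz0"
  shows "(\<integral>\<^sup>+\<omega>. ennreal ((h \<omega> \<phi> - h \<omega> \<psi>)\<^sup>2) \<partial>M) = log_energy (\<lambda>\<zeta>. spectrum \<phi> \<zeta> - spectrum \<psi> \<zeta>)"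
proof -
  have "(\<integral>\<^sup>+\<omega>. ennreal ((h \<omega> \<phi> - h \<omega> \<psi>)\<^sup>2) \<partial>M) = (\<integral>\<^sup>+\<omega>. ennreal ((h \<omega> (\<lambda>x. 1 * \<phi> x + (- 1) * \<psi> x))\<^sup>2) \<partial>M)"
    by (intro nn_integral_cong) (simp add: h_linear[OF _ assms, of _ 1 "- 1", simplified])
  also have "\<dots> = log_energy (spectrum (\<lambda>x. 1 * \<phi> x + (- 1) * \<psi> x))"
    by (rule h_second_moment[OF schwartz0_linear[OF assms]])
  finally show ?thesis unfolding spectrum_diff[OF assms, abs_def] .
qed

lemma pairing_linear:
  assumes f: "LGF_pairing M h f X" and g: "LGF_pairing M h g Y"
  shows "LGF_pairing M h (\<lambda>x. c * f x + g x) (\<lambda>\<omega>. c * X \<omega> + Y \<omega>)"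
proof -
  obtain \<phi> where \<phi>: "\<And>n. \<phi> n \<in> schwartz0" "(\<lambda>n. \<integral>\<^sup>+x. ennreal ((\<phi> n x - f x)\<^sup>2) \<partial>lborel) \<longlonglongrightarrow> 0"
    "(\<lambda>n. \<integral>\<^sup>+\<omega>. ennreal ((h \<omega> (\<phi> n) - X \<omega>)\<^sup>2) \<partial>M) \<longlonglongrightarrow> 0"
    using f by (auto simp: LGF_pairing_def)
  obtain \<psi> where \<psi>: "\<And>n. \<psi> n \<in> schwartz0" "(\<lambda>n. \<integral>\<^sup>+x. ennreal ((\<psi> n x - g x)\<^sup>2) \<partial>lborel) \<longlonglongrightarrow> 0"
    "(\<lambda>n. \<integral>\<^sup>+\<omega>. ennreal ((h \<omega> (\<psi> n) - Y \<omega>)\<^sup>2) \<partial>M) \<longlonglongrightarrow> 0"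
    using g by (auto simp: LGF_pairing_def)
  have [measurable]: "f \<in> borel_measurable borel" "g \<in> borel_measurable borel" "X \<in> borel_measurable M" "Y \<in> borel_measurable M"
    using f g by (auto simp: LGF_pairing_def)
  have [measurable]: "\<phi> n \<in> borel_measurable borel" "\<psi> n \<in> borel_measurable borel" for n
    using \<phi>(1) \<psi>(1) schwartz_measurable by (auto simp: schwartz0_def)
  have [measurable]: "(\<lambda>\<omega>. h \<omega> (\<phi> n)) \<in> borel_measurable M" "(\<lambda>\<omega>. h \<omega> (\<psi> n)) \<in> borel_measurable M" for n
    using \<phi>(1) \<psi>(1) h_measurable by auto
  have combine: "(\<lambda>n. \<integral>\<^sup>+x. ennreal ((c * u n x + w n x)\<^sup>2) \<partial>N) \<longlonglongrightarrow> 0"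
    if [measurable]: "\<And>n. u n \<in> borel_measurable N" "\<And>n. w n \<in> borel_measurable N"
      and lim: "(\<lambda>n. \<integral>\<^sup>+x. ennreal ((u n x)\<^sup>2) \<partial>N) \<longlonglongrightarrow> 0" "(\<lambda>n. \<integral>\<^sup>+x. ennreal ((w n x)\<^sup>2) \<partial>N) \<longlonglongrightarrow> 0"
    for N :: "'z measure" and u w :: "nat \<Rightarrow> 'z \<Rightarrow> real"
  proof (rule ennreal_tendsto_0_le)
    show "(\<integral>\<^sup>+x. ennreal ((c * u n x + w n x)\<^sup>2) \<partial>N) \<le>
        2 * (ennreal (c\<^sup>2) * (\<integral>\<^sup>+x. ennreal ((u n x)\<^sup>2) \<partial>N)) + 2 * (\<integral>\<^sup>+x. ennreal ((w n x)\<^sup>2) \<partial>N)" for n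
      using nn_integral_power2_norm_add_le[of "\<lambda>x. c * u n x" N "w n" 1]
      by (simp add: power_mult_distrib ennreal_mult nn_integral_cmult)
    have "(\<lambda>n. 2 * (ennreal (c\<^sup>2) * (\<integral>\<^sup>+x. ennreal ((u n x)\<^sup>2) \<partial>N)) + 2 * (\<integral>\<^sup>+x. ennreal ((w n x)\<^sup>2) \<partial>N)) \<longlonglongrightarrow>
        2 * (ennreal (c\<^sup>2) * 0) + 2 * 0"
      by (intro tendsto_add ennreal_tendsto_cmult lim) simp_all
    then show "(\<lambda>n. 2 * (ennreal (c\<^sup>2) * (\<integral>\<^sup>+x. ennreal ((u n x)\<^sup>2) \<partial>N)) + 2 * (\<integral>\<^sup>+x. ennreal ((w n x)\<^sup>2) \<partial>N)) \<longlonglongrightarrow> 0"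
      by simp
  qed
  show ?thesis
    unfolding LGF_pairing_def
  proof (intro conjI exI[of _ "\<lambda>n x. c * \<phi> n x + 1 * \<psi> n x"] allI)
    show "(\<lambda>x. c * \<phi> n x + 1 * \<psi> n x) \<in> schwartz0" for n
      by (intro schwartz0_linear \<phi> \<psi>)
    have "(\<lambda>n. \<integral>\<^sup>+x. ennreal ((c * (\<phi> n x - f x) + (\<psi> n x - g x))\<^sup>2) \<partial>lborel) \<longlonglongrightarrow> 0"
      by (rule combine) (use \<phi> \<psi> in simp_all)
    then show "(\<lambda>n. \<integral>\<^sup>+x. ennreal ((c * \<phi> n x + 1 * \<psi> n x - (c * f x + g x))\<^sup>2) \<partial>lborel) \<longlonglongrightarrow> 0"
      by (simp add: algebra_simps)
    have "(\<lambda>n. \<integral>\<^sup>+\<omega>. ennreal ((c * (h \<omega> (\<phi> n) - X \<omega>) + (h \<omega> (\<psi> n) - Y \<omega>))\<^sup>2) \<partial>M) \<longlonglongrightarrow> 0"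
      by (rule combine) (use \<phi> \<psi> in simp_all)
    moreover have "(\<integral>\<^sup>+\<omega>. ennreal ((h \<omega> (\<lambda>x. c * \<phi> n x + 1 * \<psi> n x) - (c * X \<omega> + Y \<omega>))\<^sup>2) \<partial>M) =
        (\<integral>\<^sup>+\<omega>. ennreal ((c * (h \<omega> (\<phi> n) - X \<omega>) + (h \<omega> (\<psi> n) - Y \<omega>))\<^sup>2) \<partial>M)" for n
      by (intro nn_integral_cong) (simp only: h_linear[OF _ \<phi>(1) \<psi>(1)], simp add: algebra_simps)
    ultimately show "(\<lambda>n. \<integral>\<^sup>+\<omega>. ennreal ((h \<omega> (\<lambda>x. c * \<phi> n x + 1 * \<psi> n x) - (c * X \<omega> + Y \<omega>))\<^sup>2) \<partial>M) \<longlonglongrightarrow> 0"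
      by simp
  qed measurable
qed

lemma pairing_zero: "LGF_pairing M h (\<lambda>x. 0) (\<lambda>\<omega>. 0)"
proof -
  have "(\<integral>\<^sup>+\<omega>. ennreal ((h \<omega> (\<lambda>x. 0) - 0)\<^sup>2) \<partial>M) = (\<integral>\<^sup>+\<omega>. 0 \<partial>M)"
    by (intro nn_integral_cong) (simp add: h_zero)
  then show ?thesis
    unfolding LGF_pairing_def by (intro conjI exI[of _ "\<lambda>n x. 0"]) (simp_all add: schwartz0_zero)
qed

lemma pairing_sum:
  assumes "finite J" "\<And>j. j \<in> J \<Longrightarrow> LGF_pairing M h (f j) (X j)"
  shows "LGF_pairing M h (\<lambda>x. \<Sum>j\<in>J. c j * f j x) (\<lambda>\<omega>. \<Sum>j\<in>J. c j * X j \<omega>)"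
  using assms
proof (induction J rule: finite_induct)
  case empty
  then show ?case using pairing_zero by simp
next
  case (insert j J)
  then show ?case using pairing_linear[of "f j" "X j" _ _ "c j"] by simp
qed

lemma pairing_cong_AE:
  assumes X: "LGF_pairing M h f X" and [measurable]: "Y \<in> borel_measurable M" and eq: "AE \<omega> in M. X \<omega> = Y \<omega>"
  shows "LGF_pairing M h f Y"
proof -
  have "(\<integral>\<^sup>+\<omega>. ennreal ((h \<omega> \<phi> - X \<omega>)\<^sup>2) \<partial>M) = (\<integral>\<^sup>+\<omega>. ennreal ((h \<omega> \<phi> - Y \<omega>)\<^sup>2) \<partial>M)" for \<phi>
    using eq by (intro nn_integral_cong_AE) (auto elim: eventually_mono)
  then show ?thesis using X by (simp add: LGF_pairing_def)
qed

text \<open>Closability: along a subsequence the spectra converge almost everywhere, so Fatou's lemma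
  bounds the energy of the difference to the limiting spectrum.\<close>

theorem pairing_normal:
  fixes G :: "'a \<Rightarrow> complex"
  assumes pair: "LGF_pairing M h F X" and F: "\<And>z. complex_of_real (F z) = fourier G z"
    and G: "integrable lborel G" "continuous_on UNIV G" "\<And>\<zeta>. cmod (G \<zeta>) \<le> C"
  shows "log_energy G < \<infinity>" "centered_normal M X (enn2real (log_energy G))"
proof -
  obtain \<phi> where \<phi>: "\<And>n. \<phi> n \<in> schwartz0" "(\<lambda>n. \<integral>\<^sup>+x. ennreal ((\<phi> n x - F x)\<^sup>2) \<partial>lborel) \<longlonglongrightarrow> 0"
    "(\<lambda>n. \<integral>\<^sup>+\<omega>. ennreal ((h \<omega> (\<phi> n) - X \<omega>)\<^sup>2) \<partial>M) \<longlonglongrightarrow> 0"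
    using pair by (auto simp: LGF_pairing_def)
  have [measurable]: "X \<in> borel_measurable M" using pair by (simp add: LGF_pairing_def)
  have [measurable]: "G \<in> borel_measurable borel" using G(2) by (rule borel_measurable_continuous_onI)
  have [measurable]: "(\<lambda>\<omega>. h \<omega> (\<phi> n)) \<in> borel_measurable M" for n by (rule h_measurable[OF \<phi>(1)])
  define A where "A n = spectrum (\<phi> n)" for n
  have [measurable]: "A n \<in> borel_measurable borel" for n unfolding A_def by (rule spectrum_measurable[OF \<phi>(1)])
  have sw: "schwartz (\<phi> n)" for n using \<phi>(1) by (simp add: schwartz0_def)
  have AG: "(\<integral>\<^sup>+\<zeta>. ennreal ((cmod (A n \<zeta> - G \<zeta>))\<^sup>2) \<partial>lborel) = (\<integral>\<^sup>+x. ennreal ((\<phi> n x - F x)\<^sup>2) \<partial>lborel)" for n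
  proof -
    obtain B where B: "\<And>x. \<bar>\<phi> n x\<bar> \<le> B" using schwartz_bounded[OF sw] by metis
    have "(\<integral>\<^sup>+x. ennreal ((\<phi> n x - F x)\<^sup>2) \<partial>lborel) = (\<integral>\<^sup>+z. ennreal ((cmod (complex_of_real (\<phi> n z) - fourier G z))\<^sup>2) \<partial>lborel)"
      unfolding F[symmetric] of_real_diff[symmetric] norm_of_real power2_abs ..
    also have "\<dots> = (\<integral>\<^sup>+\<zeta>. ennreal ((cmod (inv_fourier (\<lambda>x. complex_of_real (\<phi> n x)) \<zeta> - G \<zeta>))\<^sup>2) \<partial>lborel)"
    proof (rule plancherel_diff)
      show "integrable lborel (\<lambda>x. complex_of_real (\<phi> n x))" using schwartz_integrable[OF sw] by simp
      show "continuous_on UNIV (\<lambda>x. complex_of_real (\<phi> n x))" by (intro continuous_intros schwartz_continuous sw)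
      show "cmod (complex_of_real (\<phi> n x)) \<le> B" for x using B by simp
    qed (rule G)+
    finally show ?thesis by (simp add: A_def spectrum_def)
  qed
  have AG0: "(\<lambda>n. \<integral>\<^sup>+\<zeta>. ennreal ((cmod (A n \<zeta> - G \<zeta>))\<^sup>2) \<partial>lborel) \<longlonglongrightarrow> 0"
    unfolding AG by (rule \<phi>(2))
  \<comment> \<open>From \<open>n0\<close> on the squared distance is finite, which makes the
    functions \<open>q\<close> below integrable. They tend to 0 in L1, so a subsequence converges
    almost everywhere.\<close>
  obtain n0 where n0: "\<And>n. n \<ge> n0 \<Longrightarrow> (\<integral>\<^sup>+\<zeta>. ennreal ((cmod (A n \<zeta> - G \<zeta>))\<^sup>2) \<partial>lborel) < 1"
    using order_tendstoD(2)[OF AG0, of 1] by (auto simp: eventually_sequentially)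
  obtain r where r: "strict_mono r" "AE \<zeta> in lborel. (\<lambda>n. A (r n) \<zeta>) \<longlonglongrightarrow> G \<zeta>"
  proof -
    define q where "q n \<zeta> = (cmod (A (n + n0) \<zeta> - G \<zeta>))\<^sup>2" for n \<zeta>
    have [measurable]: "q n \<in> borel_measurable borel" for n unfolding q_def by measurable
    have qi: "integrable lborel (q n)" for n
      unfolding q_def using order_less_trans[OF n0[of "n + n0"], of \<infinity>] by (simp add: integrable_iff_bounded)
    have "(LINT \<zeta>|lborel. norm (q n \<zeta>)) = enn2real (\<integral>\<^sup>+\<zeta>. ennreal ((cmod (A (n + n0) \<zeta> - G \<zeta>))\<^sup>2) \<partial>lborel)" for n
      by (simp add: q_def integral_eq_nn_integral)
    moreover have "(\<lambda>n. enn2real (\<integral>\<^sup>+\<zeta>. ennreal ((cmod (A (n + n0) \<zeta> - G \<zeta>))\<^sup>2) \<partial>lborel)) \<longlonglongrightarrow> 0"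
      using tendsto_enn2real[where l=0] LIMSEQ_ignore_initial_segment[OF AG0, of n0] by simp
    ultimately have "(\<lambda>n. LINT \<zeta>|lborel. norm (q n \<zeta>)) \<longlonglongrightarrow> 0" by simp
    from tendsto_L1_AE_subseq[OF qi this]
    obtain r where r: "strict_mono r" "AE \<zeta> in lborel. (\<lambda>n. q (r n) \<zeta>) \<longlonglongrightarrow> 0" by auto
    have "AE \<zeta> in lborel. (\<lambda>n. A (r n + n0) \<zeta>) \<longlonglongrightarrow> G \<zeta>"
      using r(2)
    proof eventually_elim
      case (elim \<zeta>)
      have "(\<lambda>n. sqrt (q (r n) \<zeta>)) \<longlonglongrightarrow> sqrt 0" by (intro tendsto_intros elim)
      then have "(\<lambda>n. cmod (A (r n + n0) \<zeta> - G \<zeta>)) \<longlonglongrightarrow> 0" by (simp add: q_def)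
      then show ?case by (simp add: tendsto_norm_zero_iff LIM_zero_iff)
    qed
    moreover have "strict_mono (\<lambda>n. r n + n0)" using r(1) by (simp add: strict_mono_def)
    ultimately show ?thesis using that by blast
  qed
  define e where "e n = (\<integral>\<^sup>+\<omega>. ennreal ((h \<omega> (\<phi> n) - X \<omega>)\<^sup>2) \<partial>M)" for n
  have e0: "e \<longlonglongrightarrow> 0" using \<phi>(3) by (simp add: e_def[abs_def])
  have cauchy: "log_energy (\<lambda>\<zeta>. A n \<zeta> - A m \<zeta>) \<le> 2 * e n + 2 * e m" for n m
  proof -
    have "log_energy (\<lambda>\<zeta>. A n \<zeta> - A m \<zeta>) = (\<integral>\<^sup>+\<omega>. ennreal ((norm ((h \<omega> (\<phi> n) - X \<omega>) + (X \<omega> - h \<omega> (\<phi> m))))\<^sup>2) \<partial>M)"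
      unfolding A_def h_diff_second_moment[OF \<phi>(1) \<phi>(1), symmetric] by simp
    also have "\<dots> \<le> ennreal (1 + 1) * (\<integral>\<^sup>+\<omega>. ennreal ((norm (h \<omega> (\<phi> n) - X \<omega>))\<^sup>2) \<partial>M) + ennreal (1 + 1 / 1) * (\<integral>\<^sup>+\<omega>. ennreal ((norm (X \<omega> - h \<omega> (\<phi> m)))\<^sup>2) \<partial>M)"
      by (rule nn_integral_power2_norm_add_le) simp_all
    also have "\<dots> = 2 * e n + 2 * e m"
      unfolding e_def real_norm_def power2_abs by (simp add: power2_commute)
    finally show ?thesis .
  qed
  have AE_energy: "AE \<zeta> in energy_measure. (\<lambda>n. A (r n) \<zeta>) \<longlonglongrightarrow> G \<zeta>"
    unfolding energy_measure_def using r(2) by (subst AE_density) (auto elim: eventually_mono)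
  \<comment> \<open>The limit of the Cauchy bound in \<open>m\<close> along \<open>r\<close>; with
    it the whole sequence of spectra, and not just the subsequence, converges to \<open>G\<close> in
    energy.\<close>
  have le: "log_energy (\<lambda>\<zeta>. A n \<zeta> - G \<zeta>) \<le> 2 * e n" for n
  proof -
    have "(\<integral>\<^sup>+\<zeta>. ennreal ((cmod (A n \<zeta> - G \<zeta>))\<^sup>2) \<partial>energy_measure) \<le> 2 * e n"
    proof (rule nn_integral_le_of_AE_limit)
      show "AE \<zeta> in energy_measure. (\<lambda>m. ennreal ((cmod (A n \<zeta> - A (r m) \<zeta>))\<^sup>2)) \<longlonglongrightarrow> ennreal ((cmod (A n \<zeta> - G \<zeta>))\<^sup>2)"
        using AE_energy by eventually_elim (intro tendsto_ennrealI tendsto_intros)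
      show "(\<integral>\<^sup>+\<zeta>. ennreal ((cmod (A n \<zeta> - A (r m) \<zeta>))\<^sup>2) \<partial>energy_measure) \<le> 2 * e n + 2 * e (r m)" for m
        using cauchy[of n "r m"] by (simp add: log_energy_eq)
      have "(\<lambda>m. e (r m)) \<longlonglongrightarrow> 0" using LIMSEQ_subseq_LIMSEQ[OF e0 r(1)] by (simp add: o_def)
      from ennreal_tendsto_cmult[OF _ this, of 2] show "(\<lambda>m. 2 * e (r m)) \<longlonglongrightarrow> 0" by simp
    qed measurable
    then show ?thesis by (simp add: log_energy_eq)
  qed
  have lim: "(\<lambda>n. log_energy (\<lambda>\<zeta>. A n \<zeta> - G \<zeta>)) \<longlonglongrightarrow> 0"
  proof (rule ennreal_tendsto_0_le[OF le])
    from ennreal_tendsto_cmult[OF _ e0, of 2] show "(\<lambda>n. 2 * e n) \<longlonglongrightarrow> 0" by simp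
  qed
  obtain n1 where n1: "log_energy (\<lambda>\<zeta>. A n1 \<zeta> - G \<zeta>) < 1"
    using order_tendstoD(2)[OF lim, of 1] by (auto simp: eventually_sequentially)
  \<comment> \<open>\<open>log_cov\<close> is a real number, so the spectrum of a Schwartz function
    of integral zero has finite energy; a single approximant close to \<open>G\<close> passes this
    on.\<close>
  have An_fin: "log_energy (A n) < \<infinity>" for n
    unfolding A_def ennreal_log_cov[OF \<phi>(1), symmetric] by simp
  have "log_energy G \<le> 2 * log_energy (A n1) + 2 * log_energy (\<lambda>\<zeta>. - (A n1 \<zeta> - G \<zeta>))"
    using log_energy_add_le[of "A n1" "\<lambda>\<zeta>. - (A n1 \<zeta> - G \<zeta>)"] by simp
  also have "log_energy (\<lambda>\<zeta>. - (A n1 \<zeta> - G \<zeta>)) = log_energy (\<lambda>\<zeta>. A n1 \<zeta> - G \<zeta>)"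
    unfolding log_energy_def norm_minus_cancel ..
  also have "2 * log_energy (A n1) + 2 * log_energy (\<lambda>\<zeta>. A n1 \<zeta> - G \<zeta>) < \<infinity>"
    using An_fin[of n1] order_less_trans[OF n1, of \<infinity>] by (simp add: ennreal_mult_less_top)
  finally show fin: "log_energy G < \<infinity>" .
  have "(\<lambda>n. \<integral>\<^sup>+\<zeta>. ennreal ((cmod (A n \<zeta>))\<^sup>2) \<partial>energy_measure) \<longlonglongrightarrow> (\<integral>\<^sup>+\<zeta>. ennreal ((cmod (G \<zeta>))\<^sup>2) \<partial>energy_measure)"
    by (rule tendsto_L2_norm) (use lim fin in \<open>simp_all add: log_energy_eq\<close>)
  then have "(\<lambda>n. ennreal (log_cov (\<phi> n) (\<phi> n))) \<longlonglongrightarrow> ennreal (enn2real (log_energy G))"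
    using fin by (simp add: ennreal_log_cov \<phi>(1) A_def log_energy_eq less_top)
  then have v: "(\<lambda>n. log_cov (\<phi> n) (\<phi> n)) \<longlonglongrightarrow> enn2real (log_energy G)"
    using log_cov_fourier(2)[OF dim \<phi>(1)] by (subst (asm) tendsto_ennreal_iff) auto
  show "centered_normal M X (enn2real (log_energy G))"
    by (rule centered_normal_L2_limit[OF prob_space_axioms h_normal[OF \<phi>(1)] _ \<phi>(3) v]) measurable
qed

text \<open>The isometry makes the pairings Cauchy in mean square. A subsequence converges almost
  surely, and Fatou's lemma shows that its limit is the mean square limit of the whole sequence.
  \<open>H\<close> is the limiting spectrum through which the Cauchy property is expressed.\<close>

theorem pairing_exists:
  fixes H :: "'a \<Rightarrow> complex"
  assumes [measurable]: "f \<in> borel_measurable borel" "H \<in> borel_measurable borel"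
    and \<phi>: "\<And>n. \<phi> n \<in> schwartz0"
    and L2: "(\<lambda>n. \<integral>\<^sup>+x. ennreal ((\<phi> n x - f x)\<^sup>2) \<partial>lborel) \<longlonglongrightarrow> 0"
    and en: "(\<lambda>n. log_energy (\<lambda>\<zeta>. spectrum (\<phi> n) \<zeta> - H \<zeta>)) \<longlonglongrightarrow> 0"
  shows "\<exists>X. LGF_pairing M h f X"
proof -
  define X where "X n \<omega> = h \<omega> (\<phi> n)" for n \<omega>
  have [measurable]: "X n \<in> borel_measurable M" for n unfolding X_def by (rule h_measurable[OF \<phi>])
  have [measurable]: "spectrum (\<phi> n) \<in> borel_measurable borel" for n by (rule spectrum_measurable[OF \<phi>])
  define e where "e n = log_energy (\<lambda>\<zeta>. spectrum (\<phi> n) \<zeta> - H \<zeta>)" for n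
  have e0: "e \<longlonglongrightarrow> 0" using en by (simp add: e_def[abs_def])
  have cauchy: "(\<integral>\<^sup>+\<omega>. ennreal ((X n \<omega> - X m \<omega>)\<^sup>2) \<partial>M) \<le> 2 * e n + 2 * e m" for n m
  proof -
    have "(\<integral>\<^sup>+\<omega>. ennreal ((X n \<omega> - X m \<omega>)\<^sup>2) \<partial>M) =
        log_energy (\<lambda>\<zeta>. (spectrum (\<phi> n) \<zeta> - H \<zeta>) + - (spectrum (\<phi> m) \<zeta> - H \<zeta>))"
      unfolding X_def h_diff_second_moment[OF \<phi> \<phi>] by simp
    also have "\<dots> \<le> 2 * e n + 2 * log_energy (\<lambda>\<zeta>. - (spectrum (\<phi> m) \<zeta> - H \<zeta>))"
      unfolding e_def by (rule log_energy_add_le) measurable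
    also have "log_energy (\<lambda>\<zeta>. - (spectrum (\<phi> m) \<zeta> - H \<zeta>)) = e m"
      unfolding e_def log_energy_def norm_minus_cancel ..
    finally show ?thesis .
  qed
  have X2: "integrable M (\<lambda>\<omega>. (X n \<omega>)\<^sup>2)" for n
  proof -
    have "log_energy (spectrum (\<phi> n)) < \<infinity>" unfolding ennreal_log_cov[OF \<phi>, symmetric] by simp
    then have "(\<integral>\<^sup>+\<omega>. ennreal ((X n \<omega>)\<^sup>2) \<partial>M) < \<infinity>" unfolding X_def h_second_moment[OF \<phi>] .
    then show ?thesis by (simp add: integrable_iff_bounded)
  qed
  have X1: "integrable M (X n)" for n
  proof (rule Bochner_Integration.integrable_bound)
    show "integrable M (\<lambda>\<omega>. 1 + (X n \<omega>)\<^sup>2)" using X2 by simp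
    have "\<bar>x\<bar> \<le> 1 + x\<^sup>2" for x :: real
    proof -
      have "0 \<le> (\<bar>x\<bar> - 1)\<^sup>2" by simp
      then show ?thesis by (simp add: power2_eq_square algebra_simps abs_mult_self_eq)
    qed
    then show "AE \<omega> in M. norm (X n \<omega>) \<le> norm (1 + (X n \<omega>)\<^sup>2)" by simp
  qed measurable
  have "\<exists>N. \<forall>i\<ge>N. \<forall>j\<ge>N. (LINT \<omega>|M. norm (X i \<omega> - X j \<omega>)) < d" if d: "d > 0" for d
  proof -
    \<comment> \<open>With this threshold the Cauchy bound is \<open>d\<^sup>2 / 4\<close>, and the
      elementary inequality for the modulus below turns it into a first moment of at most
      \<open>d / 2 + d / 8\<close>.\<close>
    have "ennreal (d\<^sup>2 / 16) > 0" using d by simp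
    from order_tendstoD(2)[OF e0 this] obtain N where N: "\<And>n. n \<ge> N \<Longrightarrow> e n < ennreal (d\<^sup>2 / 16)"
      by (auto simp: eventually_sequentially)
    have "(LINT \<omega>|M. norm (X i \<omega> - X j \<omega>)) < d" if ij: "i \<ge> N" "j \<ge> N" for i j
    proof -
      have "(\<integral>\<^sup>+\<omega>. ennreal ((X i \<omega> - X j \<omega>)\<^sup>2) \<partial>M) \<le> 2 * e i + 2 * e j" by (rule cauchy)
      also have "\<dots> \<le> ennreal 2 * ennreal (d\<^sup>2 / 16) + ennreal 2 * ennreal (d\<^sup>2 / 16)"
        using N[OF ij(1)] N[OF ij(2)] by (intro add_mono mult_mono) (auto intro: less_imp_le)
      also have "\<dots> = ennreal (d\<^sup>2 / 4)"
        by (simp del: ennreal_numeral flip: ennreal_mult ennreal_plus)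
      finally have q: "(\<integral>\<^sup>+\<omega>. ennreal ((X i \<omega> - X j \<omega>)\<^sup>2) \<partial>M) \<le> ennreal (d\<^sup>2 / 4)" .
      then have qi: "integrable M (\<lambda>\<omega>. (X i \<omega> - X j \<omega>)\<^sup>2)"
        by (simp add: integrable_iff_bounded) (metis ennreal_less_top order_le_less_trans)
      have "ennreal (LINT \<omega>|M. (X i \<omega> - X j \<omega>)\<^sup>2) \<le> ennreal (d\<^sup>2 / 4)"
        using q qi by (subst nn_integral_eq_integral[symmetric]) auto
      then have q': "(LINT \<omega>|M. (X i \<omega> - X j \<omega>)\<^sup>2) \<le> d\<^sup>2 / 4"
        by (subst (asm) ennreal_le_iff) auto
      have "(LINT \<omega>|M. norm (X i \<omega> - X j \<omega>)) \<le> (LINT \<omega>|M. d / 2 + (X i \<omega> - X j \<omega>)\<^sup>2 / (2 * d))"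
      proof (rule integral_mono)
        show "integrable M (\<lambda>\<omega>. norm (X i \<omega> - X j \<omega>))" using X1 by simp
        show "integrable M (\<lambda>\<omega>. d / 2 + (X i \<omega> - X j \<omega>)\<^sup>2 / (2 * d))" using qi by simp
        fix \<omega>
        have "0 \<le> (\<bar>X i \<omega> - X j \<omega>\<bar> - d)\<^sup>2" by simp
        also have "\<dots> = (X i \<omega> - X j \<omega>)\<^sup>2 + d\<^sup>2 - 2 * d * \<bar>X i \<omega> - X j \<omega>\<bar>"
          by (simp add: power2_diff)
        finally have "2 * d * \<bar>X i \<omega> - X j \<omega>\<bar> \<le> (X i \<omega> - X j \<omega>)\<^sup>2 + d\<^sup>2" by simp
        then have "\<bar>X i \<omega> - X j \<omega>\<bar> \<le> ((X i \<omega> - X j \<omega>)\<^sup>2 + d\<^sup>2) / (2 * d)"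
          using d by (simp add: pos_le_divide_eq mult.commute)
        also have "\<dots> = d / 2 + (X i \<omega> - X j \<omega>)\<^sup>2 / (2 * d)"
          using d by (simp add: add_divide_distrib power2_eq_square)
        finally show "norm (X i \<omega> - X j \<omega>) \<le> d / 2 + (X i \<omega> - X j \<omega>)\<^sup>2 / (2 * d)" by simp
      qed
      also have "\<dots> = d / 2 + (LINT \<omega>|M. (X i \<omega> - X j \<omega>)\<^sup>2) / (2 * d)"
        using qi by (simp add: prob_space)
      also have "\<dots> \<le> d / 2 + (d\<^sup>2 / 4) / (2 * d)"
        using q' d by (intro add_left_mono divide_right_mono) auto
      also have "\<dots> < d" using d by (simp add: power2_eq_square)
      finally show ?thesis .
    qed
    then show ?thesis by blast
  qed
  from cauchy_L1_AE_cauchy_subseq[OF X1 this]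
  obtain r where r: "strict_mono r" "AE \<omega> in M. Cauchy (\<lambda>i. X (r i) \<omega>)" by auto
  define Y where "Y \<omega> = lim (\<lambda>i. X (r i) \<omega>)" for \<omega>
  have [measurable]: "Y \<in> borel_measurable M" unfolding Y_def by measurable
  have Y: "AE \<omega> in M. (\<lambda>i. X (r i) \<omega>) \<longlonglongrightarrow> Y \<omega>"
    using r(2) by eventually_elim (simp add: Y_def Cauchy_convergent_iff convergent_LIMSEQ_iff)
  have le: "(\<integral>\<^sup>+\<omega>. ennreal ((X n \<omega> - Y \<omega>)\<^sup>2) \<partial>M) \<le> 2 * e n" for n
  proof (rule nn_integral_le_of_AE_limit)
    show "AE \<omega> in M. (\<lambda>m. ennreal ((X n \<omega> - X (r m) \<omega>)\<^sup>2)) \<longlonglongrightarrow> ennreal ((X n \<omega> - Y \<omega>)\<^sup>2)"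
      using Y by eventually_elim (intro tendsto_ennrealI tendsto_intros)
    show "(\<integral>\<^sup>+\<omega>. ennreal ((X n \<omega> - X (r m) \<omega>)\<^sup>2) \<partial>M) \<le> 2 * e n + 2 * e (r m)" for m
      by (rule cauchy)
    have "(\<lambda>m. e (r m)) \<longlonglongrightarrow> 0" using LIMSEQ_subseq_LIMSEQ[OF e0 r(1)] by (simp add: o_def)
    from ennreal_tendsto_cmult[OF _ this, of 2] show "(\<lambda>m. 2 * e (r m)) \<longlonglongrightarrow> 0" by simp
  qed measurable
  have "(\<lambda>n. \<integral>\<^sup>+\<omega>. ennreal ((X n \<omega> - Y \<omega>)\<^sup>2) \<partial>M) \<longlonglongrightarrow> 0"
  proof (rule ennreal_tendsto_0_le[OF le])
    from ennreal_tendsto_cmult[OF _ e0, of 2] show "(\<lambda>n. 2 * e n) \<longlonglongrightarrow> 0" by simp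
  qed
  then have "LGF_pairing M h f Y"
    unfolding LGF_pairing_def X_def using \<phi> L2 by auto
  then show ?thesis by blast
qed

end

subsection \<open>Extending continuous functions from a dense sequence\<close>

lemma pred_Ball_countable:
  assumes D: "countable D" and P: "\<And>a. a \<in> D \<Longrightarrow> Measurable.pred M (P a)"
  shows "Measurable.pred M (\<lambda>\<omega>. \<forall>a\<in>D. P a \<omega>)"
proof (cases "D = {}")
  case False
  have "(\<forall>a\<in>D. P a \<omega>) \<longleftrightarrow> (\<forall>i::nat. P (from_nat_into D i) \<omega>)" for \<omega>
    using from_nat_into[OF False] from_nat_into_surj[OF D] by metis
  moreover have "Measurable.pred M (\<lambda>\<omega>. \<forall>i::nat. P (from_nat_into D i) \<omega>)"
    by (intro pred_intros_countable P from_nat_into False)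
  ultimately show ?thesis by simp
qed simp

locale dense_approximation =
  fixes D :: "'a::euclidean_space set" and d :: "nat \<Rightarrow> 'a \<Rightarrow> 'a"
  assumes D_countable: "countable D" and d_in_D: "d n x \<in> D" and d_close: "dist (d n x) x < 1 / real (Suc n)"
begin

lemma d_tendsto: "(\<lambda>n. d n x) \<longlonglongrightarrow> x"
proof (rule metric_tendsto_imp_tendsto)
  show "(\<lambda>n. 1 / real (Suc n)) \<longlonglongrightarrow> 0" using LIMSEQ_Suc[OF lim_1_over_n] by simp
  show "eventually (\<lambda>n. dist (d n x) x \<le> dist (1 / real (Suc n)) 0) sequentially"
    using d_close by (intro always_eventually allI) (simp add: less_imp_le)
qed

text \<open>Uniform continuity on bounded parts of \<open>D\<close>. Tolerances are reciprocals of
  natural numbers and points range over a countable set, so that the property is a measurable event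
  for a random function.\<close>

definition locally_uniform :: "('a \<Rightarrow> real) \<Rightarrow> bool" where
  "locally_uniform f \<longleftrightarrow> (\<forall>m k :: nat. \<exists>j :: nat. \<forall>a\<in>D. \<forall>b\<in>D. norm a < real m \<longrightarrow> norm b < real m \<longrightarrow>
     dist a b < 1 / real (Suc j) \<longrightarrow> \<bar>f a - f b\<bar> \<le> 1 / real (Suc k))"

text \<open>The approximating points are chosen once and for all, so this is a limit of countably
  many values of \<open>f\<close> and stays measurable when \<open>f\<close> is random.\<close>

definition extension :: "('a \<Rightarrow> real) \<Rightarrow> 'a \<Rightarrow> real" where
  "extension f x = lim (\<lambda>n. f (d n x))"

lemma continuous_imp_locally_uniform:
  assumes "continuous_on UNIV f"
  shows "locally_uniform f"
  unfolding locally_uniform_def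
proof (intro allI)
  fix m k :: nat
  have "uniformly_continuous_on (cball 0 (real m)) f"
    by (rule compact_uniformly_continuous) (auto intro: continuous_on_subset[OF assms])
  then obtain e where e: "e > 0" "\<And>a b. a \<in> cball 0 (real m) \<Longrightarrow> b \<in> cball 0 (real m) \<Longrightarrow> dist b a < e \<Longrightarrow> dist (f b) (f a) < 1 / real (Suc k)"
    unfolding uniformly_continuous_on_def by (metis of_nat_0_less_iff zero_less_Suc zero_less_divide_1_iff)
  obtain j where j: "1 / real (Suc j) < e" using nat_approx_posE[OF e(1)] by auto
  show "\<exists>j. \<forall>a\<in>D. \<forall>b\<in>D. norm a < real m \<longrightarrow> norm b < real m \<longrightarrow> dist a b < 1 / real (Suc j) \<longrightarrow> \<bar>f a - f b\<bar> \<le> 1 / real (Suc k)"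
  proof (intro exI ballI impI)
    fix a b :: 'a assume "norm a < real m" "norm b < real m" "dist a b < 1 / real (Suc j)"
    then have "dist (f a) (f b) < 1 / real (Suc k)" using j by (intro e(2)) auto
    then show "\<bar>f a - f b\<bar> \<le> 1 / real (Suc k)" by (simp add: dist_real_def)
  qed
qed

lemma extension_continuous_eq:
  assumes "continuous_on UNIV f"
  shows "extension f x = f x"
  unfolding extension_def
  by (intro limI continuous_on_tendsto_compose[OF assms d_tendsto]) auto

text \<open>One estimate with two uses: \<open>y = z = x\<close> gives the Cauchy property,
  \<open>z = x\<close> the continuity of the extension.\<close>

lemma locally_uniform_modulus:
  assumes f: "locally_uniform f" and e: "e > 0"
  obtains r where "r > 0" "\<And>y z. dist x y < r \<Longrightarrow> dist x z < r \<Longrightarrow>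
    \<exists>n0. \<forall>n\<ge>n0. \<forall>n'\<ge>n0. \<bar>f (d n y) - f (d n' z)\<bar> \<le> e"
proof -
  obtain k where k: "1 / real (Suc k) < e" using nat_approx_posE[OF e] by auto
  obtain m :: nat where m: "norm x + 2 < real m" using reals_Archimedean2 by blast
  obtain j where j: "\<And>a b. a \<in> D \<Longrightarrow> b \<in> D \<Longrightarrow> norm a < real m \<Longrightarrow> norm b < real m \<Longrightarrow>
      dist a b < 1 / real (Suc j) \<Longrightarrow> \<bar>f a - f b\<bar> \<le> 1 / real (Suc k)"
    using f unfolding locally_uniform_def by blast
  \<comment> \<open>Late approximants of points within \<open>r\<close> of \<open>x\<close> lie
    within \<open>2 * r\<close> of \<open>x\<close>, hence within \<open>4 * r\<close> of each
    other; \<open>r \<le> 1\<close> keeps them in the ball whose radius \<open>m\<close> exceeds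
    \<open>norm x + 2\<close>.\<close>
  define r where "r = 1 / (4 * real (Suc j))"
  have r: "r > 0" "r \<le> 1" "4 * r = 1 / real (Suc j)" by (simp_all add: r_def divide_simps)
  show ?thesis
  proof (rule that[OF r(1)])
    fix y z assume yz: "dist x y < r" "dist x z < r"
    obtain n0 where n0: "1 / real (Suc n0) < r" using nat_approx_posE[OF r(1)] by auto
    show "\<exists>n0. \<forall>n\<ge>n0. \<forall>n'\<ge>n0. \<bar>f (d n y) - f (d n' z)\<bar> \<le> e"
    proof (intro exI allI impI)
      fix n n' assume n: "n0 \<le> n" "n0 \<le> n'"
      have close: "dist (d i w) x < 2 * r" if "n0 \<le> i" "dist x w < r" for i w
      proof -
        have "1 / real (Suc i) \<le> 1 / real (Suc n0)" using that(1) by (simp add: frac_le)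
        then have "dist (d i w) w < r" using d_close[of i w] n0 by linarith
        then show ?thesis using that(2) dist_triangle2[of "d i w" x w] by (simp add: dist_commute)
      qed
      have nb: "norm a < real m" if "dist a x < 2 * r" for a
      proof -
        have "norm a \<le> norm x + dist a x"
          unfolding dist_norm by (metis add.commute diff_add_cancel norm_triangle_ineq)
        then show ?thesis using that m r(2) by linarith
      qed
      have "dist (d n y) (d n' z) < 1 / real (Suc j)"
        using close[OF n(1) yz(1)] close[OF n(2) yz(2)] dist_triangle2[of "d n y" "d n' z" x] r(3) by (simp add: dist_commute)
      then have "\<bar>f (d n y) - f (d n' z)\<bar> \<le> 1 / real (Suc k)"
        by (intro j d_in_D nb close[OF n(1) yz(1)] close[OF n(2) yz(2)])
      then show "\<bar>f (d n y) - f (d n' z)\<bar> \<le> e" using k by linarith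
    qed
  qed
qed

lemma extension_tendsto:
  assumes f: "locally_uniform f"
  shows "(\<lambda>n. f (d n x)) \<longlonglongrightarrow> extension f x"
proof -
  have "Cauchy (\<lambda>n. f (d n x))"
  proof (rule CauchyI)
    fix e :: real assume "e > 0"
    then have "e / 2 > 0" by simp
    from locally_uniform_modulus[OF f this, of x] obtain r where "r > 0"
      "\<And>y z. dist x y < r \<Longrightarrow> dist x z < r \<Longrightarrow> \<exists>n0. \<forall>n\<ge>n0. \<forall>n'\<ge>n0. \<bar>f (d n y) - f (d n' z)\<bar> \<le> e / 2" by metis
    then have "\<exists>n0. \<forall>n\<ge>n0. \<forall>n'\<ge>n0. \<bar>f (d n x) - f (d n' x)\<bar> \<le> e / 2" by simp
    then show "\<exists>n0. \<forall>m\<ge>n0. \<forall>n\<ge>n0. norm (f (d m x) - f (d n x)) < e"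
      using \<open>e > 0\<close> by (metis field_sum_of_halves less_add_same_cancel1 order_le_less_trans half_gt_zero real_norm_def)
  qed
  then show ?thesis
    unfolding extension_def by (simp add: Cauchy_convergent_iff convergent_LIMSEQ_iff)
qed

lemma extension_continuous:
  assumes f: "locally_uniform f"
  shows "continuous_on UNIV (extension f)"
  unfolding continuous_on_iff
proof (intro ballI allI impI)
  fix x and e :: real assume e: "e > 0"
  then have "e / 2 > 0" by simp
  from locally_uniform_modulus[OF f this, of x] obtain r where r: "r > 0"
    "\<And>y z. dist x y < r \<Longrightarrow> dist x z < r \<Longrightarrow> \<exists>n0. \<forall>n\<ge>n0. \<forall>n'\<ge>n0. \<bar>f (d n y) - f (d n' z)\<bar> \<le> e / 2" by metis
  have "dist (extension f y) (extension f x) < e" if "dist y x < r" for y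
  proof -
    have "dist x y < r" "dist x x < r" using that r(1) by (simp_all add: dist_commute)
    then obtain n0 where n0: "\<And>n. n \<ge> n0 \<Longrightarrow> \<bar>f (d n y) - f (d n x)\<bar> \<le> e / 2" using r(2) by blast
    have "(\<lambda>n. \<bar>f (d n y) - f (d n x)\<bar>) \<longlonglongrightarrow> \<bar>extension f y - extension f x\<bar>"
      by (intro tendsto_intros extension_tendsto f)
    then have "\<bar>extension f y - extension f x\<bar> \<le> e / 2"
      by (rule LIMSEQ_le_const2) (use n0 in blast)
    then show ?thesis using e by (simp add: dist_real_def)
  qed
  then show "\<exists>r>0. \<forall>y\<in>UNIV. dist y x < r \<longrightarrow> dist (extension f y) (extension f x) < e" using r(1) by blast
qed

lemma locally_uniform_measurable:
  assumes [measurable]: "\<And>a. (\<lambda>\<omega>. F \<omega> a) \<in> borel_measurable M"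
  shows "Measurable.pred M (\<lambda>\<omega>. locally_uniform (F \<omega>))"
  unfolding locally_uniform_def
  by (intro pred_intros_countable pred_Ball_countable D_countable pred_intros_imp') measurable

end

lemma dense_approximation_exists: "\<exists>D d. dense_approximation (D :: 'a::euclidean_space set) d"
proof -
  obtain D :: "'a set" where D: "countable D" "\<And>X. open X \<Longrightarrow> X \<noteq> {} \<Longrightarrow> \<exists>a\<in>D. a \<in> X"
    by (rule countable_dense_setE) blast
  have "\<exists>a. a \<in> D \<and> dist a x < 1 / real (Suc n)" for n x
    using D(2)[of "ball x (1 / real (Suc n))"] by (auto simp: dist_commute)
  from someI_ex[OF this] have "dense_approximation D (\<lambda>n x. SOME a. a \<in> D \<and> dist a x < 1 / real (Suc n))"
    using D(1) by unfold_locales auto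
  then show ?thesis by blast
qed

subsection \<open>Comparison of the two fields\<close>

locale field_comparison = radial_bump K + log_field M h
  for K :: "real ^ 'n \<Rightarrow> real" and M :: "'w measure" and h :: "'w \<Rightarrow> (real ^ 'n \<Rightarrow> real) \<Rightarrow> real" +
  fixes N :: "'v measure" and W :: "((real ^ 'n) \<times> real \<Rightarrow> real) \<Rightarrow> 'v \<Rightarrow> real"
    and Z :: "'v \<Rightarrow> real ^ 'n \<Rightarrow> real" and \<epsilon> :: real
  assumes W: "spacetime_white_noise N W" and eps: "\<epsilon> > 0" and Z: "white_noise_field N W K \<epsilon> Z"
begin

sublocale N: prob_space N
  using W by (simp add: spacetime_white_noise_def centered_gaussian_family_def)

definition g where "g \<zeta> = mollifier_hat K (\<epsilon> *\<^sub>R \<zeta>)"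

sublocale even_rapid g
proof
  show "continuous_on UNIV g"
    unfolding g_def by (intro continuous_on_compose2[OF mollifier_hat_continuous[of UNIV]] continuous_intros) auto
  show "g (- \<zeta>) = g \<zeta>" for \<zeta> by (simp add: g_def mollifier_hat_minus)
  show "rapidly_decaying g"
    unfolding rapidly_decaying_def
  proof
    fix m
    obtain C where C: "C \<ge> 0" "\<And>\<zeta>. \<bar>mollifier_hat K \<zeta>\<bar> \<le> C / (1 + norm \<zeta>) ^ m"
      using mollifier_hat_rapidly_decaying unfolding rapidly_decaying_def by blast
    \<comment> \<open>With \<open>b\<close> the smaller of 1 and \<open>\<epsilon>\<close>,
      \<open>b * (1 + norm \<zeta>)\<close> is at most
      \<open>1 + norm (\<epsilon> *\<^sub>R \<zeta>)\<close>, which transfers the decay to the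
      dilated symbol.\<close>
    define b where "b = min 1 \<epsilon>"
    have b: "b > 0" "b \<le> 1" "b \<le> \<epsilon>" using eps by (auto simp: b_def)
    have "\<bar>g \<zeta>\<bar> \<le> (C / b ^ m) / (1 + norm \<zeta>) ^ m" for \<zeta>
    proof -
      have "b * (1 + norm \<zeta>) \<le> 1 + norm (\<epsilon> *\<^sub>R \<zeta>)"
        using b eps mult_right_mono[OF b(3) norm_ge_zero[of \<zeta>]] by (simp add: distrib_left)
      then have "(b * (1 + norm \<zeta>)) ^ m \<le> (1 + norm (\<epsilon> *\<^sub>R \<zeta>)) ^ m"
        using b by (intro power_mono) auto
      then have "C / (1 + norm (\<epsilon> *\<^sub>R \<zeta>)) ^ m \<le> C / (b * (1 + norm \<zeta>)) ^ m"
        using C(1) b(1) by (intro divide_left_mono mult_pos_pos zero_less_power) (auto intro: add_pos_nonneg)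
      with C(2)[of "\<epsilon> *\<^sub>R \<zeta>"] show ?thesis by (simp add: g_def power_mult_distrib)
    qed
    then show "\<exists>C\<ge>0. \<forall>\<zeta>. \<bar>g \<zeta>\<bar> \<le> C / (1 + norm \<zeta>) ^ m"
      using C(1) b(1) by (intro exI[of _ "C / b ^ m"]) auto
  qed
qed

lemma rescale_mollifier: "rescale (mollifier K) \<epsilon> x = real_inv_fourier g x"
proof -
  have [measurable]: "mollifier_hat K \<in> borel_measurable borel"
    by (rule borel_measurable_continuous_onI[OF mollifier_hat_continuous])
  have "inv_fourier (\<lambda>\<zeta>. complex_of_real (mollifier_hat K \<zeta>)) (x /\<^sub>R \<epsilon>) =
      (\<bar>\<epsilon>\<bar> ^ DIM(real ^ 'n)) *\<^sub>R (LINT \<zeta>|lborel. cis (2 * pi * ((x /\<^sub>R \<epsilon>) \<bullet> (0 + \<epsilon> *\<^sub>R \<zeta>))) * complex_of_real (mollifier_hat K (0 + \<epsilon> *\<^sub>R \<zeta>)))"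
    unfolding inv_fourier_def using eps by (intro integral_affine) auto
  also have "(LINT \<zeta>|lborel. cis (2 * pi * ((x /\<^sub>R \<epsilon>) \<bullet> (0 + \<epsilon> *\<^sub>R \<zeta>))) * complex_of_real (mollifier_hat K (0 + \<epsilon> *\<^sub>R \<zeta>))) = inv_fourier cg x"
    unfolding inv_fourier_def g_def using eps by (simp add: mult.assoc[symmetric])
  finally show ?thesis
    using eps by (simp add: rescale_def mollifier_eq real_inv_fourier_def)
qed

definition increment_kernel :: "(real ^ 'n) \<times> (real ^ 'n) \<Rightarrow> real ^ 'n \<Rightarrow> real" where
  "increment_kernel p z = real_inv_fourier g (fst p - z) - real_inv_fourier g (snd p - z)"

text \<open>Gaussian cutoffs of the increment converge to it in L2, as \<open>LGF_pairing\<close>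
  demands, and in energy, as \<open>pairing_exists\<close> demands.\<close>

lemma increment_pairing_exists: "\<exists>X. LGF_pairing M h (increment_kernel p) X"
proof -
  define s where "s n = 1 / real (Suc n)" for n
  have s: "s \<longlonglongrightarrow> 0" "\<And>n. s n > 0" unfolding s_def using LIMSEQ_Suc[OF lim_1_over_n] by simp_all
  obtain x y where p: "p = (x, y)" by (cases p)
  show ?thesis
  proof (rule pairing_exists)
    show "increment_kernel p \<in> borel_measurable borel" unfolding increment_kernel_def by measurable
    show "(\<lambda>\<zeta>. plane_wave_diff x y \<zeta> * cg \<zeta>) \<in> borel_measurable borel" by measurable
    show "increment_cutoff (s n) x y \<in> schwartz0" for n
      using s(2)[of n] by (intro increment_cutoff_schwartz0) simp
    show "(\<lambda>n. \<integral>\<^sup>+z. ennreal ((increment_cutoff (s n) x y z - increment_kernel p z)\<^sup>2) \<partial>lborel) \<longlonglongrightarrow> 0"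
      using increment_cutoff_L2_tendsto[OF s, of x y] by (simp add: increment_kernel_def p)
    have "spectrum (increment_cutoff (s n) x y) \<zeta> - plane_wave_diff x y \<zeta> * cg \<zeta> =
        plane_wave_diff x y \<zeta> * (fourier (\<lambda>x. complex_of_real (cutoff (s n) x)) \<zeta> - cg \<zeta>)" for n \<zeta>
      using s(2)[of n] by (simp add: spectrum_def inv_fourier_increment_cutoff right_diff_distrib)
    then show "(\<lambda>n. log_energy (\<lambda>\<zeta>. spectrum (increment_cutoff (s n) x y) \<zeta> - plane_wave_diff x y \<zeta> * cg \<zeta>)) \<longlonglongrightarrow> 0"
      using log_energy_cutoff_tendsto[OF s, of x y] by simp
  qed
qed

abbreviation combination_energy :: "('i \<Rightarrow> real) \<Rightarrow> 'i set \<Rightarrow> ('i \<Rightarrow> (real ^ 'n) \<times> (real ^ 'n)) \<Rightarrow> ennreal" where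
  "combination_energy c J w \<equiv> log_energy (\<lambda>\<zeta>. increment_symbol c J w \<zeta> * cg \<zeta>)"

text \<open>Stated for arbitrary versions \<open>X j\<close>, because the law has to be found for
  every convolution and not only for a constructed one. The combined kernel is the transform of the
  symbol times \<open>g\<close>, so \<open>pairing_normal\<close> applies.\<close>

lemma increment_combination_normal:
  assumes J: "finite J" and X: "\<And>j. j \<in> J \<Longrightarrow> LGF_pairing M h (increment_kernel (w j)) (X j)"
  shows "combination_energy c J w < \<infinity>"
    and "centered_normal M (\<lambda>\<omega>. \<Sum>j\<in>J. c j * X j \<omega>) (enn2real (combination_energy c J w))"
proof -
  let ?F = "\<lambda>z. \<Sum>j\<in>J. c j * increment_kernel (w j) z"
  let ?G = "\<lambda>\<zeta>. increment_symbol c J w \<zeta> * cg \<zeta>"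
  have pair: "LGF_pairing M h ?F (\<lambda>\<omega>. \<Sum>j\<in>J. c j * X j \<omega>)" by (rule pairing_sum[OF J X])
  have sb: "cmod (increment_symbol c J w \<zeta>) \<le> (\<Sum>j\<in>J. \<bar>c j\<bar> * 2)" for \<zeta>
    unfolding increment_symbol_def
  proof (rule sum_norm_le)
    fix j
    show "cmod (complex_of_real (c j) * (cis (2 * pi * (fst (w j) \<bullet> \<zeta>)) - cis (2 * pi * (snd (w j) \<bullet> \<zeta>)))) \<le> \<bar>c j\<bar> * 2"
      unfolding norm_mult norm_of_real
      using norm_triangle_ineq4[of "cis (2 * pi * (fst (w j) \<bullet> \<zeta>))" "cis (2 * pi * (snd (w j) \<bullet> \<zeta>))"]
      by (intro mult_left_mono) auto
  qed
  have G: "integrable lborel ?G" by (rule rapidly_decaying_integrable[OF g_rapid g_measurable _, of _ "\<Sum>j\<in>J. \<bar>c j\<bar> * 2" 0]) (use sb in simp_all)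
  have Gc: "continuous_on UNIV ?G" by (intro continuous_on_mult increment_symbol_continuous cg_cont)
  obtain B where B: "B \<ge> 0" "\<And>\<zeta>. \<bar>g \<zeta>\<bar> \<le> B" using g_bounded by auto
  have Gb: "cmod (?G \<zeta>) \<le> (\<Sum>j\<in>J. \<bar>c j\<bar> * 2) * B" for \<zeta>
    unfolding norm_mult using sb B by (intro mult_mono) (auto intro: sum_nonneg)
  have F: "complex_of_real (?F z) = fourier ?G z" for z
  proof -
    have i: "integrable lborel (\<lambda>\<zeta>. cis (- 2 * pi * (\<zeta> \<bullet> (z - x))) * cg \<zeta>)" for x
      by (intro integrable_cis_mult cg_integrable) simp
    have e: "cis (- 2 * pi * (\<zeta> \<bullet> z)) * (cis (2 * pi * (x \<bullet> \<zeta>)) * u) = cis (- 2 * pi * (\<zeta> \<bullet> (z - x))) * u" for x \<zeta> u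
      unfolding mult.assoc[symmetric] cis_mult
      by (rule arg_cong[where f="\<lambda>a. cis a * u"]) (simp add: inner_diff_right inner_commute[of x] algebra_simps)
    have "fourier ?G z = (LINT \<zeta>|lborel. (\<Sum>j\<in>J. complex_of_real (c j) *
        (cis (- 2 * pi * (\<zeta> \<bullet> (z - fst (w j)))) * cg \<zeta> - cis (- 2 * pi * (\<zeta> \<bullet> (z - snd (w j)))) * cg \<zeta>)))"
      unfolding fourier_def increment_symbol_def e[symmetric]
      by (intro Bochner_Integration.integral_cong refl)
        (simp add: sum_distrib_left sum_distrib_right right_diff_distrib left_diff_distrib mult_ac)
    also have "\<dots> = (\<Sum>j\<in>J. complex_of_real (c j) * (fourier cg (z - fst (w j)) - fourier cg (z - snd (w j))))"
      unfolding fourier_def using i by simp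
    also have "\<dots> = complex_of_real (?F z)"
      using fourier_cg_minus[of "z - x" for x] by (simp add: increment_kernel_def of_real_kernel)
    finally show ?thesis ..
  qed
  show "combination_energy c J w < \<infinity>"
    "centered_normal M (\<lambda>\<omega>. \<Sum>j\<in>J. c j * X j \<omega>) (enn2real (combination_energy c J w))"
    by (rule pairing_normal[OF pair F G Gc Gb])+
qed

text \<open>Read off from the existence of pairings instead of a direct estimate of the
  integral.\<close>

lemma combination_energy_finite:
  assumes "finite J"
  shows "combination_energy c J w < \<infinity>"
proof -
  obtain X where "\<And>p. LGF_pairing M h (increment_kernel p) (X p)" using increment_pairing_exists by metis
  then show ?thesis by (intro increment_combination_normal(1)[OF assms, of w "\<lambda>j. X (w j)"])
qed

section \<open>White-noise increments and their covariances\<close>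

definition wn_increment :: "(real ^ 'n) \<times> (real ^ 'n) \<Rightarrow> (real ^ 'n) \<times> real \<Rightarrow> real" where
  "wn_increment p = (\<lambda>q. wn_kernel K \<epsilon> (fst p) q - wn_kernel K \<epsilon> (snd p) q)"

lemma wn_increment_measurable [measurable]: "wn_increment p \<in> borel_measurable borel"
  unfolding wn_increment_def by measurable

text \<open>A single kernel need not be square integrable. For the difference, the squared norm is
  an energy, and its finiteness is known from the field \<open>h\<close>.\<close>

lemma wn_increment_square_integrable: "integrable lborel (\<lambda>q. (wn_increment p q)\<^sup>2)"
proof -
  have "wn_combination \<epsilon> (\<lambda>_. 1) {p} (\<lambda>p. p) q = wn_increment p q" for q
    by (simp add: wn_combination_def wn_increment_def)
  then have "(\<integral>\<^sup>+q. ennreal ((wn_increment p q)\<^sup>2) \<partial>lborel) = combination_energy (\<lambda>_. 1) {p} (\<lambda>p. p)"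
    using nn_integral_wn_combination[of "{p}" \<epsilon> "\<lambda>_. 1" "\<lambda>p. p"] eps by (simp add: g_def)
  also have "\<dots> < \<infinity>" by (rule combination_energy_finite) simp
  finally show ?thesis by (simp add: integrable_iff_bounded)
qed

text \<open>The kernels vanish for \<open>t \<le> \<epsilon>\<close> and \<open>\<epsilon>\<close>
  is positive, so restricting to positive times changes nothing. The factor \<open>r\<close> covers
  squares and products alike.\<close>

lemma wn_increment_support: "indicator (UNIV \<times> {0<..}) q *\<^sub>R (wn_increment p q * r) = wn_increment p q * r"
  using eps by (cases q) (auto simp: wn_increment_def wn_kernel_def indicator_def)

lemma wn_increment_spacetime_L2: "wn_increment p \<in> spacetime_L2"
  using wn_increment_square_integrable[of p]
  unfolding spacetime_L2_def set_integrable_def power2_eq_square mem_Collect_eq wn_increment_support by simp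

lemma wn_increment_product_integrable: "integrable lborel (\<lambda>q. wn_increment p q * wn_increment p' q)"
proof (rule Bochner_Integration.integrable_bound)
  show "integrable lborel (\<lambda>q. (wn_increment p q)\<^sup>2 + (wn_increment p' q)\<^sup>2)"
    by (intro Bochner_Integration.integrable_add wn_increment_square_integrable)
  have "\<bar>a * b\<bar> \<le> a\<^sup>2 + b\<^sup>2" for a b :: real
  proof -
    have "0 \<le> (\<bar>a\<bar> - \<bar>b\<bar>)\<^sup>2" by simp
    then have "2 * \<bar>a * b\<bar> \<le> a\<^sup>2 + b\<^sup>2" by (simp add: power2_diff abs_mult)
    then show ?thesis by linarith
  qed
  then show "AE q in lborel. norm (wn_increment p q * wn_increment p' q) \<le> norm ((wn_increment p q)\<^sup>2 + (wn_increment p' q)\<^sup>2)"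
    by simp
qed measurable

lemma spacetime_inner_combination:
  assumes J: "finite J"
  shows "(\<Sum>j\<in>J. \<Sum>k\<in>J. c j * c k * spacetime_inner (wn_increment (w j)) (wn_increment (w k))) = enn2real (combination_energy c J w)"
proof -
  have inner: "spacetime_inner (wn_increment p) (wn_increment p') = (LINT q|lborel. wn_increment p q * wn_increment p' q)" for p p'
    unfolding spacetime_inner_def set_lebesgue_integral_def wn_increment_support ..
  have comb: "wn_combination \<epsilon> c J w q = (\<Sum>j\<in>J. c j * wn_increment (w j) q)" for q
    by (simp add: wn_combination_def wn_increment_def)
  have sq: "(wn_combination \<epsilon> c J w q)\<^sup>2 = (\<Sum>j\<in>J. \<Sum>k\<in>J. c j * c k * (wn_increment (w j) q * wn_increment (w k) q))" for q
    unfolding comb power2_eq_square sum_product by (simp add: mult_ac)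
  have i: "integrable lborel (\<lambda>q. c j * c k * (wn_increment (w j) q * wn_increment (w k) q))" for j k
    by (intro integrable_mult_right wn_increment_product_integrable)
  have "(\<Sum>j\<in>J. \<Sum>k\<in>J. c j * c k * spacetime_inner (wn_increment (w j)) (wn_increment (w k))) = (LINT q|lborel. (wn_combination \<epsilon> c J w q)\<^sup>2)"
    unfolding sq inner by (simp add: Bochner_Integration.integral_sum i wn_increment_product_integrable)
  also have "\<dots> = enn2real (\<integral>\<^sup>+q. ennreal ((wn_combination \<epsilon> c J w q)\<^sup>2) \<partial>lborel)"
    by (rule integral_eq_nn_integral) auto
  also have "\<dots> = enn2real (combination_energy c J w)"
    unfolding nn_integral_wn_combination[OF J eps] g_def ..
  finally show ?thesis .
qed

lemma Z_increment_measurable [measurable]: "(\<lambda>\<omega>. Z \<omega> x - Z \<omega> y) \<in> borel_measurable N"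
  using Z by (simp add: white_noise_field_def random_continuous_mod_const_def)

lemma Z_continuous: "\<omega> \<in> space N \<Longrightarrow> continuous_on UNIV (Z \<omega>)"
  using Z by (simp add: white_noise_field_def random_continuous_mod_const_def)

lemma Z_combination_normal:
  assumes J: "finite J"
  shows "distr N borel (\<lambda>\<omega>. \<Sum>j\<in>J. c j * (Z \<omega> (fst j) - Z \<omega> (snd j))) =
    distr N borel (\<lambda>\<omega>. \<Sum>j\<in>J. c j * W (wn_increment j) \<omega>)"
    and "centered_normal N (\<lambda>\<omega>. \<Sum>j\<in>J. c j * W (wn_increment j) \<omega>) (enn2real (combination_energy c J (\<lambda>p. p)))"
proof -
  show cn: "centered_normal N (\<lambda>\<omega>. \<Sum>j\<in>J. c j * W (wn_increment j) \<omega>) (enn2real (combination_energy c J (\<lambda>p. p)))"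
    unfolding spacetime_inner_combination[OF J, symmetric]
    by (rule centered_gaussian_family_combination[OF W[unfolded spacetime_white_noise_def] J])
      (auto intro: wn_increment_spacetime_L2)
  \<comment> \<open>For each pair the equality holds only almost surely; finiteness of
    \<open>J\<close> gives one exceptional null set.\<close>
  have "AE \<omega> in N. \<forall>j\<in>J. Z \<omega> (fst j) - Z \<omega> (snd j) = W (wn_increment j) \<omega>"
    using Z J by (intro AE_finite_allI) (auto simp: white_noise_field_def wn_increment_def)
  then have "AE \<omega> in N. (\<Sum>j\<in>J. c j * (Z \<omega> (fst j) - Z \<omega> (snd j))) = (\<Sum>j\<in>J. c j * W (wn_increment j) \<omega>)"
    by eventually_elim simp
  then show "distr N borel (\<lambda>\<omega>. \<Sum>j\<in>J. c j * (Z \<omega> (fst j) - Z \<omega> (snd j))) =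
    distr N borel (\<lambda>\<omega>. \<Sum>j\<in>J. c j * W (wn_increment j) \<omega>)"
    using cn by (intro distr_cong_AE) (auto simp: centered_normal_def)
qed

section \<open>Equality of laws and continuous versions\<close>

text \<open>Arbitrary versions \<open>X\<close> are allowed on the side of \<open>h\<close>, and no
  continuity is assumed of them. Hence the statement can be used first to transport continuity from
  \<open>Z\<close> and then to compare \<open>Z\<close> with any convolution.\<close>

lemma law_eq:
  assumes X: "\<And>p. LGF_pairing M h (increment_kernel p) (X p)"
  shows "law_mod_const N Z = distr M (PiM UNIV (\<lambda>_. borel)) (\<lambda>\<omega> p. X p \<omega>)"
  unfolding law_mod_const_def
proof (rule distr_PiM_eqI_linear_combinations[OF N.prob_space_axioms prob_space_axioms])
  show "X p \<in> borel_measurable M" for p using X[of p] by (simp add: LGF_pairing_def)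
  fix J :: "((real ^ 'n) \<times> (real ^ 'n)) set" and c assume J: "finite J"
  have "centered_normal M (\<lambda>\<omega>. \<Sum>j\<in>J. c j * X j \<omega>) (enn2real (combination_energy c J (\<lambda>p. p)))"
    by (rule increment_combination_normal(2)[OF J X])
  then show "distr N borel (\<lambda>\<omega>. \<Sum>j\<in>J. c j * (Z \<omega> (fst j) - Z \<omega> (snd j))) = distr M borel (\<lambda>\<omega>. \<Sum>j\<in>J. c j * X j \<omega>)"
    using Z_combination_normal[OF J] by (simp add: centered_normal_def)
qed measurable

lemma convolution_kernel: "(\<lambda>z. rescale (mollifier K) \<epsilon> (x - z) - rescale (mollifier K) \<epsilon> (y - z)) = increment_kernel (x, y)"
  by (simp add: increment_kernel_def rescale_mollifier fun_eq_iff)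

text \<open>Since the increments of the two fields have the same law, almost sure properties of the
  continuous field \<open>Z\<close> that only involve countably many increments pass to \<open>h\<close>; no separate
  continuity criterion is needed.\<close>

theorem convolution_exists: "\<exists>Y. LGF_convolution M h (rescale (mollifier K) \<epsilon>) Y"
proof -
  obtain X where X: "\<And>p. LGF_pairing M h (increment_kernel p) (X p)" using increment_pairing_exists by metis
  have [measurable]: "X p \<in> borel_measurable M" for p using X[of p] by (simp add: LGF_pairing_def)
  obtain D d where "dense_approximation (D :: (real ^ 'n) set) d" using dense_approximation_exists by metis
  then interpret dense_approximation D d .
  let ?P = "PiM UNIV (\<lambda>_. borel) :: ((real ^ 'n) \<times> (real ^ 'n) \<Rightarrow> real) measure"
  \<comment> \<open>The event that the increments come from a continuous function:
    \<open>u (a, 0)\<close> is locally uniformly continuous in \<open>a\<close> on \<open>D\<close>,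
    and its extension reproduces the increment at \<open>(x, y)\<close>. Only countably many
    coordinates of \<open>u\<close> are involved, hence measurability in the product
    sigma-algebra.\<close>
  define good where "good u x y \<longleftrightarrow> locally_uniform (\<lambda>a. u (a, 0)) \<and>
      extension (\<lambda>a. u (a, 0)) x - extension (\<lambda>a. u (a, 0)) y = u (x, y)"
    for u :: "(real ^ 'n) \<times> (real ^ 'n) \<Rightarrow> real" and x y
  have good_meas: "{u \<in> space ?P. good u x y} \<in> sets ?P" for x y
  proof -
    have [measurable]: "Measurable.pred ?P (\<lambda>u. locally_uniform (\<lambda>a. u (a, 0)))"
      by (rule locally_uniform_measurable) measurable
    have [measurable]: "(\<lambda>u. extension (\<lambda>a. u (a, 0)) x) \<in> borel_measurable ?P" for x
      unfolding extension_def by measurable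
    have "{u \<in> space ?P. locally_uniform (\<lambda>a. u (a, 0))} \<in> sets ?P" by measurable
    moreover have "{u \<in> space ?P. extension (\<lambda>a. u (a, 0)) x - extension (\<lambda>a. u (a, 0)) y = u (x, y)} \<in> sets ?P"
      by (rule borel_measurable_eq) measurable
    ultimately show ?thesis unfolding good_def by (rule sets.sets_Collect_conj[rotated])
  qed
  have Zm: "(\<lambda>\<omega> p. Z \<omega> (fst p) - Z \<omega> (snd p)) \<in> measurable N ?P"
    by (rule measurable_PiM_single') auto
  have Xm: "(\<lambda>\<omega> p. X p \<omega>) \<in> measurable M ?P"
    by (rule measurable_PiM_single') auto
  have "AE \<omega> in N. good (\<lambda>p. Z \<omega> (fst p) - Z \<omega> (snd p)) x y" for x y
  proof (rule AE_I2)
    fix \<omega> assume "\<omega> \<in> space N"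
    then have "continuous_on UNIV (\<lambda>a. Z \<omega> a - Z \<omega> 0)" by (intro continuous_intros Z_continuous)
    from continuous_imp_locally_uniform[OF this] extension_continuous_eq[OF this]
    show "good (\<lambda>p. Z \<omega> (fst p) - Z \<omega> (snd p)) x y" by (simp add: good_def)
  qed
  then have "AE u in law_mod_const N Z. good u x y" for x y
    unfolding law_mod_const_def by (subst AE_distr_iff[OF Zm good_meas])
  \<comment> \<open>Whether a measurable event is almost sure depends only on the law. The null set
    may depend on \<open>x\<close> and \<open>y\<close>, which suffices because
    \<open>LGF_convolution\<close> treats each increment separately.\<close>
  then have goodX: "AE \<omega> in M. good (\<lambda>p. X p \<omega>) x y" for x y
    unfolding law_eq[OF X] by (subst (asm) AE_distr_iff[OF Xm good_meas])
  \<comment> \<open>The value 0 on the exceptional event makes every path continuous, as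
    \<open>random_continuous_mod_const\<close> asks for all outcomes.\<close>
  define Y where "Y \<omega> x = (if locally_uniform (\<lambda>a. X (a, 0) \<omega>) then extension (\<lambda>a. X (a, 0) \<omega>) x else 0)" for \<omega> x
  have [measurable]: "Measurable.pred M (\<lambda>\<omega>. locally_uniform (\<lambda>a. X (a, 0) \<omega>))"
    by (rule locally_uniform_measurable) measurable
  have Ym [measurable]: "(\<lambda>\<omega>. Y \<omega> x) \<in> borel_measurable M" for x
    unfolding Y_def extension_def by measurable
  have "LGF_convolution M h (rescale (mollifier K) \<epsilon>) Y"
    unfolding LGF_convolution_def random_continuous_mod_const_def convolution_kernel
  proof (intro conjI ballI allI)
    show "continuous_on UNIV (Y \<omega>)" for \<omega>
      unfolding Y_def by (cases "locally_uniform (\<lambda>a. X (a, 0) \<omega>)") (simp_all add: extension_continuous)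
    show "(\<lambda>\<omega>. Y \<omega> x - Y \<omega> y) \<in> borel_measurable M" for x y by measurable
    show "LGF_pairing M h (increment_kernel (x, y)) (\<lambda>\<omega>. Y \<omega> x - Y \<omega> y)" for x y
    proof (rule pairing_cong_AE[OF X])
      show "AE \<omega> in M. X (x, y) \<omega> = Y \<omega> x - Y \<omega> y"
        using goodX[of x y] by eventually_elim (simp add: good_def Y_def)
    qed measurable
  qed
  then show ?thesis by blast
qed

theorem convolution_law:
  assumes "LGF_convolution M h (rescale (mollifier K) \<epsilon>) Y"
  shows "law_mod_const N Z = law_mod_const M Y"
proof -
  have "LGF_pairing M h (increment_kernel p) (\<lambda>\<omega>. Y \<omega> (fst p) - Y \<omega> (snd p))" for p
    using assms unfolding LGF_convolution_def convolution_kernel by (cases p) simp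
  from law_eq[OF this] show ?thesis unfolding law_mod_const_def[of M] .
qed

end

text \<open>The existence clause keeps the statement about the law from being vacuous; that
  statement itself covers every continuous version of the convolution.\<close>

theorem proposition1p10:
  fixes K :: "real ^ 'n \<Rightarrow> real"
    and M :: "'w measure" and h :: "'w \<Rightarrow> (real ^ 'n \<Rightarrow> real) \<Rightarrow> real"
    and N :: "'v measure" and W :: "((real ^ 'n) \<times> real \<Rightarrow> real) \<Rightarrow> 'v \<Rightarrow> real"
    and Z :: "'v \<Rightarrow> real ^ 'n \<Rightarrow> real"
    and \<epsilon> :: real
  assumes dim: "CARD('n) \<ge> 2"
    and K_radial: "radial K"
    and K_compact_support: "compact (closure {x. K x \<noteq> 0})"
    and K_smooth: "smooth K"
    and K_normalized: "(LINT x|lborel. (K x)\<^sup>2) = 1"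
    and h: "whole_space_LGF M h"
    and W: "spacetime_white_noise N W"
    and eps: "\<epsilon> > 0"
    and Z: "white_noise_field N W K \<epsilon> Z"
  shows "(\<exists>Y. LGF_convolution M h (rescale (mollifier K) \<epsilon>) Y) \<and>
    (\<forall>Y. LGF_convolution M h (rescale (mollifier K) \<epsilon>) Y \<longrightarrow>
       law_mod_const N Z = law_mod_const M Y)"
proof -
  interpret field_comparison K M h N W Z \<epsilon>
    by unfold_locales (use assms in simp_all)
  show ?thesis using convolution_exists convolution_law by blast
qed

end
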